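(* Let $p$ be an odd prime, and let $k$ be a field of characteristic $p$. Write $(l_1, l_2, l_3, \ldots)$ for the (strictly) increasing sequence of integers that are ghost numbers of the group algebras $kG$, with $G$ a non-trivial finite $p$-group. Then $l_1 = \frac{p-1}{2}$, \[\frac{3(p-1)}{2} \le l_2 = \text{ghost number of } k(C_p \times C_p) \le 2p-3,\] and $\min\left(\frac{p^2-1}{2},\,2p-1\right) \le l_3$.
   Context: $C_n$ denotes the cyclic group of order $n$. Let $G$ be a finite group and $k$ a field whose characteristic divides $|G|$. $\mathrm{StMod}(kG)$ is the stable module category: objects are left $kG$-modules, morphisms are $[M,N] = \mathrm{Hom}_{kG}(M,N)$ modulo maps factoring through a projective. It is triangulated, with desuspension $\Omega M$ the kernel of a surjection from a projective onto $M$, and $\Sigma=\Omega^{-1}$. $\mathrm{Thick}\langle k\rangle$ is the smallest full triangulated subcategory closed under retracts and containing the trivial module $k$. A ghost is a map $f$ in $\mathrm{StMod}(kG)$ that induces zero on Tate cohomology, i.e. $[\Omega^n k,f]=0$ for all $n\in\mathbb{Z}$. The ghost length of $M\in\mathrm{Thick}\langle k\rangle$ is the smallest $n\ge 0$ such that every composite of $n$ ghosts between objects of $\mathrm{Thick}\langle k\rangle$ with domain $M$ is zero in $\mathrm{StMod}(kG)$ (a composite of $0$ ghosts being any map). The ghost number of $kG$ is the least upper bound of the ghost lengths of modules in $\mathrm{Thick}\langle k\rangle$. *)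

theory Defs
  imports
    "HOL-Computational_Algebra.Primes"
    "HOL-Algebra.Elementary_Groups"
    "HOL-Algebra.Module"
    "HOL-Library.Extended_Nat"
begin

section \<open>Left modules over a ring\<close>

text \<open>
  The library locale \<open>module\<close> requires a commutative ring of scalars, but group algebras are
  in general not commutative. We keep its record type, of which only the fields \<open>carrier\<close>,
  \<open>add\<close>, \<open>zero\<close> and \<open>smult\<close> matter: no definition below looks at the fields \<open>mult\<close> and \<open>one\<close>
  of a module.

  All modules over a given ring have their carriers inside one type \<open>'u\<close>, the universe.
  In particular the quantifiers over modules hidden in ``projective'', ``factors through a
  projective'' and ``thick subcategory'' range over the modules in this universe. If \<open>'u\<close> is
  infinite and at least as large as the ring, every module in the universe has a copy in it of
  a free module mapping onto it, and a copy of each of its quotients, submodules and finite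
  powers.
\<close>

locale left_module = R?: ring R + M?: abelian_group M
  for R (structure) and M :: "('r, 'u) module" (structure) +
  assumes smult_closed:
      "\<lbrakk>a \<in> carrier R; x \<in> carrier M\<rbrakk> \<Longrightarrow> a \<odot>\<^bsub>M\<^esub> x \<in> carrier M"
    and smult_l_distr:
      "\<lbrakk>a \<in> carrier R; b \<in> carrier R; x \<in> carrier M\<rbrakk> \<Longrightarrow>
        (a \<oplus>\<^bsub>R\<^esub> b) \<odot>\<^bsub>M\<^esub> x = a \<odot>\<^bsub>M\<^esub> x \<oplus>\<^bsub>M\<^esub> b \<odot>\<^bsub>M\<^esub> x"
    and smult_r_distr:
      "\<lbrakk>a \<in> carrier R; x \<in> carrier M; y \<in> carrier M\<rbrakk> \<Longrightarrow>
        a \<odot>\<^bsub>M\<^esub> (x \<oplus>\<^bsub>M\<^esub> y) = a \<odot>\<^bsub>M\<^esub> x \<oplus>\<^bsub>M\<^esub> a \<odot>\<^bsub>M\<^esub> y"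
    and smult_assoc:
      "\<lbrakk>a \<in> carrier R; b \<in> carrier R; x \<in> carrier M\<rbrakk> \<Longrightarrow>
        (a \<otimes>\<^bsub>R\<^esub> b) \<odot>\<^bsub>M\<^esub> x = a \<odot>\<^bsub>M\<^esub> (b \<odot>\<^bsub>M\<^esub> x)"
    and smult_one:
      "x \<in> carrier M \<Longrightarrow> \<one>\<^bsub>R\<^esub> \<odot>\<^bsub>M\<^esub> x = x"

text \<open>As everywhere in HOL-Algebra, only the values of a homomorphism on the carrier matter.\<close>

definition left_module_hom ::
  "('r, 'm) ring_scheme \<Rightarrow> ('r, 'u) module \<Rightarrow> ('r, 'u) module \<Rightarrow> ('u \<Rightarrow> 'u) set" where
  "left_module_hom R M N =
    {f \<in> carrier M \<rightarrow> carrier N.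
      (\<forall>x\<in>carrier M. \<forall>y\<in>carrier M. f (x \<oplus>\<^bsub>M\<^esub> y) = f x \<oplus>\<^bsub>N\<^esub> f y) \<and>
      (\<forall>a\<in>carrier R. \<forall>x\<in>carrier M. f (a \<odot>\<^bsub>M\<^esub> x) = a \<odot>\<^bsub>N\<^esub> f x)}"

definition projective_module :: "('r, 'm) ring_scheme \<Rightarrow> ('r, 'u) module \<Rightarrow> bool" where
  "projective_module R P \<longleftrightarrow> left_module R P \<and>
    (\<forall>(M :: ('r, 'u) module) (N :: ('r, 'u) module) g f.
      left_module R M \<and> left_module R N \<and>
      g \<in> left_module_hom R M N \<and> g ` carrier M = carrier N \<and> f \<in> left_module_hom R P N \<longrightarrow>
      (\<exists>h\<in>left_module_hom R P M. \<forall>x\<in>carrier P. g (h x) = f x))"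

definition short_exact ::
  "('r, 'm) ring_scheme \<Rightarrow> ('r, 'u) module \<Rightarrow> ('r, 'u) module \<Rightarrow> ('r, 'u) module \<Rightarrow> bool" where
  "short_exact R A B C \<longleftrightarrow> left_module R A \<and> left_module R B \<and> left_module R C \<and>
    (\<exists>i\<in>left_module_hom R A B. \<exists>q\<in>left_module_hom R B C.
      inj_on i (carrier A) \<and> q ` carrier B = carrier C \<and>
      i ` carrier A = {x \<in> carrier B. q x = \<zero>\<^bsub>C\<^esub>})"

section \<open>The stable module category\<close>

definition stably_zero ::
  "('r, 'm) ring_scheme \<Rightarrow> ('r, 'u) module \<Rightarrow> ('r, 'u) module \<Rightarrow> ('u \<Rightarrow> 'u) \<Rightarrow> bool" where
  "stably_zero R M N f \<longleftrightarrow>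
    (\<exists>P. projective_module R P \<and>
      (\<exists>a\<in>left_module_hom R M P. \<exists>b\<in>left_module_hom R P N. \<forall>x\<in>carrier M. f x = b (a x)))"

definition stably_equal ::
  "('r, 'm) ring_scheme \<Rightarrow> ('r, 'u) module \<Rightarrow> ('r, 'u) module \<Rightarrow> ('u \<Rightarrow> 'u) \<Rightarrow> ('u \<Rightarrow> 'u) \<Rightarrow> bool"
  where
  "stably_equal R M N f g \<longleftrightarrow> stably_zero R M N (\<lambda>x. f x \<ominus>\<^bsub>N\<^esub> g x)"

definition stably_isomorphic ::
  "('r, 'm) ring_scheme \<Rightarrow> ('r, 'u) module \<Rightarrow> ('r, 'u) module \<Rightarrow> bool" where
  "stably_isomorphic R M N \<longleftrightarrow> left_module R M \<and> left_module R N \<and>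
    (\<exists>f\<in>left_module_hom R M N. \<exists>g\<in>left_module_hom R N M.
      stably_equal R M M (g \<circ> f) id \<and> stably_equal R N N (f \<circ> g) id)"

definition stable_retract ::
  "('r, 'm) ring_scheme \<Rightarrow> ('r, 'u) module \<Rightarrow> ('r, 'u) module \<Rightarrow> bool" where
  "stable_retract R M N \<longleftrightarrow> left_module R M \<and> left_module R N \<and>
    (\<exists>i\<in>left_module_hom R M N. \<exists>r\<in>left_module_hom R N M. stably_equal R M M (r \<circ> i) id)"

text \<open>
  \<open>is_Omega R M W\<close>: the module \<open>W\<close> is the kernel of a surjection from a projective module
  onto \<open>M\<close>. This determines \<open>W\<close> only up to stable isomorphism. Read from right to left the
  relation says that \<open>M\<close> is a value of \<open>\<Sigma> = \<Omega>\<^sup>-\<^sup>1\<close> at \<open>W\<close>.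
\<close>

definition is_Omega ::
  "('r, 'm) ring_scheme \<Rightarrow> ('r, 'u) module \<Rightarrow> ('r, 'u) module \<Rightarrow> bool" where
  "is_Omega R M W \<longleftrightarrow> (\<exists>P. projective_module R P \<and> short_exact R W P M)"

definition is_Omega_power ::
  "('r, 'm) ring_scheme \<Rightarrow> int \<Rightarrow> ('r, 'u) module \<Rightarrow> ('r, 'u) module \<Rightarrow> bool" where
  "is_Omega_power R n M W \<longleftrightarrow>
    (if 0 \<le> n then (is_Omega R ^^ nat n) M W else (is_Omega R ^^ nat (- n)) W M)"

text \<open>
  The exact triangles of the stable module category are those isomorphic to a triangle coming
  from a short exact sequence of modules. For a full subcategory only the three objects
  matter, and so only these are recorded: \<open>exact_triangle R A B C\<close> says that there is an exact
  triangle \<open>A \<rightarrow> B \<rightarrow> C \<rightarrow> \<Sigma> A\<close>.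
\<close>

definition exact_triangle ::
  "('r, 'm) ring_scheme \<Rightarrow> ('r, 'u) module \<Rightarrow> ('r, 'u) module \<Rightarrow> ('r, 'u) module \<Rightarrow> bool" where
  "exact_triangle R A B C \<longleftrightarrow>
    (\<exists>A' B' C'. short_exact R A' B' C' \<and>
      stably_isomorphic R A A' \<and> stably_isomorphic R B B' \<and> stably_isomorphic R C C')"

text \<open>A full subcategory is given by its class of objects.\<close>

definition triangulated_subcategory ::
  "('r, 'm) ring_scheme \<Rightarrow> ('r, 'u) module set \<Rightarrow> bool" where
  "triangulated_subcategory R S \<longleftrightarrow>
    S \<noteq> {} \<and> (\<forall>M\<in>S. left_module R M) \<and>
    (\<forall>M\<in>S. \<forall>N. stably_isomorphic R M N \<longrightarrow> N \<in> S) \<and>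
    (\<forall>M\<in>S. \<forall>N. is_Omega R M N \<or> is_Omega R N M \<longrightarrow> N \<in> S) \<and>
    (\<forall>A\<in>S. \<forall>B\<in>S. \<forall>C. exact_triangle R A B C \<longrightarrow> C \<in> S)"

definition thick_subcategory ::
  "('r, 'm) ring_scheme \<Rightarrow> ('r, 'u) module set \<Rightarrow> bool" where
  "thick_subcategory R S \<longleftrightarrow>
    triangulated_subcategory R S \<and> (\<forall>N\<in>S. \<forall>M. stable_retract R M N \<longrightarrow> M \<in> S)"

definition Thick ::
  "('r, 'm) ring_scheme \<Rightarrow> ('r, 'u) module \<Rightarrow> ('r, 'u) module set" where
  "Thick R K = \<Inter>{S. thick_subcategory R S \<and> K \<in> S}"

section \<open>Ghosts\<close>

text \<open>In this section \<open>K\<close> plays the role of the trivial module.\<close>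

definition ghost ::
  "('r, 'm) ring_scheme \<Rightarrow> ('r, 'u) module \<Rightarrow> ('r, 'u) module \<Rightarrow> ('r, 'u) module \<Rightarrow> ('u \<Rightarrow> 'u) \<Rightarrow> bool"
  where
  "ghost R K M N f \<longleftrightarrow> left_module R M \<and> left_module R N \<and> f \<in> left_module_hom R M N \<and>
    (\<forall>(n :: int) W. is_Omega_power R n K W \<longrightarrow>
      (\<forall>h\<in>left_module_hom R W M. stably_zero R W N (f \<circ> h)))"

text \<open>
  Composites of \<open>n\<close> ghosts between objects of \<open>Thick R K\<close>. The base case is the convention
  that a composite of no ghosts is any map; for \<open>n > 0\<close> the initial arbitrary map is absorbed
  by the first ghost, since a ghost composed with any map is a ghost.
\<close>

inductive ghost_composite ::
  "('r, 'm) ring_scheme \<Rightarrow> ('r, 'u) module \<Rightarrow> nat \<Rightarrow> ('r, 'u) module \<Rightarrow> ('r, 'u) module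
    \<Rightarrow> ('u \<Rightarrow> 'u) \<Rightarrow> bool"
  for R K where
  zero: "\<lbrakk>M \<in> Thick R K; N \<in> Thick R K; f \<in> left_module_hom R M N\<rbrakk>
    \<Longrightarrow> ghost_composite R K 0 M N f"
| Suc: "\<lbrakk>ghost_composite R K n M L f; L \<in> Thick R K; N \<in> Thick R K; ghost R K L N g\<rbrakk>
    \<Longrightarrow> ghost_composite R K (Suc n) M N (g \<circ> f)"

text \<open>Both invariants are \<open>\<infinity>\<close> if there is no bound.\<close>

definition ghost_length ::
  "('r, 'm) ring_scheme \<Rightarrow> ('r, 'u) module \<Rightarrow> ('r, 'u) module \<Rightarrow> enat" where
  "ghost_length R K M =
    Inf {enat n | n. \<forall>N f. ghost_composite R K n M N f \<longrightarrow> stably_zero R M N f}"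

section \<open>Group algebras\<close>

definition group_algebra :: "('g, 'm) monoid_scheme \<Rightarrow> ('g \<Rightarrow> 'k::field) ring" where
  "group_algebra G =
    \<lparr>carrier = carrier G \<rightarrow>\<^sub>E UNIV,
     monoid.mult = (\<lambda>a b. \<lambda>x\<in>carrier G. \<Sum>y\<in>carrier G. a y * b (inv\<^bsub>G\<^esub> y \<otimes>\<^bsub>G\<^esub> x)),
     one = (\<lambda>x\<in>carrier G. if x = \<one>\<^bsub>G\<^esub> then 1 else 0),
     zero = (\<lambda>x\<in>carrier G. 0),
     add = (\<lambda>a b. \<lambda>x\<in>carrier G. a x + b x)\<rparr>"

text \<open>
  The trivial module \<open>k\<close>, on which every group element acts as the identity, transported into
  the universe \<open>'u\<close> along an injection \<open>e\<close>.
\<close>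

definition trivial_module ::
  "('k::field \<Rightarrow> 'u) \<Rightarrow> ('g, 'm) monoid_scheme \<Rightarrow> ('g \<Rightarrow> 'k, 'u) module" where
  "trivial_module e G =
    \<lparr>carrier = range e,
     monoid.mult = undefined,
     one = undefined,
     zero = e 0,
     add = (\<lambda>x y. e (inv_into UNIV e x + inv_into UNIV e y)),
     smult = (\<lambda>a x. e ((\<Sum>g\<in>carrier G. a g) * inv_into UNIV e x))\<rparr>"

text \<open>
  The ghost number of \<open>kG\<close>, for modules in the universe \<open>'u\<close>, where \<open>k\<close> is the domain type of \<open>e\<close>.
\<close>

definition ghost_number :: "('k::field \<Rightarrow> 'u) \<Rightarrow> ('g, 'm) monoid_scheme \<Rightarrow> enat" where
  "ghost_number e G =
    (SUP M\<in>Thick (group_algebra G) (trivial_module e G).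
      ghost_length (group_algebra G) (trivial_module e G) M)"

text \<open>Every finite group is isomorphic to one with elements in \<open>nat\<close>.\<close>

definition ghost_numbers_of_p_groups :: "nat \<Rightarrow> ('k::field \<Rightarrow> 'u) \<Rightarrow> nat set" where
  "ghost_numbers_of_p_groups p e =
    {n. \<exists>G :: nat monoid. group G \<and> finite (carrier G) \<and> carrier G \<noteq> {\<one>\<^bsub>G\<^esub>} \<and>
      (\<exists>r. order G = p ^ r) \<and> ghost_number e G = enat n}"

end

theory Submission
  imports Defs "HOL-Algebra.Free_Abelian_Groups" "HOL-Algebra.Multiplicative_Group" "HOL-Algebra.Group_Action" "HOL-Algebra.Weak_Morphisms" "HOL-Library.Infinite_Set"
begin

text \<open>
Every module in the universe is replaced by a representation of the group on one fixed vector space of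
finitely supported functions, where group elements act by total linear maps and the neutral element acts
as a projection onto (a copy of) the module; lemmas \<open>coord_exists\<close> and \<open>coord_realize\<close> go back and forth.
In these terms a homomorphism vanishes stably if and only if it is a trace \<open>\<Sum>g. g \<phi> g\<^sup>-\<^sup>1\<close> of a linear map
(\<open>stably_zero_iff\<close>), and all questions about the stable category become questions of linear algebra.

Lower bound (\<open>ghost_number_lower_bound\<close>). Let \<open>z\<close> be central of odd order \<open>q\<close> in a group of order \<open>q p\<^sup>m\<close>, and let
\<open>U\<close> be the ideal generated by \<open>(z - 1)\<^sup>c\<close> in the group algebra, \<open>c = (q + 1) / 2\<close>. On a syzygy of \<open>k\<close> of any degree
every \<open>g - 1\<close> is a trace over \<open>\<langle>z\<rangle>\<close>, so right multiplications by \<open>g - 1\<close> are ghosts of \<open>U\<close>. A composite of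
\<open>(q - 1) / 2 - 1 + m (p - 1)\<close> of them sends \<open>(z - 1)\<^sup>c\<close> to the norm element. It is not stably zero: otherwise it would
extend to the group algebra, and then it would send \<open>(z - 1)\<^sup>c\<close> into \<open>(z - 1)\<^sup>2\<^sup>c = 0\<close>.

Upper bound for cyclic groups (\<open>cyclic_upper_bound\<close>). For a generator \<open>g\<close> and \<open>x = g - 1\<close> a ghost sends \<open>ker x\<close> into
\<open>im x\<^sup>n\<^sup>-\<^sup>1\<close> and \<open>ker x\<^sup>n\<^sup>-\<^sup>1\<close> into \<open>im x\<close>. Hence a composite of \<open>(n - 1) / 2\<close> ghosts sends \<open>ker x\<^sup>a\<close> into \<open>im x\<^sup>n\<^sup>-\<^sup>a\<close> for all \<open>a\<close>,
and such a map is a trace (\<open>cyc_layers\<close>), because in characteristic \<open>p\<close> traces are the sums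
\<open>\<Sum>b. x\<^sup>n\<^sup>-\<^sup>1\<^sup>-\<^sup>b \<phi> x\<^sup>b\<close> (\<open>cyc_trace\<close>).

Upper bound for the elementary group of order \<open>p\<^sup>2\<close> (\<open>elementary_upper_bound\<close>). After removing a trace, a ghost may be restricted
to the kernels of the norm. A composite of \<open>2 p - 3\<close> of them has the form \<open>\<alpha> a + \<beta> b\<close> with \<open>\<alpha> = x\<^sup>p\<^sup>-\<^sup>1 y\<^sup>p\<^sup>-\<^sup>2\<close> and
\<open>\<beta> = x\<^sup>p\<^sup>-\<^sup>2 y\<^sup>p\<^sup>-\<^sup>1\<close>, and it kills the common kernel of \<open>\<alpha>\<close> and \<open>\<beta>\<close>. What ghosts do in degree \<open>-2\<close> controls \<open>a\<close> and \<open>b\<close> on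
the relations \<open>x s + y t = 0\<close> well enough to write the composite as a trace (\<open>expands_Suc\<close>, \<open>top_map_is_dtr\<close>).

For odd \<open>p\<close> the theorem follows: groups of order \<open>p\<close> have ghost number \<open>(p - 1) / 2\<close>; a group of order \<open>p\<^sup>2\<close> is cyclic, with
ghost number \<open>(p\<^sup>2 - 1) / 2\<close>, or elementary; and the lower bound gives at least \<open>2 p - 1\<close> for order \<open>p\<^sup>3\<close> and above. The
cyclic groups have arbitrarily large finite ghost numbers, so the sequence is infinite.
\<close>

section \<open>Linear algebra with total linear maps\<close>

lemma prime_power_choose_zero:
 assumes p: "prime p" and char: "CHAR('k::field) = p" and b: "0 < b" "b < p ^ a"
 shows "of_nat (p ^ a choose b) = (0 :: 'k)"
proof -
 have "b * (p ^ a choose b) = p ^ a * ((p ^ a - 1) choose (b - 1))"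
  using b times_binomial_minus1_eq[of b "p ^ a"] by simp
 then have dvd: "p ^ a dvd b * (p ^ a choose b)" by simp
 have "p dvd (p ^ a choose b)"
 proof (rule ccontr)
  assume "\<not> p dvd (p ^ a choose b)"
  then have "coprime (p ^ a) (p ^ a choose b)"
   using p prime_imp_coprime by (simp add: coprime_commute prime_imp_coprime)
  then have "p ^ a dvd b" using dvd coprime_dvd_mult_left_iff by blast
  then show False using b dvd_imp_le by fastforce
 qed
 then show ?thesis using char of_nat_eq_0_iff_char_dvd by blast
qed

text \<open>In the polynomial ring this says \<open>(X - Y) ^ (n - 1) = \<Sum>b<n. X ^ (n - 1 - b) * Y ^ b\<close>
 for a power \<open>n\<close> of the characteristic.\<close>

text \<open>
The coefficients of \<open>(X - Y)\<^sup>q\<^sup>-\<^sup>1 = (X\<^sup>q - Y\<^sup>q) / (X - Y)\<close> for a power \<open>q\<close> of the characteristic.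
\<close>

lemma prime_power_choose_alternating:
 assumes p: "prime p" and char: "CHAR('k::field) = p" and "b < p ^ a"
 shows "of_nat ((p ^ a - 1) choose b) = ((- 1) ^ b :: 'k)"
 using \<open>b < p ^ a\<close>
proof (induction b)
 case (Suc b)
 have "p ^ a = Suc (p ^ a - 1)" using Suc.prems by simp
 then have "(p ^ a choose Suc b) = ((p ^ a - 1) choose b) + ((p ^ a - 1) choose Suc b)"
  by (metis binomial_Suc_Suc)
 then have "(of_nat ((p ^ a - 1) choose b) + of_nat ((p ^ a - 1) choose Suc b) :: 'k) = 0"
  using prime_power_choose_zero[OF p char, of "Suc b" a] Suc.prems by (metis of_nat_add zero_less_Suc)
 then show ?case using Suc by (simp add: eq_neg_iff_add_eq_0 add.commute)
qed simp

locale kspace = vector_space scale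
 for scale :: "'k::field => 'v::ab_group_add => 'v"
begin

abbreviation lin :: "('v => 'v) => bool" where "lin \<equiv> Vector_Spaces.linear scale scale"

lemma linI:
 assumes "\<And>x y. f (x + y) = f x + f y" "\<And>c x. f (scale c x) = scale c (f x)"
 shows "lin f"
 by (simp add: assms Vector_Spaces.linear_iff vector_space_axioms)

lemma lin_add: "lin f ==> f (x + y) = f x + f y"
 and lin_scale: "lin f ==> f (scale c x) = scale c (f x)"
 by (simp_all add: Vector_Spaces.linear_iff)

lemma lin_0: assumes f: "lin f" shows "f 0 = 0"
 using lin_scale[OF f, of 0 0] by simp
lemma lin_minus: assumes f: "lin f" shows "f (- x) = - f x"
 using lin_scale[OF f, of "- 1" x] by simp
lemma lin_diff: assumes f: "lin f" shows "f (x - y) = f x - f y"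
 using lin_add[OF f, of x "- y"] lin_minus[OF f, of y] by simp
lemma lin_sum: assumes f: "lin f" shows "f (sum h A) = (\<Sum>i\<in>A. f (h i))"
 by (induction A rule: infinite_finite_induct) (auto simp: lin_0[OF f] lin_add[OF f])

lemmas lin_simps = lin_add lin_scale lin_0 lin_minus lin_diff lin_sum

lemma lin_id [intro, simp]: "lin id" "lin (%x. x)" by (simp_all add: linI)
lemma lin_zero [intro, simp]: "lin (%x. 0)" by (simp add: linI)
lemma lin_comp: assumes f: "lin f" and g: "lin g" shows "lin (%x. f (g x))"
 by (rule linI) (simp_all only: lin_simps[OF f] lin_simps[OF g])
lemma lin_compo: assumes f: "lin f" and g: "lin g" shows "lin (f \<circ> g)"
 unfolding comp_def using assms by (rule lin_comp)
lemma lin_plus: assumes f: "lin f" and g: "lin g" shows "lin (%x. f x + g x)"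
 by (rule linI) (simp_all only: lin_simps[OF f] lin_simps[OF g] scale_right_distrib add.assoc add.left_commute)
lemma lin_uminus: assumes f: "lin f" shows "lin (%x. - f x)"
 by (rule linI) (simp_all only: lin_simps[OF f] scale_minus_right minus_add_distrib)
lemma lin_sub: assumes f: "lin f" and g: "lin g" shows "lin (%x. f x - g x)"
 using lin_plus[OF f lin_uminus[OF g]] by simp
lemma lin_scal: assumes f: "lin f" shows "lin (%x. scale c (f x))"
 by (rule linI) (simp_all add: lin_add[OF f] lin_scale[OF f] scale_right_distrib mult.commute)
lemma lin_summ: assumes f: "\<And>i. i \<in> A ==> lin (f i)" shows "lin (%x. \<Sum>i\<in>A. f i x)"
 by (rule linI) (simp_all add: lin_add[OF f] lin_scale[OF f] sum.distrib scale_sum_right)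
lemma lin_pow: assumes f: "lin f" shows "lin (f ^^ n)"
 proof (induction n)
 case (Suc n)
 then show ?case unfolding funpow.simps by (rule lin_compo[OF f])
qed (simp only: funpow_0 funpow.simps lin_id)

lemma subspace_image:
 assumes f: "lin f" and U: "subspace U"
 shows "subspace (f ` U)"
proof (rule subspaceI)
 show "0 \<in> f ` U" using lin_0[OF f] subspace_0[OF U] by (metis imageI)
 show "x + y \<in> f ` U" if "x \<in> f ` U" "y \<in> f ` U" for x y
  using that lin_add[OF f] subspace_add[OF U] by (metis (no_types, lifting) image_iff)
 show "scale c x \<in> f ` U" if "x \<in> f ` U" for c x
  using that lin_scale[OF f] subspace_scale[OF U] by (metis (no_types, lifting) image_iff)
qed

lemma subspace_range: "lin f ==> subspace (range f)"
 using subspace_image[OF _ subspace_UNIV] .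

lemma subspace_ker: assumes f: "lin f" shows "subspace {v. f v = 0}"
 by (rule subspaceI) (simp_all add: lin_simps[OF f])

lemma section_on:
 assumes "lin h" "subspace U"
 shows "\<exists>s. lin s \<and> range s \<subseteq> U \<and> (\<forall>v\<in>h ` U. h (s v) = v)"
proof -
 interpret vector_space_pair scale scale by unfold_locales
 show ?thesis using linear_exists_right_inverse_on[OF assms] by blast
qed

lemma retraction:
 assumes "subspace U"
 shows "\<exists>r. lin r \<and> range r \<subseteq> U \<and> (\<forall>v\<in>U. r v = v)"
 using section_on[of "%x. x" U] assms by auto

lemma projection_along:
 assumes "subspace U"
 shows "\<exists>r. lin r \<and> (\<forall>v. r (r v) = r v) \<and> (\<forall>v. r v = 0 \<longleftrightarrow> v \<in> U)"
proof -
 obtain s where s: "lin s" "range s \<subseteq> U" "\<And>v. v \<in> U ==> s v = v"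
  using retraction[OF assms] by auto
 have "lin (%v. v - s v)" by (rule lin_sub[OF lin_id(2) s(1)])
 moreover have "(v - s v) - s (v - s v) = v - s v" for v
  using s(3)[of "s v"] range_subsetD[OF s(2), of v] by (simp add: lin_diff[OF s(1)])
 moreover have "v - s v = 0 \<longleftrightarrow> v \<in> U" for v using range_subsetD[OF s(2), of v] s(3)[of v] by auto
 ultimately have "lin (%v. v - s v) \<and> (\<forall>v. (v - s v) - s (v - s v) = v - s v) \<and> (\<forall>v. v - s v = 0 \<longleftrightarrow> v \<in> U)"
  by blast
 then show ?thesis by (rule exI[of _ "%v. v - s v"])
qed

text \<open>
A map that vanishes on the kernel of \<open>h\<close> in \<open>U\<close> is a function of \<open>h\<close>; it extends linearly because every subspace has a complement.
\<close>

lemma factor_through: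
 assumes h: "lin h" and g: "lin g" and U: "subspace U"
  and ker: "\<And>u. u \<in> U ==> h u = 0 ==> g u = 0"
 shows "\<exists>L. lin L \<and> (\<forall>u\<in>U. L (h u) = g u)"
proof -
 obtain s where s: "lin s" "range s \<subseteq> U" "\<And>v. v \<in> h ` U ==> h (s v) = v"
  using section_on[OF h U] by auto
 have "g (s (h u)) = g u" if "u \<in> U" for u
 proof -
  have "s (h u) - u \<in> U" using s that U by (simp add: range_subsetD subspace_diff)
  moreover have "h (s (h u) - u) = 0" using s that h by (simp add: lin_diff[OF h])
  ultimately have "g (s (h u) - u) = 0" by (rule ker)
  then show ?thesis by (simp add: lin_diff[OF g])
 qed
 then show ?thesis using lin_comp[OF g s(1)] by blast
qed

lemma lift_through:
 assumes h: "lin h" and g: "lin g" and U: "subspace U" and sub: "range g \<subseteq> h ` U"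
 shows "\<exists>L. lin L \<and> range L \<subseteq> U \<and> (\<forall>v. h (L v) = g v)"
proof -
 obtain s where s: "lin s" "range s \<subseteq> U" "\<And>v. v \<in> h ` U ==> h (s v) = v"
  using section_on[OF h U] by auto
 show ?thesis using s lin_comp[OF s(1) g] range_subsetD[OF sub] by (intro exI[of _ "%v. s (g v)"]) auto
qed

lemma lift_through_sum:
 assumes h: "lin h" "lin h'" and g: "lin g" and U: "subspace U"
  and sub: "\<And>v. \<exists>s\<in>U. \<exists>t\<in>U. g v = h s + h' t"
 shows "\<exists>s t. lin s \<and> lin t \<and> range s \<subseteq> U \<and> range t \<subseteq> U \<and> (\<forall>v. g v = h (s v) + h' (t v))"
proof -
 have "subspace (h ` U)"
  using h(1) U by (rule subspace_image)
 then obtain r where r: "lin r" "\<And>v. r v = 0 \<longleftrightarrow> v \<in> h ` U"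
  using projection_along by meson
 have "range (%v. r (g v)) \<subseteq> (%v. r (h' v)) ` U"
 proof safe
  fix v
  obtain s t where st: "s \<in> U" "t \<in> U" "g v = h s + h' t" using sub by blast
  then have "r (g v) = r (h' t)" using r(2)[of "h s"] by (simp add: lin_add[OF r(1)])
  then show "r (g v) \<in> (%v. r (h' v)) ` U" using st by blast
 qed
 then obtain t where t: "lin t" "range t \<subseteq> U" "\<And>v. r (h' (t v)) = r (g v)"
  using lift_through[OF lin_comp[OF r(1) h(2)] lin_comp[OF r(1) g] U] by blast
 have "range (%v. g v - h' (t v)) \<subseteq> h ` U"
 proof safe
  fix v have "r (g v - h' (t v)) = 0" using t(3) by (simp add: lin_diff[OF r(1)])
  then show "g v - h' (t v) \<in> h ` U" using r(2) by blast
 qed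
 then obtain s where s: "lin s" "range s \<subseteq> U" "\<And>v. h (s v) = g v - h' (t v)"
  using lift_through[OF h(1) lin_sub[OF g lin_comp[OF h(2) t(1)]] U] by blast
 show ?thesis using s t by (intro exI[of _ s] exI[of _ t]) auto
qed

definition commutator :: "('v => 'v) => ('v => 'v) => ('v => 'v) => 'v => 'v" where
 "commutator y' y \<phi> = (%v. y' (\<phi> v) - \<phi> (y v))"

lemma commutator_power:
 assumes y': "lin y'" and "lin y" "lin \<phi>"
 shows "(commutator y' y ^^ m) \<phi> v =
  (\<Sum>b\<le>m. scale ((- 1) ^ b * of_nat (m choose b)) ((y' ^^ (m - b)) (\<phi> ((y ^^ b) v))))"
proof (induction m arbitrary: v)
 case (Suc m)
 define t where "t b = (y' ^^ (Suc m - b)) (\<phi> ((y ^^ b) v))" for b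
 define a where "a n b = ((- 1) ^ b * of_nat (n choose b) :: 'k)" for n b
 have 1: "y' ((y' ^^ (m - b)) (\<phi> ((y ^^ b) v))) = t b" if "b \<le> m" for b
  using that by (simp add: t_def Suc_diff_le)
 have 2: "(y' ^^ (m - b)) (\<phi> ((y ^^ b) (y v))) = t (Suc b)" for b
  by (simp add: t_def funpow_swap1)
 have "(commutator y' y ^^ Suc m) \<phi> v = y' ((commutator y' y ^^ m) \<phi> v) - (commutator y' y ^^ m) \<phi> (y v)"
  by (simp add: commutator_def)
 also have "\<dots> = (\<Sum>b\<le>m. scale (a m b) (t b)) - (\<Sum>b\<le>m. scale (a m b) (t (Suc b)))"
  unfolding Suc.IH using 1 2 by (simp add: lin_sum[OF y'] lin_scale[OF y'] a_def)
 also have "(\<Sum>b\<le>m. scale (a m b) (t b)) = (\<Sum>b\<le>Suc m. scale (a m b) (t b))"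
  by (simp add: a_def binomial_eq_0)
 also have "\<dots> = t 0 + (\<Sum>b\<le>m. scale (a m (Suc b)) (t (Suc b)))"
  by (subst sum.atMost_Suc_shift) (simp add: a_def)
 also have "\<dots> - (\<Sum>b\<le>m. scale (a m b) (t (Suc b))) =
   t 0 + (\<Sum>b\<le>m. scale (a m (Suc b)) (t (Suc b)) - scale (a m b) (t (Suc b)))"
  by (simp add: sum_subtractf)
 also have "\<dots> = t 0 + (\<Sum>b\<le>m. scale (a (Suc m) (Suc b)) (t (Suc b)))"
 proof -
  have "a (Suc m) (Suc b) = a m (Suc b) - a m b" for b by (simp add: a_def algebra_simps)
  then show ?thesis by (simp only: scale_left_diff_distrib)
 qed
 also have "\<dots> = (\<Sum>b\<le>Suc m. scale (a (Suc m) b) (t b))"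
  by (subst sum.atMost_Suc_shift) (simp add: a_def)
 finally show ?case by (simp add: a_def t_def)
qed simp

end

section \<open>Finite p-groups\<close>

lemma (in group) subgroup_nat_pow_closed:
 assumes "subgroup H G" "x \<in> H"
 shows "x [^] (n::nat) \<in> H"
 using assms by (induction n) (auto simp: subgroup.one_closed subgroup.m_closed)

lemma (in group) fixed_points_cong:
 assumes p: "prime p" and order: "order G = p ^ r" and "finite (carrier G)" "finite E"
  and closed: "\<And>g x. g \<in> carrier G ==> x \<in> E ==> act g x \<in> E"
  and one: "\<And>x. x \<in> E ==> act \<one> x = x"
  and mult: "\<And>g h x. g \<in> carrier G ==> h \<in> carrier G ==> x \<in> E ==> act (g \<otimes> h) x = act g (act h x)"
  and dvd: "p dvd card E" and x: "x \<in> E" "\<And>g. g \<in> carrier G ==> act g x = x"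
 shows "\<exists>y\<in>E. y \<noteq> x \<and> (\<forall>g\<in>carrier G. act g y = y)"
proof (rule ccontr)
 assume neg: "\<not> ?thesis"
 define \<phi> where "\<phi> g = (\<lambda>x\<in>E. act g x)" for g
 have bij: "\<phi> g \<in> Bij E" if g: "g \<in> carrier G" for g
 proof -
  have "bij_betw (\<phi> g) E E"
  proof (rule bij_betw_byWitness[where f' = "\<phi> (inv g)"])
   show "\<forall>a\<in>E. \<phi> (inv g) (\<phi> g a) = a"
    using g closed one by (simp add: \<phi>_def flip: mult)
   show "\<forall>a\<in>E. \<phi> g (\<phi> (inv g) a) = a"
    using g closed one by (simp add: \<phi>_def flip: mult)
  qed (use g closed in \<open>auto simp: \<phi>_def\<close>)
  then show ?thesis by (simp add: Bij_def \<phi>_def)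
 qed
 have hom: "\<phi> \<in> hom G (BijGroup E)"
 proof (rule homI)
  fix g h assume gh: "g \<in> carrier G" "h \<in> carrier G"
  show "\<phi> (g \<otimes> h) = \<phi> g \<otimes>\<^bsub>BijGroup E\<^esub> \<phi> h"
   using gh bij closed mult by (auto simp: BijGroup_def \<phi>_def compose_def restrict_def fun_eq_iff)
 qed (use bij in \<open>simp add: BijGroup_def\<close>)
 interpret act: group_action G E \<phi>
  using hom group_BijGroup is_group by (auto simp: group_action_def group_hom_def group_hom_axioms_def)
 let ?O = "orbits G E \<phi>"
 have fin: "finite ?O" using \<open>finite E\<close> by (simp add: orbits_def setcompr_eq_image)
 have part: "partition E ?O" by (rule act.orbit_partition)
 have "card E = (\<Sum>C\<in>?O. card C)"
  using disjoint_sum[OF fin \<open>finite E\<close> part, of "%_. 1 :: nat"] by simp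
 also have "\<dots> = card (orbit G \<phi> x) + (\<Sum>C\<in>?O - {orbit G \<phi> x}. card C)"
  using fin x(1) by (subst sum.remove[of _ "orbit G \<phi> x"]) (auto simp: orbits_def)
 also have "orbit G \<phi> x = {x}"
 proof -
  have "\<phi> \<one> x = x" using x one_closed by (simp add: \<phi>_def)
  then show ?thesis using x one_closed by (auto simp: orbit_def \<phi>_def intro!: exI[of _ \<one>])
 qed
 finally have E: "card E = 1 + (\<Sum>C\<in>?O - {{x}}. card C)" by simp
 have "p dvd card C" if "C \<in> ?O - {{x}}" for C
 proof -
  obtain y where y: "y \<in> E" "C = orbit G \<phi> y" using \<open>C \<in> ?O - {{x}}\<close> by (auto simp: orbits_def)
  have "card C * card (stabilizer G \<phi> y) = p ^ r"
   using act.orbit_stabilizer_theorem[OF y(1)] order y(2) by simp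
  then have "card C dvd p ^ r" by (metis dvd_triv_left)
  then obtain i where i: "card C = p ^ i" using p by (auto simp: divides_primepow_nat)
  have "card C \<noteq> 1"
  proof
   assume "card C = 1"
   then obtain w where w: "C = {w}" by (auto simp: card_1_singleton_iff)
   have yC: "y \<in> C" using y act.orbit_refl by simp
   have "act g y = y" if g: "g \<in> carrier G" for g
   proof -
    have "\<phi> g y \<in> C" using y g by (auto simp: orbit_def)
    then show ?thesis using yC w y(1) by (simp add: \<phi>_def)
   qed
   then have "y = x" using neg y(1) by blast
   then show False using that w yC by auto
  qed
  then show ?thesis using i by (cases i) auto
 qed
 then have "p dvd (\<Sum>C\<in>?O - {{x}}. card C)" by (intro dvd_sum)
 then have "p dvd 1" using dvd E by (metis dvd_add_left_iff)
 then show False using p by simp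
qed

locale p_group = group G for G (structure) +
 fixes p r :: nat
 assumes prime_p: "prime p" and order_G: "order G = p ^ r"
begin

lemma finite_G: "finite (carrier G)"
 using order_G prime_p by (intro card_ge_0_finite) (simp add: order_def prime_gt_0_nat)

lemma pow_pr: "x \<in> carrier G ==> x [^] (p ^ r) = \<one>"
 using pow_order_eq_1 order_G by metis

text \<open>
\<open>H\<close> acts on its own cosets. Modulo \<open>p\<close> the number of fixed cosets is the index of \<open>H\<close>, hence \<open>0\<close>; the
coset \<open>H\<close> itself is fixed, so there is another one; the fixed cosets lie in the normalizer.
\<close>

lemma normalizer_grows:
 assumes H: "subgroup H G" and "H \<noteq> carrier G"
 shows "\<exists>a\<in>carrier G - H. \<forall>h\<in>H. a \<otimes> h \<otimes> inv a \<in> H"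
proof -
 interpret H: group "G\<lparr>carrier := H\<rparr>" using H by (rule subgroup_imp_group)
 have finH: "finite H" using finite_G H subgroup.subset finite_subset by blast
 have lag: "card (rcosets H) * card H = p ^ r" using lagrange[OF H] order_G by (simp add: mult.commute)
 then have "card H dvd p ^ r" "card (rcosets H) dvd p ^ r" by (metis dvd_triv_right, metis dvd_triv_left)
 then obtain i j where i: "card H = p ^ i" and j: "card (rcosets H) = p ^ j"
  using prime_p by (auto simp: divides_primepow_nat)
 have "j \<noteq> 0"
 proof
  assume "j = 0"
  then have "card H = card (carrier G)" using lag j order_G by (simp add: order_def)
  then have "H = carrier G" using finite_G H subgroup.subset by (metis card_subset_eq)
  then show False using assms by simp
 qed
 then have dvd: "p dvd card (rcosets H)" using j by simp
 have HH: "H \<in> rcosets H" using H by (metis coset_join1 one_closed rcosetsI subgroup.subset coset_mult_one)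
 have car: "C \<subseteq> carrier G" if "C \<in> rcosets H" for C using that H rcosets_part_G by blast
 have "\<exists>C\<in>rcosets H. C \<noteq> H \<and> (\<forall>h\<in>carrier (G\<lparr>carrier := H\<rparr>). C #> inv h = C)"
 proof (rule H.fixed_points_cong[OF prime_p, of i])
  show "order (G\<lparr>carrier := H\<rparr>) = p ^ i" using i by (simp add: order_def)
  show "finite (rcosets H)" using finite_G by (simp add: RCOSETS_def)
  show "C #> inv h \<in> rcosets H" if "h \<in> carrier (G\<lparr>carrier := H\<rparr>)" "C \<in> rcosets H" for h C
   using that H by (auto simp: RCOSETS_def coset_mult_assoc subgroup.mem_carrier subgroup.subset
    intro!: bexI[of _ "_ \<otimes> inv h"])
  show "C #> inv \<one>\<^bsub>G\<lparr>carrier := H\<rparr>\<^esub> = C" if "C \<in> rcosets H" for C using that car by simp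
  show "C #> inv (g \<otimes>\<^bsub>G\<lparr>carrier := H\<rparr>\<^esub> h) = C #> inv h #> inv g"
   if "g \<in> carrier (G\<lparr>carrier := H\<rparr>)" "h \<in> carrier (G\<lparr>carrier := H\<rparr>)" "C \<in> rcosets H" for g h C
   using that car H by (simp add: coset_mult_assoc inv_mult_group subgroup.mem_carrier)
  show "H #> inv g = H" if "g \<in> carrier (G\<lparr>carrier := H\<rparr>)" for g
   using that H by (simp add: coset_join2 subgroup.mem_carrier subgroup.m_inv_closed)
 qed (use finH dvd HH in auto)
 then obtain C where C: "C \<in> rcosets H" "C \<noteq> H" and fixed: "\<And>h. h \<in> H ==> C #> inv h = C" by auto
 then obtain a where a: "a \<in> carrier G" "C = H #> a" by (auto simp: RCOSETS_def)
 have "a \<notin> H" using C(2) a H coset_join2 by blast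
 moreover have "a \<otimes> h \<otimes> inv a \<in> H" if h: "h \<in> H" for h
 proof -
  have hc: "h \<in> carrier G" using H h by (rule subgroup.mem_carrier)
  have "C #> inv (inv h) = C" using fixed[of "inv h"] H h by (simp add: subgroup.m_inv_closed)
  then have "H #> (a \<otimes> h) = H #> a" using a hc H by (simp add: coset_mult_assoc subgroup.subset)
  moreover have "a \<otimes> h \<in> H #> (a \<otimes> h)" using a hc H by (intro rcos_self) auto
  ultimately obtain h' where h': "h' \<in> H" "a \<otimes> h = h' \<otimes> a" by (auto simp: r_coset_def)
  then have "a \<otimes> h \<otimes> inv a = h'" using a H by (simp add: m_assoc subgroup.mem_carrier)
  then show ?thesis using h' by simp
 qed
 ultimately show ?thesis using a by blast
qed

lemma conj_pow:
 assumes H: "subgroup H G" and a: "a \<in> carrier G" "\<And>h. h \<in> H ==> a \<otimes> h \<otimes> inv a \<in> H" and h: "h \<in> H"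
 shows "a [^] (n::nat) \<otimes> h \<otimes> inv (a [^] n) \<in> H"
proof (induction n)
 case 0
 then show ?case using h H by (simp add: subgroup.mem_carrier)
next
 case (Suc n)
 have hc: "h \<in> carrier G" using H h by (rule subgroup.mem_carrier)
 have "a \<otimes> (a [^] n \<otimes> h \<otimes> inv (a [^] n)) \<otimes> inv a \<in> H" using Suc a by blast
 also have "a \<otimes> (a [^] n \<otimes> h \<otimes> inv (a [^] n)) \<otimes> inv a = a [^] Suc n \<otimes> h \<otimes> inv (a [^] Suc n)"
  using a hc nat_pow_Suc2[of a n] by (simp add: inv_mult_group m_assoc del: nat_pow_Suc)
 finally show ?case .
qed

lemma p_root:
 assumes H: "subgroup H G" and a: "a \<in> carrier G" "a \<notin> H"
 shows "\<exists>n::nat. a [^] n \<notin> H \<and> (a [^] n) [^] p \<in> H"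
proof -
 have ex: "a [^] (p ^ r) \<in> H" using a H by (simp add: pow_pr subgroup.one_closed)
 define j where "j = (LEAST j. a [^] (p ^ j) \<in> H)"
 have j: "a [^] (p ^ j) \<in> H" unfolding j_def using ex by (rule LeastI)
 have "j \<noteq> 0" using j a by (cases j) auto
 then obtain i where i: "j = Suc i" by (cases j) auto
 have "a [^] (p ^ i) \<notin> H" using not_less_Least[of i "%j. a [^] (p ^ j) \<in> H"] i j_def by simp
 moreover have "(a [^] (p ^ i)) [^] p \<in> H" using j i a by (simp add: nat_pow_pow mult.commute)
 ultimately show ?thesis by blast
qed

lemma normalizer_grows_p:
 assumes H: "subgroup H G" and "H \<noteq> carrier G"
 shows "\<exists>a\<in>carrier G - H. a [^] p \<in> H \<and> (\<forall>h\<in>H. a \<otimes> h \<otimes> inv a \<in> H)"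
proof -
 obtain a where a: "a \<in> carrier G" "a \<notin> H" "\<And>h. h \<in> H ==> a \<otimes> h \<otimes> inv a \<in> H"
  using normalizer_grows[OF assms] by auto
 obtain n :: nat where "a [^] n \<notin> H" "(a [^] n) [^] p \<in> H" using p_root[OF H a(1,2)] by auto
 then show ?thesis using conj_pow[OF H a(1,3)] a(1) by (intro bexI[of _ "a [^] n"]) auto
qed

lemma central_element:
 assumes "r \<noteq> 0"
 shows "\<exists>z\<in>carrier G. z \<noteq> \<one> \<and> z [^] p = \<one> \<and> (\<forall>g\<in>carrier G. g \<otimes> z = z \<otimes> g)"
proof -
 have "\<exists>z\<in>carrier G. z \<noteq> \<one> \<and> (\<forall>g\<in>carrier G. g \<otimes> z \<otimes> inv g = z)"
 proof (rule fixed_points_cong[OF prime_p order_G])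
  show "p dvd card (carrier G)" using assms order_G by (simp add: order_def)
  show "g \<otimes> h \<otimes> x \<otimes> inv (g \<otimes> h) = g \<otimes> (h \<otimes> x \<otimes> inv h) \<otimes> inv g"
   if "g \<in> carrier G" "h \<in> carrier G" "x \<in> carrier G" for g h x
   using that by (simp add: inv_mult_group m_assoc)
 qed (use finite_G in auto)
 then obtain z where z: "z \<in> carrier G" "z \<noteq> \<one>" "\<And>g. g \<in> carrier G ==> g \<otimes> z \<otimes> inv g = z" by auto
 obtain n :: nat where n: "z [^] n \<notin> {\<one>}" "(z [^] n) [^] p \<in> {\<one>}"
  using p_root[OF triv_subgroup z(1)] z(2) by auto
 have "g \<otimes> z = z \<otimes> g" if "g \<in> carrier G" for g
  using z(1,3) that by (metis inv_closed inv_solve_right m_closed)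
 then have "g \<otimes> z [^] n = z [^] n \<otimes> g" if "g \<in> carrier G" for g
  using pow_mult_distrib z(1) that by (induction n) (auto simp: m_assoc, metis m_assoc nat_pow_closed)
 then show ?thesis using n z(1) by (intro bexI[of _ "z [^] n"]) auto
qed

lemma extend_subgroup:
 assumes H: "subgroup H G" and a: "a \<in> carrier G" "a \<notin> H" "a [^] p \<in> H"
  and conj: "\<And>h. h \<in> H ==> a \<otimes> h \<otimes> inv a \<in> H"
 defines "H' \<equiv> (%(h, l). h \<otimes> a [^] l) ` (H \<times> {..<p})"
 shows "subgroup H' G" and "inj_on (%(h, l). h \<otimes> a [^] l) (H \<times> {..<p})" and "H \<subset> H'"
proof -
 have Hc: "h \<in> carrier G" if "h \<in> H" for h using H that by (rule subgroup.mem_carrier)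
 have p0: "0 < p" "1 < p" using prime_p prime_gt_0_nat prime_gt_1_nat by auto
 have red: "h \<otimes> a [^] (n::nat) \<in> H'" if h: "h \<in> H" for h n
 proof -
  have "a [^] n = (a [^] p) [^] (n div p) \<otimes> a [^] (n mod p)"
   using a by (simp add: nat_pow_pow nat_pow_mult)
  moreover have ap: "(a [^] p) [^] (n div p) \<in> H" using H a(3) by (simp add: subgroup_nat_pow_closed)
  ultimately have "h \<otimes> a [^] n = (h \<otimes> (a [^] p) [^] (n div p)) \<otimes> a [^] (n mod p)"
   using a h Hc by (simp add: m_assoc)
  moreover have "h \<otimes> (a [^] p) [^] (n div p) \<in> H" using H h ap by (simp add: subgroup.m_closed)
  ultimately show ?thesis unfolding H'_def using p0 by (auto intro!: image_eqI[of _ _ "(_, n mod p)"])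
 qed
 have sub: "H' \<subseteq> carrier G" unfolding H'_def using Hc a by auto
 have mult: "x \<otimes> y \<in> H'" if xy: "x \<in> H'" "y \<in> H'" for x y
 proof -
  obtain h l h' l' where x: "x = h \<otimes> a [^] (l::nat)" "h \<in> H" and y: "y = h' \<otimes> a [^] (l'::nat)" "h' \<in> H"
   using xy unfolding H'_def by auto
  have c: "a [^] l \<otimes> h' \<otimes> inv (a [^] l) \<in> H" using conj_pow[OF H a(1) conj y(2)] by simp
  have "x \<otimes> y = (h \<otimes> (a [^] l \<otimes> h' \<otimes> inv (a [^] l))) \<otimes> a [^] (l + l')"
   using x y Hc a by (simp add: m_assoc inv_solve_left flip: nat_pow_mult)
  then show ?thesis using red[of "h \<otimes> (a [^] l \<otimes> h' \<otimes> inv (a [^] l))" "l + l'"] c H x(2) by (simp add: subgroup.m_closed)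
 qed
 have one: "\<one> \<in> H'" using red[OF subgroup.one_closed[OF H], of 0] by simp
 have pow: "x [^] (n::nat) \<in> H'" if "x \<in> H'" for x n
  using that by (induction n) (auto simp: one mult)
 show "subgroup H' G"
 proof (rule subgroupI)
  show "inv x \<in> H'" if x: "x \<in> H'" for x
  proof -
   have xc: "x \<in> carrier G" using x sub by auto
   have "x \<otimes> x [^] (p ^ r - 1) = x [^] (p ^ r)"
    using xc p0 nat_pow_mult[of x 1 "p ^ r - 1"] by simp
   then have "inv x = x [^] (p ^ r - 1)" using xc pow_pr by (metis inv_equality inv_inv nat_pow_closed inv_unique' r_inv)
   then show ?thesis using pow[OF x] by simp
  qed
 qed (use sub one mult in auto)
 show "inj_on (%(h, l). h \<otimes> a [^] l) (H \<times> {..<p})"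
 proof -
  have key: False if "h \<in> H" "h' \<in> H" "h \<otimes> a [^] l = h' \<otimes> a [^] l'" "l < l'" "l' < p" for h h' and l l' :: nat
  proof -
   define d where "d = l' - l"
   have d: "0 < d" "d < p" "l' = d + l" using that by (auto simp: d_def)
   have "h \<otimes> a [^] l = (h' \<otimes> a [^] d) \<otimes> a [^] l" using that d Hc a by (simp add: m_assoc nat_pow_mult)
   then have "h = h' \<otimes> a [^] d" using Hc a that by (simp add: right_cancel)
   then have "a [^] d = inv h' \<otimes> h" using Hc a that by (simp add: inv_solve_left)
   then have ad: "a [^] d \<in> H" using H that by (simp add: subgroup.m_closed subgroup.m_inv_closed)
   have "coprime d p" using d prime_p by (metis coprime_commute nat_dvd_not_less prime_imp_coprime)
   then obtain i k where ik: "d * i = p * k + 1"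
    using bezout_nat[of d p] d by (metis coprime_bezout_strong[of d p] nat_neq_iff prime_p not_prime_1)
   have "(a [^] d) [^] i = a [^] (p * k) \<otimes> a [^] (1::nat)"
    by (simp only: nat_pow_pow[OF a(1)] nat_pow_mult[OF a(1)] ik)
   then have "(a [^] d) [^] i = (a [^] p) [^] k \<otimes> a" using a(1) by (simp add: nat_pow_pow)
   then have "a = inv ((a [^] p) [^] k) \<otimes> (a [^] d) [^] i"
    using a(1) by (simp add: m_assoc[symmetric])
   moreover have "(a [^] d) [^] i \<in> H" "(a [^] p) [^] k \<in> H"
    using H ad a by (simp_all add: subgroup_nat_pow_closed)
   ultimately show False using H a by (metis subgroup.m_closed subgroup.m_inv_closed)
  qed
  show ?thesis
  proof (rule inj_onI, clarsimp)
   fix h l h' l' assume *: "h \<in> H" "l < p" "h' \<in> H" "l' < p" "h \<otimes> a [^] l = h' \<otimes> a [^] l'"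
   then have "l = l'" using key[of h h' l l'] key[of h' h l' l] by (metis nat_neq_iff)
   then show "h = h' \<and> l = l'" using * Hc a by (metis right_cancel nat_pow_closed)
  qed
 qed
 have "H \<subseteq> H'" using red[of _ 0] Hc by auto
 moreover have "a \<in> H'" using red[OF subgroup.one_closed[OF H], of 1] a by simp
 ultimately show "H \<subset> H'" using a by auto
qed

end

section \<open>Groups of order p squared\<close>

context p_group begin

lemma commutative_of_generators:
 assumes z: "z \<in> carrier G" "\<And>g. g \<in> carrier G ==> g \<otimes> z = z \<otimes> g" and h: "h \<in> carrier G"
  and gen: "\<And>k. k \<in> carrier G ==> \<exists>(i :: nat) (j :: nat). k = z [^] i \<otimes> h [^] j"
  and k: "k \<in> carrier G" "l \<in> carrier G"
 shows "k \<otimes> l = l \<otimes> k"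
proof -
 have zc: "g \<otimes> z [^] (i :: nat) = z [^] i \<otimes> g" if g: "g \<in> carrier G" for g i
 proof (induction i)
  case (Suc i)
  have "g \<otimes> z [^] Suc i = (g \<otimes> z [^] i) \<otimes> z" using g z(1) by (simp add: m_assoc)
  also have "\<dots> = z [^] i \<otimes> (g \<otimes> z)" unfolding Suc using g z(1) by (simp add: m_assoc)
  also have "\<dots> = z [^] Suc i \<otimes> g" unfolding z(2)[OF g] using g z(1) by (simp add: m_assoc)
  finally show ?case .
 qed (use g in simp)
 obtain i j i' j' :: nat where kl: "k = z [^] i \<otimes> h [^] j" "l = z [^] i' \<otimes> h [^] j'" using gen[OF k(1)] gen[OF k(2)] by blast
 have "k \<otimes> l = z [^] i \<otimes> (h [^] j \<otimes> z [^] i') \<otimes> h [^] j'" using z(1) h by (simp add: kl m_assoc)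
 also have "\<dots> = (z [^] i \<otimes> z [^] i') \<otimes> (h [^] j \<otimes> h [^] j')"
  unfolding zc[OF nat_pow_closed[OF h]] using z(1) h by (simp add: m_assoc)
 also have "\<dots> = (z [^] i' \<otimes> z [^] i) \<otimes> (h [^] j' \<otimes> h [^] j)"
  unfolding nat_pow_mult[OF z(1)] nat_pow_mult[OF h] by (simp only: add.commute)
 also have "\<dots> = z [^] i' \<otimes> (h [^] j' \<otimes> z [^] i) \<otimes> h [^] j"
  unfolding zc[OF nat_pow_closed[OF h]] using z(1) h by (simp add: m_assoc)
 also have "\<dots> = l \<otimes> k" using z(1) h by (simp add: kl m_assoc)
 finally show ?thesis .
qed

text \<open>
If no element has order \<open>p\<^sup>2\<close>, then a central element \<open>z\<close> of order \<open>p\<close> and any element outside \<open>\<langle>z\<rangle>\<close> generate the group.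
\<close>

lemma cyclic_or_elementary:
 assumes order: "order G = p ^ 2"
 shows "(\<exists>g\<in>carrier G. bij_betw (%i. g [^] i) {..<p ^ 2} (carrier G) \<and> g [^] (p ^ 2) = \<one>) \<or>
  (\<exists>g\<in>carrier G. \<exists>h\<in>carrier G. g [^] p = \<one> \<and> h [^] p = \<one> \<and>
   bij_betw (%(i, j). g [^] i \<otimes> h [^] j) ({..<p} \<times> {..<p}) (carrier G) \<and> (\<forall>k\<in>carrier G. \<forall>l\<in>carrier G. k \<otimes> l = l \<otimes> k))"
proof -
 have p1: "1 < p" and p0: "0 < p" using prime_gt_1_nat[OF prime_p] by auto
 have cardG: "card (carrier G) = p ^ 2" using order by (simp add: order_def)
 have pp: "g [^] (p ^ 2) = \<one>" if "g \<in> carrier G" for g using pow_order_eq_1[OF that] order by simp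
 show ?thesis
 proof (cases "\<exists>g\<in>carrier G. ord g = p ^ 2")
  case True
  then obtain g where g: "g \<in> carrier G" "ord g = p ^ 2" by blast
  have inj: "inj_on (%i. g [^] i) {..<p ^ 2}"
   using ord_inj[OF g(1)] p0 by (auto simp: g(2) inj_on_def)
  have "(%i. g [^] i) ` {..<p ^ 2} = carrier G"
   using card_image[OF inj] cardG g(1) by (intro card_subset_eq[OF finite_G]) auto
  then show ?thesis using inj g(1) pp by (auto simp: bij_betw_def)
 next
  case False
  have ordp: "g [^] p = \<one>" if g: "g \<in> carrier G" for g
  proof -
   have "ord g dvd p ^ 2" using ord_dvd_group_order[OF g] order by simp
   then obtain i where "i \<le> 2" "ord g = p ^ i" using divides_primepow_nat[OF prime_p] by blast
   then have "ord g dvd p" using False g by (cases "i = 2") (auto simp: le_Suc_eq numeral_2_eq_2)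
   then show ?thesis using pow_eq_id[OF g] by simp
  qed
  have "r \<noteq> 0" using order order_G one_less_power[OF p1, of 2] by (intro notI) simp
  then obtain z where z: "z \<in> carrier G" "z \<noteq> \<one>" "\<And>g. g \<in> carrier G ==> g \<otimes> z = z \<otimes> g"
   using central_element by blast
  define Z where "Z = (%(k, l). k \<otimes> z [^] l) ` ({\<one>} \<times> {..<p})"
  have t: "subgroup {\<one>} G" by (rule triv_subgroup)
  have zZ: "z \<notin> {\<one>}" "z [^] p \<in> {\<one>}" "\<And>k. k \<in> {\<one>} ==> z \<otimes> k \<otimes> inv z \<in> {\<one>}" using z ordp by auto
  have Z: "subgroup Z G" unfolding Z_def by (rule extend_subgroup(1)[OF t z(1) zZ])
  have injZ: "inj_on (%(k, l). k \<otimes> z [^] l) ({\<one>} \<times> {..<p})" by (rule extend_subgroup(2)[OF t z(1) zZ])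
  have Zc: "k \<otimes> x = x \<otimes> k" if k: "k \<in> carrier G" and x: "x \<in> Z" for k x
  proof -
   have "k \<otimes> z [^] (i :: nat) = z [^] i \<otimes> k" for i
   proof (induction i)
    case (Suc i)
    have "k \<otimes> z [^] Suc i = (k \<otimes> z [^] i) \<otimes> z" using k z(1) by (simp add: m_assoc)
    also have "\<dots> = z [^] i \<otimes> (k \<otimes> z)" unfolding Suc using k z(1) by (simp add: m_assoc)
    also have "\<dots> = z [^] Suc i \<otimes> k" unfolding z(3)[OF k] using k z(1) by (simp add: m_assoc)
    finally show ?case .
   qed (use k in simp)
   then show ?thesis using x z(1) by (auto simp: Z_def)
  qed
  have cZ: "card Z = p" unfolding Z_def using card_image[OF injZ] by simp
  have "Z \<noteq> carrier G"
  proof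
   assume "Z = carrier G"
   then have "p = p ^ 2" using cZ cardG by simp
   then show False using p1 by (simp add: power2_eq_square)
  qed
  then obtain h where h: "h \<in> carrier G" "h \<notin> Z" using subgroup.subset[OF Z] by blast
  have hZ: "h [^] p \<in> Z" using ordp[OF h(1)] subgroup.one_closed[OF Z] by simp
  have conj: "h \<otimes> k \<otimes> inv h \<in> Z" if k: "k \<in> Z" for k
   using Zc[OF h(1) k] h(1) k subgroup.mem_carrier[OF Z k] by (simp add: m_assoc)
  have inj2: "inj_on (%(k, l). k \<otimes> h [^] l) (Z \<times> {..<p})" by (rule extend_subgroup(2)[OF Z h hZ conj])
  have inj: "inj_on (%(i, j). z [^] i \<otimes> h [^] j) ({..<p} \<times> {..<p})"
  proof (rule inj_onI)
   fix x y assume xy: "x \<in> {..<p} \<times> {..<p}" "y \<in> {..<p} \<times> {..<p}"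
    and eq: "(%(i, j). z [^] i \<otimes> h [^] j) x = (%(i, j). z [^] i \<otimes> h [^] j) y"
   obtain i j i' j' where x: "x = (i, j)" "y = (i', j')" "i < p" "j < p" "i' < p" "j' < p" using xy by auto
   have iZ: "z [^] l \<in> Z" if "l < p" for l unfolding Z_def using that z(1) by (intro image_eqI[of _ _ "(\<one>, l)"]) auto
   have "(z [^] i, j) = (z [^] i', j')"
    by (rule inj_onD[OF inj2]) (use eq x iZ in auto)
   moreover have "(\<one>, i) = (\<one>, i')" if "z [^] i = z [^] i'"
    by (rule inj_onD[OF injZ]) (use that x z(1) in auto)
   ultimately show "x = y" using x by auto
  qed
  have im: "(%(i, j). z [^] i \<otimes> h [^] j) ` ({..<p} \<times> {..<p}) = carrier G"
  proof (rule card_subset_eq[OF finite_G])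
   show "(%(i, j). z [^] i \<otimes> h [^] j) ` ({..<p} \<times> {..<p}) \<subseteq> carrier G" using z(1) h(1) by auto
   show "card ((%(i, j). z [^] i \<otimes> h [^] j) ` ({..<p} \<times> {..<p})) = card (carrier G)"
    using card_image[OF inj] cardG by (simp add: card_cartesian_product power2_eq_square)
  qed
  have gen: "\<exists>(i :: nat) (j :: nat). k = z [^] i \<otimes> h [^] j" if "k \<in> carrier G" for k
  proof -
   have "k \<in> (%(i, j). z [^] i \<otimes> h [^] j) ` ({..<p} \<times> {..<p})" unfolding im by (rule that)
   then show ?thesis by (elim imageE) (auto simp: case_prod_unfold)
  qed
  have comm: "k \<otimes> l = l \<otimes> k" if "k \<in> carrier G" "l \<in> carrier G" for k l
   by (rule commutative_of_generators[OF z(1) z(3) h(1) gen that])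
  have "bij_betw (%(i, j). z [^] i \<otimes> h [^] j) ({..<p} \<times> {..<p}) (carrier G)"
   using inj im by (rule bij_betw_imageI)
  then show ?thesis
   by (intro disjI2 bexI[of _ z] bexI[of _ h] conjI ballI ordp z(1) h(1) comm)
 qed
qed

end

section \<open>The group algebra\<close>

context group begin

definition kd :: "'a => 'k::field => 'a => 'k" where
 "kd g c = (\<lambda>x\<in>carrier G. if x = g then c else 0)"

lemma kd_closed [simp]: "kd g c \<in> carrier (group_algebra G)"
 by (simp add: kd_def group_algebra_def)

lemma kd_add: "kd g c \<oplus>\<^bsub>group_algebra G\<^esub> kd g d = kd g (c + d)"
 by (auto simp: kd_def group_algebra_def fun_eq_iff)

lemma sum_group_left: "z \<in> carrier G ==> (\<Sum>w\<in>carrier G. f (z \<otimes> w)) = (\<Sum>w\<in>carrier G. f w)"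
 by (rule sum.reindex_bij_witness[where i = "%w. inv z \<otimes> w" and j = "%w. z \<otimes> w"])
  (auto simp flip: m_assoc)

lemma sum_group_right: "z \<in> carrier G ==> (\<Sum>w\<in>carrier G. f (w \<otimes> z)) = (\<Sum>w\<in>carrier G. f w)"
 by (rule sum.reindex_bij_witness[where i = "%w. w \<otimes> inv z" and j = "%w. w \<otimes> z"])
  (auto simp: m_assoc)

lemma kd_mult:
 assumes fin: "finite (carrier G)" and g: "g \<in> carrier G" "h \<in> carrier G"
 shows "kd g c \<otimes>\<^bsub>group_algebra G\<^esub> kd h d = (kd (g \<otimes> h) (c * d) :: 'a => 'k::field)"
proof -
 have "(\<Sum>y\<in>carrier G. kd g c y * kd h d (inv y \<otimes> x)) = kd (g \<otimes> h) (c * d) x" if x: "x \<in> carrier G" for x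
 proof -
  have "(\<Sum>y\<in>carrier G. kd g c y * kd h d (inv y \<otimes> x)) = (\<Sum>y\<in>carrier G. if y = g then c * kd h d (inv g \<otimes> x) else 0)"
   by (rule sum.cong) (auto simp: kd_def)
  also have "\<dots> = c * kd h d (inv g \<otimes> x)" using fin g by simp
  also have "\<dots> = kd (g \<otimes> h) (c * d) x"
   using g x by (auto simp: kd_def inv_solve_left inv_solve_left')
  finally show ?thesis .
 qed
 then show ?thesis by (auto simp: group_algebra_def fun_eq_iff kd_def)
qed

lemma group_algebra_ring:
 assumes fin: "finite (carrier G)"
 shows "ring (group_algebra G :: ('a => 'k::field) ring)" (is "ring ?R")
proof (rule ringI)
 show "abelian_group ?R"
 proof (rule abelian_groupI)
  fix a assume a: "a \<in> carrier ?R"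
  show "\<zero>\<^bsub>?R\<^esub> \<oplus>\<^bsub>?R\<^esub> a = a"
   using a by (auto simp: group_algebra_def fun_eq_iff PiE_def extensional_def)
  show "\<exists>b\<in>carrier ?R. b \<oplus>\<^bsub>?R\<^esub> a = \<zero>\<^bsub>?R\<^esub>"
   by (rule bexI[of _ "\<lambda>x\<in>carrier G. - a x"]) (auto simp: group_algebra_def fun_eq_iff)
 qed (auto simp: group_algebra_def fun_eq_iff algebra_simps)
 show "Group.monoid ?R"
 proof (rule monoidI)
  fix a b c assume a: "a \<in> carrier ?R" and b: "b \<in> carrier ?R" and c: "c \<in> carrier ?R"
  have "(\<Sum>y\<in>carrier G. (\<Sum>z\<in>carrier G. a z * b (inv z \<otimes> y)) * c (inv y \<otimes> x)) =
    (\<Sum>z\<in>carrier G. a z * (\<Sum>w\<in>carrier G. b w * c (inv w \<otimes> (inv z \<otimes> x))))" if x: "x \<in> carrier G" for x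
  proof -
   have "(\<Sum>y\<in>carrier G. (\<Sum>z\<in>carrier G. a z * b (inv z \<otimes> y)) * c (inv y \<otimes> x)) =
     (\<Sum>z\<in>carrier G. \<Sum>y\<in>carrier G. a z * b (inv z \<otimes> y) * c (inv y \<otimes> x))"
    by (subst sum.swap) (simp add: sum_distrib_right)
   also have "\<dots> = (\<Sum>z\<in>carrier G. \<Sum>w\<in>carrier G. a z * b (inv z \<otimes> (z \<otimes> w)) * c (inv (z \<otimes> w) \<otimes> x))"
    by (intro sum.cong refl sum_group_left[symmetric])
   also have "\<dots> = (\<Sum>z\<in>carrier G. \<Sum>w\<in>carrier G. a z * (b w * c (inv w \<otimes> (inv z \<otimes> x))))"
   proof (intro sum.cong refl)
    fix z w assume z: "z \<in> carrier G" and w: "w \<in> carrier G"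
    have "inv z \<otimes> (z \<otimes> w) = w" using z w by (simp add: m_assoc[symmetric])
    moreover have "inv (z \<otimes> w) \<otimes> x = inv w \<otimes> (inv z \<otimes> x)"
     using z w x by (simp add: inv_mult_group m_assoc)
    ultimately show "a z * b (inv z \<otimes> (z \<otimes> w)) * c (inv (z \<otimes> w) \<otimes> x) =
      a z * (b w * c (inv w \<otimes> (inv z \<otimes> x)))" by (simp only: mult.assoc)
   qed
   finally show ?thesis by (simp add: sum_distrib_left)
  qed
  then show "a \<otimes>\<^bsub>?R\<^esub> b \<otimes>\<^bsub>?R\<^esub> c = a \<otimes>\<^bsub>?R\<^esub> (b \<otimes>\<^bsub>?R\<^esub> c)"
   by (simp add: group_algebra_def fun_eq_iff cong: sum.cong)
 next
  fix a assume a: "a \<in> carrier ?R"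
  have "(\<Sum>y\<in>carrier G. (if y = \<one> then 1 else 0) * a (inv y \<otimes> x)) = a x" if x: "x \<in> carrier G" for x
  proof -
   have "(\<Sum>y\<in>carrier G. (if y = \<one> then 1 else 0) * a (inv y \<otimes> x)) = (\<Sum>y\<in>carrier G. if y = \<one> then a x else 0)"
    by (rule sum.cong) (use x in auto)
   then show ?thesis using fin by simp
  qed
  then show "\<one>\<^bsub>?R\<^esub> \<otimes>\<^bsub>?R\<^esub> a = a"
   using a by (auto simp: group_algebra_def fun_eq_iff PiE_def extensional_def cong: sum.cong)
  have "(\<Sum>y\<in>carrier G. a y * (if inv y \<otimes> x = \<one> then 1 else 0)) = a x" if x: "x \<in> carrier G" for x
  proof -
   have "(\<Sum>y\<in>carrier G. a y * (if inv y \<otimes> x = \<one> then 1 else 0)) = (\<Sum>y\<in>carrier G. if y = x then a x else 0)"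
    by (rule sum.cong) (use x in \<open>auto simp: inv_solve_left'\<close>)
   then show ?thesis using fin x by simp
  qed
  then show "a \<otimes>\<^bsub>?R\<^esub> \<one>\<^bsub>?R\<^esub> = a"
   using a by (auto simp: group_algebra_def fun_eq_iff PiE_def extensional_def cong: sum.cong)
 qed (auto simp: group_algebra_def)
qed (auto simp: group_algebra_def fun_eq_iff algebra_simps sum.distrib cong: sum.cong)

end

section \<open>Representations on a fixed vector space\<close>

abbreviation "lookup \<equiv> Poly_Mapping.lookup"
abbreviation "keys \<equiv> Poly_Mapping.keys"

definition pscale :: "'k::field => ('u \<Rightarrow>\<^sub>0 'k) => ('u \<Rightarrow>\<^sub>0 'k)" where
 "pscale c v = Poly_Mapping.map ((*) c) v"

lemma lookup_pscale [simp]: "lookup (pscale c v) u = c * lookup v u"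
 by (simp add: pscale_def Poly_Mapping.map.rep_eq when_def)

lemma kspace_pscale: "kspace pscale"
 by unfold_locales (auto intro!: poly_mapping_eqI simp: lookup_add algebra_simps)

definition lext :: "('u => ('w \<Rightarrow>\<^sub>0 'k)) => ('u \<Rightarrow>\<^sub>0 'k::field) => ('w \<Rightarrow>\<^sub>0 'k)" where
 "lext f v = (\<Sum>u\<in>keys v. pscale (lookup v u) (f u))"

locale group_modules = group G for G :: "('g, 'm) monoid_scheme" (structure) +
 fixes e :: "'k::field => 'u"
 assumes finite_G: "finite (carrier G)" and infinite_U: "infinite (UNIV :: 'u set)" and inj_e: "inj e"
begin

sublocale kspace "pscale :: 'k => ('u \<Rightarrow>\<^sub>0 'k) => ('u \<Rightarrow>\<^sub>0 'k)" by (rule kspace_pscale)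

lemma lext_superset:
 fixes f :: "'u => ('u \<Rightarrow>\<^sub>0 'k)"
 assumes "finite A" "keys v \<subseteq> A"
 shows "lext f v = (\<Sum>u\<in>A. pscale (lookup v u) (f u))"
 unfolding lext_def using assms by (intro sum.mono_neutral_left) (auto simp: in_keys_iff)

lemma lext_lin: "lin (lext (f :: 'u => ('u \<Rightarrow>\<^sub>0 'k)))"
proof (rule linI)
 fix v w :: "'u \<Rightarrow>\<^sub>0 'k"
 let ?A = "keys v \<union> keys w"
 have "keys (v + w) \<subseteq> ?A" by (rule keys_add)
 then show "lext f (v + w) = lext f v + lext f w"
  using lext_superset[of ?A "v + w" f] lext_superset[of ?A v f] lext_superset[of ?A w f]
  by (simp add: lookup_add scale_left_distrib sum.distrib)
next
 fix c and v :: "'u \<Rightarrow>\<^sub>0 'k"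
 have "keys (pscale c v) \<subseteq> keys v" by (auto simp: in_keys_iff)
 then show "lext f (pscale c v) = pscale c (lext f v)"
  using lext_superset[of "keys v" "pscale c v" f] lext_superset[of "keys v" v f]
  by (simp add: scale_sum_right)
qed

lemma lext_single [simp]: "lext f (Poly_Mapping.single u 1) = (f u :: 'u \<Rightarrow>\<^sub>0 'k)"
 by (simp add: lext_def)

lemma single_expansion: "(v :: 'u \<Rightarrow>\<^sub>0 'k) = (\<Sum>u\<in>keys v. pscale (lookup v u) (Poly_Mapping.single u 1))"
proof (rule poly_mapping_eqI)
 fix w
 have "lookup (\<Sum>u\<in>keys v. pscale (lookup v u) (Poly_Mapping.single u 1)) w =
   (\<Sum>u\<in>keys v. lookup v u * (if u = w then 1 else 0))"
  by (simp add: lookup_sum lookup_single when_def)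
 also have "\<dots> = (\<Sum>u\<in>keys v. if u = w then lookup v u else 0)" by (rule sum.cong) auto
 also have "\<dots> = lookup v w" by (simp add: in_keys_iff)
 finally show "lookup v w = lookup (\<Sum>u\<in>keys v. pscale (lookup v u) (Poly_Mapping.single u 1)) w" ..
qed

lemma lin_eqI:
 assumes f: "lin f" and g: "lin g" and "\<And>u. f (Poly_Mapping.single u 1) = g (Poly_Mapping.single u 1)"
 shows "f v = g v"
 by (subst (1 2) single_expansion) (simp add: lin_sum[OF f] lin_sum[OF g] lin_scale[OF f] lin_scale[OF g] assms(3))

abbreviation KG :: "('g => 'k) ring" where "KG \<equiv> group_algebra G"

lemma times_inj: "\<exists>j :: 'g \<times> 'u => 'u. inj_on j (carrier G \<times> UNIV)"
proof -
 obtain B :: "'u set" where "finite B" "card B = card (carrier G)"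
  using infinite_arbitrarily_large[OF infinite_U] by blast
 then obtain b where b: "bij_betw b (carrier G) B" using finite_G by (metis finite_same_card_bij)
 obtain c :: "'u \<times> 'u => 'u" where c: "inj c"
  using card_of_Times_same_infinite[OF infinite_U] card_of_ordIso bij_betw_imp_inj_on by (metis UNIV_Times_UNIV)
 have "inj_on (%(g, u). c (b g, u)) (carrier G \<times> UNIV)"
  using inj_onD[OF bij_betw_imp_inj_on[OF b]] by (auto intro!: inj_onI dest!: injD[OF c])
 then show ?thesis by blast
qed

text \<open>
The space of finitely supported functions fits into the universe: such a function is determined by its graph, a finite set of pairs, and an infinite
set is equipotent to its finite subsets.
\<close>

lemma vector_inj: "\<exists>\<iota> :: ('u \<Rightarrow>\<^sub>0 'k) => 'u. inj \<iota>"
proof -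
 obtain c :: "'u \<times> 'u => 'u" where c: "inj c"
  using card_of_Times_same_infinite[OF infinite_U] card_of_ordIso bij_betw_imp_inj_on by (metis UNIV_Times_UNIV)
 obtain s :: "'u set => 'u" where s: "inj_on s (Fpow UNIV)"
  using eqpoll_Fpow[OF infinite_U] by (auto simp: eqpoll_def bij_betw_def)
 define \<iota> where "\<iota> v = s ((%u. c (u, e (lookup v u))) ` keys v)" for v :: "'u \<Rightarrow>\<^sub>0 'k"
 have "v = w" if "\<iota> v = \<iota> w" for v w
 proof (rule poly_mapping_eqI)
  fix u
  have "(%u. c (u, e (lookup v u))) ` keys v = (%u. c (u, e (lookup w u))) ` keys w"
   using that s by (auto simp: \<iota>_def inj_on_def Fpow_def)
  then have "(%u. (u, lookup v u)) ` keys v = (%u. (u, lookup w u)) ` keys w"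
  proof -
   assume *: "(%u. c (u, e (lookup v u))) ` keys v = (%u. c (u, e (lookup w u))) ` keys w"
   have "inj (%(u, k). c (u, e k))" by (auto intro!: injI dest!: injD[OF c] injD[OF inj_e])
   moreover have "(%(u, k). c (u, e k)) ` (%u. (u, lookup v u)) ` keys v = (%(u, k). c (u, e k)) ` (%u. (u, lookup w u)) ` keys w"
    using * by (simp add: image_image)
   ultimately show ?thesis by (simp add: inj_image_eq_iff)
  qed
  then have "(u, x) \<in> (%u. (u, lookup v u)) ` keys v \<longleftrightarrow> (u, x) \<in> (%u. (u, lookup w u)) ` keys w" for x by simp
  then show "lookup v u = lookup w u" by (auto simp: in_keys_iff image_iff) metis
 qed
 then show ?thesis by (auto simp: inj_def)
qed

definition \<iota> :: "('u \<Rightarrow>\<^sub>0 'k) => 'u" where "\<iota> = (SOME i. inj i)"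

lemma inj_\<iota>: "inj \<iota>" unfolding \<iota>_def using vector_inj by (rule someI_ex)

text \<open>
Multiplicative, but the neutral element need only act as a projection: modules that are smaller than the ambient space are represented on it as well.
\<close>

definition rep :: "('g => ('u \<Rightarrow>\<^sub>0 'k) => ('u \<Rightarrow>\<^sub>0 'k)) => bool" where
 "rep rh \<longleftrightarrow> (\<forall>g\<in>carrier G. lin (rh g)) \<and>
  (\<forall>g\<in>carrier G. \<forall>h\<in>carrier G. \<forall>v. rh (g \<otimes> h) v = rh g (rh h v))"

lemma repD: assumes "rep rh"
 shows "g \<in> carrier G ==> lin (rh g)"
  and "g \<in> carrier G ==> h \<in> carrier G ==> rh g (rh h v) = rh (g \<otimes> h) v"
 using assms by (auto simp: rep_def)

text \<open>
\<open>ka\<close> and \<open>em\<close> identify the module \<open>M\<close> with the image of the projection by which the neutral element acts.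
\<close>

definition coord :: "('g => 'k, 'u) module => ('g => ('u \<Rightarrow>\<^sub>0 'k) => ('u \<Rightarrow>\<^sub>0 'k)) =>
  ('u => ('u \<Rightarrow>\<^sub>0 'k)) => (('u \<Rightarrow>\<^sub>0 'k) => 'u) => bool" where
 "coord M rh ka em \<longleftrightarrow> left_module KG M \<and> rep rh \<and> (\<forall>v. em v \<in> carrier M) \<and>
  (\<forall>x\<in>carrier M. em (ka x) = x) \<and> (\<forall>v. ka (em v) = rh \<one> v) \<and>
  (\<forall>x\<in>carrier M. \<forall>y\<in>carrier M. ka (x \<oplus>\<^bsub>M\<^esub> y) = ka x + ka y) \<and>
  (\<forall>a\<in>carrier KG. \<forall>x\<in>carrier M. ka (a \<odot>\<^bsub>M\<^esub> x) = (\<Sum>g\<in>carrier G. pscale (a g) (rh g (ka x))))"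

lemma coordD:
 assumes "coord M rh ka em"
 shows "left_module KG M" "rep rh" "em v \<in> carrier M"
  and "x \<in> carrier M ==> em (ka x) = x" and "ka (em v) = rh \<one> v"
  and "x \<in> carrier M ==> y \<in> carrier M ==> ka (x \<oplus>\<^bsub>M\<^esub> y) = ka x + ka y"
  and "a \<in> carrier KG ==> x \<in> carrier M ==> ka (a \<odot>\<^bsub>M\<^esub> x) = (\<Sum>g\<in>carrier G. pscale (a g) (rh g (ka x)))"
  and "x \<in> carrier M ==> rh \<one> (ka x) = ka x"
  and "x \<in> carrier M ==> y \<in> carrier M ==> ka x = ka y ==> x = y"
 using assms unfolding coord_def by (auto, metis, metis)

lemma coord_exists:
 assumes M: "left_module KG M"
 shows "\<exists>rh ka em. coord M rh ka em"
proof -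
 note one_G = one_closed and l_one_G = l_one
 interpret left_module KG M by (rule M)
 define el where "el u = (if u \<in> carrier M then u else \<zero>\<^bsub>M\<^esub>)" for u
 have el: "el u \<in> carrier M" for u by (simp add: el_def)
 have sc: "kd g c \<odot>\<^bsub>M\<^esub> x \<in> carrier M" if "x \<in> carrier M" for g c x using that by (simp add: smult_closed)
 have kd0: "kd g 0 \<odot>\<^bsub>M\<^esub> x = \<zero>\<^bsub>M\<^esub>" if "x \<in> carrier M" for g x
 proof -
  have "kd g 0 \<odot>\<^bsub>M\<^esub> x = kd g 0 \<odot>\<^bsub>M\<^esub> x \<oplus>\<^bsub>M\<^esub> kd g 0 \<odot>\<^bsub>M\<^esub> x"
   using smult_l_distr[of "kd g 0" "kd g 0" x] that by (simp add: kd_add)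
  then show ?thesis using sc[OF that, of g 0] by (metis M.add.l_cancel_one)
 qed
 have kdl: "kd g (c + d) \<odot>\<^bsub>M\<^esub> x = kd g c \<odot>\<^bsub>M\<^esub> x \<oplus>\<^bsub>M\<^esub> kd g d \<odot>\<^bsub>M\<^esub> x" if "x \<in> carrier M" for g c d x
  using that by (simp flip: kd_add add: smult_l_distr)
 have kdm: "kd g c \<odot>\<^bsub>M\<^esub> (kd h d \<odot>\<^bsub>M\<^esub> x) = kd (g \<otimes> h) (c * d) \<odot>\<^bsub>M\<^esub> x"
  if "x \<in> carrier M" "g \<in> carrier G" "h \<in> carrier G" for g h c d x
  using that by (simp flip: smult_assoc add: kd_mult[OF finite_G])
 have kd1: "kd \<one> 1 \<odot>\<^bsub>M\<^esub> x = x" if "x \<in> carrier M" for x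
  using smult_one[OF that] by (simp add: kd_def group_algebra_def)
 define em where "em v = (\<Oplus>\<^bsub>M\<^esub>u\<in>keys v. kd \<one> (lookup v u) \<odot>\<^bsub>M\<^esub> el u)" for v :: "'u \<Rightarrow>\<^sub>0 'k"
 have em_sup: "em v = (\<Oplus>\<^bsub>M\<^esub>u\<in>A. kd \<one> (lookup v u) \<odot>\<^bsub>M\<^esub> el u)" if "finite A" "keys v \<subseteq> A" for v A
  unfolding em_def using that
  by (intro M.add.finprod_mono_neutral_cong_left) (auto simp: sc el in_keys_iff kd0)
 have em_car: "em v \<in> carrier M" for v unfolding em_def by (intro M.finsum_closed) (auto simp: sc el)
 have em_add: "em (v + w) = em v \<oplus>\<^bsub>M\<^esub> em w" for v w
 proof -
  let ?A = "keys v \<union> keys w"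
  have fin: "finite ?A" by simp
  have "em (v + w) = (\<Oplus>\<^bsub>M\<^esub>u\<in>?A. kd \<one> (lookup (v + w) u) \<odot>\<^bsub>M\<^esub> el u)"
   using fin keys_add by (rule em_sup)
  also have "\<dots> = (\<Oplus>\<^bsub>M\<^esub>u\<in>?A. kd \<one> (lookup v u) \<odot>\<^bsub>M\<^esub> el u \<oplus>\<^bsub>M\<^esub> kd \<one> (lookup w u) \<odot>\<^bsub>M\<^esub> el u)"
   by (simp only: lookup_add kdl[OF el])
  also have "\<dots> = (\<Oplus>\<^bsub>M\<^esub>u\<in>?A. kd \<one> (lookup v u) \<odot>\<^bsub>M\<^esub> el u) \<oplus>\<^bsub>M\<^esub> (\<Oplus>\<^bsub>M\<^esub>u\<in>?A. kd \<one> (lookup w u) \<odot>\<^bsub>M\<^esub> el u)"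
   by (rule M.finsum_addf) (simp_all add: sc[OF el])
  also have "\<dots> = em v \<oplus>\<^bsub>M\<^esub> em w"
   using em_sup[OF fin Un_upper1] em_sup[OF fin Un_upper2] by simp
  finally show ?thesis .
 qed
 have em_scale: "em (pscale c v) = kd \<one> c \<odot>\<^bsub>M\<^esub> em v" for c v
 proof -
  have "em (pscale c v) = (\<Oplus>\<^bsub>M\<^esub>u\<in>keys v. kd \<one> (lookup (pscale c v) u) \<odot>\<^bsub>M\<^esub> el u)"
   by (rule em_sup) (auto simp: in_keys_iff)
  also have "\<dots> = (\<Oplus>\<^bsub>M\<^esub>u\<in>keys v. kd \<one> c \<odot>\<^bsub>M\<^esub> (kd \<one> (lookup v u) \<odot>\<^bsub>M\<^esub> el u))"
   by (simp only: lookup_pscale kdm[OF el one_G one_G] l_one_G[OF one_G])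
  also have "\<dots> = kd \<one> c \<odot>\<^bsub>M\<^esub> (\<Oplus>\<^bsub>M\<^esub>u\<in>A. kd \<one> (lookup v u) \<odot>\<^bsub>M\<^esub> el u)" if "A = keys v" for A
  proof -
   have "finite A" using that by simp
   then have "(\<Oplus>\<^bsub>M\<^esub>u\<in>A. kd \<one> c \<odot>\<^bsub>M\<^esub> (kd \<one> (lookup v u) \<odot>\<^bsub>M\<^esub> el u)) = kd \<one> c \<odot>\<^bsub>M\<^esub> (\<Oplus>\<^bsub>M\<^esub>u\<in>A. kd \<one> (lookup v u) \<odot>\<^bsub>M\<^esub> el u)"
   proof (induction A)
    case empty
    have "kd \<one> c \<odot>\<^bsub>M\<^esub> \<zero>\<^bsub>M\<^esub> = kd \<one> c \<odot>\<^bsub>M\<^esub> \<zero>\<^bsub>M\<^esub> \<oplus>\<^bsub>M\<^esub> kd \<one> c \<odot>\<^bsub>M\<^esub> \<zero>\<^bsub>M\<^esub>"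
     using smult_r_distr[of "kd \<one> c" "\<zero>\<^bsub>M\<^esub>" "\<zero>\<^bsub>M\<^esub>"] by simp
    then have "kd \<one> c \<odot>\<^bsub>M\<^esub> \<zero>\<^bsub>M\<^esub> = \<zero>\<^bsub>M\<^esub>"
     using sc[OF M.zero_closed, of \<one> c] by (metis M.add.l_cancel_one M.zero_closed)
    then show ?case by simp
   next
    case (insert a A)
    then show ?case by (simp add: M.finsum_insert sc el smult_r_distr Pi_iff M.finsum_closed)
   qed
   then show ?thesis using that by simp
  qed
  finally show ?thesis unfolding em_def by blast
 qed
 have em_single: "em (Poly_Mapping.single x 1) = x" if "x \<in> carrier M" for x
  using that by (simp add: em_def M.finsum_insert el_def kd1)
 have em_0: "em 0 = \<zero>\<^bsub>M\<^esub>" by (simp add: em_def)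
 have sub: "subspace {v. em v = \<zero>\<^bsub>M\<^esub>}"
 proof (rule subspaceI)
  fix c v assume "v \<in> {v. em v = \<zero>\<^bsub>M\<^esub>}"
  then have "em (pscale c v) = em (pscale c 0)" by (simp add: em_scale em_0 del: scale_zero_right)
  then show "pscale c v \<in> {v. em v = \<zero>\<^bsub>M\<^esub>}" by (simp add: em_0)
 qed (auto simp: em_0 em_add)
 obtain \<pi> where \<pi>': "lin \<pi> \<and> (\<forall>v. \<pi> (\<pi> v) = \<pi> v) \<and> (\<forall>v. \<pi> v = 0 \<longleftrightarrow> v \<in> {v. em v = \<zero>\<^bsub>M\<^esub>})"
  using projection_along[OF sub] by (rule exE)
 have \<pi>: "lin \<pi>" "\<And>v. \<pi> (\<pi> v) = \<pi> v" "\<And>v. \<pi> v = 0 \<longleftrightarrow> em v = \<zero>\<^bsub>M\<^esub>"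
  using \<pi>' by (simp_all only: mem_Collect_eq simp_thms)
 have em_diff: "em (v - w) = \<zero>\<^bsub>M\<^esub> \<longleftrightarrow> em v = em w" for v w
 proof -
  obtain z where z: "em (v - w) = z" by simp
  have zc: "z \<in> carrier M" using em_car[of "v - w"] unfolding z .
  have ev: "em v = z \<oplus>\<^bsub>M\<^esub> em w" using em_add[of "v - w" w] unfolding z by simp
  have "z = \<zero>\<^bsub>M\<^esub>" if "z \<oplus>\<^bsub>M\<^esub> em w = em w"
   using that M.add.right_cancel[OF em_car[of w] zc M.zero_closed] em_car[of w] by simp
  then show ?thesis unfolding z ev using M.l_zero[OF em_car[of w]] by metis
 qed
 have eq: "\<pi> v = \<pi> w \<longleftrightarrow> em v = em w" for v w
  using \<pi>(3)[of "v - w"] by (simp add: lin_diff[OF \<pi>(1)] em_diff)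
 define ka where "ka x = \<pi> (Poly_Mapping.single x 1)" for x
 define rh where "rh g v = ka (kd g 1 \<odot>\<^bsub>M\<^esub> em v)" for g v
 have kaem: "ka (em v) = \<pi> v" for v unfolding ka_def by (simp add: eq em_single em_car)
 have emka: "em (ka x) = x" if "x \<in> carrier M" for x
 proof -
  have "\<pi> (ka x) = \<pi> (Poly_Mapping.single x 1)" by (simp add: ka_def \<pi>)
  then show ?thesis using that by (simp add: eq em_single)
 qed
 have ka_add: "ka (x \<oplus>\<^bsub>M\<^esub> y) = ka x + ka y" if "x \<in> carrier M" "y \<in> carrier M" for x y
  unfolding ka_def using that by (simp flip: lin_add[OF \<pi>(1)] add: eq em_single em_add)
 have ka_scale: "ka (kd \<one> c \<odot>\<^bsub>M\<^esub> x) = pscale c (ka x)" if "x \<in> carrier M" for c x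
  unfolding ka_def using that by (simp flip: lin_scale[OF \<pi>(1)] add: eq em_single em_scale sc)
 have rh1: "rh \<one> v = \<pi> v" for v by (simp add: rh_def kd1 em_car kaem)
 have "rep rh"
  unfolding rep_def
 proof (intro conjI ballI allI)
  fix g assume g: "g \<in> carrier G"
  show "lin (rh g)"
   using g by (intro linI) (simp_all add: rh_def em_add em_scale smult_r_distr em_car sc ka_add kdm flip: ka_scale)
  fix h v assume h: "h \<in> carrier G"
  show "rh (g \<otimes> h) v = rh g (rh h v)"
   using g h by (simp add: rh_def emka sc em_car kdm)
 qed
 moreover have "ka (a \<odot>\<^bsub>M\<^esub> x) = (\<Sum>g\<in>carrier G. pscale (a g) (rh g (ka x)))"
  if a: "a \<in> carrier KG" and x: "x \<in> carrier M" for a x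
 proof -
  define res where "res A = (\<lambda>y\<in>carrier G. if y \<in> A then a y else 0)" for A
  have resc: "res A \<in> carrier KG" for A by (simp add: res_def group_algebra_def)
  have ka0: "ka \<zero>\<^bsub>M\<^esub> = 0" using ka_add[of "\<zero>\<^bsub>M\<^esub>" "\<zero>\<^bsub>M\<^esub>"] by simp
  have "ka (res A \<odot>\<^bsub>M\<^esub> x) = (\<Sum>g\<in>A. pscale (a g) (rh g (ka x)))" if "finite A" "A \<subseteq> carrier G" for A
   using that
  proof (induction A)
   case empty
   have "res {} = kd \<one> 0" by (auto simp: res_def kd_def)
   then show ?case using x by (simp add: kd0 ka0)
  next
   case (insert g A)
   have "res (insert g A) = kd g (a g) \<oplus>\<^bsub>KG\<^esub> res A"
    using insert by (auto simp: res_def kd_def group_algebra_def fun_eq_iff)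
   moreover have "kd g (a g) \<odot>\<^bsub>M\<^esub> x = kd \<one> (a g) \<odot>\<^bsub>M\<^esub> (kd g 1 \<odot>\<^bsub>M\<^esub> x)"
    using insert x by (simp add: kdm)
   ultimately have "ka (res (insert g A) \<odot>\<^bsub>M\<^esub> x) = pscale (a g) (ka (kd g 1 \<odot>\<^bsub>M\<^esub> x)) + ka (res A \<odot>\<^bsub>M\<^esub> x)"
    using x resc by (simp add: smult_l_distr sc smult_closed ka_add ka_scale)
   then show ?case using insert x by (simp add: rh_def emka)
  qed
  moreover have "res (carrier G) = a"
   using a by (auto simp: res_def group_algebra_def fun_eq_iff PiE_def extensional_def)
  ultimately show ?thesis using finite_G by (metis order_refl)
 qed
 ultimately have "coord M rh ka em"
  unfolding coord_def using M by (simp add: em_car emka kaem rh1 ka_add)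
 then show ?thesis by blast
qed

definition realize :: "('g => ('u \<Rightarrow>\<^sub>0 'k) => ('u \<Rightarrow>\<^sub>0 'k)) => ('g => 'k, 'u) module" where
 "realize rh = \<lparr>carrier = \<iota> ` range (rh \<one>), monoid.mult = undefined, monoid.one = undefined, ring.zero = \<iota> 0,
  ring.add = (%a b. \<iota> (inv_into UNIV \<iota> a + inv_into UNIV \<iota> b)),
  module.smult = (%a x. \<iota> (\<Sum>g\<in>carrier G. pscale (a g) (rh g (inv_into UNIV \<iota> x))))\<rparr>"

lemma coord_realize:
 assumes rh: "rep rh"
 shows "coord (realize rh) rh (inv_into UNIV \<iota>) (%v. \<iota> (rh \<one> v))"
proof -
 have R: "ring KG" by (rule group_algebra_ring[OF finite_G])
 note l = repD(1)[OF rh] and m = repD(2)[OF rh]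
 note inv[simp] = inv_f_f[OF inj_\<iota>]
 define act where "act a v = (\<Sum>g\<in>carrier G. pscale (a g) (rh g v))" for a v
 have act_lin: "lin (act a)" for a unfolding act_def using l by (intro lin_summ lin_scal)
 have act_mult: "act (a \<otimes>\<^bsub>KG\<^esub> b) v = act a (act b v)" for a b v
 proof -
  have "act (a \<otimes>\<^bsub>KG\<^esub> b) v = (\<Sum>x\<in>carrier G. \<Sum>y\<in>carrier G. pscale (a y * b (inv y \<otimes> x)) (rh x v))"
   by (simp add: act_def group_algebra_def scale_sum_left)
  also have "\<dots> = (\<Sum>y\<in>carrier G. \<Sum>x\<in>carrier G. pscale (a y * b (inv y \<otimes> x)) (rh x v))" by (rule sum.swap)
  also have "\<dots> = (\<Sum>y\<in>carrier G. \<Sum>z\<in>carrier G. pscale (a y * b (inv y \<otimes> (y \<otimes> z))) (rh (y \<otimes> z) v))"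
   by (intro sum.cong refl sum_group_left[symmetric])
  also have "\<dots> = (\<Sum>y\<in>carrier G. \<Sum>z\<in>carrier G. pscale (a y) (rh y (pscale (b z) (rh z v))))"
   by (intro sum.cong refl) (simp add: m lin_scale[OF l] flip: m_assoc)
  finally show ?thesis by (simp add: act_def scale_sum_right lin_sum[OF l])
 qed
 have act1: "act \<one>\<^bsub>KG\<^esub> v = rh \<one> v" for v
 proof -
  have "act \<one>\<^bsub>KG\<^esub> v = (\<Sum>g\<in>carrier G. if g = \<one> then rh \<one> v else 0)"
   unfolding act_def by (rule sum.cong) (auto simp: group_algebra_def)
  then show ?thesis using finite_G by simp
 qed
 have act_car: "act a v \<in> range (rh \<one>)" for a v
 proof -
  have "rh \<one> (act a v) = act a v" by (simp add: act_def lin_sum[OF l] lin_scale[OF l] m)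
  then show ?thesis by (metis rangeI)
 qed
 have r: "rh \<one> v + rh \<one> w \<in> range (rh \<one>)" "0 \<in> range (rh \<one>)" for v w
  using lin_add[OF l[OF one_closed]] lin_0[OF l[OF one_closed]] by (metis rangeI)+
 have rm: "- rh \<one> v \<in> range (rh \<one>)" for v
  using lin_minus[OF l[OF one_closed]] by (metis rangeI)
 have ab: "abelian_group (realize rh)"
 proof (rule abelian_groupI)
  fix x assume "x \<in> carrier (realize rh)"
  then obtain v where x: "x = \<iota> (rh \<one> v)" by (auto simp: realize_def)
  show "\<exists>y\<in>carrier (realize rh). y \<oplus>\<^bsub>realize rh\<^esub> x = \<zero>\<^bsub>realize rh\<^esub>"
   by (rule bexI[of _ "\<iota> (rh \<one> (- v))"]) (auto simp: realize_def x lin_minus[OF l[OF one_closed]] rm)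
 qed (use r in \<open>auto simp: realize_def add_ac\<close>)
 have sm: "a \<odot>\<^bsub>realize rh\<^esub> x = \<iota> (act a (inv_into UNIV \<iota> x))" for a x by (simp add: realize_def act_def)
 have add: "x \<oplus>\<^bsub>realize rh\<^esub> y = \<iota> (inv_into UNIV \<iota> x + inv_into UNIV \<iota> y)" for x y by (simp add: realize_def)
 have "left_module KG (realize rh)"
  unfolding left_module_def left_module_axioms_def
 proof (intro conjI allI impI)
  fix a b x assume "a \<in> carrier KG" "b \<in> carrier KG"
  show "(a \<oplus>\<^bsub>KG\<^esub> b) \<odot>\<^bsub>realize rh\<^esub> x = a \<odot>\<^bsub>realize rh\<^esub> x \<oplus>\<^bsub>realize rh\<^esub> b \<odot>\<^bsub>realize rh\<^esub> x"
   by (simp add: sm add) (simp add: act_def group_algebra_def scale_left_distrib sum.distrib)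
 next
  fix x assume "x \<in> carrier (realize rh)"
  then show "\<one>\<^bsub>KG\<^esub> \<odot>\<^bsub>realize rh\<^esub> x = x" by (auto simp: sm act1) (auto simp: realize_def m)
 qed (use ab R in \<open>auto simp: sm add lin_add[OF act_lin] act_mult\<close>, use act_car in \<open>simp add: realize_def\<close>)
 then show ?thesis
  unfolding coord_def using rh by (auto simp: m sm add act_def) (auto simp: realize_def m)
qed

end

section \<open>Invariance under isomorphism of groups\<close>

definition ring_transport ::
 "('r, 'm) ring_scheme => ('s, 'n) ring_scheme => ('s => 'r) => ('r => 's) => bool" where
 "ring_transport R R' \<tau> \<tau>' \<longleftrightarrow> ring R \<and> ring R' \<and>
  (\<forall>a\<in>carrier R'. \<tau> a \<in> carrier R \<and> \<tau>' (\<tau> a) = a) \<and> (\<forall>a\<in>carrier R. \<tau>' a \<in> carrier R' \<and> \<tau> (\<tau>' a) = a) \<and>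
  (\<forall>a\<in>carrier R'. \<forall>b\<in>carrier R'. \<tau> (a \<oplus>\<^bsub>R'\<^esub> b) = \<tau> a \<oplus>\<^bsub>R\<^esub> \<tau> b \<and> \<tau> (a \<otimes>\<^bsub>R'\<^esub> b) = \<tau> a \<otimes>\<^bsub>R\<^esub> \<tau> b) \<and>
  (\<forall>a\<in>carrier R. \<forall>b\<in>carrier R. \<tau>' (a \<oplus>\<^bsub>R\<^esub> b) = \<tau>' a \<oplus>\<^bsub>R'\<^esub> \<tau>' b \<and> \<tau>' (a \<otimes>\<^bsub>R\<^esub> b) = \<tau>' a \<otimes>\<^bsub>R'\<^esub> \<tau>' b) \<and>
  \<tau> \<one>\<^bsub>R'\<^esub> = \<one>\<^bsub>R\<^esub> \<and> \<tau>' \<one>\<^bsub>R\<^esub> = \<one>\<^bsub>R'\<^esub>"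

lemma ring_transport_sym: "ring_transport R R' \<tau> \<tau>' ==> ring_transport R' R \<tau>' \<tau>"
 unfolding ring_transport_def by simp

text \<open>
Restriction of scalars. The fields that no definition looks at are kept, so that the trivial module goes literally to the trivial module.
\<close>

definition pull :: "('s => 'r) => ('r, 'u) module => ('s, 'u) module" where
 "pull \<tau> M = \<lparr>carrier = carrier M, monoid.mult = monoid.mult M, monoid.one = one M, ring.zero = ring.zero M,
  ring.add = ring.add M, module.smult = (%a. module.smult M (\<tau> a))\<rparr>"

text \<open>
Equality of modules up to the transport of scalars: outside the carrier of the ring the scalar multiplications may differ, and so
restriction along mutually inverse maps returns a module that is only alike to the original.
\<close>

definition alike :: "('s, 'n) ring_scheme => ('s => 'r) => ('r, 'u) module => ('s, 'u) module => bool" where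
 "alike R' \<tau> M M' \<longleftrightarrow> carrier M' = carrier M \<and> ring.add M' = ring.add M \<and> ring.zero M' = ring.zero M \<and>
  (\<forall>a\<in>carrier R'. \<forall>x\<in>carrier M. a \<odot>\<^bsub>M'\<^esub> x = \<tau> a \<odot>\<^bsub>M\<^esub> x)"

lemma alike_pull: "alike R' \<tau> M (pull \<tau> M)" by (simp add: alike_def pull_def)

lemma alike_sym: "ring_transport R R' \<tau> \<tau>' ==> alike R' \<tau> M M' ==> alike R \<tau>' M' M"
 by (auto simp: alike_def ring_transport_def)

lemma pull_alike: "ring_transport R R' \<tau> \<tau>' ==> alike R' \<tau> (pull \<tau>' M) M"
 using alike_sym[OF ring_transport_sym alike_pull] .

lemma alike_left_module:
 assumes t: "ring_transport R R' \<tau> \<tau>'" and a: "alike R' \<tau> M M'" and M: "left_module R M"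
 shows "left_module R' M'"
proof -
 interpret left_module R M by (rule M)
 have s: "carrier M' = carrier M" "ring.add M' = ring.add M" "ring.zero M' = ring.zero M"
  "\<And>b x. b \<in> carrier R' ==> x \<in> carrier M ==> b \<odot>\<^bsub>M'\<^esub> x = \<tau> b \<odot>\<^bsub>M\<^esub> x" using a by (auto simp: alike_def)
 have \<tau>: "\<And>b. b \<in> carrier R' ==> \<tau> b \<in> carrier R" "\<And>b c. b \<in> carrier R' ==> c \<in> carrier R' ==> \<tau> (b \<oplus>\<^bsub>R'\<^esub> c) = \<tau> b \<oplus>\<^bsub>R\<^esub> \<tau> c"
  "\<And>b c. b \<in> carrier R' ==> c \<in> carrier R' ==> \<tau> (b \<otimes>\<^bsub>R'\<^esub> c) = \<tau> b \<otimes>\<^bsub>R\<^esub> \<tau> c" "\<tau> \<one>\<^bsub>R'\<^esub> = \<one>\<^bsub>R\<^esub>"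
  and R': "ring R'" using t by (auto simp: ring_transport_def)
 interpret R': ring R' by (rule R')
 have "abelian_group M'"
 proof (rule abelian_groupI)
  fix x assume "x \<in> carrier M'"
  then show "\<exists>y\<in>carrier M'. y \<oplus>\<^bsub>M'\<^esub> x = \<zero>\<^bsub>M'\<^esub>" unfolding s using M.l_neg M.a_inv_closed by blast
 qed (simp_all add: s M.a_ac)
 then show ?thesis
  unfolding left_module_def left_module_axioms_def
  using R' by (simp add: s \<tau> smult_closed smult_l_distr smult_r_distr smult_assoc smult_one)
qed

lemma alike_hom:
 assumes t: "ring_transport R R' \<tau> \<tau>'" and a: "alike R' \<tau> M M'" "alike R' \<tau> N N'" and f: "f \<in> left_module_hom R M N"
 shows "f \<in> left_module_hom R' M' N'"
 using f a t by (auto simp: left_module_hom_def alike_def ring_transport_def Pi_iff)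

lemma alike_projective:
 assumes t: "ring_transport R R' \<tau> \<tau>'" and a: "alike R' \<tau> P P'" and P: "projective_module R (P :: ('r, 'u) module)"
 shows "projective_module R' P'"
 unfolding projective_module_def
proof (intro conjI allI impI)
 show "left_module R' P'" using P alike_left_module[OF t a] by (simp add: projective_module_def)
 note t' = ring_transport_sym[OF t] and a' = alike_sym[OF t a]
 fix M' N' g f
 assume H: "left_module R' M' \<and> left_module R' N' \<and> g \<in> left_module_hom R' M' N' \<and> g ` carrier M' = carrier N' \<and>
  f \<in> left_module_hom R' P' N'"
 from H have M: "left_module R' M'" "left_module R' N'" by blast+
 from H have g: "g \<in> left_module_hom R' M' N'" "g ` carrier M' = carrier N'" and f: "f \<in> left_module_hom R' P' N'" by blast+
 let ?M = "pull \<tau>' M'" and ?N = "pull \<tau>' N'"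
 have "left_module R ?M" "left_module R ?N" using alike_left_module[OF t' alike_pull] M by blast+
 moreover have "g \<in> left_module_hom R ?M ?N" by (rule alike_hom[OF t' alike_pull alike_pull g(1)])
 moreover have "f \<in> left_module_hom R P ?N" by (rule alike_hom[OF t' a' alike_pull f])
 moreover have "g ` carrier ?M = carrier ?N" using g(2) by (simp add: pull_def)
 ultimately obtain h where h: "h \<in> left_module_hom R P ?M" "\<forall>x\<in>carrier P. g (h x) = f x"
  using P unfolding projective_module_def by blast
 have "h \<in> left_module_hom R' P' M'" by (rule alike_hom[OF t a pull_alike[OF t] h(1)])
 then show "\<exists>h\<in>left_module_hom R' P' M'. \<forall>x\<in>carrier P'. g (h x) = f x" using h(2) a by (auto simp: alike_def)
qed

lemma alike_short_exact:
 assumes t: "ring_transport R R' \<tau> \<tau>'" and a: "alike R' \<tau> A A'" "alike R' \<tau> B B'" "alike R' \<tau> C C'" and e: "short_exact R A B C"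
 shows "short_exact R' A' B' C'"
proof -
 have c: "carrier A' = carrier A" "carrier B' = carrier B" "carrier C' = carrier C" "\<zero>\<^bsub>C'\<^esub> = \<zero>\<^bsub>C\<^esub>" using a by (auto simp: alike_def)
 obtain i q where "i \<in> left_module_hom R A B" "q \<in> left_module_hom R B C" "inj_on i (carrier A)" "q ` carrier B = carrier C"
  "i ` carrier A = {x \<in> carrier B. q x = \<zero>\<^bsub>C\<^esub>}" and m: "left_module R A" "left_module R B" "left_module R C"
  using e unfolding short_exact_def by blast
 then show ?thesis
  unfolding short_exact_def c
  using alike_hom[OF t a(1,2)] alike_hom[OF t a(2,3)] alike_left_module[OF t a(1) m(1)] alike_left_module[OF t a(2) m(2)]
   alike_left_module[OF t a(3) m(3)] by blast
qed

lemma alike_stably_zero: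
 assumes t: "ring_transport R R' \<tau> \<tau>'" and a: "alike R' \<tau> M M'" "alike R' \<tau> N N'" and z: "stably_zero R M N f"
 shows "stably_zero R' M' N' f"
proof -
 obtain P x y where P: "projective_module R P" "x \<in> left_module_hom R M P" "y \<in> left_module_hom R P N" "\<forall>v\<in>carrier M. f v = y (x v)"
  using z unfolding stably_zero_def by blast
 have "\<forall>v\<in>carrier M'. f v = y (x v)" using P(4) a by (simp add: alike_def)
 then show ?thesis
  unfolding stably_zero_def
  using alike_projective[OF t alike_pull P(1)] alike_hom[OF t a(1) alike_pull P(2)] alike_hom[OF t alike_pull a(2) P(3)] by blast
qed

lemma alike_minus: "alike R' \<tau> N N' ==> x \<ominus>\<^bsub>N'\<^esub> y = x \<ominus>\<^bsub>N\<^esub> y"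
 by (simp add: alike_def a_minus_def a_inv_def m_inv_def)

lemma alike_stably_equal:
 assumes t: "ring_transport R R' \<tau> \<tau>'" and a: "alike R' \<tau> M M'" "alike R' \<tau> N N'" and z: "stably_equal R M N f g"
 shows "stably_equal R' M' N' f g"
 using alike_stably_zero[OF t a] z by (simp add: stably_equal_def alike_minus[OF a(2)])

lemma alike_stably_isomorphic:
 assumes t: "ring_transport R R' \<tau> \<tau>'" and a: "alike R' \<tau> M M'" "alike R' \<tau> N N'" and z: "stably_isomorphic R M N"
 shows "stably_isomorphic R' M' N'"
 using z alike_left_module[OF t a(1)] alike_left_module[OF t a(2)] alike_hom[OF t a] alike_hom[OF t a(2,1)]
  alike_stably_equal[OF t a(1,1)] alike_stably_equal[OF t a(2,2)]
 unfolding stably_isomorphic_def by meson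

lemma alike_stable_retract:
 assumes t: "ring_transport R R' \<tau> \<tau>'" and a: "alike R' \<tau> M M'" "alike R' \<tau> N N'" and z: "stable_retract R M N"
 shows "stable_retract R' M' N'"
 using z alike_left_module[OF t a(1)] alike_left_module[OF t a(2)] alike_hom[OF t a] alike_hom[OF t a(2,1)]
  alike_stably_equal[OF t a(1,1)]
 unfolding stable_retract_def by meson

lemma pull_Omega:
 assumes t: "ring_transport R R' \<tau> \<tau>'" and "is_Omega R M W" shows "is_Omega R' (pull \<tau> M) (pull \<tau> W)"
proof -
 obtain P where P: "projective_module R P" "short_exact R W P M" using assms(2) unfolding is_Omega_def by blast
 show ?thesis unfolding is_Omega_def
  using alike_projective[OF t alike_pull P(1)] alike_short_exact[OF t alike_pull alike_pull alike_pull P(2)] by blast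
qed

lemma pull_Omega_relpow:
 assumes t: "ring_transport R R' \<tau> \<tau>'" shows "(is_Omega R ^^ n) M W ==> (is_Omega R' ^^ n) (pull \<tau> M) (pull \<tau> W)"
proof (induction n arbitrary: W)
 case (Suc n)
 then obtain L where "(is_Omega R ^^ n) M L" "is_Omega R L W" by auto
 then show ?case using Suc.IH pull_Omega[OF t] by auto
qed simp

lemma pull_exact_triangle:
 assumes t: "ring_transport R R' \<tau> \<tau>'" and "exact_triangle R A B C" shows "exact_triangle R' (pull \<tau> A) (pull \<tau> B) (pull \<tau> C)"
proof -
 obtain A1 B1 C1 where 1: "short_exact R A1 B1 C1" "stably_isomorphic R A A1" "stably_isomorphic R B B1" "stably_isomorphic R C C1"
  using assms(2) unfolding exact_triangle_def by blast
 show ?thesis unfolding exact_triangle_def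
  using alike_short_exact[OF t alike_pull alike_pull alike_pull 1(1)] alike_stably_isomorphic[OF t alike_pull alike_pull 1(2)]
   alike_stably_isomorphic[OF t alike_pull alike_pull 1(3)] alike_stably_isomorphic[OF t alike_pull alike_pull 1(4)] by blast
qed

lemma pull_Thick:
 assumes t: "ring_transport R R' \<tau> \<tau>'" and K: "pull \<tau> K = K'" and M: "M \<in> Thick R K"
 shows "pull \<tau> M \<in> Thick R' K'"
 unfolding Thick_def
proof (rule InterI, clarify)
 fix S' assume S': "thick_subcategory R' S'" "K' \<in> S'"
 define S where "S = {M. left_module R M \<and> pull \<tau> M \<in> S'}"
 have tri: "triangulated_subcategory R' S'" and ret: "\<And>M N. N \<in> S' ==> stable_retract R' M N ==> M \<in> S'"
  using S'(1) by (auto simp: thick_subcategory_def)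
 have lm: "\<And>M. M \<in> S' ==> left_module R' M" and iso: "\<And>M N. M \<in> S' ==> stably_isomorphic R' M N ==> N \<in> S'"
  and om: "\<And>M N. M \<in> S' ==> is_Omega R' M N \<or> is_Omega R' N M ==> N \<in> S'"
  and ex: "\<And>A B C. A \<in> S' ==> B \<in> S' ==> exact_triangle R' A B C ==> C \<in> S'"
  using tri unfolding triangulated_subcategory_def by blast+
 have KS: "K \<in> S"
  using S'(2) K alike_left_module[OF ring_transport_sym[OF t] alike_sym[OF t alike_pull] lm] by (auto simp: S_def)
 have "thick_subcategory R S"
  unfolding thick_subcategory_def triangulated_subcategory_def
 proof (intro conjI ballI allI impI)
  show "S \<noteq> {}" using KS by blast
  show "left_module R M" if "M \<in> S" for M using that by (simp add: S_def)
  show "N \<in> S" if MN: "M \<in> S" "stably_isomorphic R M N" for M N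
  proof -
   have 1: "left_module R N" using MN(2) unfolding stably_isomorphic_def by blast
   have "pull \<tau> M \<in> S'" using MN(1) by (simp add: S_def)
   from iso[OF this alike_stably_isomorphic[OF t alike_pull alike_pull MN(2)]] 1 show ?thesis by (simp add: S_def)
  qed
  show "N \<in> S" if MN: "M \<in> S" "is_Omega R M N \<or> is_Omega R N M" for M N
  proof -
   have 1: "left_module R N" using MN(2) by (auto simp: is_Omega_def short_exact_def)
   have 2: "is_Omega R' (pull \<tau> M) (pull \<tau> N) \<or> is_Omega R' (pull \<tau> N) (pull \<tau> M)"
    using MN(2) pull_Omega[OF t, of M N] pull_Omega[OF t, of N M] by argo
   have "pull \<tau> M \<in> S'" using MN(1) by (simp add: S_def)
   from om[OF this 2] 1 show ?thesis by (simp add: S_def)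
  qed
  show "C \<in> S" if ABC: "A \<in> S" "B \<in> S" "exact_triangle R A B C" for A B C
  proof -
   have 1: "left_module R C" using ABC(3) unfolding exact_triangle_def stably_isomorphic_def by blast
   have "pull \<tau> A \<in> S'" "pull \<tau> B \<in> S'" using ABC(1,2) by (simp_all add: S_def)
   from ex[OF this pull_exact_triangle[OF t ABC(3)]] 1 show ?thesis by (simp add: S_def)
  qed
  show "M \<in> S" if MN: "N \<in> S" "stable_retract R M N" for M N
  proof -
   have 1: "left_module R M" using MN(2) unfolding stable_retract_def by blast
   have "pull \<tau> N \<in> S'" using MN(1) by (simp add: S_def)
   from ret[OF this alike_stable_retract[OF t alike_pull alike_pull MN(2)]] 1 show ?thesis by (simp add: S_def)
  qed
 qed
 then have "M \<in> S" using M KS unfolding Thick_def by blast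
 then show "pull \<tau> M \<in> S'" by (simp add: S_def)
qed

lemma pull_ghost:
 assumes t: "ring_transport R R' \<tau> \<tau>'" and K: "pull \<tau>' K' = K" and g: "ghost R K M N f"
 shows "ghost R' K' (pull \<tau> M) (pull \<tau> N) f"
 unfolding ghost_def
proof (intro conjI allI impI ballI)
 have M: "left_module R M" "left_module R N" "f \<in> left_module_hom R M N" using g by (auto simp: ghost_def)
 show "left_module R' (pull \<tau> M)" "left_module R' (pull \<tau> N)" "f \<in> left_module_hom R' (pull \<tau> M) (pull \<tau> N)"
  using alike_left_module[OF t alike_pull M(1)] alike_left_module[OF t alike_pull M(2)] alike_hom[OF t alike_pull alike_pull M(3)] .
 note t' = ring_transport_sym[OF t]
 fix n W' h assume W': "is_Omega_power R' n K' W'" and h: "h \<in> left_module_hom R' W' (pull \<tau> M)"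
 have "is_Omega_power R n K (pull \<tau>' W')"
  using W' pull_Omega_relpow[OF t', of _ K' W'] pull_Omega_relpow[OF t', of _ W' K'] K
  by (auto simp: is_Omega_power_def split: if_splits)
 moreover have "h \<in> left_module_hom R (pull \<tau>' W') M" by (rule alike_hom[OF t' alike_pull alike_sym[OF t alike_pull] h])
 ultimately have "stably_zero R (pull \<tau>' W') N (f \<circ> h)" using g by (simp add: ghost_def)
 then show "stably_zero R' W' (pull \<tau> N) (f \<circ> h)" by (rule alike_stably_zero[OF t pull_alike[OF t] alike_pull])
qed

lemma pull_ghost_composite:
 assumes t: "ring_transport R R' \<tau> \<tau>'" and K: "pull \<tau> K = K'" "pull \<tau>' K' = K"
 shows "ghost_composite R K n M N f ==> ghost_composite R' K' n (pull \<tau> M) (pull \<tau> N) f"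
proof (induction rule: ghost_composite.induct)
 case (zero M N f)
 then show ?case using pull_Thick[OF t K(1)] alike_hom[OF t alike_pull alike_pull] by (intro ghost_composite.zero) auto
next
 case (Suc n M L f N g)
 then show ?case using pull_Thick[OF t K(1)] pull_ghost[OF t K(2)] by (intro ghost_composite.Suc) auto
qed

lemma transport_ghost_number:
 assumes t: "ring_transport R R' \<tau> \<tau>'" and K: "pull \<tau> K = K'" "pull \<tau>' K' = K"
 shows "(SUP M\<in>Thick R K. ghost_length R K M) \<le> (SUP M\<in>Thick R' K'. ghost_length R' K' M)"
proof (rule SUP_least)
 fix M assume M: "M \<in> Thick R K"
 have "ghost_length R K M \<le> ghost_length R' K' (pull \<tau> M)"
  unfolding ghost_length_def
 proof (rule Inf_superset_mono, clarify)
  fix n assume n: "\<forall>N f. ghost_composite R' K' n (pull \<tau> M) N f --> stably_zero R' (pull \<tau> M) N f"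
  have "stably_zero R M N f" if "ghost_composite R K n M N f" for N f
  proof -
   have "stably_zero R' (pull \<tau> M) (pull \<tau> N) f" using n pull_ghost_composite[OF t K that] by blast
   then show ?thesis
    by (rule alike_stably_zero[OF ring_transport_sym[OF t] alike_sym[OF t alike_pull] alike_sym[OF t alike_pull]])
  qed
  then show "\<exists>m. enat n = enat m \<and> (\<forall>N f. ghost_composite R K m M N f --> stably_zero R M N f)" by blast
 qed
 also have "\<dots> \<le> (SUP M\<in>Thick R' K'. ghost_length R' K' M)" by (rule SUP_upper) (rule pull_Thick[OF t K(1) M])
 finally show "ghost_length R K M \<le> (SUP M\<in>Thick R' K'. ghost_length R' K' M)" .
qed

lemma group_algebra_transport:
 assumes G: "group G" "finite (carrier G)" and G': "group G'" "finite (carrier G')" and \<phi>: "\<phi> \<in> iso G G'"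
 defines "\<tau> \<equiv> %b :: 'h => 'k::field. \<lambda>x\<in>carrier G. b (\<phi> x)"
  and "\<tau>' \<equiv> %b :: 'g => 'k. \<lambda>y\<in>carrier G'. b (inv_into (carrier G) \<phi> y)"
 shows "ring_transport (group_algebra G) (group_algebra G') \<tau> \<tau>'"
  and "pull \<tau> (trivial_module e G) = trivial_module e G'"
  and "pull \<tau>' (trivial_module e G') = trivial_module e G"
proof -
 interpret G: group G by (rule G(1))
 interpret G': group G' by (rule G'(1))
 have bij: "bij_betw \<phi> (carrier G) (carrier G')" and hom: "\<phi> \<in> hom G G'" using \<phi> by (auto simp: iso_def)
 let ?\<psi> = "inv_into (carrier G) \<phi>"
 have bij': "bij_betw ?\<psi> (carrier G') (carrier G)" by (rule bij_betw_inv_into[OF bij])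
 have cl: "x \<in> carrier G ==> \<phi> x \<in> carrier G'" "y \<in> carrier G' ==> ?\<psi> y \<in> carrier G" for x y
  using bij bij' bij_betwE by blast+
 have inv: "x \<in> carrier G ==> ?\<psi> (\<phi> x) = x" "y \<in> carrier G' ==> \<phi> (?\<psi> y) = y" for x y
  using bij_betw_inv_into_left[OF bij] bij_betw_inv_into_right[OF bij] by auto
 interpret h: group_hom G G' \<phi> by (unfold_locales) (rule hom)
 have \<psi>mult: "?\<psi> (x \<otimes>\<^bsub>G'\<^esub> y) = ?\<psi> x \<otimes>\<^bsub>G\<^esub> ?\<psi> y" "?\<psi> (inv\<^bsub>G'\<^esub> x) = inv\<^bsub>G\<^esub> (?\<psi> x)" if "x \<in> carrier G'" "y \<in> carrier G'" for x y
 proof -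
  have "\<phi> (?\<psi> x \<otimes>\<^bsub>G\<^esub> ?\<psi> y) = x \<otimes>\<^bsub>G'\<^esub> y" "\<phi> (inv\<^bsub>G\<^esub> (?\<psi> x)) = inv\<^bsub>G'\<^esub> x" using that cl inv by simp_all
  then show "?\<psi> (x \<otimes>\<^bsub>G'\<^esub> y) = ?\<psi> x \<otimes>\<^bsub>G\<^esub> ?\<psi> y" "?\<psi> (inv\<^bsub>G'\<^esub> x) = inv\<^bsub>G\<^esub> (?\<psi> x)" using inv(1) cl that by (metis G.m_closed, metis G.inv_closed)
 qed
 have one: "\<phi> x = \<one>\<^bsub>G'\<^esub> \<longleftrightarrow> x = \<one>\<^bsub>G\<^esub>" if "x \<in> carrier G" for x
  using that inv(1) h.hom_one by (metis G.one_closed)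
 have one': "?\<psi> y = \<one>\<^bsub>G\<^esub> \<longleftrightarrow> y = \<one>\<^bsub>G'\<^esub>" if "y \<in> carrier G'" for y using one[OF cl(2)[OF that]] inv(2)[OF that] by simp
 have S: "(\<Sum>x\<in>carrier G. f (\<phi> x)) = (\<Sum>y\<in>carrier G'. f y)" for f :: "'h => 'k" by (rule sum.reindex_bij_betw[OF bij])
 have S': "(\<Sum>y\<in>carrier G'. f (?\<psi> y)) = (\<Sum>x\<in>carrier G. f x)" for f :: "'g => 'k" by (rule sum.reindex_bij_betw[OF bij'])
 have m1: "\<tau> (a \<otimes>\<^bsub>group_algebra G'\<^esub> b) = \<tau> a \<otimes>\<^bsub>group_algebra G\<^esub> \<tau> b" for a b
 proof
  fix x
  show "\<tau> (a \<otimes>\<^bsub>group_algebra G'\<^esub> b) x = (\<tau> a \<otimes>\<^bsub>group_algebra G\<^esub> \<tau> b) x"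
  proof (cases "x \<in> carrier G")
   case True
   have "(\<Sum>y\<in>carrier G. a (\<phi> y) * b (inv\<^bsub>G'\<^esub> \<phi> y \<otimes>\<^bsub>G'\<^esub> \<phi> x)) = (\<Sum>y\<in>carrier G'. a y * b (inv\<^bsub>G'\<^esub> y \<otimes>\<^bsub>G'\<^esub> \<phi> x))"
    by (rule S[of "%y. a y * b (inv\<^bsub>G'\<^esub> y \<otimes>\<^bsub>G'\<^esub> \<phi> x)"])
   then show ?thesis using True cl by (simp add: \<tau>_def group_algebra_def cong: sum.cong)
  qed (simp add: \<tau>_def group_algebra_def)
 qed
 have m2: "\<tau>' (a \<otimes>\<^bsub>group_algebra G\<^esub> b) = \<tau>' a \<otimes>\<^bsub>group_algebra G'\<^esub> \<tau>' b" for a b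
 proof
  fix x
  show "\<tau>' (a \<otimes>\<^bsub>group_algebra G\<^esub> b) x = (\<tau>' a \<otimes>\<^bsub>group_algebra G'\<^esub> \<tau>' b) x"
  proof (cases "x \<in> carrier G'")
   case True
   have "(\<Sum>y\<in>carrier G'. a (?\<psi> y) * b (inv\<^bsub>G\<^esub> ?\<psi> y \<otimes>\<^bsub>G\<^esub> ?\<psi> x)) = (\<Sum>y\<in>carrier G. a y * b (inv\<^bsub>G\<^esub> y \<otimes>\<^bsub>G\<^esub> ?\<psi> x))"
    by (rule S'[of "%y. a y * b (inv\<^bsub>G\<^esub> y \<otimes>\<^bsub>G\<^esub> ?\<psi> x)"])
   then show ?thesis using True cl \<psi>mult by (simp add: \<tau>'_def group_algebra_def cong: sum.cong)
  qed (simp add: \<tau>'_def group_algebra_def)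
 qed
 show "ring_transport (group_algebra G) (group_algebra G') \<tau> \<tau>'"
  unfolding ring_transport_def
 proof (intro conjI ballI m1 m2 G.group_algebra_ring[OF G(2)] G'.group_algebra_ring[OF G'(2)])
  fix a b :: "'h => 'k" assume ab: "a \<in> carrier (group_algebra G')"
  show "\<tau> a \<in> carrier (group_algebra G)" by (simp add: \<tau>_def group_algebra_def)
  show "\<tau>' (\<tau> a) = a" using ab inv(2) cl by (auto simp: \<tau>_def \<tau>'_def group_algebra_def fun_eq_iff PiE_def extensional_def)
  show "\<tau> (a \<oplus>\<^bsub>group_algebra G'\<^esub> b) = \<tau> a \<oplus>\<^bsub>group_algebra G\<^esub> \<tau> b" using cl by (auto simp: \<tau>_def group_algebra_def fun_eq_iff)
 next
  fix a b :: "'g => 'k" assume ab: "a \<in> carrier (group_algebra G)"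
  show "\<tau>' a \<in> carrier (group_algebra G')" by (simp add: \<tau>'_def group_algebra_def)
  show "\<tau> (\<tau>' a) = a" using ab inv(1) cl by (auto simp: \<tau>_def \<tau>'_def group_algebra_def fun_eq_iff PiE_def extensional_def)
  show "\<tau>' (a \<oplus>\<^bsub>group_algebra G\<^esub> b) = \<tau>' a \<oplus>\<^bsub>group_algebra G'\<^esub> \<tau>' b" using cl by (auto simp: \<tau>'_def group_algebra_def fun_eq_iff)
 next
  show "\<tau> \<one>\<^bsub>group_algebra G'\<^esub> = \<one>\<^bsub>group_algebra G\<^esub>" using cl one by (auto simp: \<tau>_def group_algebra_def fun_eq_iff)
  show "\<tau>' \<one>\<^bsub>group_algebra G\<^esub> = \<one>\<^bsub>group_algebra G'\<^esub>" using cl one' by (auto simp: \<tau>'_def group_algebra_def fun_eq_iff)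
 qed
 have "(\<Sum>x\<in>carrier G. \<tau> b x) = (\<Sum>y\<in>carrier G'. b y)" for b using S[of b] by (simp add: \<tau>_def)
 then show "pull \<tau> (trivial_module e G) = trivial_module e G'" by (simp add: pull_def trivial_module_def)
 have "(\<Sum>y\<in>carrier G'. \<tau>' b y) = (\<Sum>x\<in>carrier G. b x)" for b using S'[of b] by (simp add: \<tau>'_def)
 then show "pull \<tau>' (trivial_module e G') = trivial_module e G" by (simp add: pull_def trivial_module_def)
qed

lemma ghost_number_iso:
 assumes "group G" "finite (carrier G)" "group G'" "finite (carrier G')" "G \<cong> G'"
 shows "ghost_number e G = ghost_number e G'"
proof -
 obtain \<phi> where \<phi>: "\<phi> \<in> iso G G'" using assms(5) by (auto simp: is_iso_def)
 note t = group_algebra_transport(1)[OF assms(1-4) \<phi>] group_algebra_transport(2,3)[OF assms(1-4) \<phi>, of e]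
 show ?thesis
  unfolding ghost_number_def
  using transport_ghost_number[OF t] transport_ghost_number[OF ring_transport_sym[OF t(1)] t(3,2)] by (rule order_antisym)
qed

section \<open>Equivariant maps and traces\<close>

context group_modules begin

definition equiv :: "('g => ('u \<Rightarrow>\<^sub>0 'k) => ('u \<Rightarrow>\<^sub>0 'k)) => ('g => ('u \<Rightarrow>\<^sub>0 'k) => ('u \<Rightarrow>\<^sub>0 'k)) =>
  (('u \<Rightarrow>\<^sub>0 'k) => ('u \<Rightarrow>\<^sub>0 'k)) => bool" where
 "equiv rh rh' F \<longleftrightarrow> lin F \<and> (\<forall>g\<in>carrier G. \<forall>v. F (rh g v) = rh' g (F v))"

definition Tr :: "('g => ('u \<Rightarrow>\<^sub>0 'k) => ('u \<Rightarrow>\<^sub>0 'k)) => ('g => ('u \<Rightarrow>\<^sub>0 'k) => ('u \<Rightarrow>\<^sub>0 'k)) =>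
  (('u \<Rightarrow>\<^sub>0 'k) => ('u \<Rightarrow>\<^sub>0 'k)) => ('u \<Rightarrow>\<^sub>0 'k) => ('u \<Rightarrow>\<^sub>0 'k)" where
 "Tr rh rh' \<phi> v = (\<Sum>g\<in>carrier G. rh' g (\<phi> (rh (inv g) v)))"

definition szero where
 "szero rh rh' F \<longleftrightarrow> (\<exists>\<phi>. lin \<phi> \<and> (\<forall>v. F v = Tr rh rh' \<phi> v))"

definition proj where
 "proj rh \<longleftrightarrow> rep rh \<and> szero rh rh (rh \<one>)"

definition exact where
 "exact rhA rhB rhC I Q \<longleftrightarrow> equiv rhA rhB I \<and> equiv rhB rhC Q \<and>
  (\<forall>v. I (rhA \<one> v) = 0 --> rhA \<one> v = 0) \<and> (\<forall>v. \<exists>w. Q (rhB \<one> w) = rhC \<one> v) \<and>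
  (\<forall>w. Q (rhB \<one> w) = 0 \<longleftrightarrow> (\<exists>v. I (rhA \<one> v) = rhB \<one> w))"

lemma equivD: assumes "equiv rh rh' F"
 shows "lin F" "g \<in> carrier G ==> F (rh g v) = rh' g (F v)"
 using assms by (auto simp: equiv_def)

lemma rep1: assumes "rep rh"
 shows "g \<in> carrier G ==> rh g (rh \<one> v) = rh g v" "g \<in> carrier G ==> rh \<one> (rh g v) = rh g v"
 using repD(2)[OF assms] by simp_all

lemma Tr_lin: assumes "rep rh" "rep rh'" and \<phi>: "lin \<phi>" shows "lin (Tr rh rh' \<phi>)"
proof -
 have "lin (%v. \<Sum>g\<in>carrier G. rh' g (\<phi> (rh (inv g) v)))"
  by (rule lin_summ) (rule lin_comp[OF repD(1)[OF assms(2)] lin_comp[OF \<phi> repD(1)[OF assms(1)]]], auto)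
 then show ?thesis by (simp only: Tr_def[abs_def])
qed

lemma Tr_equiv: assumes r: "rep rh" "rep rh'" and \<phi>: "lin \<phi>" shows "equiv rh rh' (Tr rh rh' \<phi>)"
 unfolding equiv_def
proof (intro conjI ballI allI)
 show "lin (Tr rh rh' \<phi>)" using assms by (rule Tr_lin)
 fix h v assume h: "h \<in> carrier G"
 have "Tr rh rh' \<phi> (rh h v) = (\<Sum>g\<in>carrier G. rh' g (\<phi> (rh (inv g \<otimes> h) v)))"
  using h by (simp add: Tr_def repD(2)[OF r(1)])
 also have "\<dots> = (\<Sum>g\<in>carrier G. rh' (h \<otimes> g) (\<phi> (rh (inv (h \<otimes> g) \<otimes> h) v)))"
  by (rule sum_group_left[OF h, symmetric])
 also have "\<dots> = (\<Sum>g\<in>carrier G. rh' h (rh' g (\<phi> (rh (inv g) v))))"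
  using h by (intro sum.cong refl) (simp add: repD(2)[OF r(2)] inv_mult_group m_assoc)
 also have "\<dots> = rh' h (Tr rh rh' \<phi> v)" using h by (simp add: Tr_def lin_sum[OF repD(1)[OF r(2)]])
 finally show "Tr rh rh' \<phi> (rh h v) = rh' h (Tr rh rh' \<phi> v)" .
qed

lemma Tr_comp_right: assumes "equiv rh0 rh H" shows "Tr rh rh' \<phi> (H v) = Tr rh0 rh' (%v. \<phi> (H v)) v"
 unfolding Tr_def using equivD(2)[OF assms] by (intro sum.cong refl) simp

lemma Tr_comp_left: assumes "equiv rh' rh'' H" shows "H (Tr rh rh' \<phi> v) = Tr rh rh'' (%v. H (\<phi> v)) v"
 unfolding Tr_def using equivD[OF assms] by (simp add: lin_sum)

lemma Tr_one: assumes "rep rh" shows "Tr rh rh' \<phi> (rh \<one> v) = Tr rh rh' \<phi> v"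
 unfolding Tr_def by (intro sum.cong refl) (simp add: rep1[OF assms])

lemma Tr_cong_range: assumes "rep rh" "\<And>v. \<phi> (rh \<one> v) = \<psi> (rh \<one> v)"
 shows "Tr rh rh' \<phi> v = Tr rh rh' \<psi> v"
 unfolding Tr_def
proof (intro sum.cong refl)
 fix g assume g: "g \<in> carrier G"
 have "\<phi> (rh (inv g) v) = \<psi> (rh (inv g) v)" using assms(2)[of "rh (inv g) v"] g by (simp add: rep1[OF assms(1)])
 then show "rh' g (\<phi> (rh (inv g) v)) = rh' g (\<psi> (rh (inv g) v))" by simp
qed

lemma equiv_comp: assumes "equiv rh rh' F" "equiv rh' rh'' H" shows "equiv rh rh'' (%v. H (F v))"
 using assms lin_comp[of H F] by (simp add: equiv_def)

lemma equiv_one: assumes "rep rh" "equiv rh rh' F" shows "rh' \<one> (F (rh \<one> v)) = F (rh \<one> v)"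
 using equivD(2)[OF assms(2) one_closed, of "rh \<one> v"] rep1[OF assms(1) one_closed] by simp

lemma equiv_rep1: "rep rh ==> equiv rh rh (rh \<one>)"
 by (simp add: equiv_def repD rep1)

subsection \<open>Coordinates\<close>

lemma coord_kd: assumes "coord M rh ka em" and g: "g \<in> carrier G" and x: "x \<in> carrier M"
 shows "ka (kd g c \<odot>\<^bsub>M\<^esub> x) = pscale c (rh g (ka x))"
proof -
 have "ka (kd g c \<odot>\<^bsub>M\<^esub> x) = (\<Sum>h\<in>carrier G. if h = g then pscale c (rh g (ka x)) else 0)"
  unfolding coordD(7)[OF assms(1) kd_closed x] by (rule sum.cong) (auto simp: kd_def)
 then show ?thesis using finite_G g by simp
qed

lemma coord_smult: assumes "coord M rh ka em" shows "a \<in> carrier KG ==> x \<in> carrier M ==> a \<odot>\<^bsub>M\<^esub> x \<in> carrier M"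
 and "x \<in> carrier M ==> y \<in> carrier M ==> x \<oplus>\<^bsub>M\<^esub> y \<in> carrier M" and "\<zero>\<^bsub>M\<^esub> \<in> carrier M"
proof -
 interpret left_module KG M using assms by (rule coordD)
 show "a \<in> carrier KG ==> x \<in> carrier M ==> a \<odot>\<^bsub>M\<^esub> x \<in> carrier M" by (rule smult_closed)
 show "x \<in> carrier M ==> y \<in> carrier M ==> x \<oplus>\<^bsub>M\<^esub> y \<in> carrier M" "\<zero>\<^bsub>M\<^esub> \<in> carrier M" by auto
qed

lemma coord_zero: assumes c: "coord M rh ka em" shows "ka \<zero>\<^bsub>M\<^esub> = 0" "em 0 = \<zero>\<^bsub>M\<^esub>"
proof -
 interpret left_module KG M using c by (rule coordD)
 show 0: "ka \<zero>\<^bsub>M\<^esub> = 0" using coordD(6)[OF c, of "\<zero>\<^bsub>M\<^esub>" "\<zero>\<^bsub>M\<^esub>"] by simp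
 show "em 0 = \<zero>\<^bsub>M\<^esub>" using coordD(4)[OF c, of "\<zero>\<^bsub>M\<^esub>"] 0 by simp
qed

lemma coord_eps: assumes c: "coord M rh ka em"
 shows "em (v + w) = em v \<oplus>\<^bsub>M\<^esub> em w" and "em (rh \<one> v) = em v"
  and "em (pscale c v) = kd \<one> c \<odot>\<^bsub>M\<^esub> em v" and "g \<in> carrier G ==> em (rh g v) = kd g 1 \<odot>\<^bsub>M\<^esub> em v"
proof -
 note r = coordD(2)[OF c] and cl = coord_smult[OF c] and car = coordD(3)[OF c] and inj = coordD(9)[OF c]
 note l1 = repD(1)[OF r one_closed]
 show "em (v + w) = em v \<oplus>\<^bsub>M\<^esub> em w"
  by (rule inj) (simp_all add: cl car coordD(5,6)[OF c] lin_add[OF l1])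
 show "em (rh \<one> v) = em v" by (rule inj) (simp_all add: car coordD(5)[OF c] rep1[OF r])
 show "em (pscale c v) = kd \<one> c \<odot>\<^bsub>M\<^esub> em v"
  by (rule inj) (simp_all add: car cl coordD(5)[OF c] coord_kd[OF c] lin_scale[OF l1] rep1[OF r])
 show "em (rh g v) = kd g 1 \<odot>\<^bsub>M\<^esub> em v" if "g \<in> carrier G"
  using that by (intro inj) (simp_all add: car cl coordD(5)[OF c] coord_kd[OF c] rep1[OF r])
qed

lemma homD: assumes "f \<in> left_module_hom R M N"
 shows "x \<in> carrier M ==> f x \<in> carrier N"
  and "x \<in> carrier M ==> y \<in> carrier M ==> f (x \<oplus>\<^bsub>M\<^esub> y) = f x \<oplus>\<^bsub>N\<^esub> f y"
  and "a \<in> carrier R ==> x \<in> carrier M ==> f (a \<odot>\<^bsub>M\<^esub> x) = a \<odot>\<^bsub>N\<^esub> f x"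
 using assms by (auto simp: left_module_hom_def)

lemma hom_hat:
 assumes M: "coord M rh ka em" and N: "coord N rh' ka' em'" and f: "f \<in> left_module_hom KG M N"
 shows "equiv rh rh' (%v. ka' (f (em v)))" and "rh' \<one> (ka' (f (em v))) = ka' (f (em v))"
proof -
 note car = coordD(3)[OF M] and eps = coord_eps[OF M]
 have fc: "f (em v) \<in> carrier N" for v using homD(1)[OF f] car .
 show "equiv rh rh' (%v. ka' (f (em v)))"
  unfolding equiv_def
 proof (intro conjI ballI allI linI)
  show "ka' (f (em (pscale c x))) = pscale c (ka' (f (em x)))" for c x
   using coord_kd[OF N one_closed fc] fc
   by (simp add: eps homD(3)[OF f] car coordD(8)[OF N])
 qed (simp_all add: eps homD(2,3)[OF f] car fc coordD(6)[OF N] coord_kd[OF N])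
 show "rh' \<one> (ka' (f (em v))) = ka' (f (em v))" by (rule coordD(8)[OF N fc])
qed

lemma hom_unhat:
 assumes M: "coord M rh ka em" and N: "coord N rh' ka' em'" and F: "equiv rh rh' F"
 shows "(%x. em' (F (ka x))) \<in> left_module_hom KG M N"
  and "x \<in> carrier M ==> ka' (em' (F (ka x))) = F (ka x)"
proof -
 note inj = coordD(9)[OF N]
 show k: "ka' (em' (F (ka x))) = F (ka x)" if "x \<in> carrier M" for x
  using equivD(2)[OF F one_closed, of "ka x"] that by (simp add: coordD(5)[OF N] coordD(8)[OF M])
 show "(%x. em' (F (ka x))) \<in> left_module_hom KG M N"
  unfolding left_module_hom_def
 proof (intro CollectI conjI ballI)
  fix x y assume "x \<in> carrier M" "y \<in> carrier M"
  then show "em' (F (ka (x \<oplus>\<^bsub>M\<^esub> y))) = em' (F (ka x)) \<oplus>\<^bsub>N\<^esub> em' (F (ka y))"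
   by (simp add: coordD(6)[OF M] lin_add[OF equivD(1)[OF F]] coord_eps[OF N])
 next
  fix a x assume a: "a \<in> carrier KG" and x: "x \<in> carrier M"
  show "em' (F (ka (a \<odot>\<^bsub>M\<^esub> x))) = a \<odot>\<^bsub>N\<^esub> em' (F (ka x))"
  proof (rule inj)
   show "ka' (em' (F (ka (a \<odot>\<^bsub>M\<^esub> x)))) = ka' (a \<odot>\<^bsub>N\<^esub> em' (F (ka x)))"
   proof -
    have "ka' (em' (F (ka (a \<odot>\<^bsub>M\<^esub> x)))) = F (ka (a \<odot>\<^bsub>M\<^esub> x))"
     using a x by (intro k coord_smult[OF M])
    also have "\<dots> = (\<Sum>g\<in>carrier G. pscale (a g) (rh' g (F (ka x))))"
     using a x by (simp add: coordD(7)[OF M] lin_sum[OF equivD(1)[OF F]] lin_scale[OF equivD(1)[OF F]] equivD(2)[OF F])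
    also have "\<dots> = ka' (a \<odot>\<^bsub>N\<^esub> em' (F (ka x)))"
     using a x by (simp add: coordD(7)[OF N] coordD(3)[OF N] k)
    finally show ?thesis .
   qed
  qed (use a x coord_smult[OF N] coordD(3)[OF N] in auto)
 qed (use coordD(3)[OF N] in auto)
qed

subsection \<open>Free representations\<close>

definition emb :: "'g \<times> 'u => 'u" where "emb = (SOME j. inj_on j (carrier G \<times> UNIV))"

lemma inj_emb: "inj_on emb (carrier G \<times> UNIV)"
 unfolding emb_def using times_inj by (rule someI_ex)

definition \<theta> :: "'g => ('u \<Rightarrow>\<^sub>0 'k) => ('u \<Rightarrow>\<^sub>0 'k)" where
 "\<theta> g = lext (%u. Poly_Mapping.single (emb (g, u)) 1)"

definition \<sigma> :: "'g => ('u \<Rightarrow>\<^sub>0 'k) => ('u \<Rightarrow>\<^sub>0 'k)" where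
 "\<sigma> g = lext (%w. if \<exists>u. w = emb (g, u) then Poly_Mapping.single (THE u. w = emb (g, u)) 1 else 0)"

lemma lin_\<theta>: "lin (\<theta> g)" and lin_\<sigma>: "lin (\<sigma> g)" unfolding \<theta>_def \<sigma>_def by (rule lext_lin)+

lemma emb_eq: "g \<in> carrier G ==> h \<in> carrier G ==> emb (g, u) = emb (h, w) \<longleftrightarrow> g = h \<and> u = w"
 using inj_onD[OF inj_emb, of "(g, u)" "(h, w)"] by auto

lemma \<sigma>\<theta>: assumes "g \<in> carrier G" "h \<in> carrier G" shows "\<sigma> h (\<theta> g v) = (if g = h then v else 0)"
proof (cases "g = h")
 case True
 have "(%v. \<sigma> h (\<theta> g v)) v = v"
 proof (rule lin_eqI[of "%v. \<sigma> h (\<theta> g v)" "%v. v" v])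
  fix u
  have "(THE u'. emb (h, u) = emb (h, u')) = u" using emb_eq[OF assms(2) assms(2)] by auto
  then show "\<sigma> h (\<theta> g (Poly_Mapping.single u 1)) = Poly_Mapping.single u 1"
   using True by (auto simp: \<theta>_def \<sigma>_def)
 qed (rule lin_comp[OF lin_\<sigma> lin_\<theta>], rule lin_id)
 then show ?thesis using True by simp
next
 case False
 have "(%v. \<sigma> h (\<theta> g v)) v = 0"
 proof (rule lin_eqI[of "%v. \<sigma> h (\<theta> g v)" "%v. 0" v])
  fix u
  show "\<sigma> h (\<theta> g (Poly_Mapping.single u 1)) = 0"
   using False emb_eq[OF assms] by (auto simp: \<theta>_def \<sigma>_def)
 qed (rule lin_comp[OF lin_\<sigma> lin_\<theta>], rule lin_zero)
 then show ?thesis using False by simp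
qed

text \<open>
The free representation whose coefficient space is the image of the projection \<open>E\<close>; the ambient space holds \<open>|G|\<close> disjoint copies of itself,
with inclusions \<open>\<theta>\<close> and projections \<open>\<sigma>\<close>.
\<close>

definition Fr :: "(('u \<Rightarrow>\<^sub>0 'k) => ('u \<Rightarrow>\<^sub>0 'k)) => 'g => ('u \<Rightarrow>\<^sub>0 'k) => ('u \<Rightarrow>\<^sub>0 'k)" where
 "Fr E g v = (\<Sum>d\<in>carrier G. \<theta> (g \<otimes> d) (E (\<sigma> d v)))"

lemma \<sigma>_Fr: assumes g: "g \<in> carrier G" and h: "h \<in> carrier G"
 shows "\<sigma> h (Fr E g v) = E (\<sigma> (inv g \<otimes> h) v)"
proof -
 have "\<sigma> h (Fr E g v) = (\<Sum>d\<in>carrier G. if d = inv g \<otimes> h then E (\<sigma> (inv g \<otimes> h) v) else 0)"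
  unfolding Fr_def lin_sum[OF lin_\<sigma>]
  using g h by (intro sum.cong refl) (auto simp: \<sigma>\<theta> inv_solve_left m_assoc[symmetric])
 then show ?thesis using finite_G g h by simp
qed

lemma Fr_\<theta>: assumes E: "lin E" and g: "g \<in> carrier G" and h: "h \<in> carrier G"
 shows "Fr E g (\<theta> h v) = \<theta> (g \<otimes> h) (E v)"
proof -
 have "Fr E g (\<theta> h v) = (\<Sum>d\<in>carrier G. if d = h then \<theta> (g \<otimes> h) (E v) else 0)"
  unfolding Fr_def using h by (intro sum.cong refl) (auto simp: \<sigma>\<theta> lin_0[OF E] lin_0[OF lin_\<theta>])
 then show ?thesis using finite_G h by simp
qed

lemma Fr_lin: assumes E: "lin E" shows "lin (Fr E g)"
proof -
 have "lin (%v. \<Sum>d\<in>carrier G. \<theta> (g \<otimes> d) (E (\<sigma> d v)))"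
  by (rule lin_summ, rule lin_comp[OF lin_\<theta> lin_comp[OF E lin_\<sigma>]])
 then show ?thesis by (simp only: Fr_def[abs_def])
qed

lemma rep_Fr: assumes E: "lin E" "\<And>v. E (E v) = E v" shows "rep (Fr E)"
 unfolding rep_def
proof (intro conjI ballI allI)
 show "lin (Fr E g)" for g using E(1) by (rule Fr_lin)
 fix g h v assume g: "g \<in> carrier G" and h: "h \<in> carrier G"
 have "Fr E g (Fr E h v) = (\<Sum>d\<in>carrier G. \<theta> (g \<otimes> d) (E (\<sigma> (inv h \<otimes> d) v)))"
  unfolding Fr_def[of E g] using h by (intro sum.cong refl) (simp add: \<sigma>_Fr E)
 also have "\<dots> = (\<Sum>d\<in>carrier G. \<theta> (g \<otimes> (h \<otimes> d)) (E (\<sigma> (inv h \<otimes> (h \<otimes> d)) v)))"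
  by (rule sum_group_left[OF h, symmetric])
 also have "\<dots> = Fr E (g \<otimes> h) v"
  unfolding Fr_def using g h by (intro sum.cong refl) (simp add: m_assoc m_assoc[symmetric, of "inv h"])
 finally show "Fr E (g \<otimes> h) v = Fr E g (Fr E h v)" ..
qed

lemma proj_Fr: assumes E: "lin E" "\<And>v. E (E v) = E v" shows "proj (Fr E)"
 unfolding proj_def szero_def
proof (intro conjI exI allI)
 show "rep (Fr E)" using E by (rule rep_Fr)
 show "lin (%v. \<theta> \<one> (\<sigma> \<one> v))" by (rule lin_comp[OF lin_\<theta> lin_\<sigma>])
 fix v
 show "Fr E \<one> v = Tr (Fr E) (Fr E) (%v. \<theta> \<one> (\<sigma> \<one> v)) v"
  unfolding Tr_def Fr_def[of E \<one>]
  by (intro sum.cong refl) (simp add: \<sigma>_Fr Fr_\<theta>[OF E(1)] E(2))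
qed

text \<open>A linear map out of the coefficients extends to a free representation.\<close>

definition ext where
 "ext rh \<phi> v = (\<Sum>g\<in>carrier G. rh g (\<phi> (\<sigma> g v)))"

lemma ext_lin: assumes "rep rh" "lin \<phi>" shows "lin (ext rh \<phi>)"
proof -
 have "lin (%v. \<Sum>g\<in>carrier G. rh g (\<phi> (\<sigma> g v)))"
  by (rule lin_summ) (rule lin_comp[OF repD(1)[OF assms(1)] lin_comp[OF assms(2) lin_\<sigma>]])
 then show ?thesis by (simp only: ext_def[abs_def])
qed

lemma ext_equiv: assumes r: "rep rh" and \<phi>: "lin \<phi>" "\<And>v. \<phi> (E v) = \<phi> v"
 shows "equiv (Fr E) rh (ext rh \<phi>)"
 unfolding equiv_def
proof (intro conjI ballI allI)
 show "lin (ext rh \<phi>)" using r \<phi>(1) by (rule ext_lin)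
 fix h v assume h: "h \<in> carrier G"
 have "ext rh \<phi> (Fr E h v) = (\<Sum>g\<in>carrier G. rh g (\<phi> (\<sigma> (inv h \<otimes> g) v)))"
  unfolding ext_def using h by (intro sum.cong refl) (simp add: \<sigma>_Fr \<phi>)
 also have "\<dots> = (\<Sum>g\<in>carrier G. rh (h \<otimes> g) (\<phi> (\<sigma> (inv h \<otimes> (h \<otimes> g)) v)))"
  by (rule sum_group_left[OF h, symmetric])
 also have "\<dots> = (\<Sum>g\<in>carrier G. rh h (rh g (\<phi> (\<sigma> g v))))"
  using h by (intro sum.cong refl) (simp add: repD(2)[OF r] m_assoc[symmetric, of "inv h"])
 also have "\<dots> = rh h (ext rh \<phi> v)" using h by (simp add: ext_def lin_sum[OF repD(1)[OF r]])
 finally show "ext rh \<phi> (Fr E h v) = rh h (ext rh \<phi> v)" .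
qed

lemma ext_\<theta>: assumes r: "rep rh" and \<phi>: "lin \<phi>" and h: "h \<in> carrier G"
 shows "ext rh \<phi> (\<theta> h v) = rh h (\<phi> v)"
proof -
 have "ext rh \<phi> (\<theta> h v) = (\<Sum>d\<in>carrier G. if d = h then rh h (\<phi> v) else 0)"
  unfolding ext_def using h by (intro sum.cong refl) (auto simp: \<sigma>\<theta> lin_0[OF \<phi>] lin_0[OF repD(1)[OF r]])
 then show ?thesis using finite_G h by simp
qed

subsection \<open>The trace criterion\<close>

lemma proj_imp_projective:
 assumes P: "coord P rh ka em" and pr: "proj rh"
 shows "projective_module KG P"
 unfolding projective_module_def
proof (intro conjI allI impI; (elim conjE)?)
 show "left_module KG P" using P by (rule coordD)
 fix M N :: "('g => 'k, 'u) module" and g f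
 assume "left_module KG M" "left_module KG N" and g: "g \<in> left_module_hom KG M N" and onto: "g ` carrier M = carrier N"
  and f: "f \<in> left_module_hom KG P N"
 then obtain rhM kaM emM rhN kaN emN where M: "coord M rhM kaM emM" and N: "coord N rhN kaN emN"
  using coord_exists by meson
 define Gh where "Gh = (%v. kaN (g (emM v)))"
 define F where "F = (%v. kaN (f (em v)))"
 have Gh: "equiv rhM rhN Gh" unfolding Gh_def by (rule hom_hat(1)[OF M N g])
 have F: "equiv rh rhN F" unfolding F_def by (rule hom_hat(1)[OF P N f])
 obtain \<phi> where \<phi>: "lin \<phi>" "\<And>v. Tr rh rh \<phi> v = rh \<one> v" using pr by (auto simp: proj_def szero_def)
 have "range F \<subseteq> Gh ` UNIV"
 proof safe
  fix v
  have "f (em v) \<in> g ` carrier M" using onto homD(1)[OF f coordD(3)[OF P]] by simp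
  then obtain x where "x \<in> carrier M" "f (em v) = g x" by auto
  then have "F v = Gh (kaM x)" by (simp add: F_def Gh_def coordD(4)[OF M])
  then show "F v \<in> range Gh" by simp
 qed
 then obtain L where L: "lin L" "\<And>v. Gh (L v) = F v"
  using lift_through[OF equivD(1)[OF Gh] equivD(1)[OF F] subspace_UNIV] by auto
 define H where "H = Tr rh rhM (%v. L (\<phi> v))"
 have H: "equiv rh rhM H" unfolding H_def
  by (rule Tr_equiv[OF coordD(2)[OF P] coordD(2)[OF M] lin_comp[OF L(1) \<phi>(1)]])
 have GH: "Gh (H v) = F v" for v
 proof -
  have "Gh (H v) = Tr rh rhN (%v. F (\<phi> v)) v" unfolding H_def by (simp add: Tr_comp_left[OF Gh] L(2))
  also have "\<dots> = F (rh \<one> v)" by (simp flip: Tr_comp_left[OF F] add: \<phi>(2))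
  also have "\<dots> = F v" by (simp add: F_def coord_eps(2)[OF P])
  finally show ?thesis .
 qed
 show "\<exists>h\<in>left_module_hom KG P M. \<forall>x\<in>carrier P. g (h x) = f x"
 proof (intro bexI ballI)
  show "(%x. emM (H (ka x))) \<in> left_module_hom KG P M" by (rule hom_unhat(1)[OF P M H])
  fix x assume x: "x \<in> carrier P"
  have "kaN (g (emM (H (ka x)))) = kaN (f x)"
   using GH[of "ka x"] by (simp add: Gh_def F_def coordD(4)[OF P x])
  then show "g (emM (H (ka x))) = f x"
   using coordD(9)[OF N] homD(1)[OF g coordD(3)[OF M]] homD(1)[OF f x] by blast
 qed
qed

lemma projective_imp_proj:
 assumes P: "coord P rh ka em" and pr: "projective_module KG P"
 shows "proj rh"
proof -
 let ?F = "Fr (%v. v)"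
 note r = coordD(2)[OF P]
 have rF: "rep ?F" by (rule rep_Fr) auto
 note Q = coord_realize[OF rF]
 define b where "b = ext rh (%v. v)"
 have b: "equiv ?F rh b" unfolding b_def by (rule ext_equiv[OF r]) auto
 have bh: "(%x. em (b (inv_into UNIV \<iota> x))) \<in> left_module_hom KG (realize ?F) P" (is "?b \<in> _")
  by (rule hom_unhat(1)[OF Q P b])
 have onto: "?b ` carrier (realize ?F) = carrier P"
 proof (intro equalityI subsetI)
  fix x assume x: "x \<in> carrier P"
  let ?y = "\<iota> (?F \<one> (\<theta> \<one> (ka x)))"
  have "?y \<in> carrier (realize ?F)" using coordD(3)[OF Q] .
  moreover have "?b ?y = x"
   using x by (simp add: inv_f_f[OF inj_\<iota>] Fr_\<theta> b_def ext_\<theta>[OF r] coord_eps(2)[OF P] coordD(4)[OF P])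
  ultimately show "x \<in> ?b ` carrier (realize ?F)" by (metis image_eqI)
 qed (use homD(1)[OF bh] in auto)
 have idh: "(%x. x) \<in> left_module_hom KG P P" by (auto simp: left_module_hom_def)
 obtain h where h: "h \<in> left_module_hom KG P (realize ?F)" "\<And>x. x \<in> carrier P ==> ?b (h x) = x"
  using pr onto bh idh coordD(1)[OF Q] coordD(1)[OF P] unfolding projective_module_def by blast
 define H where "H = (%v. inv_into UNIV \<iota> (h (em v)))"
 have H: "equiv rh ?F H" unfolding H_def by (rule hom_hat(1)[OF P Q h(1)])
 have bH: "b (H v) = rh \<one> v" for v
 proof -
  have "em (b (H v)) = em v" using h(2)[OF coordD(3)[OF P, of v]] by (simp add: H_def)
  then have "rh \<one> (b (H v)) = rh \<one> v" using coordD(5)[OF P] by metis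
  moreover have "rh \<one> (b (H v)) = b (H v)"
   unfolding b_def ext_def by (simp add: lin_sum[OF repD(1)[OF r]] rep1[OF r])
  ultimately show ?thesis by simp
 qed
 obtain \<phi> where \<phi>: "lin \<phi>" "\<And>v. Tr ?F ?F \<phi> v = ?F \<one> v"
  using proj_Fr[of "%v. v"] by (auto simp: proj_def szero_def)
 have "rh \<one> v = Tr rh rh (%v. b (\<phi> (H v))) v" for v
 proof -
  have "rh \<one> v = b (?F \<one> (H v))" using equivD(2)[OF b one_closed, of "H v"] bH[of v]
   by (simp add: rep1[OF r])
  also have "\<dots> = b (Tr ?F ?F \<phi> (H v))" by (simp add: \<phi>)
  also have "\<dots> = Tr rh rh (%v. b (\<phi> (H v))) v" by (simp add: Tr_comp_right[OF H] Tr_comp_left[OF b])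
  finally show ?thesis .
 qed
 moreover have "lin (%v. b (\<phi> (H v)))"
  by (rule lin_comp[OF equivD(1)[OF b] lin_comp[OF \<phi>(1) equivD(1)[OF H]]])
 ultimately show ?thesis using r by (auto simp: proj_def szero_def)
qed

lemma stably_zeroI:
 assumes M: "coord M rh ka em" and N: "coord N rh' ka' em'"
  and f: "\<And>x. x \<in> carrier M ==> f x \<in> carrier N" "\<And>x. x \<in> carrier M ==> ka' (f x) = Tr rh rh' \<phi> (ka x)"
  and \<phi>: "lin \<phi>"
 shows "stably_zero KG M N f"
proof -
 let ?F = "Fr (%v. v)"
 note r = coordD(2)[OF M] and r' = coordD(2)[OF N]
 have pF: "proj ?F" by (rule proj_Fr) auto
 then have rF: "rep ?F" by (simp add: proj_def)
 note Q = coord_realize[OF rF]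
 define A where "A v = (\<Sum>g\<in>carrier G. \<theta> g (rh (inv g) v))" for v
 have \<sigma>A: "\<sigma> h (A v) = rh (inv h) v" if h: "h \<in> carrier G" for h v
 proof -
  have "\<sigma> h (A v) = (\<Sum>d\<in>carrier G. if d = h then rh (inv h) v else 0)"
   unfolding A_def lin_sum[OF lin_\<sigma>] using h by (intro sum.cong refl) (auto simp: \<sigma>\<theta>)
  then show ?thesis using finite_G h by simp
 qed
 have A: "equiv rh ?F A"
  unfolding equiv_def
 proof (intro conjI ballI allI)
  have "lin (%v. \<Sum>g\<in>carrier G. \<theta> g (rh (inv g) v))"
   by (rule lin_summ) (rule lin_comp[OF lin_\<theta> repD(1)[OF r]], simp)
  then show "lin A" by (simp only: A_def[abs_def])
  fix h v assume h: "h \<in> carrier G"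
  have "?F h (A v) = (\<Sum>d\<in>carrier G. \<theta> (h \<otimes> d) (rh (inv (h \<otimes> d) \<otimes> h) v))"
   unfolding Fr_def using h by (intro sum.cong refl) (simp add: \<sigma>A inv_mult_group m_assoc)
  also have "\<dots> = (\<Sum>d\<in>carrier G. \<theta> d (rh (inv d \<otimes> h) v))" by (rule sum_group_left[OF h])
  also have "\<dots> = A (rh h v)" unfolding A_def using h by (intro sum.cong refl) (simp add: repD(2)[OF r])
  finally show "A (rh h v) = ?F h (A v)" ..
 qed
 define B where "B = ext rh' \<phi>"
 have B: "equiv ?F rh' B" unfolding B_def by (rule ext_equiv[OF r' \<phi>]) auto
 have BA: "B (A v) = Tr rh rh' \<phi> v" for v
  unfolding B_def ext_def Tr_def by (intro sum.cong refl) (simp add: \<sigma>A)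
 let ?a = "%x. \<iota> (?F \<one> (A (ka x)))" and ?b = "%y. em' (B (inv_into UNIV \<iota> y))"
 show ?thesis
  unfolding stably_zero_def
 proof (intro exI conjI bexI ballI)
  show "projective_module KG (realize ?F)" by (rule proj_imp_projective[OF Q pF])
  show "?a \<in> left_module_hom KG M (realize ?F)" by (rule hom_unhat(1)[OF M Q A])
  show "?b \<in> left_module_hom KG (realize ?F) N" by (rule hom_unhat(1)[OF Q N B])
  fix x assume x: "x \<in> carrier M"
  have "?b (?a x) = em' (ka' (f x))"
   using hom_unhat(2)[OF M Q A x] by (simp add: BA f x)
  also have "\<dots> = f x" by (rule coordD(4)[OF N f(1)[OF x]])
  finally show "f x = ?b (?a x)" ..
 qed
qed

lemma stably_zeroD:
 assumes M: "coord M rh ka em" and N: "coord N rh' ka' em'" and z: "stably_zero KG M N f"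
 shows "szero rh rh' (%v. ka' (f (em v)))"
proof -
 obtain P a b where P': "projective_module KG P" and a: "a \<in> left_module_hom KG M P"
  and b: "b \<in> left_module_hom KG P N" and f: "\<And>x. x \<in> carrier M ==> f x = b (a x)"
  using z by (auto simp: stably_zero_def)
 obtain rhP kaP emP where P: "coord P rhP kaP emP"
  using coord_exists[of P] P' unfolding projective_module_def by blast
 obtain \<phi> where \<phi>: "lin \<phi>" "\<And>v. Tr rhP rhP \<phi> v = rhP \<one> v"
  using projective_imp_proj[OF P P'] by (auto simp: proj_def szero_def)
 let ?A = "%v. kaP (a (em v))" and ?B = "%v. ka' (b (emP v))"
 have A: "equiv rh rhP ?A" by (rule hom_hat(1)[OF M P a])
 have B: "equiv rhP rh' ?B" by (rule hom_hat(1)[OF P N b])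
 have "ka' (f (em v)) = Tr rh rh' (%v. ?B (\<phi> (?A v))) v" for v
 proof -
  have "ka' (f (em v)) = ?B (?A v)"
   using f[OF coordD(3)[OF M]] coordD(4)[OF P homD(1)[OF a coordD(3)[OF M]]] by simp
  also have "\<dots> = ?B (Tr rhP rhP \<phi> (?A v))" using hom_hat(2)[OF M P a] by (simp add: \<phi>)
  also have "\<dots> = Tr rh rh' (%v. ?B (\<phi> (?A v))) v"
   unfolding Tr_comp_right[OF A] by (rule Tr_comp_left[OF B])
  finally show ?thesis .
 qed
 moreover have "lin (%v. ?B (\<phi> (?A v)))"
  using lin_comp[OF equivD(1)[OF B] lin_comp[OF \<phi>(1) equivD(1)[OF A]]] .
 ultimately show ?thesis unfolding szero_def by blast
qed

text \<open>
The identity of a free module is the trace of the projection onto the coefficients of one group element, and composites of traces with homomorphisms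
are traces. Conversely a trace factors through a free module on the whole ambient space.
\<close>

lemma stably_zero_iff:
 assumes M: "coord M rh ka em" and N: "coord N rh' ka' em'" and f: "f \<in> left_module_hom KG M N"
 shows "stably_zero KG M N f \<longleftrightarrow> szero rh rh' (%v. ka' (f (em v)))"
proof
 assume "szero rh rh' (%v. ka' (f (em v)))"
 then obtain \<phi> where \<phi>: "lin \<phi>" "\<And>v. ka' (f (em v)) = Tr rh rh' \<phi> v" by (auto simp: szero_def)
 show "stably_zero KG M N f"
 proof (rule stably_zeroI[OF M N _ _ \<phi>(1)])
  fix x assume x: "x \<in> carrier M"
  show "f x \<in> carrier N" using homD(1)[OF f x] .
  show "ka' (f x) = Tr rh rh' \<phi> (ka x)" using \<phi>(2)[of "ka x"] by (simp add: coordD(4)[OF M x])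
 qed
qed (rule stably_zeroD[OF M N])

lemma short_exact_iff:
 assumes A: "coord A rhA kaA emA" and B: "coord B rhB kaB emB" and C: "coord C rhC kaC emC"
 shows "short_exact KG A B C \<longleftrightarrow> (\<exists>I Q. exact rhA rhB rhC I Q)"
proof
 assume "short_exact KG A B C"
 then obtain i q where i: "i \<in> left_module_hom KG A B" and q: "q \<in> left_module_hom KG B C"
  and inj: "inj_on i (carrier A)" and onto: "q ` carrier B = carrier C"
  and ker: "i ` carrier A = {x \<in> carrier B. q x = \<zero>\<^bsub>C\<^esub>}"
  by (auto simp: short_exact_def)
 let ?I = "%v. kaB (i (emA v))" and ?Q = "%v. kaC (q (emB v))"
 have eI: "equiv rhA rhB ?I" by (rule hom_hat(1)[OF A B i])
 have eQ: "equiv rhB rhC ?Q" by (rule hom_hat(1)[OF B C q])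
 have "exact rhA rhB rhC ?I ?Q"
  unfolding exact_def
 proof (intro conjI allI impI eI eQ)
  fix v assume "?I (rhA \<one> v) = 0"
  then have "?I v = ?I 0" using lin_0[OF equivD(1)[OF eI]] by (simp add: coord_eps(2)[OF A])
  then have "i (emA v) = i (emA 0)" using coordD(9)[OF B] homD(1)[OF i coordD(3)[OF A]] by blast
  then have "emA v = emA 0" using inj_onD[OF inj] coordD(3)[OF A] by blast
  then show "rhA \<one> v = 0" using coordD(5)[OF A] lin_0[OF repD(1)[OF coordD(2)[OF A] one_closed]] by metis
 next
  fix v
  have "emC v \<in> q ` carrier B" unfolding onto by (rule coordD(3)[OF C])
  then obtain x where x: "x \<in> carrier B" "q x = emC v" by (metis imageE)
  then have "?Q (rhB \<one> (kaB x)) = rhC \<one> v"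
   by (simp add: coord_eps(2)[OF B] coordD(4)[OF B] coordD(5)[OF C])
  then show "\<exists>w. ?Q (rhB \<one> w) = rhC \<one> v" by blast
 next
  fix w
  have "?Q (rhB \<one> w) = 0 \<longleftrightarrow> q (emB w) = \<zero>\<^bsub>C\<^esub>"
   using coord_zero(1)[OF C] coordD(9)[OF C, of "q (emB w)" "\<zero>\<^bsub>C\<^esub>"] homD(1)[OF q coordD(3)[OF B]] coord_smult(3)[OF C]
   by (auto simp: coord_eps(2)[OF B])
  also have "\<dots> \<longleftrightarrow> emB w \<in> i ` carrier A" using ker coordD(3)[OF B] by auto
  also have "\<dots> \<longleftrightarrow> (\<exists>v. ?I (rhA \<one> v) = rhB \<one> w)"
  proof
   assume "emB w \<in> i ` carrier A"
   then obtain x where "x \<in> carrier A" "emB w = i x" by auto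
   then have "?I (rhA \<one> (kaA x)) = rhB \<one> w"
    by (simp add: coord_eps(2)[OF A] coordD(4)[OF A] flip: coordD(5)[OF B])
   then show "\<exists>v. ?I (rhA \<one> v) = rhB \<one> w" by blast
  next
   assume "\<exists>v. ?I (rhA \<one> v) = rhB \<one> w"
   then obtain v where "kaB (i (emA v)) = kaB (emB w)" by (auto simp: coord_eps(2)[OF A] coordD(5)[OF B])
   then have "i (emA v) = emB w" using coordD(9)[OF B] homD(1)[OF i coordD(3)[OF A]] coordD(3)[OF B] by blast
   then show "emB w \<in> i ` carrier A" using coordD(3)[OF A] by (metis image_eqI)
  qed
  finally show "?Q (rhB \<one> w) = 0 \<longleftrightarrow> (\<exists>v. ?I (rhA \<one> v) = rhB \<one> w)" .
 qed
 then show "\<exists>I Q. exact rhA rhB rhC I Q" by blast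
next
 assume "\<exists>I Q. exact rhA rhB rhC I Q"
 then obtain I Q where I: "equiv rhA rhB I" and Q: "equiv rhB rhC Q" and inj: "\<And>v. I (rhA \<one> v) = 0 ==> rhA \<one> v = 0"
  and onto: "\<And>v. \<exists>w. Q (rhB \<one> w) = rhC \<one> v"
  and ker: "\<And>w. Q (rhB \<one> w) = 0 \<longleftrightarrow> (\<exists>v. I (rhA \<one> v) = rhB \<one> w)" by (auto simp: exact_def)
 let ?i = "%x. emB (I (kaA x))" and ?q = "%x. emC (Q (kaB x))"
 have i: "?i \<in> left_module_hom KG A B" by (rule hom_unhat(1)[OF A B I])
 have q: "?q \<in> left_module_hom KG B C" by (rule hom_unhat(1)[OF B C Q])
 have ki: "kaB (?i x) = I (kaA x)" if "x \<in> carrier A" for x using hom_unhat(2)[OF A B I that] .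
 have kq: "kaC (?q x) = Q (kaB x)" if "x \<in> carrier B" for x using hom_unhat(2)[OF B C Q that] .
 have "inj_on ?i (carrier A)"
 proof (rule inj_onI)
  fix x y assume xy: "x \<in> carrier A" "y \<in> carrier A" "?i x = ?i y"
  then have "I (kaA x) = I (kaA y)" using ki by metis
  then have "I (rhA \<one> (kaA x - kaA y)) = 0"
   using xy by (simp add: lin_diff[OF repD(1)[OF coordD(2)[OF A] one_closed]] coordD(8)[OF A] lin_diff[OF equivD(1)[OF I]])
  then have "rhA \<one> (kaA x - kaA y) = 0" by (rule inj)
  then have "kaA x = kaA y"
   using xy by (simp add: lin_diff[OF repD(1)[OF coordD(2)[OF A] one_closed]] coordD(8)[OF A])
  then show "x = y" using coordD(9)[OF A] xy by blast
 qed
 moreover have "?q ` carrier B = carrier C"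
 proof (intro equalityI subsetI)
  fix x assume x: "x \<in> carrier C"
  obtain w where "Q (rhB \<one> w) = rhC \<one> (kaC x)" using onto by blast
  then have "?q (emB w) = x" by (simp add: coordD(5)[OF B] coordD(8)[OF C x] coordD(4)[OF C x])
  then show "x \<in> ?q ` carrier B" using coordD(3)[OF B] by (metis image_eqI)
 qed (use homD(1)[OF q] in auto)
 moreover have "?i ` carrier A = {x \<in> carrier B. ?q x = \<zero>\<^bsub>C\<^esub>}"
 proof (intro equalityI subsetI)
  fix y assume "y \<in> ?i ` carrier A"
  then obtain x where x: "x \<in> carrier A" "y = ?i x" by blast
  have "kaB y = I (rhA \<one> (kaA x))" using x ki by (simp add: coordD(8)[OF A])
  moreover have y: "y \<in> carrier B" using x homD(1)[OF i] by blast
  ultimately have "Q (rhB \<one> (kaB y)) = 0" unfolding ker by (metis coordD(8)[OF B])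
  then show "y \<in> {x \<in> carrier B. ?q x = \<zero>\<^bsub>C\<^esub>}" using y by (simp add: coordD(8)[OF B] coord_zero[OF C])
 next
  fix y assume "y \<in> {x \<in> carrier B. ?q x = \<zero>\<^bsub>C\<^esub>}"
  then have y: "y \<in> carrier B" "?q y = \<zero>\<^bsub>C\<^esub>" by auto
  then have "Q (rhB \<one> (kaB y)) = 0" using kq coord_zero(1)[OF C] by (metis coordD(8)[OF B])
  then obtain v where v: "I (rhA \<one> v) = kaB y" using ker[of "kaB y"] coordD(8)[OF B y(1)] by auto
  then have "?i (emA v) = y" by (simp add: coordD(5)[OF A] coordD(4)[OF B] y)
  then show "y \<in> ?i ` carrier A" using coordD(3)[OF A] by (metis image_eqI)
 qed
 ultimately show "short_exact KG A B C"
  unfolding short_exact_def using coordD(1)[OF A] coordD(1)[OF B] coordD(1)[OF C] i q by blast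
qed

lemma is_Omega_iff:
 assumes M: "coord M rhM kaM emM" and W: "coord W rhW kaW emW"
 shows "is_Omega KG M W \<longleftrightarrow> (\<exists>rhP I Q. proj rhP \<and> exact rhW rhP rhM I Q)"
proof
 assume "is_Omega KG M W"
 then obtain P where P': "projective_module KG P" "short_exact KG W P M" by (auto simp: is_Omega_def)
 obtain rhP kaP emP where P: "coord P rhP kaP emP"
  using coord_exists[of P] P'(1) unfolding projective_module_def by blast
 then show "\<exists>rhP I Q. proj rhP \<and> exact rhW rhP rhM I Q"
  using projective_imp_proj[OF P P'(1)] short_exact_iff[OF W P M] P'(2) by blast
next
 assume "\<exists>rhP I Q. proj rhP \<and> exact rhW rhP rhM I Q"
 then obtain rhP I Q where P: "proj rhP" and ex: "exact rhW rhP rhM I Q" by blast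
 then have "rep rhP" by (simp add: proj_def)
 note C = coord_realize[OF this]
 show "is_Omega KG M W"
  unfolding is_Omega_def using proj_imp_projective[OF C P] short_exact_iff[OF W C M] ex by blast
qed

text \<open>
A trace \<open>\<Sum>g. g \<phi> g\<^sup>-\<^sup>1\<close> extends as soon as the linear map \<open>\<phi>\<close> does.
\<close>

lemma extend_over_injection:
 assumes r: "rep rhW" "rep rhP" "rep rhN" and I: "equiv rhW rhP I" "\<And>v. I (rhW \<one> v) = 0 ==> rhW \<one> v = 0"
  and F: "szero rhW rhN F"
 shows "\<exists>H. equiv rhP rhN H \<and> (\<forall>v. H (I v) = F v)"
proof -
 obtain \<phi> where \<phi>: "lin \<phi>" "\<And>v. F v = Tr rhW rhN \<phi> v" using F by (auto simp: szero_def)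
 have "\<exists>L. lin L \<and> (\<forall>u\<in>range (rhW \<one>). L (I u) = (%x. x) u)"
  using I(2) by (intro factor_through equivD(1)[OF I(1)] lin_id subspace_range repD(1)[OF r(1)] one_closed) auto
 then obtain L where L: "lin L" "\<And>u. L (I (rhW \<one> u)) = rhW \<one> u" by auto
 show ?thesis
 proof (intro exI conjI allI)
  show "equiv rhP rhN (Tr rhP rhN (%v. \<phi> (L v)))" by (rule Tr_equiv[OF r(2,3) lin_comp[OF \<phi>(1) L(1)]])
  show "Tr rhP rhN (%v. \<phi> (L v)) (I v) = F v" for v
   unfolding Tr_comp_right[OF I(1)] \<phi>(2) by (rule Tr_cong_range[OF r(1)]) (simp add: L(2))
 qed
qed

end

section \<open>The trivial module and the thick subcategory it generates\<close>

context group_modules begin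

abbreviation K :: "('g => 'k, 'u) module" where "K \<equiv> trivial_module e G"

definition triv where
 "triv rh k0 \<longleftrightarrow> rep rh \<and> k0 \<noteq> 0 \<and> rh \<one> k0 = k0 \<and> (\<forall>g\<in>carrier G. \<forall>v. rh g v = rh \<one> v) \<and>
  (\<forall>v. \<exists>c. rh \<one> v = pscale c k0)"

lemma left_module_trivial: "left_module KG K"
proof -
 have R: "ring KG" by (rule group_algebra_ring[OF finite_G])
 note inv[simp] = inv_f_f[OF inj_e]
 have ab: "abelian_group K"
 proof (rule abelian_groupI)
  fix x assume "x \<in> carrier K"
  then obtain c where "x = e c" by (auto simp: trivial_module_def)
  then show "\<exists>y\<in>carrier K. y \<oplus>\<^bsub>K\<^esub> x = \<zero>\<^bsub>K\<^esub>"
   by (intro bexI[of _ "e (- c)"]) (auto simp: trivial_module_def)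
 qed (auto simp: trivial_module_def algebra_simps)
 have mult: "(\<Sum>x\<in>carrier G. (a \<otimes>\<^bsub>KG\<^esub> b) x) = (\<Sum>x\<in>carrier G. a x) * (\<Sum>x\<in>carrier G. b x)" for a b
 proof -
  have "(\<Sum>x\<in>carrier G. (a \<otimes>\<^bsub>KG\<^esub> b) x) = (\<Sum>y\<in>carrier G. \<Sum>x\<in>carrier G. a y * b (inv y \<otimes> x))"
   by (simp add: group_algebra_def) (rule sum.swap)
  also have "\<dots> = (\<Sum>y\<in>carrier G. \<Sum>x\<in>carrier G. a y * b x)"
   by (intro sum.cong refl sum_group_left) auto
  finally show ?thesis by (simp add: sum_product)
 qed
 have one: "(\<Sum>x\<in>carrier G. \<one>\<^bsub>KG\<^esub> x) = 1"
  using finite_G by (simp add: group_algebra_def)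
 have add: "(\<Sum>x\<in>carrier G. (a \<oplus>\<^bsub>KG\<^esub> b) x) = (\<Sum>x\<in>carrier G. a x) + (\<Sum>x\<in>carrier G. b x)" for a b
  by (simp add: group_algebra_def sum.distrib)
 show ?thesis
  unfolding left_module_def left_module_axioms_def
  using R ab by (simp add: mult one add) (auto simp: trivial_module_def algebra_simps mult one add)
qed

lemma coord_trivial:
 assumes c: "coord K rh ka em"
 shows "triv rh (ka (e 1))"
proof -
 note r = coordD(2)[OF c]
 note inv[simp] = inv_f_f[OF inj_e]
 have sm: "kd g d \<odot>\<^bsub>K\<^esub> e b = e (d * b)" if "g \<in> carrier G" for g and d b :: 'k
  using that finite_G by (simp add: trivial_module_def kd_def)
 have car: "carrier K = range e" by (simp add: trivial_module_def)
 have fixed: "rh g v = rh \<one> v" if g: "g \<in> carrier G" for g v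
 proof -
  obtain b where b: "em v = e b" using coordD(3)[OF c, of v] car by auto
  have "em (rh g v) = em (rh \<one> v)" using coord_eps(4)[OF c] g sm b by simp
  then have "ka (em (rh g v)) = ka (em (rh \<one> v))" by simp
  then show ?thesis unfolding coordD(5)[OF c] rep1(2)[OF r g] rep1(2)[OF r one_closed] .
 qed
 have "\<exists>d. rh \<one> v = pscale d (ka (e 1))" for v
 proof -
  obtain b where b: "em v = e b" using coordD(3)[OF c, of v] car by auto
  have "rh \<one> v = ka (kd \<one> b \<odot>\<^bsub>K\<^esub> e 1)" using sm[OF one_closed, of b 1] b coordD(5)[OF c, of v] by (metis mult.right_neutral)
  also have "\<dots> = pscale b (ka (e 1))" using coord_kd[OF c one_closed, of "e 1" b] car coordD(8)[OF c, of "e 1"] by simp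
  finally show ?thesis by blast
 qed
 moreover have "ka (e 1) \<noteq> 0"
 proof
  assume "ka (e 1) = 0"
  then have "ka (e 1) = ka (e 0)" using coord_zero(1)[OF c] by (simp add: trivial_module_def)
  then have "e 1 = e 0" using coordD(9)[OF c, of "e 1" "e 0"] car by simp
  then show False using inj_e by (simp add: inj_eq)
 qed
 moreover have "rh \<one> (ka (e 1)) = ka (e 1)" using coordD(8)[OF c] car by simp
 ultimately show ?thesis unfolding triv_def using r fixed by blast
qed

subsection \<open>Subrepresentations and quotients\<close>

lemma sub_rep:
 assumes r: "rep rh" and U: "subspace U" "U \<subseteq> range (rh \<one>)" "\<And>g v. g \<in> carrier G ==> v \<in> U ==> rh g v \<in> U"
 shows "\<exists>\<pi>. lin \<pi> \<and> range \<pi> \<subseteq> U \<and> (\<forall>v\<in>U. \<pi> v = v) \<and> rep (%g v. rh g (\<pi> v)) \<and>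
  (\<forall>v. rh \<one> (\<pi> v) = \<pi> v) \<and> equiv (%g v. rh g (\<pi> v)) rh \<pi>"
proof -
 obtain \<pi> where \<pi>: "lin \<pi>" "range \<pi> \<subseteq> U" "\<And>v. v \<in> U ==> \<pi> v = v" using retraction[OF U(1)] by auto
 have pU: "\<pi> v \<in> U" for v using \<pi>(2) by auto
 have one: "rh \<one> (\<pi> v) = \<pi> v" for v
 proof -
  obtain w where "\<pi> v = rh \<one> w" using pU[of v] U(2) by auto
  then show ?thesis by (simp add: rep1[OF r])
 qed
 have st: "\<pi> (rh g (\<pi> v)) = rh g (\<pi> v)" if "g \<in> carrier G" for g v using \<pi>(3) U(3) that pU by blast
 have "rep (%g v. rh g (\<pi> v))"
  unfolding rep_def using lin_comp[OF repD(1)[OF r] \<pi>(1)] by (auto simp: st repD(2)[OF r])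
 moreover have "equiv (%g v. rh g (\<pi> v)) rh \<pi>" using \<pi>(1) st by (auto simp: equiv_def)
 ultimately show ?thesis using \<pi> one by (intro exI[of _ \<pi>]) auto
qed

lemma quotient_rep:
 assumes r: "rep rh" and L: "subspace L" "\<And>g v. g \<in> carrier G ==> v \<in> L ==> rh g v \<in> L"
 shows "\<exists>\<pi>. lin \<pi> \<and> (\<forall>v. \<pi> (\<pi> v) = \<pi> v) \<and> (\<forall>v. \<pi> v = 0 \<longleftrightarrow> v \<in> L) \<and> rep (%g v. \<pi> (rh g v)) \<and>
  (\<forall>g\<in>carrier G. \<forall>v. \<pi> (rh g (\<pi> v)) = \<pi> (rh g v))"
proof -
 obtain \<pi> where \<pi>: "lin \<pi>" "\<And>v. \<pi> (\<pi> v) = \<pi> v" "\<And>v. \<pi> v = 0 \<longleftrightarrow> v \<in> L" using projection_along[OF L(1)] by auto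
 have st: "\<pi> (rh g (\<pi> v)) = \<pi> (rh g v)" if g: "g \<in> carrier G" for g v
 proof -
  have "\<pi> v - v \<in> L" using \<pi>(2)[of v] by (simp add: lin_diff[OF \<pi>(1)] flip: \<pi>(3))
  then have "\<pi> (rh g (\<pi> v - v)) = 0" using L(2)[OF g] \<pi>(3) by blast
  then show ?thesis by (simp add: lin_diff[OF \<pi>(1)] lin_diff[OF repD(1)[OF r g]])
 qed
 have "rep (%g v. \<pi> (rh g v))"
  unfolding rep_def using lin_comp[OF \<pi>(1) repD(1)[OF r]] by (auto simp: st repD(2)[OF r])
 then show ?thesis using \<pi> st by (intro exI[of _ \<pi>]) auto
qed

subsection \<open>Thick subcategories\<close>

lemma coord_minus: assumes c: "coord M rh ka em" and x: "x \<in> carrier M" "y \<in> carrier M"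
 shows "x \<ominus>\<^bsub>M\<^esub> y \<in> carrier M" "ka (x \<ominus>\<^bsub>M\<^esub> y) = ka x - ka y"
proof -
 interpret left_module KG M using c by (rule coordD)
 show m: "x \<ominus>\<^bsub>M\<^esub> y \<in> carrier M" using x by simp
 have "(x \<ominus>\<^bsub>M\<^esub> y) \<oplus>\<^bsub>M\<^esub> y = x" using x by (simp add: M.minus_eq M.a_assoc M.l_neg)
 then have "ka x = ka (x \<ominus>\<^bsub>M\<^esub> y) + ka y" using coordD(6)[OF c m x(2)] by simp
 then show "ka (x \<ominus>\<^bsub>M\<^esub> y) = ka x - ka y" by simp
qed

lemma stably_isomorphic_refl:
 fixes M :: "('g => 'k, 'u) module"
 assumes "left_module KG M" shows "stably_isomorphic KG M M"
proof -
 obtain rh ka em where c: "coord M rh ka em" using coord_exists[OF assms] by blast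
 have "stably_equal KG M M (id \<circ> id) id"
  unfolding stably_equal_def
 proof (rule stably_zeroI[OF c c _ _ lin_zero])
  fix x assume x: "x \<in> carrier M"
  show "(id \<circ> id) x \<ominus>\<^bsub>M\<^esub> id x \<in> carrier M" using coord_minus(1)[OF c x x] by simp
  show "ka ((id \<circ> id) x \<ominus>\<^bsub>M\<^esub> id x) = Tr rh rh (%x. 0) (ka x)"
   using coord_minus(2)[OF c x x] by (simp add: Tr_def lin_0[OF repD(1)[OF coordD(2)[OF c]]])
 qed
 moreover have "id \<in> left_module_hom KG M M" by (auto simp: left_module_hom_def)
 ultimately show ?thesis unfolding stably_isomorphic_def using assms by blast
qed

context
 fixes S :: "('g => 'k, 'u) module set" assumes S: "thick_subcategory KG S" and KS: "K \<in> S"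
begin

lemma thick_closed:
 shows "\<forall>N\<in>S. \<forall>M. stable_retract KG M N --> M \<in> S"
  and "\<forall>M\<in>S. \<forall>N. is_Omega KG M N \<or> is_Omega KG N M --> N \<in> S"
  and "\<forall>A\<in>S. \<forall>B\<in>S. \<forall>C. exact_triangle KG A B C --> C \<in> S"
proof -
 note S' = S[unfolded thick_subcategory_def triangulated_subcategory_def]
 show "\<forall>N\<in>S. \<forall>M. stable_retract KG M N --> M \<in> S" using S' by (elim conjE)
 show "\<forall>M\<in>S. \<forall>N. is_Omega KG M N \<or> is_Omega KG N M --> N \<in> S" using S' by (elim conjE)
 show "\<forall>A\<in>S. \<forall>B\<in>S. \<forall>C. exact_triangle KG A B C --> C \<in> S" using S' by (elim conjE)
qed

lemma thick_projective:
 assumes P: "coord P rh ka em" "proj rh" shows "P \<in> S"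
proof -
 obtain rhK kaK emK where K: "coord K rhK kaK emK" using coord_exists[OF left_module_trivial] by blast
 have z: "equiv rh rh' (%x. 0)" if "rep rh'" for rh rh' using that by (auto simp: equiv_def lin_0[OF repD(1)])
 obtain \<phi> where \<phi>: "lin \<phi>" "\<And>v. Tr rh rh \<phi> v = rh \<one> v" using P(2) by (auto simp: proj_def szero_def)
 let ?i = "%x. emK 0" and ?r = "%x. em 0"
 have i: "?i \<in> left_module_hom KG P K" using hom_unhat(1)[OF P(1) K z[OF coordD(2)[OF K]]] .
 have r: "?r \<in> left_module_hom KG K P" using hom_unhat(1)[OF K P(1) z[OF coordD(2)[OF P(1)]]] .
 have "stably_equal KG P P (?r \<circ> ?i) id"
  unfolding stably_equal_def
 proof (rule stably_zeroI[OF P(1) P(1) _ _ lin_uminus[OF \<phi>(1)]])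
  fix x assume x: "x \<in> carrier P"
  have e0: "em 0 \<in> carrier P" by (rule coordD(3)[OF P(1)])
  show "(?r \<circ> ?i) x \<ominus>\<^bsub>P\<^esub> id x \<in> carrier P" using coord_minus(1)[OF P(1) e0 x] by simp
  have "Tr rh rh (%v. - \<phi> v) (ka x) = - Tr rh rh \<phi> (ka x)"
   by (simp add: Tr_def lin_minus[OF repD(1)[OF coordD(2)[OF P(1)]]] sum_negf)
  then show "ka ((?r \<circ> ?i) x \<ominus>\<^bsub>P\<^esub> id x) = Tr rh rh (%v. - \<phi> v) (ka x)"
   using coord_minus(2)[OF P(1) e0 x] coord_zero[OF P(1)] by (simp add: \<phi> coordD(8)[OF P(1) x])
 qed
 then have "stable_retract KG P K"
  unfolding stable_retract_def using i r coordD(1)[OF P(1)] left_module_trivial by blast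
 then show ?thesis using thick_closed(1)[rule_format, OF KS] by blast
qed

lemma thick_cokernel:
 assumes "coord A rhA kaA emA" "coord B rhB kaB emB" "coord C rhC kaC emC" "exact rhA rhB rhC I Q" "A \<in> S" "B \<in> S"
 shows "C \<in> S"
proof -
 have "short_exact KG A B C" using short_exact_iff[OF assms(1-3)] assms(4) by blast
 then have "exact_triangle KG A B C"
  unfolding exact_triangle_def
  by (intro exI[of _ A] exI[of _ B] exI[of _ C] conjI stably_isomorphic_refl coordD(1)[OF assms(1)] coordD(1)[OF assms(2)] coordD(1)[OF assms(3)])
 then show ?thesis using thick_closed(3)[rule_format, OF assms(5,6)] by blast
qed

lemma thick_Omega:
 assumes "coord M rhM kaM emM" "coord W rhW kaW emW" "proj rhP" "exact rhW rhP rhM I Q" "M \<in> S"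
 shows "W \<in> S"
proof -
 have "is_Omega KG M W" using is_Omega_iff[OF assms(1,2)] assms(3,4) by blast
 then show ?thesis using thick_closed(2)[rule_format, OF assms(5) disjI1] by blast
qed

lemma thick_quotient:
 assumes r: "rep rh" and Q: "coord Q rhQ kaQ emQ" "Q \<in> S" and \<pi>: "lin \<pi>" "\<And>v. \<pi> v = 0 \<longleftrightarrow> v \<in> L"
  and rhQ: "\<And>g v. g \<in> carrier G ==> rhQ g v = \<pi> (rh g v)" "\<And>g v. g \<in> carrier G ==> \<pi> (rh g (\<pi> v)) = \<pi> (rh g v)"
  and L: "subspace L" and v: "v \<notin> L" "rh \<one> v = v" "\<And>g. g \<in> carrier G ==> rh g v - v \<in> L"
  and L': "L' = {l + pscale c v | l c. l \<in> L}"
  and \<pi>': "lin \<pi>'" "\<And>v. \<pi>' v = 0 \<longleftrightarrow> v \<in> L'" "\<And>g v. g \<in> carrier G ==> \<pi>' (rh g (\<pi>' v)) = \<pi>' (rh g v)"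
  and C: "coord C (%g v. \<pi>' (rh g v)) kaC emC"
  and idem: "\<And>v. \<pi> (\<pi> v) = \<pi> v"
 shows "C \<in> S"
proof -
 obtain rhK kaK emK where K: "coord K rhK kaK emK" using coord_exists[OF left_module_trivial] by blast
 obtain k0 where t: "triv rhK k0" using coord_trivial[OF K] by blast
 then have rK: "rep rhK" and k0: "k0 \<noteq> 0" "rhK \<one> k0 = k0" and fixed: "\<And>g v. g \<in> carrier G ==> rhK g v = rhK \<one> v"
  and rank: "\<And>v. \<exists>c. rhK \<one> v = pscale c k0" unfolding triv_def by blast+
 obtain u0 where u0: "lookup k0 u0 \<noteq> 0" using k0(1) by (metis poly_mapping_eqI lookup_zero)
 define f where "f x = pscale (lookup (rhK \<one> x) u0 / lookup k0 u0) (\<pi> v)" for x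
 have fk: "f x = pscale c (\<pi> v)" if "rhK \<one> x = pscale c k0" for x c using that u0 by (simp add: f_def)
 have lf: "lin f"
  by (rule linI) (simp_all add: f_def lin_add[OF repD(1)[OF rK one_closed]] lin_scale[OF repD(1)[OF rK one_closed]]
   lookup_add add_divide_distrib scale_left_distrib)
 have LL: "L \<subseteq> L'"
 proof
  fix x assume "x \<in> L"
  then show "x \<in> L'" unfolding L' by (intro CollectI exI[of _ x] exI[of _ 0]) simp
 qed
 have \<pi>v: "\<pi> v \<noteq> 0" using v(1) \<pi>(2) by simp
 have \<pi>g: "\<pi> (rh g v) = \<pi> v" if "g \<in> carrier G" for g
  using v(3)[OF that] \<pi>(2)[of "rh g v - v"] by (simp add: lin_diff[OF \<pi>(1)])
 have l: "lin (rh g)" if "g \<in> carrier G" for g using repD(1)[OF r that] .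
 have "exact rhK rhQ (%g v. \<pi>' (rh g v)) f \<pi>'"
  unfolding exact_def
 proof (intro conjI allI impI)
  show "equiv rhK rhQ f"
   unfolding equiv_def
  proof (intro conjI ballI allI lf)
   fix g x assume g: "g \<in> carrier G"
   obtain c where c: "rhK \<one> x = pscale c k0" using rank by blast
   have "f (rhK g x) = f x" using g by (simp add: f_def rep1[OF rK] fixed[OF g])
   also have "\<dots> = pscale c (\<pi> v)" by (rule fk[OF c])
   also have "\<dots> = rhQ g (f x)"
    using g by (simp add: fk[OF c] rhQ lin_scale[OF l] lin_scale[OF \<pi>(1)] \<pi>g)
   finally show "f (rhK g x) = rhQ g (f x)" .
  qed
  show "equiv rhQ (%g v. \<pi>' (rh g v)) \<pi>'"
   unfolding equiv_def
  proof (intro conjI ballI allI \<pi>'(1))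
   fix g w assume g: "g \<in> carrier G"
   have "\<pi> (rh g w) - rh g w \<in> L" using idem[of "rh g w"] by (simp add: lin_diff[OF \<pi>(1)] flip: \<pi>(2))
   then have "\<pi>' (\<pi> (rh g w) - rh g w) = 0" using LL \<pi>'(2) by blast
   then show "\<pi>' (rhQ g w) = \<pi>' (rh g (\<pi>' w))" using g by (simp add: rhQ \<pi>'(3) lin_diff[OF \<pi>'(1)])
  qed
  note eq = this
  fix x assume "f (rhK \<one> x) = 0"
  moreover obtain c where c: "rhK \<one> x = pscale c k0" using rank by blast
  moreover have "f (rhK \<one> x) = pscale c (\<pi> v)"
   using rep1(2)[OF rK one_closed, of x] unfolding c by (rule fk)
  ultimately have "pscale c (\<pi> v) = 0" by simp
  then show "rhK \<one> x = 0" using \<pi>v c by simp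
 next
  fix w
  have sub: "\<pi> w - w \<in> L'" for w using idem[of w] LL by (auto simp: lin_diff[OF \<pi>(1)] subset_iff simp flip: \<pi>(2))
  have \<pi>\<pi>: "\<pi>' (\<pi> w) = \<pi>' w" for w using sub[of w] by (simp add: lin_diff[OF \<pi>'(1)] flip: \<pi>'(2))
  show "\<exists>x. \<pi>' (rhQ \<one> x) = \<pi>' (rh \<one> w)" by (rule exI[of _ w]) (simp add: rhQ \<pi>\<pi>)
  have "\<pi>' (rhQ \<one> w) = 0 \<longleftrightarrow> rh \<one> w \<in> L'" by (simp add: rhQ \<pi>\<pi> \<pi>'(2))
  also have "\<dots> \<longleftrightarrow> (\<exists>c. rh \<one> w - pscale c v \<in> L)"
  proof
   assume "rh \<one> w \<in> L'"
   then obtain l c where "l \<in> L" "rh \<one> w = l + pscale c v" unfolding L' by blast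
   then show "\<exists>c. rh \<one> w - pscale c v \<in> L" by (intro exI[of _ c]) simp
  next
   assume "\<exists>c. rh \<one> w - pscale c v \<in> L"
   then obtain c where "rh \<one> w - pscale c v \<in> L" by blast
   then show "rh \<one> w \<in> L'" unfolding L' by (intro CollectI exI[of _ "rh \<one> w - pscale c v"] exI[of _ c]) auto
  qed
  also have "\<dots> \<longleftrightarrow> (\<exists>c. \<pi> (rh \<one> w) = pscale c (\<pi> v))"
   by (simp add: lin_diff[OF \<pi>(1)] lin_scale[OF \<pi>(1)] flip: \<pi>(2))
  also have "\<dots> \<longleftrightarrow> (\<exists>x. f (rhK \<one> x) = rhQ \<one> w)"
  proof
   assume "\<exists>c. \<pi> (rh \<one> w) = pscale c (\<pi> v)"
   then obtain c where c: "\<pi> (rh \<one> w) = pscale c (\<pi> v)" by blast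
   have "f (rhK \<one> (pscale c k0)) = pscale c (\<pi> v)"
    by (rule fk) (simp add: k0 lin_scale[OF repD(1)[OF rK one_closed]])
   then show "\<exists>x. f (rhK \<one> x) = rhQ \<one> w" using c by (auto simp: rhQ)
  next
   assume "\<exists>x. f (rhK \<one> x) = rhQ \<one> w"
   then obtain x where x: "f (rhK \<one> x) = rhQ \<one> w" by blast
   obtain c where c: "rhK \<one> x = pscale c k0" using rank by blast
   have "f (rhK \<one> x) = pscale c (\<pi> v)" using rep1(2)[OF rK one_closed, of x] unfolding c by (rule fk)
   then show "\<exists>c. \<pi> (rh \<one> w) = pscale c (\<pi> v)" using x by (auto simp: rhQ)
  qed
  finally show "\<pi>' (rhQ \<one> w) = 0 \<longleftrightarrow> (\<exists>x. f (rhK \<one> x) = rhQ \<one> w)" .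
 qed
 then show ?thesis using thick_cokernel[OF K Q(1) C _ KS Q(2)] by blast
qed

end

end

locale p_modules = group_modules G e + p_group G p r
 for G :: "('g, 'm) monoid_scheme" (structure) and e :: "'k::field => 'u" and p r +
 assumes char_k: "CHAR('k) = p"
begin

lemma pow_minus_one:
 assumes Y: "lin Y"
 shows "((%v. Y v - v) ^^ (p ^ a - 1)) v = (\<Sum>l<p ^ a. (Y ^^ l) v)"
proof -
 let ?n = "p ^ a - 1"
 have p0: "0 < p ^ a" using prime_p prime_gt_0_nat by simp
 have it: "(commutator Y (%v. v) ^^ n) (%v. v) = ((%v. Y v - v) ^^ n)" for n
  by (induction n) (auto simp: commutator_def fun_eq_iff)
 have "((%v. Y v - v) ^^ ?n) v =
   (\<Sum>b\<le>?n. pscale ((- 1) ^ b * of_nat (?n choose b)) ((Y ^^ (?n - b)) (((%v. v) ^^ b) v)))"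
  using commutator_power[OF Y lin_id(2) lin_id(2), of ?n v] by (simp add: it)
 also have "\<dots> = (\<Sum>b\<le>?n. (Y ^^ (?n - b)) v)"
 proof (intro sum.cong refl)
  fix b assume "b \<in> {..?n}"
  then have "b < p ^ a" using p0 unfolding atMost_iff by linarith
  then have "of_nat (?n choose b) = ((- 1) ^ b :: 'k)"
   by (rule prime_power_choose_alternating[OF prime_p char_k])
  moreover have "((%v. v) ^^ b) v = v" by (induction b) auto
  moreover have "(- 1) ^ b * (- 1) ^ b = (1 :: 'k)"
   unfolding power_mult_distrib[symmetric] by simp
  ultimately show "pscale ((- 1) ^ b * of_nat (?n choose b)) ((Y ^^ (?n - b)) (((%v. v) ^^ b) v)) = (Y ^^ (?n - b)) v"
   by (simp only: scale_one)
 qed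
 also have "\<dots> = (\<Sum>b\<le>?n. (Y ^^ b) v)"
  by (rule sum.reindex_bij_witness[where i = "%b. ?n - b" and j = "%b. ?n - b"]) auto
 also have "{..?n} = {..<Suc ?n}" by (rule lessThan_Suc_atMost[symmetric])
 also have "Suc ?n = p ^ a" using p0 by simp
 finally show ?thesis .
qed

lemma pow_minus_one_zero:
 assumes Y: "lin Y" and "(Y ^^ (p ^ a)) v = v"
 shows "((%v. Y v - v) ^^ (p ^ a)) v = 0"
proof -
 have p0: "p ^ a = Suc (p ^ a - 1)" using prime_p prime_gt_0_nat by simp
 have "((%v. Y v - v) ^^ (p ^ a)) v = Y (\<Sum>l<p ^ a. (Y ^^ l) v) - (\<Sum>l<p ^ a. (Y ^^ l) v)"
  unfolding pow_minus_one[OF Y, symmetric] by (subst p0) (simp only: funpow.simps o_apply)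
 also have "\<dots> = (\<Sum>l<p ^ a. (Y ^^ Suc l) v - (Y ^^ l) v)" by (simp add: lin_sum[OF Y] sum_subtractf)
 also have "\<dots> = 0" using assms(2) by (subst sum_lessThan_telescope) simp
 finally show ?thesis .
qed

lemma rep_pow: assumes r: "rep rh" and g: "g \<in> carrier G" shows "(rh g ^^ n) (rh \<one> v) = rh (g [^] n) v"
proof (induction n)
 case (Suc n)
 then show ?case using g by (simp add: repD(2)[OF r] flip: nat_pow_Suc2)
qed simp

text \<open>
A group of order a power of \<open>p\<close> has nonzero fixed vectors in characteristic \<open>p\<close>. This gives the steps of a composition series whose factors are all trivial.
\<close>

lemma fixed_vector:
 assumes r: "rep rh" and L: "subspace L" "\<And>g v. g \<in> carrier G ==> v \<in> L ==> rh g v \<in> L"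
  and U: "subspace U" "\<And>g v. g \<in> carrier G ==> v \<in> U ==> rh g v \<in> U" "\<And>v. v \<in> U ==> rh \<one> v = v" "\<not> U \<subseteq> L"
 shows "\<exists>v\<in>U - L. \<forall>g\<in>carrier G. rh g v - v \<in> L"
proof -
 define St where "St v = {g \<in> carrier G. rh g v - v \<in> L}" for v
 have l: "lin (rh g)" if "g \<in> carrier G" for g using repD(1)[OF r that] .
 obtain v0 where v0: "v0 \<in> U - L" using U(4) by auto
 have bound: "\<forall>v. v \<in> U - L --> card (St v) < Suc (card (carrier G))"
  using finite_G by (auto simp: St_def less_Suc_eq_le intro!: card_mono)
 obtain v where v: "v \<in> U - L" and max: "\<And>w. w \<in> U - L ==> card (St w) \<le> card (St v)"
  using ex_has_greatest_nat[of "%v. v \<in> U - L", OF v0 bound] by blast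
 have Stc: "g \<otimes> h \<in> St w" if "g \<in> St w" "h \<in> St w" for g h w
 proof -
  have gh: "g \<in> carrier G" "h \<in> carrier G" "rh g w - w \<in> L" "rh h w - w \<in> L" using that by (auto simp: St_def)
  have "rh (g \<otimes> h) w - w = rh g (rh h w - w) + (rh g w - w)"
   using gh by (simp add: lin_diff[OF l] repD(2)[OF r])
  moreover have "rh g (rh h w - w) + (rh g w - w) \<in> L" using gh L by (intro subspace_add) auto
  ultimately have "rh (g \<otimes> h) w - w \<in> L" by metis
  then show ?thesis using gh by (simp add: St_def)
 qed
 have sub: "subgroup (St v) G"
 proof (rule subgroupI)
  have "\<one> \<in> St v" using U(3) v L(1) by (simp add: St_def subspace_0)
  then show "St v \<noteq> {}" by blast
  fix g assume g: "g \<in> St v"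
  then have gc: "g \<in> carrier G" "rh g v - v \<in> L" by (auto simp: St_def)
  have "rh (inv g) (rh g v - v) \<in> L" using gc L by simp
  moreover have "rh (inv g) (rh g v - v) = - (rh (inv g) v - v)"
   using gc v U(3) by (simp add: lin_diff[OF l] repD(2)[OF r])
  ultimately have "rh (inv g) v - v \<in> L" using L(1) subspace_neg by (metis minus_minus)
  then show "inv g \<in> St v" using gc by (simp add: St_def)
 qed (use Stc in \<open>auto simp: St_def\<close>)
 have "St v = carrier G"
 proof (rule ccontr)
  assume "St v \<noteq> carrier G"
  then obtain a where a: "a \<in> carrier G" "a \<notin> St v" "\<And>h. h \<in> St v ==> a \<otimes> h \<otimes> inv a \<in> St v"
   using normalizer_grows[OF sub] by auto
  have a': "inv a \<otimes> h \<otimes> a \<in> St v" if h: "h \<in> St v" for h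
  proof -
   have hc: "h \<in> carrier G" using h by (simp add: St_def)
   have "inj_on (%h. a \<otimes> h \<otimes> inv a) (St v)"
    using a(1) by (auto intro!: inj_onI simp: St_def)
   then have "(%h. a \<otimes> h \<otimes> inv a) ` St v = St v"
    using a(3) finite_G by (intro endo_inj_surj) (auto simp: St_def)
   then obtain h' where h': "h' \<in> St v" "h = a \<otimes> h' \<otimes> inv a" using h by blast
   have "h' \<in> carrier G" using h'(1) by (simp add: St_def)
   then have "inv a \<otimes> h \<otimes> a = h'" unfolding h'(2) using a(1) by (simp add: m_assoc) (simp flip: m_assoc)
   then show ?thesis using h'(1) by simp
  qed
  define w where "w j = ((%v. rh a v - v) ^^ j) v" for j
  have wU: "w j \<in> U" for j
   unfolding w_def by (induction j) (use v a(1) U in \<open>auto simp: subspace_diff\<close>)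
  have wSt: "St v \<subseteq> St (w j)" for j
  proof (induction j)
   case (Suc j)
   show ?case
   proof
    fix h assume h: "h \<in> St v"
    then have hc: "h \<in> carrier G" by (simp add: St_def)
    let ?h = "inv a \<otimes> h \<otimes> a"
    have "?h \<in> St (w j)" "h \<in> St (w j)" using a'[OF h] h Suc by auto
    then have hj: "rh ?h (w j) - w j \<in> L" "rh h (w j) - w j \<in> L" by (auto simp: St_def)
    have "a \<otimes> ?h = h \<otimes> a" using a(1) hc by (simp flip: m_assoc)
    then have "rh h (rh a (w j)) = rh a (rh ?h (w j))" using a(1) hc by (simp add: repD(2)[OF r])
    then have "rh h (w (Suc j)) - w (Suc j) = rh a (rh ?h (w j) - w j) - (rh h (w j) - w j)"
     using a(1) hc by (simp add: w_def lin_diff[OF l])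
    then have "rh h (w (Suc j)) - w (Suc j) \<in> L"
     using hj L a(1) by (simp add: subspace_diff)
    then show "h \<in> St (w (Suc j))" using hc by (simp add: St_def)
   qed
  qed (simp add: w_def)
  have "(rh a ^^ (p ^ r)) v = v"
   using rep_pow[OF \<open>rep rh\<close> a(1), of "p ^ r" v] U(3) v a(1) pow_pr by simp
  then have "w (p ^ r) = 0" unfolding w_def by (intro pow_minus_one_zero l a)
  then have ex: "w (p ^ r) \<in> L" using L(1) by (simp add: subspace_0)
  define j where "j = (LEAST j. w j \<in> L)"
  have j: "w j \<in> L" unfolding j_def using ex by (rule LeastI)
  have "j \<noteq> 0" using j v by (cases j) (auto simp: w_def)
  then obtain i where i: "j = Suc i" by (cases j) auto
  have wi: "w i \<in> U - L" using not_less_Least[of i "%j. w j \<in> L"] i j_def wU by auto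
  have "a \<in> St (w i)" using j i a(1) by (simp add: St_def w_def)
  then have "insert a (St v) \<subseteq> St (w i)" using wSt by auto
  then have "card (insert a (St v)) \<le> card (St (w i))"
   using finite_G by (intro card_mono) (auto simp: St_def)
  moreover have "finite (St v)" using finite_G by (simp add: St_def)
  ultimately show False using a(2) max[OF wi] by simp
 qed
 then show ?thesis using v by (intro bexI[of _ v]) (auto simp: St_def)
qed

text \<open>
Start with the projective module and divide by a fixed vector of the current quotient as long as \<open>U\<close> is not zero in it. Every step is the cokernel of a map
from \<open>k\<close>, so the quotients stay in the subcategory; the last one is the quotient by \<open>U\<close>, whose syzygy is \<open>U\<close>.
\<close>

lemma thick_submodule:
 assumes S: "thick_subcategory KG S" "K \<in> S" and pr: "proj rh"
  and U: "subspace U" "U \<subseteq> range (rh \<one>)" "\<And>g v. g \<in> carrier G ==> v \<in> U ==> rh g v \<in> U"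
  and fin: "finite B" "U \<subseteq> span B"
  and W: "coord W (%g v. rh g (\<pi>U v)) ka em" "lin \<pi>U" "range \<pi>U \<subseteq> U" "\<And>v. v \<in> U ==> \<pi>U v = v"
   "equiv (%g v. rh g (\<pi>U v)) rh \<pi>U"
 shows "W \<in> S"
proof -
 have r: "rep rh" using pr by (simp add: proj_def)
 have l: "lin (rh g)" if "g \<in> carrier G" for g using repD(1)[OF r that] .
 have one: "rh \<one> v = v" if "v \<in> U" for v using that U(2) rep1[OF r] by (auto simp: subset_iff image_iff)
 define good where "good L \<longleftrightarrow> subspace L \<and> L \<subseteq> U \<and> (\<forall>g\<in>carrier G. \<forall>v\<in>L. rh g v \<in> L) \<and>
  (\<exists>\<pi>. lin \<pi> \<and> (\<forall>v. \<pi> (\<pi> v) = \<pi> v) \<and> (\<forall>v. \<pi> v = 0 \<longleftrightarrow> v \<in> L) \<and> rep (%g v. \<pi> (rh g v)) \<and>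
   (\<forall>g\<in>carrier G. \<forall>v. \<pi> (rh g (\<pi> v)) = \<pi> (rh g v)) \<and>
   (\<exists>Q ka em. coord Q (%g v. \<pi> (rh g v)) ka em \<and> Q \<in> S))" for L
 have "good U" if "finite B" "good L" "U \<subseteq> span (L \<union> B)" for L B
  using that
 proof (induction "card B" arbitrary: L B rule: less_induct)
  case less
  from less.prems(2) obtain \<pi> Q kaQ emQ where L: "subspace L" "L \<subseteq> U" "\<And>g v. g \<in> carrier G ==> v \<in> L ==> rh g v \<in> L"
   and \<pi>: "lin \<pi>" "\<And>v. \<pi> (\<pi> v) = \<pi> v" "\<And>v. \<pi> v = 0 \<longleftrightarrow> v \<in> L"
    "\<And>g v. g \<in> carrier G ==> \<pi> (rh g (\<pi> v)) = \<pi> (rh g v)"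
   and Q: "coord Q (%g v. \<pi> (rh g v)) kaQ emQ" "Q \<in> S"
   unfolding good_def by blast
  show ?case
  proof (cases "U \<subseteq> L")
   case True
   then have "U = L" using L(2) by auto
   then show ?thesis using less.prems(2) by simp
  next
   case False
   obtain v where v: "v \<in> U" "v \<notin> L" "\<And>g. g \<in> carrier G ==> rh g v - v \<in> L"
    using fixed_vector[OF r L(1,3) U(1,3) one False] by auto
   define L' where "L' = {l + pscale c v | l c. l \<in> L}"
   have L'span: "L' = span (insert v L)"
   proof -
    have "x \<in> L' \<longleftrightarrow> (\<exists>c. x - pscale c v \<in> L)" for x
    proof
     assume "x \<in> L'"
     then obtain l c where "l \<in> L" "x = l + pscale c v" unfolding L'_def by blast
     then show "\<exists>c. x - pscale c v \<in> L" by (intro exI[of _ c]) simp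
    next
     assume "\<exists>c. x - pscale c v \<in> L"
     then obtain c where c: "x - pscale c v \<in> L" by blast
     have "x = (x - pscale c v) + pscale c v" by simp
     then show "x \<in> L'" unfolding L'_def using c by blast
    qed
    then show ?thesis unfolding span_insert span_eq_iff[THEN iffD2, OF L(1)] by blast
   qed
   have sL': "subspace L'" unfolding L'span by (rule subspace_span)
   have inv: "rh g w \<in> L'" if "g \<in> carrier G" "w \<in> L'" for g w
   proof -
    obtain m c where w: "w = m + pscale c v" "m \<in> L" using \<open>w \<in> L'\<close> unfolding L'_def by auto
    have "rh g w = (rh g m + pscale c (rh g v - v)) + pscale c v"
     using that(1) by (simp add: w lin_add[OF l] lin_scale[OF l] scale_right_diff_distrib)
    moreover have "rh g m + pscale c (rh g v - v) \<in> L"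
     using L v that(1) w by (intro subspace_add subspace_scale) auto
    ultimately show ?thesis unfolding L'_def by blast
   qed
   obtain \<pi>' where \<pi>': "lin \<pi>'" "\<And>v. \<pi>' (\<pi>' v) = \<pi>' v" "\<And>v. \<pi>' v = 0 \<longleftrightarrow> v \<in> L'" "rep (%g v. \<pi>' (rh g v))"
    "\<And>g v. g \<in> carrier G ==> \<pi>' (rh g (\<pi>' v)) = \<pi>' (rh g v)"
    using quotient_rep[OF r sL' inv] by blast
   note C = coord_realize[OF \<pi>'(4)]
   have "realize (%g v. \<pi>' (rh g v)) \<in> S"
    by (rule thick_quotient[OF S r Q \<pi>(1,3) _ \<pi>(4) L(1) v(2) one[OF v(1)] v(3) L'_def \<pi>'(1,3,5) C \<pi>(2)]) auto
   moreover have "L' \<subseteq> U" unfolding L'_def using L(2) v(1) U(1) by (auto intro!: subspace_add subspace_scale)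
   ultimately have gL': "good L'"
    unfolding good_def using sL' inv \<pi>' C by (intro conjI exI[of _ \<pi>'] ballI allI) blast+
   have "v \<in> span (L \<union> B)" using less.prems(3) v(1) by auto
   then have ex: "\<exists>n B0. B0 \<subseteq> B \<and> card B0 = n \<and> v \<in> span (L \<union> B0)" by blast
   define n where "n = (LEAST n. \<exists>B0. B0 \<subseteq> B \<and> card B0 = n \<and> v \<in> span (L \<union> B0))"
   obtain B0 where B0: "B0 \<subseteq> B" "card B0 = n" "v \<in> span (L \<union> B0)"
    using LeastI_ex[OF ex] unfolding n_def by blast
   have fB0: "finite B0" using B0(1) less.prems(1) finite_subset by blast
   have "B0 \<noteq> {}" using B0(3) v(2) L(1) by (auto simp: span_eq_iff[THEN iffD2])
   then obtain b where b: "b \<in> B0" by auto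
   have "v \<notin> span (L \<union> (B0 - {b}))"
   proof
    assume "v \<in> span (L \<union> (B0 - {b}))"
    then have "n \<le> card (B0 - {b})" unfolding n_def using B0(1) by (intro Least_le) blast
    then show False using b fB0 B0(2) by (metis card_Diff1_less leD)
   qed
   moreover have "insert b (L \<union> (B0 - {b})) = L \<union> B0" using b by auto
   ultimately have "b \<in> span (insert v (L \<union> (B0 - {b})))"
    using in_span_insert[of v b "L \<union> (B0 - {b})"] B0(3) by simp
   also have "\<dots> \<subseteq> span (L' \<union> (B - {b}))"
   proof (rule span_mono)
    have "L \<subseteq> L'" "v \<in> L'" unfolding L'span using span_superset[of "insert v L"] by auto
    then show "insert v (L \<union> (B0 - {b})) \<subseteq> L' \<union> (B - {b})" using B0(1) by auto
   qed
   finally have bs: "b \<in> span (L' \<union> (B - {b}))" .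
   have "L \<union> B \<subseteq> span (L' \<union> (B - {b}))"
   proof
    fix x assume "x \<in> L \<union> B"
    moreover have "L \<subseteq> L'" unfolding L'span using span_superset[of "insert v L"] by auto
    ultimately show "x \<in> span (L' \<union> (B - {b}))" using bs span_base by (cases "x = b") auto
   qed
   then have "U \<subseteq> span (L' \<union> (B - {b}))" using less.prems(3) span_minimal[OF _ subspace_span] by blast
   moreover have "card (B - {b}) < card B" using b B0(1) less.prems(1) by (meson card_Diff1_less subsetD)
   ultimately show ?thesis using less.hyps[of "B - {b}" L'] gL' less.prems(1) by simp
  qed
 qed
 moreover have "good {0}"
 proof -
  have "(%g v. id (rh g v)) = rh" by simp
  moreover note coord_realize[OF r] thick_projective[OF S coord_realize[OF r] pr]
  ultimately show ?thesis
   unfolding good_def using r U(1) l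
   by (intro conjI exI[of _ id]) (auto simp: subspace_0 lin_0 subspace_single_0)
 qed
 moreover have "U \<subseteq> span ({0} \<union> B)" using fin(2) span_mono[of B "{0} \<union> B"] by blast
 ultimately have "good U" using fin(1) by blast
 then obtain \<pi> Q kaQ emQ where \<pi>: "lin \<pi>" "\<And>v. \<pi> (\<pi> v) = \<pi> v" "\<And>v. \<pi> v = 0 \<longleftrightarrow> v \<in> U"
    "\<And>g v. g \<in> carrier G ==> \<pi> (rh g (\<pi> v)) = \<pi> (rh g v)"
   and Q: "coord Q (%g v. \<pi> (rh g v)) kaQ emQ" "Q \<in> S"
   unfolding good_def by blast
 have pU: "\<pi>U v \<in> U" for v using W(3) by auto
 have "exact (%g v. rh g (\<pi>U v)) rh (%g v. \<pi> (rh g v)) \<pi>U \<pi>"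
  unfolding exact_def
 proof (intro conjI allI impI W(5))
  show "equiv rh (%g v. \<pi> (rh g v)) \<pi>" using \<pi> by (auto simp: equiv_def)
  show "rh \<one> (\<pi>U v) = 0" if "\<pi>U (rh \<one> (\<pi>U v)) = 0" for v using that one[OF pU] W(4)[OF pU] lin_0[OF l[OF one_closed]] by simp
  show "\<exists>w. \<pi> (rh \<one> w) = \<pi> (rh \<one> v)" for v by blast
  show "\<pi> (rh \<one> w) = 0 \<longleftrightarrow> (\<exists>v. \<pi>U (rh \<one> (\<pi>U v)) = rh \<one> w)" for w
  proof
   assume "\<pi> (rh \<one> w) = 0"
   then have w: "rh \<one> w \<in> U" by (simp only: \<pi>(3))
   then show "\<exists>v. \<pi>U (rh \<one> (\<pi>U v)) = rh \<one> w"
    by (intro exI[of _ "rh \<one> w"]) (simp add: W(4) one)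
  next
   assume "\<exists>v. \<pi>U (rh \<one> (\<pi>U v)) = rh \<one> w"
   then show "\<pi> (rh \<one> w) = 0" using pU by (metis \<pi>(3))
  qed
 qed
 then show ?thesis using thick_Omega[OF S Q(1) W(1) pr _ Q(2)] by blast
qed

end

section \<open>Central subgroups act by traces on syzygies of the trivial module\<close>

context group_modules begin

definition TrZ where
 "TrZ Z rh rh' \<phi> v = (\<Sum>z\<in>Z. rh' z (\<phi> (rh (inv z) v)))"

text \<open>
All group elements act as the neutral element up to traces over \<open>Z\<close>. The property passes between a module and its syzygies in both directions, and it holds for \<open>k\<close>.
\<close>

definition Zst where
 "Zst Z rh \<longleftrightarrow> (\<forall>g\<in>carrier G. \<exists>\<psi>. lin \<psi> \<and> (\<forall>v. rh g v - rh \<one> v = TrZ Z rh rh \<psi> v))"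

lemma sum_subgroup_left:
 assumes Z: "subgroup Z G" and z: "z \<in> Z"
 shows "(\<Sum>w\<in>Z. f (z \<otimes> w)) = (\<Sum>w\<in>Z. f w)"
proof -
 have c: "w \<in> carrier G" if "w \<in> Z" for w using Z that by (rule subgroup.mem_carrier)
 have "inv z \<otimes> w \<in> Z" if "w \<in> Z" for w using Z z that by (simp add: subgroup.m_closed subgroup.m_inv_closed)
 moreover have "z \<otimes> w \<in> Z" if "w \<in> Z" for w using Z z that by (simp add: subgroup.m_closed)
 ultimately show ?thesis
  by (intro sum.reindex_bij_witness[where i = "%w. inv z \<otimes> w" and j = "%w. z \<otimes> w"])
   (use c z in \<open>auto simp: m_assoc[symmetric]\<close>)
qed

lemma TrZ_lin: assumes Z: "subgroup Z G" and "rep rh" "rep rh'" and \<phi>: "lin \<phi>" shows "lin (TrZ Z rh rh' \<phi>)"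
proof -
 have c: "w \<in> carrier G" if "w \<in> Z" for w using Z that by (rule subgroup.mem_carrier)
 have "lin (%v. \<Sum>g\<in>Z. rh' g (\<phi> (rh (inv g) v)))"
  by (rule lin_summ) (rule lin_comp[OF repD(1)[OF assms(3)] lin_comp[OF \<phi> repD(1)[OF assms(2)]]], auto simp: c)
 then show ?thesis by (simp only: TrZ_def[abs_def])
qed

lemma TrZ_comm:
 assumes Z: "subgroup Z G" and r: "rep rh" "rep rh'" and z: "z \<in> Z"
 shows "TrZ Z rh rh' \<phi> (rh z v) = rh' z (TrZ Z rh rh' \<phi> v)"
proof -
 have c: "w \<in> carrier G" if "w \<in> Z" for w using Z that by (rule subgroup.mem_carrier)
 have "TrZ Z rh rh' \<phi> (rh z v) = (\<Sum>g\<in>Z. rh' g (\<phi> (rh (inv g \<otimes> z) v)))"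
  using z by (simp add: TrZ_def repD(2)[OF r(1)] c)
 also have "\<dots> = (\<Sum>g\<in>Z. rh' (z \<otimes> g) (\<phi> (rh (inv (z \<otimes> g) \<otimes> z) v)))"
  by (rule sum_subgroup_left[OF Z z, symmetric])
 also have "\<dots> = (\<Sum>g\<in>Z. rh' z (rh' g (\<phi> (rh (inv g) v))))"
  using z by (intro sum.cong refl) (simp add: repD(2)[OF r(2)] inv_mult_group m_assoc c)
 also have "\<dots> = rh' z (TrZ Z rh rh' \<phi> v)" using z by (simp add: TrZ_def lin_sum[OF repD(1)[OF r(2)]] c)
 finally show ?thesis .
qed

lemma proj_restrict:
 assumes pr: "proj rh" and Z: "subgroup Z G"
 shows "\<exists>\<phi>. lin \<phi> \<and> (\<forall>v. rh \<one> v = TrZ Z rh rh \<phi> v)"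
proof -
 have r: "rep rh" using pr by (simp add: proj_def)
 note l = repD(1)[OF r] and m = repD(2)[OF r]
 have c: "w \<in> carrier G" if "w \<in> Z" for w using Z that by (rule subgroup.mem_carrier)
 obtain \<phi> where \<phi>: "lin \<phi>" "\<And>v. rh \<one> v = Tr rh rh \<phi> v" using pr by (auto simp: proj_def szero_def)
 define t where "t C = (SOME x. x \<in> C)" for C :: "'g set"
 have t: "t C \<in> carrier G \<and> C = Z #> t C" if C: "C \<in> rcosets Z" for C
 proof -
  obtain a where a: "a \<in> carrier G" "C = Z #> a" using C by (auto simp: RCOSETS_def)
  then have "a \<in> C" using rcos_self[OF a(1) Z] by simp
  then have "t C \<in> C" unfolding t_def by (rule someI)
  then show ?thesis using a repr_independence[OF _ a(1) Z] subgroup.rcosets_carrier[OF Z is_group C] by auto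
 qed
 define \<phi>' where "\<phi>' v = (\<Sum>C\<in>rcosets Z. rh (t C) (\<phi> (rh (inv (t C)) v)))" for v
 have "lin (%v. \<Sum>C\<in>rcosets Z. rh (t C) (\<phi> (rh (inv (t C)) v)))"
  by (rule lin_summ) (rule lin_comp[OF l lin_comp[OF \<phi>(1) l]], auto simp: t)
 then have "lin \<phi>'" by (simp only: \<phi>'_def[abs_def])
 moreover have "rh \<one> v = TrZ Z rh rh \<phi>' v" for v
 proof -
  define h where "h g = rh g (\<phi> (rh (inv g) v))" for g
  have "TrZ Z rh rh \<phi>' v = (\<Sum>z\<in>Z. \<Sum>C\<in>rcosets Z. h (z \<otimes> t C))"
   unfolding TrZ_def \<phi>'_def h_def using t c
   by (intro sum.cong refl) (simp add: lin_sum[OF l] m inv_mult_group)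
  also have "\<dots> = (\<Sum>C\<in>rcosets Z. \<Sum>z\<in>Z. h (z \<otimes> t C))" by (rule sum.swap)
  also have "\<dots> = (\<Sum>C\<in>rcosets Z. \<Sum>g\<in>C. h g)"
  proof (rule sum.cong[OF refl])
   fix C assume C: "C \<in> rcosets Z"
   have "inj_on (%z. z \<otimes> t C) Z" using t[OF C] c by (auto intro!: inj_onI)
   moreover have "(%z. z \<otimes> t C) ` Z = C" using t[OF C] by (auto simp: r_coset_def)
   ultimately show "(\<Sum>z\<in>Z. h (z \<otimes> t C)) = (\<Sum>g\<in>C. h g)" by (metis (no_types, lifting) sum.reindex_cong)
  qed
  also have "\<dots> = (\<Sum>g\<in>\<Union>(rcosets Z). h g)"
  proof -
   have "\<forall>A\<in>rcosets Z. finite A" using finite_G subgroup.rcosets_carrier[OF Z is_group] finite_subset by blast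
   moreover have "\<forall>A\<in>rcosets Z. \<forall>B\<in>rcosets Z. A \<noteq> B --> A \<inter> B = {}"
    using rcos_disjoint[OF Z] by (auto simp: pairwise_def disjnt_def)
   ultimately show ?thesis by (simp add: sum.Union_disjoint)
  qed
  also have "\<dots> = rh \<one> v" using rcosets_part_G[OF Z] by (simp add: \<phi>(2) Tr_def h_def)
  finally show ?thesis ..
 qed
 ultimately show ?thesis by blast
qed

context
 fixes Z assumes Z: "subgroup Z G" and central: "\<And>z g. z \<in> Z ==> g \<in> carrier G ==> g \<otimes> z = z \<otimes> g"
begin

lemma Zc: "w \<in> Z ==> w \<in> carrier G" using Z by (rule subgroup.mem_carrier)

lemma Zst_Omega:
 assumes pr: "proj rhP" and r: "rep rhA" "rep rhC" and ex: "exact rhA rhP rhC I Q" and st: "Zst Z rhC"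
 shows "Zst Z rhA"
 unfolding Zst_def
proof
 fix g assume g: "g \<in> carrier G"
 have rP: "rep rhP" using pr by (simp add: proj_def)
 note lP = repD(1)[OF rP] and mP = repD(2)[OF rP] and lA = repD(1)[OF r(1)] and lC = repD(1)[OF r(2)]
 have I: "equiv rhA rhP I" and Q: "equiv rhP rhC Q" and inj: "\<And>v. I (rhA \<one> v) = 0 ==> rhA \<one> v = 0"
  and onto: "\<And>v. \<exists>w. Q (rhP \<one> w) = rhC \<one> v"
  and ker: "\<And>w. Q (rhP \<one> w) = 0 \<longleftrightarrow> (\<exists>v. I (rhA \<one> v) = rhP \<one> w)"
  using ex unfolding exact_def by blast+
 note lI = equivD(1)[OF I] and lQ = equivD(1)[OF Q] and eI = equivD(2)[OF I] and eQ = equivD(2)[OF Q]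
 obtain \<psi> where \<psi>: "lin \<psi>" "\<And>v. rhC g v - rhC \<one> v = TrZ Z rhC rhC \<psi> v" using st g unfolding Zst_def by blast
 have "range (rhC \<one>) \<subseteq> Q ` range (rhP \<one>)" using onto by (metis image_subsetI rangeI image_eqI)
 from lift_through[OF lQ lC[OF one_closed] subspace_range[OF lP[OF one_closed]] this]
 obtain s where s: "lin s" "\<And>v. Q (s v) = rhC \<one> v" by blast
 define \<tau> where "\<tau> = TrZ Z rhP rhP (%w. s (\<psi> (Q w)))"
 have l\<tau>: "lin \<tau>" unfolding \<tau>_def by (rule TrZ_lin[OF Z rP rP lin_comp[OF s(1) lin_comp[OF \<psi>(1) lQ]]])
 define \<beta> where "\<beta> w = rhP g w - rhP \<one> w - \<tau> w" for w
 have l\<beta>: "lin \<beta>" unfolding \<beta>_def[abs_def] by (rule lin_sub[OF lin_sub[OF lP[OF g] lP[OF one_closed]] l\<tau>])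
 have Q\<beta>: "Q (\<beta> w) = 0" for w
 proof -
  have "Q (\<tau> w) = TrZ Z rhC rhC \<psi> (Q w)"
   unfolding \<tau>_def TrZ_def lin_sum[OF lQ] by (intro sum.cong refl) (simp add: eQ s(2) rep1[OF r(2)] Zc)
  then show ?thesis using g by (simp add: \<beta>_def lin_diff[OF lQ] eQ \<psi>(2)[symmetric])
 qed
 have \<beta>1: "rhP \<one> (\<beta> w) = \<beta> w" for w
  using g by (simp add: \<beta>_def lin_diff[OF lP] rep1[OF rP] \<tau>_def TrZ_def lin_sum[OF lP] Zc)
 have \<beta>2: "\<beta> (rhP \<one> w) = \<beta> w" for w
  using g TrZ_comm[OF Z rP rP subgroup.one_closed[OF Z], of _ w]
  by (simp add: \<beta>_def rep1[OF rP] \<tau>_def) (simp add: TrZ_def lin_sum[OF lP] rep1[OF rP] Zc)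
 have "range \<beta> \<subseteq> I ` range (rhA \<one>)"
 proof safe
  fix w
  have "\<exists>v. I (rhA \<one> v) = \<beta> w" using ker[of "\<beta> w"] Q\<beta> unfolding \<beta>1 by blast
  then show "\<beta> w \<in> I ` range (rhA \<one>)" by (metis image_eqI rangeI)
 qed
 from lift_through[OF lI l\<beta> subspace_range[OF lA[OF one_closed]] this]
 obtain b where b: "lin b" "range b \<subseteq> range (rhA \<one>)" "\<And>w. I (b w) = \<beta> w" by blast
 have injI: "u = u'" if "rhA \<one> u = u" "rhA \<one> u' = u'" "I u = I u'" for u u'
  using inj[of "u - u'"] that by (simp add: lin_diff[OF lA[OF one_closed]] lin_diff[OF lI])
 have b1: "rhA \<one> (b w) = b w" for w using b(2) rep1[OF r(1)] by (metis one_closed rangeE range_subsetD)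
 have bz: "b (rhP z w) = rhA z (b w)" if z: "z \<in> Z" for z w
 proof (rule injI)
  have "rhP g (rhP z w) = rhP z (rhP g w)" using z g Zc central[OF z g] by (simp add: mP)
  moreover have "rhP \<one> (rhP z w) = rhP z (rhP \<one> w)" using z Zc by (simp add: rep1[OF rP])
  ultimately have "\<beta> (rhP z w) = rhP z (\<beta> w)"
   unfolding \<beta>_def \<tau>_def TrZ_comm[OF Z rP rP z] using z Zc by (simp add: lin_diff[OF lP])
  then show "I (b (rhP z w)) = I (rhA z (b w))" using z Zc by (simp add: b(3) eI)
 qed (use b1 z Zc rep1[OF r(1)] in auto)
 have n: "rhP \<one> (I (rhA h v)) = I (rhA h v)" if "h \<in> carrier G" for h v
  using equiv_one[OF r(1) I, of "rhA h v"] by (simp only: rep1(2)[OF r(1) that])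
 have \<tau>I: "\<tau> (I v) = 0" for v
 proof -
  have "Q (I (rhA (inv z) v)) = 0" if "z \<in> Z" for z
  proof -
   have "Q (rhP \<one> (I (rhA \<one> (rhA (inv z) v)))) = 0" unfolding ker
    by (rule exI[of _ "rhA (inv z) v"]) (rule equiv_one[OF r(1) I, symmetric])
   then show ?thesis using that by (simp only: rep1(2)[OF r(1)] n inv_closed Zc)
  qed
  then show ?thesis unfolding \<tau>_def TrZ_def
   by (intro sum.neutral ballI) (simp add: Zc eI[symmetric] lin_0[OF \<psi>(1)] lin_0[OF s(1)] lin_0[OF lP])
 qed
 obtain \<phi> where \<phi>: "lin \<phi>" "\<And>v. rhP \<one> v = TrZ Z rhP rhP \<phi> v" using proj_restrict[OF pr Z] by blast
 have "rhA g v - rhA \<one> v = TrZ Z rhA rhA (%v. b (\<phi> (I v))) v" for v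
 proof -
  have "rhA g v - rhA \<one> v = b (I v)"
  proof (rule injI)
   show "rhA \<one> (rhA g v - rhA \<one> v) = rhA g v - rhA \<one> v" using g by (simp add: lin_diff[OF lA] rep1[OF r(1)])
   show "I (rhA g v - rhA \<one> v) = I (b (I v))" using g by (simp add: b(3) lin_diff[OF lI] eI \<beta>_def \<tau>I)
  qed (rule b1)
  also have "b (I v) = b (rhP \<one> (I v))"
   by (rule injI) (simp_all add: b1 b(3) \<beta>2)
  also have "\<dots> = TrZ Z rhA rhA (%v. b (\<phi> (I v))) v"
   unfolding \<phi>(2) TrZ_def lin_sum[OF b(1)] by (intro sum.cong refl) (simp add: bz Zc eI)
  finally show ?thesis .
 qed
 moreover have "lin (%v. b (\<phi> (I v)))" by (rule lin_comp[OF b(1) lin_comp[OF \<phi>(1) lI]])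
 ultimately show "\<exists>\<psi>. lin \<psi> \<and> (\<forall>v. rhA g v - rhA \<one> v = TrZ Z rhA rhA \<psi> v)" by blast
qed

lemma Zst_Sigma:
 assumes pr: "proj rhP" and r: "rep rhA" "rep rhC" and ex: "exact rhA rhP rhC I Q" and st: "Zst Z rhA"
 shows "Zst Z rhC"
 unfolding Zst_def
proof
 fix g assume g: "g \<in> carrier G"
 have rP: "rep rhP" using pr by (simp add: proj_def)
 note lP = repD(1)[OF rP] and mP = repD(2)[OF rP] and lA = repD(1)[OF r(1)] and lC = repD(1)[OF r(2)]
 have I: "equiv rhA rhP I" and Q: "equiv rhP rhC Q" and inj: "\<And>v. I (rhA \<one> v) = 0 ==> rhA \<one> v = 0"
  and onto: "\<And>v. \<exists>w. Q (rhP \<one> w) = rhC \<one> v"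
  and ker: "\<And>w. Q (rhP \<one> w) = 0 \<longleftrightarrow> (\<exists>v. I (rhA \<one> v) = rhP \<one> w)"
  using ex unfolding exact_def by blast+
 note lI = equivD(1)[OF I] and lQ = equivD(1)[OF Q] and eI = equivD(2)[OF I] and eQ = equivD(2)[OF Q]
 obtain \<psi> where \<psi>: "lin \<psi>" "\<And>v. rhA g v - rhA \<one> v = TrZ Z rhA rhA \<psi> v" using st g unfolding Zst_def by blast
 have "\<exists>L. lin L \<and> (\<forall>u\<in>range (rhA \<one>). L (I u) = (%x. x) u)"
  using inj by (intro factor_through lI lin_id subspace_range lA one_closed) auto
 then obtain L where L: "lin L" "\<And>v. L (I (rhA \<one> v)) = rhA \<one> v" by auto
 have LI: "L (I (rhA h v)) = rhA h v" if "h \<in> carrier G" for h v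
  using L(2)[of "rhA h v"] that by (simp add: rep1[OF r(1)])
 define \<tau> where "\<tau> = TrZ Z rhP rhP (%w. I (\<psi> (L w)))"
 have l\<tau>: "lin \<tau>" unfolding \<tau>_def by (rule TrZ_lin[OF Z rP rP lin_comp[OF lI lin_comp[OF \<psi>(1) L(1)]]])
 define \<beta> where "\<beta> w = rhP g w - rhP \<one> w - \<tau> w" for w
 have l\<beta>: "lin \<beta>" unfolding \<beta>_def[abs_def] by (rule lin_sub[OF lin_sub[OF lP[OF g] lP[OF one_closed]] l\<tau>])
 have \<beta>I: "\<beta> (I v) = 0" for v
 proof -
  have "\<tau> (I v) = I (TrZ Z rhA rhA \<psi> v)"
   unfolding \<tau>_def TrZ_def lin_sum[OF lI] by (intro sum.cong refl) (simp add: Zc eI[symmetric] LI)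
  then show ?thesis using g by (simp add: \<beta>_def \<psi>(2)[symmetric] lin_diff[OF lI] eI)
 qed
 have \<beta>1: "rhP \<one> (\<beta> w) = \<beta> w" for w
  using g by (simp add: \<beta>_def lin_diff[OF lP] rep1[OF rP] \<tau>_def TrZ_def lin_sum[OF lP] Zc)
 have "\<exists>b. lin b \<and> (\<forall>u\<in>range (rhP \<one>). b (Q u) = \<beta> u)"
 proof (intro factor_through lQ l\<beta> subspace_range lP one_closed)
  fix u assume "u \<in> range (rhP \<one>)" "Q u = 0"
  then obtain v where "u = I (rhA \<one> v)" using ker by (metis rangeE)
  then show "\<beta> u = 0" using \<beta>I by simp
 qed
 then obtain b where b: "lin b" "\<And>w. b (Q (rhP \<one> w)) = \<beta> (rhP \<one> w)" by auto
 have bz: "b (rhC z (rhC \<one> v)) = rhP z (b (rhC \<one> v))" if z: "z \<in> Z" for z v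
 proof -
  obtain w where w: "Q (rhP \<one> w) = rhC \<one> v" using onto by blast
  have "b (rhC z (rhC \<one> v)) = b (Q (rhP \<one> (rhP z w)))" using z Zc by (simp add: eQ w[symmetric] rep1[OF rP] rep1[OF r(2)])
  also have "\<dots> = \<beta> (rhP z (rhP \<one> w))" using b(2)[of "rhP z w"] z Zc by (simp add: rep1[OF rP])
  also have "\<dots> = rhP z (\<beta> (rhP \<one> w))"
  proof -
   have "rhP g (rhP z w') = rhP z (rhP g w')" for w' using z g Zc central[OF z g] by (simp add: mP)
   moreover have "rhP \<one> (rhP z w') = rhP z (rhP \<one> w')" for w' using z Zc by (simp add: rep1[OF rP])
   ultimately show ?thesis
    unfolding \<beta>_def \<tau>_def TrZ_comm[OF Z rP rP z] using z Zc by (simp add: lin_diff[OF lP])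
  qed
  finally show ?thesis by (simp add: b(2) flip: w)
 qed
 have n: "rhP \<one> (I (rhA h v)) = I (rhA h v)" if "h \<in> carrier G" for h v
  using equiv_one[OF r(1) I, of "rhA h v"] by (simp only: rep1(2)[OF r(1) that])
 have \<alpha>: "rhC g v - rhC \<one> v = Q (b (rhC \<one> v))" for v
 proof -
  obtain w where w: "Q (rhP \<one> w) = rhC \<one> v" using onto by blast
  have "Q (\<tau> u) = 0" for u
  proof -
   have "Q (rhP z (I v')) = 0" if z: "z \<in> Z" for z v'
   proof -
    have "Q (rhP \<one> (I (rhA \<one> (rhA z v')))) = 0" unfolding ker
     by (rule exI[of _ "rhA z v'"]) (rule equiv_one[OF r(1) I, symmetric])
    then have "Q (I (rhA z v')) = 0" using z by (simp only: rep1(2)[OF r(1)] n Zc)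
    then show ?thesis using z Zc by (simp add: eI)
   qed
   then show ?thesis unfolding \<tau>_def TrZ_def lin_sum[OF lQ] by (intro sum.neutral ballI) simp
  qed
  then have "Q (\<beta> (rhP \<one> w)) = rhC g (rhC \<one> v) - rhC \<one> (rhC \<one> v)"
   using g by (simp add: \<beta>_def lin_diff[OF lQ] eQ flip: w)
  moreover have "b (rhC \<one> v) = \<beta> (rhP \<one> w)" using b(2)[of w] unfolding w .
  ultimately show ?thesis using g by (simp add: rep1[OF r(2)])
 qed
 obtain \<phi> where \<phi>: "lin \<phi>" "\<And>v. rhP \<one> v = TrZ Z rhP rhP \<phi> v" using proj_restrict[OF pr Z] by blast
 have "rhC g v - rhC \<one> v = TrZ Z rhC rhC (%v. Q (\<phi> (b (rhC \<one> v)))) v" for v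
 proof -
  have "b (rhC \<one> v) = rhP \<one> (b (rhC \<one> v))"
  proof -
   obtain w where w: "Q (rhP \<one> w) = rhC \<one> v" using onto by blast
   show ?thesis by (simp add: b(2) \<beta>1 flip: w)
  qed
  then have "rhC g v - rhC \<one> v = Q (TrZ Z rhP rhP \<phi> (b (rhC \<one> v)))" unfolding \<alpha> by (simp flip: \<phi>(2))
  also have "\<dots> = TrZ Z rhC rhC (%v. Q (\<phi> (b (rhC \<one> v)))) v"
   unfolding TrZ_def lin_sum[OF lQ]
  proof (intro sum.cong refl)
   fix z assume z: "z \<in> Z"
   then have iz: "inv z \<in> Z" using Z by (simp add: subgroup.m_inv_closed)
   have "rhP (inv z) (b (rhC \<one> v)) = b (rhC \<one> (rhC (inv z) v))"
    using bz[OF iz, of v] z Zc by (simp add: rep1[OF r(2)])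
   then show "Q (rhP z (\<phi> (rhP (inv z) (b (rhC \<one> v))))) = rhC z (Q (\<phi> (b (rhC \<one> (rhC (inv z) v)))))"
    using z Zc by (simp add: eQ)
  qed
  finally show ?thesis .
 qed
 moreover have "lin (%v. Q (\<phi> (b (rhC \<one> v))))"
  by (rule lin_comp[OF lQ lin_comp[OF \<phi>(1) lin_comp[OF b(1) lC[OF one_closed]]]])
 ultimately show "\<exists>\<psi>. lin \<psi> \<and> (\<forall>v. rhC g v - rhC \<one> v = TrZ Z rhC rhC \<psi> v)" by blast
qed

lemma Zst_module:
 assumes "is_Omega KG M W" "coord M rhM kaM emM" "coord W rhW kaW emW"
 shows "Zst Z rhM \<longleftrightarrow> Zst Z rhW"
 using is_Omega_iff[OF assms(2,3)] assms(1) Zst_Omega Zst_Sigma coordD(2)[OF assms(2)] coordD(2)[OF assms(3)] by blast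

lemma Zst_trivial: "coord K rh ka em ==> Zst Z rh"
 unfolding Zst_def
proof
 fix g assume c: "coord K rh ka em" and g: "g \<in> carrier G"
 have "rh g v = rh \<one> v" for v using coord_trivial[OF c] g unfolding triv_def by blast
 then have "rh g v - rh \<one> v = TrZ Z rh rh (%v. 0) v" for v
  by (simp add: TrZ_def Zc lin_0[OF repD(1)[OF coordD(2)[OF c]]])
 then show "\<exists>\<psi>. lin \<psi> \<and> (\<forall>v. rh g v - rh \<one> v = TrZ Z rh rh \<psi> v)" using lin_zero by blast
qed

lemma is_Omega_left_module: "is_Omega R M W ==> left_module R M \<and> left_module R W"
 by (auto simp: is_Omega_def short_exact_def)

lemma Zst_Omega_power:
 assumes "is_Omega_power KG n K W" "coord W rh ka em"
 shows "Zst Z rh"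
proof -
 have 1: "\<forall>W rh ka em. (is_Omega KG ^^ m) K W --> coord W rh ka em --> Zst Z rh" for m
 proof (induction m)
  case 0
  then show ?case using Zst_trivial by auto
 next
  case (Suc m)
  show ?case
  proof (intro allI impI)
   fix W rh ka em assume W: "(is_Omega KG ^^ Suc m) K W" "coord W rh ka em"
   then obtain M where M: "(is_Omega KG ^^ m) K M" "is_Omega KG M W" by auto
   obtain rhM kaM emM where c: "coord M rhM kaM emM" using coord_exists is_Omega_left_module[OF M(2)] by meson
   show "Zst Z rh" using Zst_module[OF M(2) c W(2)] Suc M(1) c by blast
  qed
 qed
 have 2: "\<forall>W rh ka em. (is_Omega KG ^^ m) W K --> coord W rh ka em --> Zst Z rh" for m
 proof (induction m)
  case 0
  then show ?case using Zst_trivial by auto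
 next
  case (Suc m)
  show ?case
  proof (intro allI impI)
   fix W rh ka em assume W: "(is_Omega KG ^^ Suc m) W K" "coord W rh ka em"
   then obtain M where M: "is_Omega KG W M" "(is_Omega KG ^^ m) M K" by (meson relpowp_Suc_D2)
   obtain rhM kaM emM where c: "coord M rhM kaM emM" using coord_exists is_Omega_left_module[OF M(1)] by meson
   show "Zst Z rh" using Zst_module[OF M(1) W(2) c] Suc M(2) c by blast
  qed
 qed
 show ?thesis using assms 1 2 unfolding is_Omega_power_def by (metis (full_types))
qed

end

subsection \<open>The regular representation\<close>

definition u0 :: 'u where "u0 = undefined"
definition w0 :: "'u \<Rightarrow>\<^sub>0 'k" where "w0 = Poly_Mapping.single u0 1"
definition E0 :: "('u \<Rightarrow>\<^sub>0 'k) => ('u \<Rightarrow>\<^sub>0 'k)" where "E0 v = pscale (lookup v u0) w0"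
definition Reg where "Reg = Fr E0"
definition bs where "bs g = \<theta> g w0"
definition rr where "rr g v = (\<Sum>d\<in>carrier G. \<theta> (d \<otimes> g) (E0 (\<sigma> d v)))"

lemma E0: "lin E0" "E0 (E0 v) = E0 v" "E0 w0 = w0" "w0 \<noteq> 0"
proof -
 show "lin E0" by (rule linI) (simp_all add: E0_def lookup_add scale_left_distrib)
 have "lookup w0 u0 = 1" by (simp add: w0_def)
 then show "E0 w0 = w0" "E0 (E0 v) = E0 v" "w0 \<noteq> 0" by (auto simp: E0_def)
qed

lemma rep_Reg: "rep Reg" and proj_Reg: "proj Reg"
 unfolding Reg_def using rep_Fr[OF E0(1,2)] proj_Fr[OF E0(1,2)] by auto

lemma Reg_bs: "g \<in> carrier G ==> h \<in> carrier G ==> Reg g (bs h) = bs (g \<otimes> h)"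
 by (simp add: Reg_def bs_def Fr_\<theta>[OF E0(1)] E0(3))

lemma rr_lin: "lin (rr g)"
proof -
 have "lin (%v. \<Sum>d\<in>carrier G. \<theta> (d \<otimes> g) (E0 (\<sigma> d v)))"
  by (rule lin_summ, rule lin_comp[OF lin_\<theta> lin_comp[OF E0(1) lin_\<sigma>]])
 then show ?thesis by (simp only: rr_def[abs_def])
qed

lemma rr_bs: assumes g: "g \<in> carrier G" and h: "h \<in> carrier G" shows "rr g (bs h) = bs (h \<otimes> g)"
proof -
 have "rr g (bs h) = (\<Sum>d\<in>carrier G. if d = h then bs (h \<otimes> g) else 0)"
  unfolding rr_def bs_def using h by (intro sum.cong refl) (auto simp: \<sigma>\<theta> E0 lin_0[OF E0(1)] lin_0[OF lin_\<theta>])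
 then show ?thesis using finite_G h by simp
qed

lemma \<sigma>_rr: assumes g: "g \<in> carrier G" and h: "h \<in> carrier G"
 shows "\<sigma> h (rr g v) = E0 (\<sigma> (h \<otimes> inv g) v)"
proof -
 have "\<sigma> h (rr g v) = (\<Sum>d\<in>carrier G. if d = h \<otimes> inv g then E0 (\<sigma> (h \<otimes> inv g) v) else 0)"
  unfolding rr_def lin_sum[OF lin_\<sigma>]
  using g h by (intro sum.cong refl) (auto simp: \<sigma>\<theta> inv_solve_right m_assoc)
 then show ?thesis using finite_G g h by simp
qed

lemma \<sigma>_Reg: "g \<in> carrier G ==> h \<in> carrier G ==> \<sigma> h (Reg g v) = E0 (\<sigma> (inv g \<otimes> h) v)"
 unfolding Reg_def by (rule \<sigma>_Fr)

lemma rr_Reg: assumes g: "g \<in> carrier G" and h: "h \<in> carrier G"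
 shows "rr g (Reg h v) = Reg h (rr g v)"
proof -
 have "rr g (Reg h v) = (\<Sum>d\<in>carrier G. \<theta> (d \<otimes> g) (E0 (\<sigma> (inv h \<otimes> d) v)))"
  unfolding rr_def using h by (intro sum.cong refl) (simp add: \<sigma>_Reg E0)
 also have "\<dots> = (\<Sum>d\<in>carrier G. \<theta> ((h \<otimes> (d \<otimes> inv g)) \<otimes> g) (E0 (\<sigma> (inv h \<otimes> (h \<otimes> (d \<otimes> inv g))) v)))"
  using sum_group_right[OF inv_closed[OF g], of "%d. \<theta> ((h \<otimes> d) \<otimes> g) (E0 (\<sigma> (inv h \<otimes> (h \<otimes> d)) v))"]
   sum_group_left[OF h, of "%d. \<theta> (d \<otimes> g) (E0 (\<sigma> (inv h \<otimes> d) v))"] by simp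
 also have "\<dots> = (\<Sum>d\<in>carrier G. \<theta> (h \<otimes> d) (E0 (\<sigma> (d \<otimes> inv g) v)))"
  using g h by (intro sum.cong refl) (simp add: m_assoc m_assoc[symmetric, of "inv h"])
 also have "\<dots> = Reg h (rr g v)"
  unfolding Reg_def Fr_def using g h by (intro sum.cong refl) (simp add: \<sigma>_rr E0)
 finally show ?thesis .
qed

lemma Reg_one_rr: "g \<in> carrier G ==> Reg \<one> (rr g v) = rr g v"
proof -
 assume g: "g \<in> carrier G"
 have "Reg \<one> (rr g v) = (\<Sum>d\<in>carrier G. \<theta> d (E0 (\<sigma> (d \<otimes> inv g) v)))"
  unfolding Reg_def Fr_def using g by (intro sum.cong refl) (simp add: \<sigma>_rr E0)
 also have "\<dots> = (\<Sum>d\<in>carrier G. \<theta> (d \<otimes> g) (E0 (\<sigma> (d \<otimes> g \<otimes> inv g) v)))"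
  by (rule sum_group_right[OF g, symmetric])
 also have "\<dots> = rr g v" unfolding rr_def using g by (intro sum.cong refl) (simp add: m_assoc)
 finally show ?thesis .
qed

lemma rr_central: assumes "z \<in> carrier G" "\<And>g. g \<in> carrier G ==> g \<otimes> z = z \<otimes> g"
 shows "rr z v = Reg z v"
 unfolding rr_def Reg_def Fr_def using assms by (intro sum.cong refl) simp

text \<open>
The identity of the regular representation is the trace of the map that keeps the coefficient of the neutral element, and that map does not
distinguish right from left multiplication by \<open>g\<close>. Left multiplication comes from the action on the source, where it is the identity up to a trace over \<open>Z\<close>; the two traces combine.
\<close>

lemma right_multiplication_ghost:
 assumes Z: "subgroup Z G" and central: "\<And>z g. z \<in> Z ==> g \<in> carrier G ==> g \<otimes> z = z \<otimes> g"
  and W: "rep rhW" "Zst Z rhW" and g: "g \<in> carrier G" and H: "equiv rhW Reg H"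
 shows "\<exists>\<psi>. lin \<psi> \<and> (\<forall>w. rr g (H w) - Reg \<one> (H w) =
  Tr rhW Reg (%w. \<Sum>z\<in>Z. Reg (inv z) (\<theta> \<one> (\<sigma> \<one> (Reg z (H (\<psi> w)))))) w)"
proof -
 have Zc: "z \<in> carrier G" if "z \<in> Z" for z using Z that by (rule subgroup.mem_carrier)
 note m = repD(2)[OF rep_Reg] and mW = repD(2)[OF W(1)] and l = repD(1)[OF rep_Reg]
 note lH = equivD(1)[OF H] and eH = equivD(2)[OF H]
 obtain \<psi> where \<psi>: "lin \<psi>" "\<And>v. rhW g v - rhW \<one> v = TrZ Z rhW rhW \<psi> v" using W(2) g unfolding Zst_def by blast
 define em1 where "em1 v = \<theta> \<one> (\<sigma> \<one> v)" for v
 have lem: "lin em1" unfolding em1_def[abs_def] by (rule lin_comp[OF lin_\<theta> lin_\<sigma>])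
 have id: "Reg \<one> v = (\<Sum>\<gamma>\<in>carrier G. Reg \<gamma> (em1 (Reg (inv \<gamma>) v)))" for v
  unfolding Reg_def Fr_def[of E0 \<one>] em1_def
  by (intro sum.cong refl) (simp add: \<sigma>_Fr Fr_\<theta>[OF E0(1)] E0(2))
 have shift: "em1 (rr g v) = em1 (Reg g v)" for v using g by (simp add: em1_def \<sigma>_rr \<sigma>_Reg)
 have "rr g (H w) - Reg \<one> (H w) = Tr rhW Reg (%w. \<Sum>z\<in>Z. Reg (inv z) (em1 (Reg z (H (\<psi> w))))) w" for w
 proof -
  let ?v = "%\<gamma>. rhW (inv \<gamma>) w"
  define h where "h z \<gamma> = Reg \<gamma> (Reg (inv z) (em1 (Reg z (H (\<psi> (rhW (inv \<gamma>) w))))))" for z \<gamma>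
  have step: "Reg \<gamma> (em1 (Reg (inv \<gamma>) (rr g (H w) - Reg \<one> (H w)))) = (\<Sum>z\<in>Z. h z (\<gamma> \<otimes> z))" if \<gamma>: "\<gamma> \<in> carrier G" for \<gamma>
  proof -
   have "Reg (inv \<gamma>) (rr g (H w) - Reg \<one> (H w)) = rr g (H (?v \<gamma>)) - Reg \<one> (H (?v \<gamma>))"
    using \<gamma> g by (simp add: lin_diff[OF l] rr_Reg[symmetric] eH rep1[OF rep_Reg] rep1[OF W(1)] m mW)
   then have "em1 (Reg (inv \<gamma>) (rr g (H w) - Reg \<one> (H w))) = em1 (Reg g (H (?v \<gamma>)) - Reg \<one> (H (?v \<gamma>)))"
    by (simp add: lin_diff[OF lem] shift)
   also have "Reg g (H (?v \<gamma>)) - Reg \<one> (H (?v \<gamma>)) = H (TrZ Z rhW rhW \<psi> (?v \<gamma>))"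
    using g by (simp add: eH[symmetric] lin_diff[OF lH, symmetric] \<psi>(2))
   also have "\<dots> = (\<Sum>z\<in>Z. Reg z (H (\<psi> (rhW (inv (\<gamma> \<otimes> z)) w))))"
    unfolding TrZ_def lin_sum[OF lH] using \<gamma> by (intro sum.cong refl) (simp add: Zc eH mW inv_mult_group)
   finally have "Reg \<gamma> (em1 (Reg (inv \<gamma>) (rr g (H w) - Reg \<one> (H w)))) =
     (\<Sum>z\<in>Z. Reg \<gamma> (em1 (Reg z (H (\<psi> (rhW (inv (\<gamma> \<otimes> z)) w))))))"
    using \<gamma> by (simp add: lin_sum[OF lem] lin_sum[OF l])
   also have "\<dots> = (\<Sum>z\<in>Z. h z (\<gamma> \<otimes> z))"
    unfolding h_def using \<gamma> by (intro sum.cong refl) (simp add: m Zc m_assoc)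
   finally show ?thesis .
  qed
  have one: "Reg \<one> (rr g (H w) - Reg \<one> (H w)) = rr g (H w) - Reg \<one> (H w)"
   using g by (simp add: lin_diff[OF l] Reg_one_rr rep1[OF rep_Reg])
  note one[symmetric]
  also note id
  also have "(\<Sum>\<gamma>\<in>carrier G. Reg \<gamma> (em1 (Reg (inv \<gamma>) (rr g (H w) - Reg \<one> (H w))))) =
    (\<Sum>\<gamma>\<in>carrier G. \<Sum>z\<in>Z. h z (\<gamma> \<otimes> z))" by (intro sum.cong refl step)
  also have "\<dots> = (\<Sum>z\<in>Z. \<Sum>\<gamma>\<in>carrier G. h z (\<gamma> \<otimes> z))" by (rule sum.swap)
  also have "\<dots> = (\<Sum>z\<in>Z. \<Sum>\<gamma>\<in>carrier G. h z \<gamma>)" by (intro sum.cong refl sum_group_right Zc)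
  also have "\<dots> = (\<Sum>\<gamma>\<in>carrier G. \<Sum>z\<in>Z. h z \<gamma>)" by (rule sum.swap)
  also have "\<dots> = Tr rhW Reg (%w. \<Sum>z\<in>Z. Reg (inv z) (em1 (Reg z (H (\<psi> w))))) w"
   unfolding Tr_def h_def by (intro sum.cong refl) (simp add: lin_sum[OF l])
  finally show ?thesis .
 qed
 then show ?thesis using \<psi>(1) unfolding em1_def by blast
qed

end

section \<open>The lower bound\<close>

context p_modules begin

abbreviation D :: "'g => ('u \<Rightarrow>\<^sub>0 'k) => ('u \<Rightarrow>\<^sub>0 'k)" where "D g v \<equiv> rr g v - v"

lemma ghost_composite_hom: "ghost_composite R T n M N f ==> f \<in> left_module_hom R M N"
 by (induction rule: ghost_composite.induct) (auto simp: ghost_def left_module_hom_def Pi_iff)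

lemma rr_pow: "g \<in> carrier G ==> h \<in> carrier G ==> (rr g ^^ l) (bs h) = bs (h \<otimes> g [^] l)"
 by (induction l) (auto simp: rr_bs m_assoc)

lemma fold_replicate: "fold f (replicate n x) v = (f x ^^ n) v"
 by (induction n arbitrary: v) (auto simp: funpow_swap1)

lemma D_pow_sum:
 assumes H: "finite H" "H \<subseteq> carrier G" and a: "a \<in> carrier G"
 shows "(D a ^^ (p ^ i - 1)) (\<Sum>h\<in>H. bs h) = (\<Sum>l<p ^ i. \<Sum>h\<in>H. bs (h \<otimes> a [^] l))"
 unfolding pow_minus_one[OF rr_lin]
 by (intro sum.cong refl) (use assms in \<open>auto simp: lin_sum[OF lin_pow[OF rr_lin]] rr_pow subset_iff intro!: sum.cong\<close>)

text \<open>
The sum over a subgroup is multiplied by \<open>(a - 1)\<^sup>p\<^sup>-\<^sup>1 = 1 + a + \<dots> + a\<^sup>p\<^sup>-\<^sup>1\<close> to obtain the sum over a subgroup that is \<open>p\<close> times as large;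
normalizers grow, so such an \<open>a\<close> exists until the whole group is reached.
\<close>

lemma norm_as_product:
 assumes H: "subgroup H G" and card: "card H = q * p ^ j" and order: "order G = q * p ^ m"
  and gs: "set gs \<subseteq> carrier G" "length gs = s + j * (p - 1)" "fold D gs v = (\<Sum>h\<in>H. bs h)"
 shows "\<exists>gs. set gs \<subseteq> carrier G \<and> length gs = s + m * (p - 1) \<and> fold D gs v = (\<Sum>h\<in>carrier G. bs h)"
 using assms
proof (induction "card (carrier G) - card H" arbitrary: H j gs rule: less_induct)
 case less
 note H = less.prems(1)
 have q0: "0 < q" using order_G less.prems(3) prime_p by (intro Nat.gr0I) (auto simp: prime_gt_0_nat)
 have p1: "1 < p" using prime_p prime_gt_1_nat by simp
 have Hsub: "H \<subseteq> carrier G" using H by (rule subgroup.subset)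
 have finH: "finite H" using Hsub finite_G finite_subset by blast
 show ?case
 proof (cases "H = carrier G")
  case True
  then have "q * p ^ j = q * p ^ m" using less.prems(2,3) by (simp add: order_def)
  then have "j = m" using q0 p1 by simp
  then show ?thesis using less.prems True by blast
 next
  case False
  obtain a where a: "a \<in> carrier G" "a \<notin> H" "a [^] p \<in> H" "\<And>h. h \<in> H ==> a \<otimes> h \<otimes> inv a \<in> H"
   using normalizer_grows_p[OF H False] by auto
  define H' where "H' = (%(h, l). h \<otimes> a [^] l) ` (H \<times> {..<p})"
  note ext = extend_subgroup[OF H a, folded H'_def]
  have "card H' = card H * p" unfolding H'_def using card_image[OF ext(2)] by (simp add: card_cartesian_product)
  then have card': "card H' = q * p ^ Suc j" using less.prems(2) by simp
  have H'sub: "H' \<subseteq> carrier G" using ext(1) by (rule subgroup.subset)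
  have "fold D (gs @ replicate (p - 1) a) v = (\<Sum>h\<in>H'. bs h)"
  proof -
   have "fold D (gs @ replicate (p - 1) a) v = (D a ^^ (p ^ 1 - 1)) (\<Sum>h\<in>H. bs h)"
    by (simp add: fold_replicate less.prems(6))
   also have "\<dots> = (\<Sum>l<p. \<Sum>h\<in>H. bs (h \<otimes> a [^] l))"
    unfolding D_pow_sum[OF finH Hsub a(1)] by simp
   also have "\<dots> = (\<Sum>(h, l)\<in>H \<times> {..<p}. bs (h \<otimes> a [^] l))"
    by (subst sum.swap) (simp add: sum.cartesian_product)
   also have "\<dots> = (\<Sum>y\<in>H \<times> {..<p}. bs ((%(h, l). h \<otimes> a [^] l) y))"
    by (rule sum.cong[OF refl]) (simp add: case_prod_unfold)
   also have "\<dots> = (\<Sum>h\<in>H'. bs h)"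
   proof -
    have "inj_on (%(h, l). h \<otimes> a [^] l) (H \<times> {..<p})" by (rule ext(2))
    from sum.reindex[OF this, of bs] show ?thesis unfolding H'_def by (simp only: o_def)
   qed
   finally show ?thesis .
  qed
  moreover have "set (gs @ replicate (p - 1) a) \<subseteq> carrier G" using less.prems(4) a(1) by auto
  moreover have "length (gs @ replicate (p - 1) a) = s + Suc j * (p - 1)" using less.prems(5) by simp
  moreover have "card (carrier G) - card H' < card (carrier G) - card H"
  proof -
   have "card H < card H'" using ext(3) H'sub finite_G by (metis finite_subset psubset_card_mono)
   moreover have "card H' \<le> card (carrier G)" using H'sub finite_G by (simp add: card_mono)
   ultimately show ?thesis by linarith
  qed
  ultimately show ?thesis using less.hyps[OF _ ext(1) card' less.prems(3)] by blast
 qed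
qed

lemma norm_bs_nonzero: "(\<Sum>h\<in>carrier G. bs h) \<noteq> 0"
proof
 assume "(\<Sum>h\<in>carrier G. bs h) = 0"
 then have "\<sigma> \<one> (\<Sum>h\<in>carrier G. bs h) = 0" by (simp add: lin_0[OF lin_\<sigma>])
 moreover have "\<sigma> \<one> (\<Sum>h\<in>carrier G. bs h) = (\<Sum>h\<in>carrier G. if h = \<one> then w0 else 0)"
  unfolding lin_sum[OF lin_\<sigma>] bs_def by (intro sum.cong refl) (auto simp: \<sigma>\<theta>)
 ultimately show False using finite_G E0(4) by simp
qed

lemma Reg_one_span: "Reg \<one> v \<in> span (bs ` carrier G)"
proof -
 have "Reg \<one> v = (\<Sum>d\<in>carrier G. pscale (lookup (\<sigma> d v) u0) (bs d))"
  unfolding Reg_def Fr_def by (intro sum.cong refl) (simp add: E0_def bs_def lin_scale[OF lin_\<theta>])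
 also have "\<dots> \<in> span (bs ` carrier G)" by (intro span_sum span_scale span_base imageI)
 finally show ?thesis .
qed

text \<open>
The module \<open>U\<close> is the image of \<open>(z - 1)\<^sup>c\<close> on the regular representation. A composite that vanished stably would extend to the regular representation
and then factor through \<open>(z - 1)\<^sup>2\<^sup>c = 0\<close> on the generator \<open>v0\<close>.
\<close>

lemma ghost_number_lower_bound:
 assumes z: "z \<in> carrier G" "\<And>g. g \<in> carrier G ==> g \<otimes> z = z \<otimes> g"
  and zq: "z [^] q = \<one>" "inj_on (%l. z [^] l) {..<q}" "q = p ^ a" and order: "order G = q * p ^ m"
  and q: "odd q" "1 < q"
 shows "enat ((q - 1) div 2 + m * (p - 1)) \<le> ghost_number e G"
proof -
 define c where "c = Suc q div 2"
 have c: "q \<le> 2 * c" "0 < c" "c \<le> q - 1" "q - 1 - c + 1 = (q - 1) div 2" using q by (auto simp: c_def elim!: oddE)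
 define Z where "Z = (%l. z [^] l) ` {..<q}"
 have q0: "0 < q" using q by simp
 have zpow: "z [^] (n::nat) \<in> Z" for n
 proof -
  have "z [^] n = (z [^] q) [^] (n div q) \<otimes> z [^] (n mod q)" using z by (simp add: nat_pow_pow nat_pow_mult)
  then have "z [^] n = z [^] (n mod q)" using z zq(1) by simp
  then show ?thesis unfolding Z_def using q0 by (metis imageI lessThan_iff mod_less_divisor)
 qed
 have Zsub: "Z \<subseteq> carrier G" using z by (auto simp: Z_def)
 have Z: "subgroup Z G"
 proof (rule subgroupI)
  fix x y assume "x \<in> Z" "y \<in> Z"
  then obtain i j :: nat where "x = z [^] i" "y = z [^] j" by (auto simp: Z_def)
  then show "x \<otimes> y \<in> Z" using z(1) zpow by (simp add: nat_pow_mult)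
 next
  fix x assume "x \<in> Z"
  then obtain i where i: "x = z [^] i" "i < q" by (auto simp: Z_def)
  then have "z [^] (q - i) \<otimes> x = \<one>" using z zq(1) by (simp add: nat_pow_mult)
  then have "inv x = z [^] (q - i)" using i z by (intro inv_equality) auto
  then show "inv x \<in> Z" using zpow by simp
 qed (use Zsub zpow[of 0] in auto)
 have central: "g \<otimes> x = x \<otimes> g" if x: "x \<in> Z" and g: "g \<in> carrier G" for x g
 proof -
  have "g \<otimes> z [^] n = z [^] n \<otimes> g" for n :: nat
  proof (induction n)
   case (Suc n)
   have "g \<otimes> z [^] Suc n = (g \<otimes> z [^] n) \<otimes> z" using g z(1) by (simp add: m_assoc)
   also have "\<dots> = z [^] n \<otimes> (g \<otimes> z)" unfolding Suc using g z(1) by (simp add: m_assoc)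
   also have "\<dots> = z [^] Suc n \<otimes> g" unfolding z(2)[OF g] using g z(1) by (simp add: m_assoc)
   finally show ?case .
  qed (use g in simp)
  then show ?thesis using x by (auto simp: Z_def)
 qed
 note l = repD(1)[OF rep_Reg] and mR = repD(2)[OF rep_Reg] and r1 = rep1[OF rep_Reg]
 \<comment> \<open>multiplication by \<open>z - 1\<close>, and its \<open>c\<close>-th power\<close>
 define x where "x v = Reg z v - Reg \<one> v" for v
 have lx: "lin x" unfolding x_def[abs_def] by (rule lin_sub[OF l[OF z(1)] l[OF one_closed]])
 have lxn: "lin (x ^^ n)" for n by (rule lin_pow[OF lx])
 have xg: "x (Reg g v) = Reg g (x v)" if "g \<in> carrier G" for g v
  using that z by (simp add: x_def mR lin_diff[OF l])
 have xgn: "(x ^^ n) (Reg g v) = Reg g ((x ^^ n) v)" if "g \<in> carrier G" for g v n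
  by (induction n) (use that xg in auto)
 have xr: "x (rr g v) = rr g (x v)" if "g \<in> carrier G" for g v
  using that z by (simp add: x_def rr_Reg lin_diff[OF rr_lin])
 have xrn: "(x ^^ n) (rr g v) = rr g ((x ^^ n) v)" if "g \<in> carrier G" for g v n
  by (induction n) (use that xr in auto)
 have xD: "(x ^^ n) (Reg \<one> v) = (D z ^^ n) (Reg \<one> v)" for n v
 proof (induction n)
  case (Suc n)
  have "x ((x ^^ n) (Reg \<one> v)) = D z ((x ^^ n) (Reg \<one> v))"
   using xgn[OF one_closed, of n v] z by (simp add: x_def rr_central[OF z] r1)
  then show ?case using Suc by simp
 qed simp
 have xq: "(x ^^ q) v = 0" for v
 proof -
  have "(rr z ^^ (p ^ a)) (Reg \<one> v) = Reg \<one> v"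
  proof -
   have "(rr z ^^ n) (Reg \<one> v) = (Reg z ^^ n) (Reg \<one> v)" for n by (induction n) (auto simp: rr_central[OF z])
   then show ?thesis using rep_pow[OF rep_Reg z(1)] zq by simp
  qed
  then have "(x ^^ q) (Reg \<one> v) = 0" unfolding xD zq(3) by (rule pow_minus_one_zero[OF rr_lin])
  moreover have "(x ^^ Suc n) (Reg \<one> v) = (x ^^ Suc n) v" for n
  proof -
   have "x (Reg \<one> v) = x v" using z by (simp add: x_def mR)
   then show ?thesis by (simp only: funpow_Suc_right o_apply)
  qed
  ultimately show ?thesis using q0 by (metis Suc_pred)
 qed
 define U where "U = range (x ^^ c)"
 have subU: "subspace U" unfolding U_def by (rule subspace_range[OF lxn])
 have oneU: "Reg \<one> v = v" if "v \<in> U" for v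
 proof -
  obtain w where "v = x ((x ^^ (c - 1)) w)" using \<open>v \<in> U\<close> c(2) unfolding U_def by (cases c) auto
  then show ?thesis using z by (simp add: x_def lin_diff[OF l] r1)
 qed
 have Urange: "U \<subseteq> range (Reg \<one>)" using oneU by (auto intro: range_eqI[OF sym])
 have Ug: "Reg g v \<in> U" if "g \<in> carrier G" "v \<in> U" for g v
  using that(2) by (auto simp: U_def xgn[OF that(1), symmetric])
 have Ur: "rr g v \<in> U" if "g \<in> carrier G" "v \<in> U" for g v
  using that(2) by (auto simp: U_def xrn[OF that(1), symmetric])
 obtain \<pi> where \<pi>: "lin \<pi>" "range \<pi> \<subseteq> U" "\<And>v. v \<in> U ==> \<pi> v = v" and rU: "rep (%g v. Reg g (\<pi> v))"
  and \<pi>1: "\<And>v. Reg \<one> (\<pi> v) = \<pi> v" and \<pi>e: "equiv (%g v. Reg g (\<pi> v)) Reg \<pi>"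
  using sub_rep[OF rep_Reg subU Urange Ug] by auto
 have \<pi>U: "\<pi> v \<in> U" for v using \<pi>(2) by auto
 define rhU where "rhU = (%g v. Reg g (\<pi> v))"
 note rU = rU[folded rhU_def] and \<pi>e = \<pi>e[folded rhU_def]
 have rhU1: "rhU \<one> v = \<pi> v" for v by (simp add: rhU_def \<pi>1)
 have rhUU: "rhU g v = Reg g v" if "v \<in> U" for g v using \<pi>(3)[OF that] by (simp add: rhU_def)
 define M where "M = realize rhU"
 define ka where "ka = inv_into UNIV \<iota>"
 define em where "em v = \<iota> (rhU \<one> v)" for v
 have M: "coord M rhU ka em" unfolding M_def ka_def em_def[abs_def] by (rule coord_realize[OF rU])
 have KinT: "M \<in> Thick KG K"
 proof -
  have fin: "finite ((x ^^ c) ` bs ` carrier G)" using finite_G by simp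
  have "U \<subseteq> span ((x ^^ c) ` bs ` carrier G)"
  proof
   fix v assume v: "v \<in> U"
   then obtain w where w: "v = (x ^^ c) w" unfolding U_def by auto
   have "v = (x ^^ c) (Reg \<one> w)" using oneU[OF v] xgn[OF one_closed] w by simp
   moreover have "(x ^^ c) (Reg \<one> w) \<in> (x ^^ c) ` span (bs ` carrier G)" using Reg_one_span by blast
   moreover have "(x ^^ c) ` span (bs ` carrier G) \<subseteq> span ((x ^^ c) ` bs ` carrier G)"
   proof -
    have "subspace {w. (x ^^ c) w \<in> span ((x ^^ c) ` bs ` carrier G)}"
     by (rule subspaceI) (simp_all add: lin_simps[OF lxn] span_zero span_add span_scale)
    then have "span (bs ` carrier G) \<subseteq> {w. (x ^^ c) w \<in> span ((x ^^ c) ` bs ` carrier G)}"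
     by (intro span_minimal) (auto intro: span_base)
    then show ?thesis by auto
   qed
   ultimately show "v \<in> span ((x ^^ c) ` bs ` carrier G)" by auto
  qed
  then have "M \<in> S" if "thick_subcategory KG S" "K \<in> S" for S
   using thick_submodule[OF that proj_Reg subU Urange Ug fin _ M[unfolded rhU_def] \<pi>(1,2,3) \<pi>e[unfolded rhU_def]] by blast
  then show ?thesis unfolding Thick_def by blast
 qed
 \<comment> \<open>the ghosts\<close>
 define F where "F g v = rr g (\<pi> v) - \<pi> v" for g v
 have FU: "F g v \<in> U" if "g \<in> carrier G" for g v
  unfolding F_def using that \<pi>U Ur subU by (simp add: subspace_diff)
 have lF: "lin (F g)" for g unfolding F_def[abs_def] by (rule lin_sub[OF lin_comp[OF rr_lin \<pi>(1)] \<pi>(1)])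
 have F: "equiv rhU rhU (F g)" if g: "g \<in> carrier G" for g
  unfolding equiv_def
 proof (intro conjI ballI allI lF)
  fix h v assume h: "h \<in> carrier G"
  have "rhU h v \<in> U" using Ug[OF h \<pi>U] by (simp add: rhU_def)
  then show "F g (rhU h v) = rhU h (F g v)"
   using \<pi>(3) rhUU[OF FU[OF g]] g h by (simp add: F_def rhU_def rr_Reg lin_diff[OF l])
 qed
 have gh: "ghost KG K M M (%v. em (F g (ka v)))" if g: "g \<in> carrier G" for g
  unfolding ghost_def
 proof (intro conjI allI impI ballI)
  show "left_module KG M" "left_module KG M" using M by (rule coordD)+
  show hom: "(%v. em (F g (ka v))) \<in> left_module_hom KG M M" by (rule hom_unhat(1)[OF M M F[OF g]])
  fix n W h assume W': "is_Omega_power KG n K W" and h: "h \<in> left_module_hom KG W M"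
  have lmW: "left_module KG W"
  proof (cases "nat \<bar>n\<bar>")
   case 0
   then have "W = K" using W' by (auto simp: is_Omega_power_def split: if_splits)
   then show ?thesis using left_module_trivial by simp
  next
   case (Suc i)
   then have "(is_Omega KG ^^ Suc i) K W \<or> (is_Omega KG ^^ Suc i) W K"
    using W' by (auto simp: is_Omega_power_def simp del: relpowp.simps split: if_splits)
   then show ?thesis
   proof
    assume "(is_Omega KG ^^ Suc i) K W"
    then show ?thesis using is_Omega_left_module[OF Z central] by auto
   next
    assume "(is_Omega KG ^^ Suc i) W K"
    then obtain M' where "is_Omega KG W M'" by (meson relpowp_Suc_D2)
    then show ?thesis using is_Omega_left_module[OF Z central] by blast
   qed
  qed
  then obtain rhW kaW emW where W: "coord W rhW kaW emW" using coord_exists by blast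
  have rW: "rep rhW" using W by (rule coordD)
  have st: "Zst Z rhW" by (rule Zst_Omega_power[OF Z central W' W])
  define H where "H v = ka (h (emW v))" for v
  have H: "equiv rhW rhU H" and HU1: "\<And>v. rhU \<one> (H v) = H v"
   using hom_hat[OF W M h] unfolding H_def by auto
  have HU: "H v \<in> U" for v using HU1[of v] \<pi>U by (metis rhU1)
  have HR: "equiv rhW Reg H" using H rhUU[OF HU] by (auto simp: equiv_def)
  obtain \<psi> where \<psi>: "lin \<psi>" "\<And>w. rr g (H w) - Reg \<one> (H w) =
    Tr rhW Reg (%w. \<Sum>z\<in>Z. Reg (inv z) (\<theta> \<one> (\<sigma> \<one> (Reg z (H (\<psi> w)))))) w"
   using right_multiplication_ghost[OF Z central rW st g HR] by blast
  define \<nu>0 where "\<nu>0 v = (\<Sum>z\<in>Z. Reg (inv z) (\<theta> \<one> (\<sigma> \<one> (Reg z v))))" for v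
  have Zc: "y \<in> carrier G" if "y \<in> Z" for y using that Zsub by auto
  have l\<nu>: "lin \<nu>0" unfolding \<nu>0_def[abs_def]
   by (rule lin_summ) (rule lin_comp[OF l lin_comp[OF lin_\<theta> lin_comp[OF lin_\<sigma> l]]], auto simp: Zc)
  have \<nu>z: "\<nu>0 (Reg y v) = Reg y (\<nu>0 v)" if y: "y \<in> Z" for y v
  proof -
   have "\<nu>0 (Reg y v) = (\<Sum>z\<in>Z. Reg (y \<otimes> inv (y \<otimes> z)) (\<theta> \<one> (\<sigma> \<one> (Reg (y \<otimes> z) v))))"
    unfolding \<nu>0_def
   proof (rule sum.cong[OF refl])
    fix x assume x: "x \<in> Z"
    have "y \<otimes> inv (y \<otimes> x) = inv (y \<otimes> x) \<otimes> y" using central[OF y, of "inv (y \<otimes> x)"] Zc y x by simp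
    also have "\<dots> = inv x" using Zc y x by (simp add: inv_mult_group m_assoc)
    finally have "y \<otimes> inv (y \<otimes> x) = inv x" .
    moreover have "Reg x (Reg y v) = Reg (y \<otimes> x) v" using central[OF x, of y] Zc y x by (simp add: mR)
    ultimately show "Reg (inv x) (\<theta> \<one> (\<sigma> \<one> (Reg x (Reg y v)))) = Reg (y \<otimes> inv (y \<otimes> x)) (\<theta> \<one> (\<sigma> \<one> (Reg (y \<otimes> x) v)))"
     by simp
   qed
   also have "\<dots> = (\<Sum>z\<in>Z. Reg (y \<otimes> inv z) (\<theta> \<one> (\<sigma> \<one> (Reg z v))))" by (rule sum_subgroup_left[OF Z y])
   also have "\<dots> = Reg y (\<nu>0 v)" unfolding \<nu>0_def using y Zc by (simp add: lin_sum[OF l] mR)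
   finally show ?thesis .
  qed
  have zZ: "z \<in> Z" "\<one> \<in> Z" using zpow[of 1] zpow[of 0] z(1) by auto
  have "\<nu>0 (x v) = x (\<nu>0 v)" for v using zZ by (simp add: x_def lin_diff[OF l\<nu>] \<nu>z)
  then have "\<nu>0 ((x ^^ n) v) = (x ^^ n) (\<nu>0 v)" for n v by (induction n) auto
  then have \<nu>U: "\<nu>0 v \<in> U" if "v \<in> U" for v using that by (auto simp: U_def)
  show "stably_zero KG W M ((%v. em (F g (ka v))) \<circ> h)"
  proof (rule stably_zeroI[OF W M])
   show "lin (%w. \<nu>0 (H (\<psi> w)))" by (rule lin_comp[OF l\<nu> lin_comp[OF equivD(1)[OF H] \<psi>(1)]])
   fix y assume y: "y \<in> carrier W"
   show "((%v. em (F g (ka v))) \<circ> h) y \<in> carrier M" using coordD(3)[OF M] by simp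
   have "ka (em (F g (ka (h y)))) = F g (ka (h y))" by (rule hom_unhat(2)[OF M M F[OF g] homD(1)[OF h y]])
   also have ky: "ka (h y) = H (kaW y)" by (simp add: H_def coordD(4)[OF W y])
   also have "F g (H (kaW y)) = rr g (H (kaW y)) - Reg \<one> (H (kaW y))"
    using \<pi>(3)[OF HU] oneU[OF HU] by (simp add: F_def)
   also have "\<dots> = Tr rhW Reg (%w. \<nu>0 (H (\<psi> w))) (kaW y)" unfolding \<psi>(2) \<nu>0_def ..
   also have "\<dots> = Tr rhW rhU (%w. \<nu>0 (H (\<psi> w))) (kaW y)"
    unfolding Tr_def by (intro sum.cong refl rhUU[symmetric] \<nu>U HU)
   finally show "ka (((%v. em (F g (ka v))) \<circ> h) y) = Tr rhW rhU (%w. \<nu>0 (H (\<psi> w))) (kaW y)" by (simp add: ky)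
  qed
 qed
 have comp: "\<exists>f. ghost_composite KG K (length gs) M M f \<and> (\<forall>v. ka (f (em v)) = fold D gs (\<pi> v))"
  if "set gs \<subseteq> carrier G" for gs
  using that
 proof (induction gs rule: rev_induct)
  case Nil
  have "(%v. v) \<in> left_module_hom KG M M" by (auto simp: left_module_hom_def)
  then have "ghost_composite KG K 0 M M (%v. v)" by (rule ghost_composite.zero[OF KinT KinT])
  moreover have "ka (em v) = \<pi> v" for v using coordD(5)[OF M] rhU1 by simp
  ultimately show ?case by (intro exI[of _ "%v. v"]) simp
 next
  case (snoc g gs)
  then obtain f where f: "ghost_composite KG K (length gs) M M f" "\<And>v. ka (f (em v)) = fold D gs (\<pi> v)" by auto
  have g: "g \<in> carrier G" and gs: "set gs \<subseteq> carrier G" using snoc.prems by auto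
  have inU: "fold D gs v \<in> U" if "v \<in> U" for v
   using gs that by (induction gs arbitrary: v) (auto simp: Ur subU subspace_diff)
  have fc: "f (em v) \<in> carrier M" for v
  proof -
   have "f \<in> left_module_hom KG M M" by (rule ghost_composite_hom[OF f(1)])
   then have "f \<in> carrier M \<rightarrow> carrier M" by (simp add: left_module_hom_def)
   then show ?thesis using coordD(3)[OF M] by blast
  qed
  have "ghost_composite KG K (Suc (length gs)) M M ((%v. em (F g (ka v))) \<circ> f)"
   by (rule ghost_composite.Suc[OF f(1) KinT KinT gh[OF g]])
  moreover have "ka (((%v. em (F g (ka v))) \<circ> f) (em v)) = fold D (gs @ [g]) (\<pi> v)" for v
   using hom_unhat(2)[OF M M F[OF g] fc, of v] \<pi>(3)[OF inU[OF \<pi>U]] by (simp add: f(2) F_def)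
  ultimately show ?case by (intro exI) auto
 qed
 \<comment> \<open>the composite that reaches the norm element\<close>
 define v0 where "v0 = (x ^^ c) (bs \<one>)"
 have bs1: "Reg \<one> (bs \<one>) = bs \<one>" by (simp add: Reg_bs)
 have v0U: "v0 \<in> U" by (simp add: v0_def U_def)
 have start: "fold D (replicate (q - 1 - c) z) v0 = (\<Sum>h\<in>Z. bs h)"
 proof -
  have "fold D (replicate (q - 1 - c) z) v0 = (D z ^^ (q - 1 - c)) ((D z ^^ c) (bs \<one>))"
   using xD[of c "bs \<one>"] by (simp add: fold_replicate v0_def bs1)
  also have "\<dots> = (D z ^^ (q - 1)) (bs \<one>)" using c by (simp flip: funpow_add[THEN fun_cong, unfolded o_apply])
  also have "\<dots> = (\<Sum>l<q. \<Sum>h\<in>{\<one>}. bs (h \<otimes> z [^] l))"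
   using D_pow_sum[of "{\<one>}" z a] z unfolding zq(3) by simp
  also have "\<dots> = (\<Sum>h\<in>Z. bs h)" unfolding Z_def sum.reindex[OF zq(2)] using z by simp
  finally show ?thesis .
 qed
 have cardZ: "card Z = q * p ^ 0" unfolding Z_def using card_image[OF zq(2)] by simp
 obtain gs where gs: "set gs \<subseteq> carrier G" "length gs = (q - 1 - c) + m * (p - 1)" "fold D gs v0 = (\<Sum>h\<in>carrier G. bs h)"
 proof -
  have "set (replicate (q - 1 - c) z) \<subseteq> carrier G" using z(1) by (auto simp: set_replicate_conv_if)
  then show ?thesis using norm_as_product[OF Z cardZ order _ _ start, of "q - 1 - c"] that by auto
 qed
 have vanish: "fold D gs' v0 = 0"
  if gs': "set gs' \<subseteq> carrier G" and z0: "\<And>N f. ghost_composite KG K (length gs') M N f ==> stably_zero KG M N f" for gs'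
 proof -
  obtain f where f: "ghost_composite KG K (length gs') M M f" "\<And>v. ka (f (em v)) = fold D gs' (\<pi> v)"
   using comp[OF gs'] by blast
  have "szero rhU rhU (%v. fold D gs' (\<pi> v))" using stably_zeroD[OF M M z0[OF f(1)]] by (simp add: f(2))
  note sz = this
  obtain H where H: "equiv Reg rhU H" "\<And>v. H (\<pi> v) = fold D gs' (\<pi> v)"
  proof -
   have inj: "\<pi> (rhU \<one> v) = 0 ==> rhU \<one> v = 0" for v using \<pi>(3)[OF \<pi>U] by (simp add: rhU1)
   have "\<exists>H. equiv Reg rhU H \<and> (\<forall>v. H (\<pi> v) = fold D gs' (\<pi> v))"
    by (rule extend_over_injection[OF rU rep_Reg rU \<pi>e _ sz]) (rule inj)
   then show ?thesis using that by blast
  qed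
  have HU: "H (Reg \<one> v) \<in> U" for v using equivD(2)[OF H(1) one_closed, of v] \<pi>U by (simp add: rhU1)
  have Hx: "H (x v) = x (H (Reg \<one> v))" for v
   using equivD(2)[OF H(1) z(1), of "Reg \<one> v"] rhUU[OF HU] equivD(2)[OF H(1) one_closed, of "Reg \<one> v"] z
   by (simp add: x_def lin_diff[OF equivD(1)[OF H(1)]] r1)
  have Hxn: "H ((x ^^ n) (Reg \<one> v)) = (x ^^ n) (H (Reg \<one> v))" for n v
  proof (induction n)
   case (Suc n)
   have "Reg \<one> ((x ^^ n) (Reg \<one> v)) = (x ^^ n) (Reg \<one> v)" using xgn[OF one_closed, of n "Reg \<one> v"] by (simp add: r1)
   then show ?case using Suc Hx[of "(x ^^ n) (Reg \<one> v)"] by simp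
  qed simp
  have "fold D gs' v0 = H v0" using H(2)[of v0] \<pi>(3)[OF v0U] by simp
  also have "\<dots> = (x ^^ c) (H (bs \<one>))" using Hxn[of c "bs \<one>"] by (simp add: v0_def bs1)
  also have "\<dots> = 0"
  proof -
   obtain u where "H (bs \<one>) = (x ^^ c) u" using HU[of "bs \<one>"] unfolding bs1 U_def by auto
   then have "(x ^^ c) (H (bs \<one>)) = (x ^^ (q + (2 * c - q))) u" using c(1) by (simp flip: funpow_add[THEN fun_cong, unfolded o_apply] add: mult_2)
   also have "\<dots> = 0" using xq by (simp only: funpow_add o_apply)
   finally show ?thesis .
  qed
  finally show ?thesis .
 qed
 have "enat ((q - 1) div 2 + m * (p - 1)) \<le> ghost_length KG K M"
  unfolding ghost_length_def
 proof (rule Inf_greatest, clarify)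
  fix n assume n: "\<forall>N f. ghost_composite KG K n M N f --> stably_zero KG M N f"
  show "enat ((q - 1) div 2 + m * (p - 1)) \<le> enat n"
  proof (rule ccontr)
   assume "\<not> ?thesis"
   then have le: "n \<le> length gs" using gs(2) c(4) by simp
   have tk: "set (take n gs) \<subseteq> carrier G" using gs(1) set_take_subset[of n gs] by (rule subset_trans[rotated])
   have len: "length (take n gs) = n" using le by simp
   have tk0: "fold D (take n gs) v0 = 0" using n by (intro vanish[OF tk, unfolded len]) simp
   have "fold D (take n gs @ drop n gs) v0 = fold D (drop n gs) (fold D (take n gs) v0)"
    unfolding fold_append o_apply ..
   then have "fold D gs v0 = fold D (drop n gs) 0" unfolding tk0 append_take_drop_id .
   also have "fold D ys 0 = 0" for ys by (induction ys) (simp_all add: lin_0[OF rr_lin])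
   finally show False using gs(3) norm_bs_nonzero by simp
  qed
 qed
 also have "\<dots> \<le> ghost_number e G" unfolding ghost_number_def using KinT by (rule SUP_upper)
 finally show ?thesis .
qed

end

section \<open>Sums over a nilpotent operator\<close>

context kspace begin

text \<open>
With \<open>x\<close> and \<open>x'\<close> the actions of \<open>g - 1\<close> this is the trace over a cyclic group of prime power order \<open>n\<close>, up to a change of \<open>\<phi>\<close>.
\<close>

definition cyc :: "('v => 'v) => ('v => 'v) => nat => ('v => 'v) => 'v => 'v" where
 "cyc x' x n \<phi> v = (\<Sum>b<n. (x' ^^ (n - 1 - b)) (\<phi> ((x ^^ b) v)))"

lemma cyc_lin: assumes "lin x" "lin x'" "lin \<phi>" shows "lin (cyc x' x n \<phi>)"
proof -
 have "lin (%v. \<Sum>b<n. (x' ^^ (n - 1 - b)) (\<phi> ((x ^^ b) v)))"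
  by (rule lin_summ) (rule lin_comp[OF lin_pow[OF assms(2)] lin_comp[OF assms(3) lin_pow[OF assms(1)]]])
 then show ?thesis by (simp only: cyc_def[abs_def])
qed

lemma cyc_add: assumes "lin x'" shows "cyc x' x n (%v. \<phi> v + \<psi> v) v = cyc x' x n \<phi> v + cyc x' x n \<psi> v"
 by (simp add: cyc_def lin_add[OF lin_pow[OF assms]] sum.distrib)

text \<open>
Both sides depend only on the commutator, which does not change when \<open>x\<close> and \<open>x'\<close> are replaced by \<open>x + 1\<close> and \<open>x' + 1\<close>: this is how
sums over powers of \<open>g - 1\<close> become sums over powers of \<open>g\<close>.
\<close>

lemma cyc_eq_commutator_power:
 assumes p: "prime p" "CHAR('k) = p" and lin: "lin x'" "lin x" "lin \<phi>"
 shows "cyc x' x (p ^ a) \<phi> v = (commutator x' x ^^ (p ^ a - 1)) \<phi> v"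
proof -
 have p0: "0 < p ^ a" using p(1) prime_gt_0_nat by simp
 have "{..p ^ a - 1} = {..<p ^ a}" using p0 unfolding lessThan_Suc_atMost[symmetric] by simp
 then have "(commutator x' x ^^ (p ^ a - 1)) \<phi> v =
   (\<Sum>b<p ^ a. scale ((- 1) ^ b * of_nat (p ^ a - 1 choose b)) ((x' ^^ (p ^ a - 1 - b)) (\<phi> ((x ^^ b) v))))"
  unfolding commutator_power[OF lin] by simp
 also have "\<dots> = cyc x' x (p ^ a) \<phi> v"
  unfolding cyc_def
 proof (rule sum.cong[OF refl])
  fix b assume "b \<in> {..<p ^ a}"
  then have "(- 1) ^ b * of_nat (p ^ a - 1 choose b) = ((- 1) ^ b * (- 1) ^ b :: 'k)"
   using prime_power_choose_alternating[OF p, of b a] by simp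
  also have "\<dots> = 1" by (simp flip: power_add)
  finally show "scale ((- 1) ^ b * of_nat (p ^ a - 1 choose b)) ((x' ^^ (p ^ a - 1 - b)) (\<phi> ((x ^^ b) v))) =
    (x' ^^ (p ^ a - 1 - b)) (\<phi> ((x ^^ b) v))" by simp
 qed
 finally show ?thesis ..
qed

lemma pow_closed: "(\<And>v. v \<in> U ==> x v \<in> U) ==> v \<in> U ==> (x ^^ k) v \<in> U"
 by (induction k) auto

lemma pow_intertwine: assumes "\<And>v. F (x v) = x' (F v)" shows "F ((x ^^ k) v) = (x' ^^ k) (F v)"
 by (induction k) (auto simp: assms)

lemma pow_pow: "(x ^^ i) ((x ^^ j) v) = (x ^^ (i + j)) v"
 by (simp add: funpow_add)

lemma pow_zero_mono: assumes "lin x" "(x ^^ i) v = 0" "i \<le> j" shows "(x ^^ j) v = 0"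
proof -
 have "(x ^^ j) v = (x ^^ (j - i)) ((x ^^ i) v)" using assms(3) by (simp add: pow_pow)
 then show ?thesis by (simp add: assms(2) lin_0[OF lin_pow[OF assms(1)]])
qed

lemma cyc_intertwine:
 assumes lin: "lin x" "lin x'" "lin \<phi>" and "(x ^^ n) v = 0" "(x' ^^ n) (\<phi> v) = 0"
 shows "cyc x' x n \<phi> (x v) = x' (cyc x' x n \<phi> v)"
proof -
 define h where "h k = (x' ^^ (n - k)) (\<phi> ((x ^^ k) v))" for k
 have "cyc x' x n \<phi> (x v) = (\<Sum>b<n. h (Suc b))"
  unfolding cyc_def h_def by (intro sum.cong refl) (simp add: funpow_swap1)
 moreover have "x' (cyc x' x n \<phi> v) = (\<Sum>b<n. h b)"
  unfolding cyc_def h_def lin_sum[OF lin(2)]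
 proof (rule sum.cong[OF refl])
  fix b assume "b \<in> {..<n}"
  then have "n - b = Suc (n - 1 - b)" by auto
  then show "x' ((x' ^^ (n - 1 - b)) (\<phi> ((x ^^ b) v))) = (x' ^^ (n - b)) (\<phi> ((x ^^ b) v))" by simp
 qed
 moreover have "(\<Sum>b<n. h (Suc b)) - (\<Sum>b<n. h b) = h n - h 0" by (simp add: sum_lessThan_telescope flip: sum_subtractf)
 moreover have "h n = 0" "h 0 = 0" using assms(4,5) lin_0[OF lin(3)] by (simp_all add: h_def)
 ultimately show ?thesis by simp
qed

text \<open>
The map is corrected on one kernel \<open>ker x\<^sup>a\<^sup>+\<^sup>1\<close> after the other. A map that vanishes on \<open>ker x\<^sup>a\<close> has the form
\<open>x'\<^sup>n\<^sup>-\<^sup>1\<^sup>-\<^sup>a \<psi> x\<^sup>a\<close> on the next kernel, and there all other terms of the sum for \<open>\<psi>\<close> vanish.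
\<close>

lemma cyc_layers:
 assumes lin: "lin x" "lin x'" "lin f" and U: "subspace U" "\<And>v. v \<in> U ==> x v \<in> U"
  and U': "subspace U'" "\<And>v. v \<in> U' ==> x' v \<in> U'"
  and nil: "\<And>v. v \<in> U ==> (x ^^ n) v = 0" "\<And>v. v \<in> U' ==> (x' ^^ n) v = 0"
  and fx: "\<And>v. f (x v) = x' (f v)"
  and layer: "\<And>a v. a \<le> n ==> v \<in> U ==> (x ^^ a) v = 0 ==> \<exists>u\<in>U'. f v = (x' ^^ (n - a)) u"
 shows "\<exists>\<phi>. lin \<phi> \<and> range \<phi> \<subseteq> U' \<and> (\<forall>v\<in>U. f v = cyc x' x n \<phi> v)"
proof -
 have "\<exists>\<phi>. lin \<phi> \<and> range \<phi> \<subseteq> U' \<and> (\<forall>v\<in>U. (x ^^ a) v = 0 --> f v = cyc x' x n \<phi> v)" if "a \<le> n" for a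
  using that
 proof (induction a)
  case 0
  show ?case
   by (rule exI[of _ "%v. 0"]) (auto simp: cyc_def lin_0[OF lin_pow[OF lin(2)]] lin_0[OF lin(3)] subspace_0[OF U'(1)])
 next
  case (Suc a)
  then obtain \<phi> where \<phi>: "lin \<phi>" "range \<phi> \<subseteq> U'" "\<And>v. v \<in> U ==> (x ^^ a) v = 0 ==> f v = cyc x' x n \<phi> v" by auto
  have \<phi>U: "\<phi> v \<in> U'" for v using \<phi>(2) by auto
  have a: "a < n" using Suc.prems by simp
  define f1 where "f1 v = f v - cyc x' x n \<phi> v" for v
  have lf1: "lin f1" unfolding f1_def[abs_def] by (rule lin_sub[OF lin(3) cyc_lin[OF lin(1,2) \<phi>(1)]])
  have f1x: "f1 (x v) = x' (f1 v)" if "v \<in> U" for v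
   unfolding f1_def by (simp add: fx cyc_intertwine[OF lin(1,2) \<phi>(1) nil(1)[OF that] nil(2)[OF \<phi>U]] lin_diff[OF lin(2)])
  have f1xn: "f1 ((x ^^ k) v) = (x' ^^ k) (f1 v)" if "v \<in> U" for k v
   by (induction k) (auto simp: f1x pow_closed[OF U(2) that])
  have f10: "f1 v = 0" if "v \<in> U" "(x ^^ a) v = 0" for v using \<phi>(3)[OF that] by (simp add: f1_def)
  have powU': "(x' ^^ k) u \<in> U'" if "u \<in> U'" for k u using pow_closed[of U' x' u k] U'(2) that by blast
  have f1l: "\<exists>u\<in>U'. f1 v = (x' ^^ (n - Suc a)) u" if v: "v \<in> U" "(x ^^ Suc a) v = 0" for v
  proof -
   obtain u where u: "u \<in> U'" "f v = (x' ^^ (n - Suc a)) u" using layer[OF Suc.prems v] by blast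
   define w where "w = (\<Sum>b<n. if b \<le> a then (x' ^^ (a - b)) (\<phi> ((x ^^ b) v)) else 0)"
   have w: "w \<in> U'" unfolding w_def using powU' \<phi>U subspace_0[OF U'(1)] by (intro subspace_sum[OF U'(1)]) auto
   have "cyc x' x n \<phi> v = (x' ^^ (n - Suc a)) w"
    unfolding cyc_def w_def lin_sum[OF lin_pow[OF lin(2)]]
   proof (rule sum.cong[OF refl])
    fix b assume b: "b \<in> {..<n}"
    show "(x' ^^ (n - 1 - b)) (\<phi> ((x ^^ b) v)) =
      (x' ^^ (n - Suc a)) (if b \<le> a then (x' ^^ (a - b)) (\<phi> ((x ^^ b) v)) else 0)"
    proof (cases "b \<le> a")
     case True
     then have "n - 1 - b = (n - Suc a) + (a - b)" using a by simp
     then show ?thesis using True by (simp only: pow_pow if_True)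
    next
     case False
     then have "(x ^^ b) v = 0" using pow_zero_mono[OF lin(1) v(2)] by simp
     then show ?thesis using False by (simp add: lin_0[OF \<phi>(1)] lin_0[OF lin_pow[OF lin(2)]])
    qed
   qed
   then show ?thesis using u w subspace_diff[OF U'(1)]
    by (intro bexI[of _ "u - w"]) (auto simp: f1_def lin_diff[OF lin_pow[OF lin(2)]])
  qed
  define A where "A = {v \<in> U. (x ^^ Suc a) v = 0}"
  have sA: "subspace A" unfolding A_def
   using subspace_inter[OF U(1) subspace_ker[OF lin_pow[OF lin(1)], of "Suc a"]] by (simp add: Int_def)
  obtain L where L: "lin L" "\<And>u. u \<in> A ==> L ((x ^^ a) u) = f1 u"
   using factor_through[OF lin_pow[OF lin(1), of a] lf1 sA] f10 by (auto simp: A_def)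
  have sW: "subspace ((x ^^ a) ` A)" by (rule subspace_image[OF lin_pow[OF lin(1)] sA])
  obtain \<pi> where \<pi>: "lin \<pi>" "range \<pi> \<subseteq> (x ^^ a) ` A" "\<And>v. v \<in> (x ^^ a) ` A ==> \<pi> v = v"
   using retraction[OF sW] by auto
  have "range (%v. L (\<pi> v)) \<subseteq> (x' ^^ (n - Suc a)) ` U'"
  proof (rule image_subsetI)
   fix v
   obtain u where "u \<in> A" "\<pi> v = (x ^^ a) u" using \<pi>(2) by (metis imageE rangeI subsetD)
   then show "L (\<pi> v) \<in> (x' ^^ (n - Suc a)) ` U'" using L(2) f1l[of u] by (auto simp: A_def)
  qed
  then obtain \<psi> where \<psi>: "lin \<psi>" "range \<psi> \<subseteq> U'" "\<And>v. (x' ^^ (n - Suc a)) (\<psi> v) = L (\<pi> v)"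
   using lift_through[OF lin_pow[OF lin(2), of "n - Suc a"] lin_comp[OF L(1) \<pi>(1)] U'(1)] by auto
  have \<psi>A: "cyc x' x n \<psi> v = f1 v" if v: "v \<in> A" for v
  proof -
   have vU: "v \<in> U" "(x ^^ Suc a) v = 0" using v by (auto simp: A_def)
   have "cyc x' x n \<psi> v = (\<Sum>b<n. if b = a then f1 v else 0)"
    unfolding cyc_def
   proof (rule sum.cong[OF refl])
    fix b assume b: "b \<in> {..<n}"
    show "(x' ^^ (n - 1 - b)) (\<psi> ((x ^^ b) v)) = (if b = a then f1 v else 0)"
    proof (cases "b \<le> a")
     case True
     then have "n - 1 - b = (a - b) + (n - Suc a)" using a by simp
     then have 1: "(x' ^^ (n - 1 - b)) (\<psi> ((x ^^ b) v)) = (x' ^^ (a - b)) (L (\<pi> ((x ^^ b) v)))"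
      by (simp only: flip: pow_pow \<psi>(3))
     show ?thesis
     proof (cases "b = a")
      case True
      then show ?thesis using 1 L(2)[OF v] \<pi>(3)[of "(x ^^ a) v"] v by simp
     next
      case False
      obtain u where u: "u \<in> A" "\<pi> ((x ^^ b) v) = (x ^^ a) u" using \<pi>(2) by (metis imageE rangeI subsetD)
      then have uU: "u \<in> U" "(x ^^ Suc a) u = 0" by (auto simp: A_def)
      have "(x' ^^ (a - b)) (L (\<pi> ((x ^^ b) v))) = f1 ((x ^^ (a - b)) u)"
       using u L(2) by (simp add: f1xn[OF uU(1)])
      also have "\<dots> = 0"
      proof (rule f10)
       show "(x ^^ (a - b)) u \<in> U" using pow_closed[of U x u] U(2) uU(1) by blast
       have "(x ^^ a) ((x ^^ (a - b)) u) = (x ^^ (a + (a - b))) u" by (rule pow_pow)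
       also have "\<dots> = 0" by (rule pow_zero_mono[OF lin(1) uU(2)]) (use True False in simp)
       finally show "(x ^^ a) ((x ^^ (a - b)) u) = 0" .
      qed
      finally show ?thesis using 1 False by simp
     qed
    next
     case False
     then have "(x ^^ b) v = 0" using pow_zero_mono[OF lin(1) vU(2)] by simp
     then show ?thesis using False by (simp add: lin_0[OF \<psi>(1)] lin_0[OF lin_pow[OF lin(2)]])
    qed
   qed
   then show ?thesis using a by simp
  qed
  show ?case
  proof (intro exI[of _ "%v. \<phi> v + \<psi> v"] conjI ballI impI)
   show "lin (%v. \<phi> v + \<psi> v)" by (rule lin_plus[OF \<phi>(1) \<psi>(1)])
   show "range (%v. \<phi> v + \<psi> v) \<subseteq> U'" using \<phi>(2) \<psi>(2) subspace_add[OF U'(1)] by (auto simp: image_subset_iff)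
   fix v assume "v \<in> U" "(x ^^ Suc a) v = 0"
   then have "v \<in> A" by (simp add: A_def)
   from \<psi>A[OF this] show "f v = cyc x' x n (%v. \<phi> v + \<psi> v) v"
    unfolding cyc_add[OF lin(2)] by (simp add: f1_def)
  qed
 qed
 from this[of n] nil(1) show ?thesis by auto
qed

text \<open>
What a composite of \<open>j\<close> ghosts does to \<open>ker x\<^sup>a\<close>. The first half is useful for \<open>a\<close> at most \<open>n / 2\<close>, where the truncated difference \<open>a - j\<close> reaches \<open>0\<close>;
the second for larger \<open>a\<close>.
\<close>

definition cyc_inv :: "nat => nat => ('v => 'v) => 'v set => ('v => 'v) => 'v set => ('v => 'v) => bool" where
 "cyc_inv n j x U x' U' C \<longleftrightarrow> (\<forall>a v. a \<le> n \<and> v \<in> U \<and> (x ^^ a) v = 0 -->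
  (\<exists>u\<in>U'. \<exists>w\<in>U'. C v = (x' ^^ (n - a)) u + w \<and> (x' ^^ (a - j)) w = 0) \<and>
  ((\<exists>u\<in>U'. C v = (x' ^^ j) u \<and> (x' ^^ (a + j)) u = 0) \<or> (\<exists>u\<in>U'. C v = (x' ^^ (n - a)) u)))"

lemma cyc_inv_0:
 assumes "subspace U'" "\<And>v. v \<in> U ==> C v \<in> U'" "\<And>v. C (x v) = x' (C v)" "lin x'" "lin C"
 shows "cyc_inv n 0 x U x' U' C"
 unfolding cyc_inv_def
proof (intro allI impI, elim conjE)
 fix a v assume v: "v \<in> U" "(x ^^ a) v = 0"
 have "(x' ^^ a) (C v) = 0"
  using pow_intertwine[of C x x' a v] assms(3) v(2) lin_0[OF assms(5)] by simp
 then show "(\<exists>u\<in>U'. \<exists>w\<in>U'. C v = (x' ^^ (n - a)) u + w \<and> (x' ^^ (a - 0)) w = 0) \<and>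
  ((\<exists>u\<in>U'. C v = (x' ^^ 0) u \<and> (x' ^^ (a + 0)) u = 0) \<or> (\<exists>u\<in>U'. C v = (x' ^^ (n - a)) u))"
  using assms(2)[OF v(1)] subspace_0[OF assms(1)] lin_0[OF lin_pow[OF assms(4)]]
  by (intro conjI disjI1 bexI[of _ 0] bexI[of _ "C v"]) auto
qed

lemma cyc_inv_Suc:
 assumes C: "cyc_inv n j x0 U0 x U C" and lin: "lin x" "lin x'" "lin F" and F: "\<And>v. v \<in> U ==> F v \<in> U'" "\<And>v. F (x v) = x' (F v)"
  and U: "\<And>v. v \<in> U ==> x v \<in> U" and U': "subspace U'" "\<And>v. v \<in> U' ==> x' v \<in> U'"
  and socle: "\<And>v. v \<in> U ==> x v = 0 ==> \<exists>u\<in>U'. F v = (x' ^^ (n - 1)) u"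
  and rad: "\<And>v. v \<in> U ==> (x ^^ (n - 1)) v = 0 ==> \<exists>u\<in>U'. F v = x' u"
 shows "cyc_inv n (Suc j) x0 U0 x' U' (%v. F (C v))"
 unfolding cyc_inv_def
proof (intro allI impI, elim conjE)
 fix a v assume v: "a \<le> n" "v \<in> U0" "(x0 ^^ a) v = 0"
 have Fx: "F ((x ^^ k) v) = (x' ^^ k) (F v)" for k v by (rule pow_intertwine) (rule F(2))
 have pU: "(x ^^ k) u \<in> U" if "u \<in> U" for k u using pow_closed[of U x u k] U that by blast
 have pU': "(x' ^^ k) u \<in> U'" if "u \<in> U'" for k u using pow_closed[of U' x' u k] U'(2) that by blast
 note CC = C[unfolded cyc_inv_def, rule_format, of a v]
 have "\<exists>u\<in>U'. \<exists>w\<in>U'. F (C v) = (x' ^^ (n - a)) u + w \<and> (x' ^^ (a - Suc j)) w = 0"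
 proof -
  obtain u w where u: "u \<in> U" "w \<in> U" "C v = (x ^^ (n - a)) u + w" "(x ^^ (a - j)) w = 0"
   using CC v by blast
  show ?thesis
  proof (cases "a \<le> j")
   case True
   then have "w = 0" using u(4) by simp
   then show ?thesis using u F(1) subspace_0[OF U'(1)] lin_0[OF lin_pow[OF lin(2)]]
    by (intro bexI[of _ "F u"] bexI[of _ 0]) (auto simp: Fx)
  next
   case False
   define z where "z = (x ^^ (a - Suc j)) w"
   have "x z = (x ^^ Suc (a - Suc j)) w" by (simp add: z_def)
   also have "Suc (a - Suc j) = a - j" using False by simp
   finally have "x z = 0" using u(4) by simp
   then obtain t where t: "t \<in> U'" "F z = (x' ^^ (n - 1)) t" using socle[of z] pU[OF u(2)] by (auto simp: z_def)
   define w' where "w' = F w - (x' ^^ (n - a + j)) t"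
   have "(x' ^^ (a - Suc j)) w' = F z - (x' ^^ (a - Suc j + (n - a + j))) t"
    by (simp only: w'_def z_def lin_diff[OF lin_pow[OF lin(2)]] Fx pow_pow)
   also have "a - Suc j + (n - a + j) = n - 1" using False v(1) by simp
   finally have "(x' ^^ (a - Suc j)) w' = 0" using t by simp
   moreover have "F (C v) = (x' ^^ (n - a)) (F u + (x' ^^ j) t) + w'"
    by (simp add: u(3) w'_def lin_add[OF lin(3)] lin_add[OF lin_pow[OF lin(2)]] Fx pow_pow)
   moreover have "w' \<in> U'" "F u + (x' ^^ j) t \<in> U'"
    using u t F(1) pU' subspace_diff[OF U'(1)] subspace_add[OF U'(1)] by (auto simp: w'_def)
   ultimately show ?thesis by blast
  qed
 qed
 moreover have "(\<exists>u\<in>U'. F (C v) = (x' ^^ Suc j) u \<and> (x' ^^ (a + Suc j)) u = 0) \<or> (\<exists>u\<in>U'. F (C v) = (x' ^^ (n - a)) u)"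
 proof -
  have "(\<exists>u\<in>U. C v = (x ^^ j) u \<and> (x ^^ (a + j)) u = 0) \<or> (\<exists>u\<in>U. C v = (x ^^ (n - a)) u)"
   using CC v by blast
  then show ?thesis
  proof
   assume "\<exists>u\<in>U. C v = (x ^^ j) u \<and> (x ^^ (a + j)) u = 0"
   then obtain u where u: "u \<in> U" "C v = (x ^^ j) u" "(x ^^ (a + j)) u = 0" by blast
   show ?thesis
   proof (cases "a + j \<le> n - 1")
    case True
    then obtain u' where u': "u' \<in> U'" "F u = x' u'" using rad[OF u(1) pow_zero_mono[OF lin(1) u(3)]] by blast
    have "F (C v) = (x' ^^ Suc j) u'" by (simp add: u Fx u'(2) funpow_swap1)
    moreover have "(x' ^^ (a + Suc j)) u' = F ((x ^^ (a + j)) u)" by (simp add: Fx u'(2) funpow_swap1)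
    ultimately show ?thesis using u' u(3) lin_0[OF lin(3)] by auto
   next
    case False
    then have "j = (n - a) + (j - (n - a))" using v(1) by simp
    then have "(x ^^ j) u = (x ^^ (n - a)) ((x ^^ (j - (n - a))) u)" unfolding pow_pow by simp
    then have "F (C v) = (x' ^^ (n - a)) (F ((x ^^ (j - (n - a))) u))" by (simp add: u(2) Fx)
    then show ?thesis using F(1)[OF pU[OF u(1)]] by blast
   qed
  next
   assume "\<exists>u\<in>U. C v = (x ^^ (n - a)) u"
   then show ?thesis using F(1) by (auto simp: Fx)
  qed
 qed
 ultimately show "(\<exists>u\<in>U'. \<exists>w\<in>U'. F (C v) = (x' ^^ (n - a)) u + w \<and> (x' ^^ (a - Suc j)) w = 0) \<and>
  ((\<exists>u\<in>U'. F (C v) = (x' ^^ Suc j) u \<and> (x' ^^ (a + Suc j)) u = 0) \<or> (\<exists>u\<in>U'. F (C v) = (x' ^^ (n - a)) u))" ..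
qed

lemma cyc_inv_final:
 assumes C: "cyc_inv n m x U x' U' C" and n: "n = 2 * m + 1" and "a \<le> n" "v \<in> U" "(x ^^ a) v = 0"
  and U': "\<And>v. v \<in> U' ==> x' v \<in> U'"
 shows "\<exists>u\<in>U'. C v = (x' ^^ (n - a)) u"
proof -
 note CC = C[unfolded cyc_inv_def, rule_format, of a v, OF conjI[OF assms(3) conjI[OF assms(4,5)]]]
 show ?thesis
 proof (cases "a \<le> m")
  case True
  then show ?thesis using CC by auto
 next
  case False
  then have m: "m = (n - a) + (m - (n - a))" using n by simp
  have "(x' ^^ m) u = (x' ^^ (n - a)) ((x' ^^ (m - (n - a))) u)" for u unfolding pow_pow using m by simp
  moreover have "(x' ^^ k) u \<in> U'" if "u \<in> U'" for k u using pow_closed[of U' x' u k] U' that by blast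
  ultimately show ?thesis using CC by metis
 qed
qed

end

section \<open>Two commuting nilpotent operators\<close>

context kspace begin

definition mon :: "('v => 'v) => ('v => 'v) => nat => nat => 'v => 'v" where
 "mon x y c d v = (x ^^ c) ((y ^^ d) v)"

definition jac :: "('v => 'v) => ('v => 'v) => 'v set => 'v set" where
 "jac x y U = {x s + y t | s t. s \<in> U \<and> t \<in> U}"

text \<open>
Here \<open>n + 3\<close> is the characteristic, and the last condition says that the norm vanishes on \<open>U\<close>.
\<close>

definition nil2 :: "nat => ('v => 'v) => ('v => 'v) => 'v set => bool" where
 "nil2 n x y U \<longleftrightarrow> lin x \<and> lin y \<and> (\<forall>v. x (y v) = y (x v)) \<and> subspace U \<and> (\<forall>v\<in>U. x v \<in> U \<and> y v \<in> U) \<and>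
  (\<forall>v. (x ^^ (n + 3)) v = 0 \<and> (y ^^ (n + 3)) v = 0) \<and> (\<forall>v\<in>U. mon x y (n + 2) (n + 2) v = 0)"

lemma nil2D:
 assumes "nil2 n x y U"
 shows "lin x" "lin y" "x (y v) = y (x v)" "subspace U" "v \<in> U ==> x v \<in> U" "v \<in> U ==> y v \<in> U"
  "(x ^^ (n + 3)) v = 0" "(y ^^ (n + 3)) v = 0" "v \<in> U ==> mon x y (n + 2) (n + 2) v = 0"
 using assms unfolding nil2_def by blast+

lemma mon_lin: assumes "lin x" "lin y" shows "lin (mon x y c d)"
proof -
 have "lin (%v. (x ^^ c) ((y ^^ d) v))" by (rule lin_comp[OF lin_pow[OF assms(1)] lin_pow[OF assms(2)]])
 then show ?thesis by (simp only: mon_def[abs_def])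
qed

lemma mon_closed: assumes "nil2 n x y U" "v \<in> U" shows "mon x y c d v \<in> U"
 unfolding mon_def by (intro pow_closed[of U x] pow_closed[of U y] nil2D(5,6)[OF assms(1)] assms(2))

lemma mon_0: "mon x y 0 0 v = v" by (simp add: mon_def)

lemma mon_mult:
 assumes N: "nil2 n x y U"
 shows "x (mon x y c d v) = mon x y (Suc c) d v" "y (mon x y c d v) = mon x y c (Suc d) v"
  "mon x y c d (x v) = mon x y (Suc c) d v" "mon x y c d (y v) = mon x y c (Suc d) v"
  "mon x y c d (mon x y c' d' v) = mon x y (c + c') (d + d') v"
proof -
 have 1: "y ((x ^^ i) v) = (x ^^ i) (y v)" for i v by (induction i) (simp_all add: nil2D(3)[OF N, symmetric])
 have 2: "(y ^^ j) ((x ^^ i) v) = (x ^^ i) ((y ^^ j) v)" for i j v by (induction j) (simp_all add: 1)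
 show "x (mon x y c d v) = mon x y (Suc c) d v" "y (mon x y c d v) = mon x y c (Suc d) v"
  by (simp_all add: mon_def 1)
 have "(y ^^ d) (x v) = x ((y ^^ d) v)" using 2[of d 1 v] by simp
 then show "mon x y c d (x v) = mon x y (Suc c) d v" by (simp add: mon_def funpow_swap1)
 show "mon x y c d (y v) = mon x y c (Suc d) v" by (simp add: mon_def funpow_swap1)
 show "mon x y c d (mon x y c' d' v) = mon x y (c + c') (d + d') v"
  by (simp add: mon_def 2 pow_pow)
qed

lemma mon_zero:
 assumes N: "nil2 n x y U"
 shows "n + 3 \<le> c ==> mon x y c d v = 0" "n + 3 \<le> d ==> mon x y c d v = 0"
  "v \<in> U ==> n + 2 \<le> c ==> n + 2 \<le> d ==> mon x y c d v = 0"
proof -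
 show 1: "mon x y c d v = 0" if "n + 3 \<le> c" for c d v
  unfolding mon_def by (rule pow_zero_mono[OF nil2D(1,7)[OF N] that])
 show 2: "mon x y c d v = 0" if "n + 3 \<le> d" for c d v
  using pow_zero_mono[OF nil2D(2,8)[OF N] that] lin_0[OF lin_pow[OF nil2D(1)[OF N]]] by (simp add: mon_def)
 assume "v \<in> U" "n + 2 \<le> c" "n + 2 \<le> d"
 then show "mon x y c d v = 0"
  using 1[of c d v] 2[of d c v] nil2D(9)[OF N, of v] by (cases "c = n + 2 \<and> d = n + 2") force+
qed

lemma mon_sub: assumes "nil2 n x y U" shows "mon x y c d 0 = 0" "mon x y c d (v + w) = mon x y c d v + mon x y c d w"
 "mon x y c d (- v) = - mon x y c d v" "mon x y c d (v - w) = mon x y c d v - mon x y c d w"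
 by (simp_all only: lin_simps[OF mon_lin[OF nil2D(1,2)[OF assms]]])

lemma jac_subspace: assumes N: "nil2 n x y U" shows "subspace (jac x y U)"
proof -
 have "jac x y U = {s + t |s t. s \<in> x ` U \<and> t \<in> y ` U}" by (auto simp: jac_def)
 then show ?thesis
  using subspace_sums[OF subspace_image[OF nil2D(1)[OF N] nil2D(4)[OF N]] subspace_image[OF nil2D(2)[OF N] nil2D(4)[OF N]]]
  by simp
qed

lemma jac_incl: assumes N: "nil2 n x y U" and "v \<in> U"
 shows "x v \<in> jac x y U" "y v \<in> jac x y U"
proof -
 have "0 \<in> U" by (rule subspace_0[OF nil2D(4)[OF N]])
 moreover have "x v = x v + y 0" "y v = x 0 + y v"
  by (simp_all add: lin_0[OF nil2D(1)[OF N]] lin_0[OF nil2D(2)[OF N]])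
 ultimately show "x v \<in> jac x y U" "y v \<in> jac x y U"
  unfolding jac_def using assms(2) by blast+
qed

lemma jac_sub: assumes N: "nil2 n x y U" shows "jac x y U \<subseteq> U"
 using nil2D(5,6)[OF N] subspace_add[OF nil2D(4)[OF N]] by (auto simp: jac_def)

text \<open>
The trace over an elementary group with two generators, written with \<open>x = g - 1\<close> and \<open>y = h - 1\<close>.
\<close>

definition dtr :: "nat => ('v => 'v) => ('v => 'v) => ('v => 'v) => ('v => 'v) => ('v => 'v) => 'v => 'v" where
 "dtr n x' y' x y \<phi> v = (\<Sum>c\<le>n + 2. \<Sum>d\<le>n + 2. mon x' y' (n + 2 - c) (n + 2 - d) (\<phi> (mon x y c d v)))"

lemma sum_point:
 assumes "c0 \<le> m" "d0 \<le> (m :: nat)" "\<And>c d. c \<le> m ==> d \<le> m ==> (c, d) \<noteq> (c0, d0) ==> f c d = (0 :: 'v)"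
 shows "(\<Sum>c\<le>m. \<Sum>d\<le>m. f c d) = f c0 d0"
proof -
 have "(\<Sum>c\<le>m. \<Sum>d\<le>m. f c d) = (\<Sum>c\<le>m. if c = c0 then f c0 d0 else 0)"
 proof (rule sum.cong[OF refl])
  fix c assume c: "c \<in> {..m}"
  have "(\<Sum>d\<le>m. f c d) = (\<Sum>d\<le>m. if d = d0 then (if c = c0 then f c0 d0 else 0) else 0)"
   by (rule sum.cong[OF refl]) (use assms(3) c in auto)
  then show "(\<Sum>d\<le>m. f c d) = (if c = c0 then f c0 d0 else 0)" using assms(2) by simp
 qed
 then show ?thesis using assms(1) by simp
qed

lemma sum_two_points:
 assumes "c0 \<le> m" "d0 \<le> m" "c1 \<le> m" "d1 \<le> (m :: nat)" "(c0, d0) \<noteq> (c1, d1)"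
  "\<And>c d. c \<le> m ==> d \<le> m ==> (c, d) \<noteq> (c0, d0) ==> (c, d) \<noteq> (c1, d1) ==> f c d = (0 :: 'v)"
 shows "(\<Sum>c\<le>m. \<Sum>d\<le>m. f c d) = f c0 d0 + f c1 d1"
proof -
 define g where "g c d = (if (c, d) = (c0, d0) then f c0 d0 else 0)" for c d
 define h where "h c d = (if (c, d) = (c1, d1) then f c1 d1 else 0)" for c d
 have "(\<Sum>c\<le>m. \<Sum>d\<le>m. f c d) = (\<Sum>c\<le>m. \<Sum>d\<le>m. g c d + h c d)"
  by (intro sum.cong[OF refl]) (use assms(5,6) in \<open>auto simp: g_def h_def\<close>)
 also have "\<dots> = (\<Sum>c\<le>m. \<Sum>d\<le>m. g c d) + (\<Sum>c\<le>m. \<Sum>d\<le>m. h c d)" by (simp add: sum.distrib)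
 also have "(\<Sum>c\<le>m. \<Sum>d\<le>m. g c d) = g c0 d0" by (rule sum_point[OF assms(1,2)]) (auto simp: g_def)
 also have "(\<Sum>c\<le>m. \<Sum>d\<le>m. h c d) = h c1 d1" by (rule sum_point[OF assms(3,4)]) (auto simp: h_def)
 finally show ?thesis by (simp add: g_def h_def)
qed

lemma dtr_monomials:
 assumes N: "nil2 n x y U" and N': "nil2 n x' y' U'" and A: "lin A" "\<And>v. A v \<in> U'" and v: "v \<in> U"
 shows "dtr n x' y' x y (%v. mon x' y' (n + 2) n (A v)) v =
   mon x' y' (n + 2) (n + 1) (A (mon x y (n + 2) (n + 1) v))"
  and "dtr n x' y' x y (%v. mon x' y' n (n + 2) (A v)) v =
   mon x' y' (n + 1) (n + 2) (A (mon x y (n + 1) (n + 2) v))"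
  and "dtr n x' y' x y (%v. mon x' y' (n + 1) (n + 1) (A v)) v =
   mon x' y' (n + 2) (n + 1) (A (mon x y (n + 1) (n + 2) v)) +
   mon x' y' (n + 1) (n + 2) (A (mon x y (n + 2) (n + 1) v))"
proof -
 note A0 = lin_0[OF A(1)] mon_sub(1)[OF N']
 have z: "mon x' y' (n + 2 - c) (n + 2 - d) (mon x' y' i j (A (mon x y c d v))) = 0"
  if "n + 3 \<le> n + 2 - c + i \<or> n + 3 \<le> n + 2 - d + j \<or> (n + 2 \<le> n + 2 - c + i \<and> n + 2 \<le> n + 2 - d + j) \<or> (c = n + 2 \<and> d = n + 2)"
  for c d i j
  unfolding mon_mult(5)[OF N']
  using that mon_zero(1)[OF N', of "n + 2 - c + i"] mon_zero(2)[OF N', of "n + 2 - d + j"]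
   mon_zero(3)[OF N' A(2), of "n + 2 - c + i" "n + 2 - d + j"] nil2D(9)[OF N v] A0 by metis
 have "dtr n x' y' x y (%v. mon x' y' (n + 2) n (A v)) v =
   mon x' y' (n + 2 - (n + 2)) (n + 2 - (n + 1)) (mon x' y' (n + 2) n (A (mon x y (n + 2) (n + 1) v)))"
  unfolding dtr_def by (rule sum_point) (simp, simp, rule z, simp only: prod.inject, arith)
 then show "dtr n x' y' x y (%v. mon x' y' (n + 2) n (A v)) v =
   mon x' y' (n + 2) (n + 1) (A (mon x y (n + 2) (n + 1) v))"
  by (simp add: mon_mult(5)[OF N'])
 have "dtr n x' y' x y (%v. mon x' y' n (n + 2) (A v)) v =
   mon x' y' (n + 2 - (n + 1)) (n + 2 - (n + 2)) (mon x' y' n (n + 2) (A (mon x y (n + 1) (n + 2) v)))"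
  unfolding dtr_def by (rule sum_point) (simp, simp, rule z, simp only: prod.inject, arith)
 then show "dtr n x' y' x y (%v. mon x' y' n (n + 2) (A v)) v =
   mon x' y' (n + 1) (n + 2) (A (mon x y (n + 1) (n + 2) v))"
  by (simp add: mon_mult(5)[OF N'])
 have "dtr n x' y' x y (%v. mon x' y' (n + 1) (n + 1) (A v)) v =
   mon x' y' (n + 2 - (n + 1)) (n + 2 - (n + 2)) (mon x' y' (n + 1) (n + 1) (A (mon x y (n + 1) (n + 2) v))) +
   mon x' y' (n + 2 - (n + 2)) (n + 2 - (n + 1)) (mon x' y' (n + 1) (n + 1) (A (mon x y (n + 2) (n + 1) v)))"
  unfolding dtr_def by (rule sum_two_points) (simp, simp, simp, simp, simp, rule z, simp only: prod.inject, arith)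
 then show "dtr n x' y' x y (%v. mon x' y' (n + 1) (n + 1) (A v)) v =
   mon x' y' (n + 2) (n + 1) (A (mon x y (n + 1) (n + 2) v)) +
   mon x' y' (n + 1) (n + 2) (A (mon x y (n + 2) (n + 1) v))"
  by (simp add: mon_mult(5)[OF N'])
qed

lemma dtr_add: assumes "nil2 n x' y' U'"
 shows "dtr n x' y' x y (%v. \<phi> v + \<psi> v) v = dtr n x' y' x y \<phi> v + dtr n x' y' x y \<psi> v"
 by (simp add: dtr_def mon_sub[OF assms] sum.distrib)

lemma dtr_eq_cyc:
 assumes N: "nil2 n x y U" and N': "nil2 n x' y' U'"
 shows "dtr n x' y' x y \<phi> v = cyc x' x (n + 3) (cyc y' y (n + 3) \<phi>) v"
proof -
 have "{..n + 2} = {..<n + 3}" by auto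
 moreover have "(y ^^ d) ((x ^^ c) v) = mon x y c d v" for c d
  using mon_mult(5)[OF N, of 0 d c 0 v] by (simp add: mon_def)
 ultimately show ?thesis
  unfolding dtr_def cyc_def lin_sum[OF lin_pow[OF nil2D(1)[OF N']]] by (simp add: mon_def)
qed

subsection \<open>Maps with trace form\<close>

lemma factor_through_pair:
 assumes h: "lin h1" "lin h2" and g: "lin g" and U: "subspace U"
  and ker: "\<And>u. u \<in> U ==> h1 u = 0 ==> h2 u = 0 ==> g u = 0"
 shows "\<exists>A B. lin A \<and> lin B \<and> (\<forall>u\<in>U. g u = A (h1 u) + B (h2 u))"
proof -
 have "subspace {u \<in> U. h1 u = 0}" using subspace_inter[OF U subspace_ker[OF h(1)]] by (simp add: Int_def)
 from factor_through[OF h(2) g this] ker obtain B where B: "lin B" "\<And>u. u \<in> U ==> h1 u = 0 ==> B (h2 u) = g u"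
  by auto
 have l: "lin (%u. g u - B (h2 u))" by (rule lin_sub[OF g lin_comp[OF B(1) h(2)]])
 from factor_through[OF h(1) l U] B(2) obtain A where A: "lin A" "\<And>u. u \<in> U ==> A (h1 u) = g u - B (h2 u)"
  by auto
 show ?thesis using A B by (intro exI[of _ A] exI[of _ B]) simp
qed

text \<open>
Vectors \<open>t\<close> for which \<open>\<alpha> t\<close> is \<open>x\<close> times a vector killed by \<open>y\<close>. If \<open>B\<close> takes good values, then \<open>\<alpha> B \<beta>\<close> is a trace.
\<close>

definition goodset where
 "goodset n x y U = {t \<in> U. \<exists>z\<in>U. mon x y (n + 2) (n + 1) t = x z \<and> y z = 0}"

lemma good_subspace: assumes N: "nil2 n x y U" shows "subspace (goodset n x y U)"
proof (rule subspaceI)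
 note U = nil2D(4)[OF N] and lx = nil2D(1)[OF N] and ly = nil2D(2)[OF N]
 show "0 \<in> goodset n x y U"
  unfolding goodset_def using subspace_0[OF U] mon_sub(1)[OF N] lin_0[OF lx] lin_0[OF ly] by (auto intro!: bexI[of _ 0])
 fix s t assume "s \<in> goodset n x y U" "t \<in> goodset n x y U"
 then obtain z w where zw: "s \<in> U" "t \<in> U" "z \<in> U" "mon x y (n + 2) (n + 1) s = x z" "y z = 0"
   "w \<in> U" "mon x y (n + 2) (n + 1) t = x w" "y w = 0" by (auto simp: goodset_def)
 then show "s + t \<in> goodset n x y U"
  unfolding goodset_def using subspace_add[OF U] by (auto simp: mon_sub[OF N] lin_add[OF lx] lin_add[OF ly] intro!: bexI[of _ "z + w"])
next
 fix c t
 note U = nil2D(4)[OF N] and lx = nil2D(1)[OF N] and ly = nil2D(2)[OF N]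
 assume "t \<in> goodset n x y U"
 then obtain z where z: "t \<in> U" "z \<in> U" "mon x y (n + 2) (n + 1) t = x z" "y z = 0" by (auto simp: goodset_def)
 then show "scale c t \<in> goodset n x y U"
  unfolding goodset_def using subspace_scale[OF U]
  by (auto simp: lin_scale[OF mon_lin[OF lx ly]] lin_scale[OF lx] lin_scale[OF ly] intro!: bexI[of _ "scale c z"])
qed

lemma goodI: "t \<in> U ==> z \<in> U ==> mon x y (n + 2) (n + 1) t = x z ==> y z = 0 ==> t \<in> goodset n x y U"
 by (auto simp: goodset_def)

lemma jac_good: assumes N: "nil2 n x y U" shows "jac x y U \<subseteq> goodset n x y U"
proof
 fix w assume "w \<in> jac x y U"
 then obtain s t where w: "w = x s + y t" "s \<in> U" "t \<in> U" by (auto simp: jac_def)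
 have "mon x y (n + 2) (n + 1) w = 0"
  using mon_zero(1)[OF N, of "Suc (n + 2)" "n + 1" s] mon_zero(3)[OF N w(3), of "n + 2" "Suc (n + 1)"]
  by (simp add: w(1) mon_sub[OF N] mon_mult[OF N])
 then show "w \<in> goodset n x y U"
  using nil2D(5,6)[OF N] w subspace_add[OF nil2D(4)[OF N]] subspace_0[OF nil2D(4)[OF N]] lin_0[OF nil2D(1)[OF N]] lin_0[OF nil2D(2)[OF N]]
  by (intro goodI[of _ _ 0]) auto
qed

lemma relation_good:
 assumes N: "nil2 n x y U" and s: "s \<in> U" "t \<in> U" "x s + y t = 0"
 shows "s \<in> goodset n x y U" "t \<in> goodset n x y U"
proof -
 have e: "x s = - y t" "y t = - x s" using s(3) by (simp_all add: eq_neg_iff_add_eq_0 add.commute)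
 have "mon x y (n + 2) (n + 1) s = mon x y (n + 1) (n + 1) (x s)" by (simp add: mon_mult[OF N])
 also have "\<dots> = - mon x y (n + 1) (n + 2) t" unfolding e(1) by (simp add: mon_mult[OF N] mon_sub[OF N])
 also have "\<dots> = x (- mon x y n (n + 2) t)" by (simp add: mon_mult[OF N] lin_minus[OF nil2D(1)[OF N]])
 finally have 1: "mon x y (n + 2) (n + 1) s = x (- mon x y n (n + 2) t)" .
 have "y (- mon x y n (n + 2) t) = 0"
  using mon_zero(2)[OF N, of "Suc (n + 2)" n t] by (simp add: mon_mult[OF N] lin_minus[OF nil2D(2)[OF N]])
 then show "s \<in> goodset n x y U"
  by (intro goodI[OF s(1) _ 1]) (auto intro!: subspace_neg[OF nil2D(4)[OF N]] mon_closed[OF N s(2)])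
 have "mon x y (n + 2) (n + 1) t = mon x y (n + 2) n (y t)" by (simp add: mon_mult[OF N])
 also have "\<dots> = - mon x y (Suc (n + 2)) n s" unfolding e(2) by (simp add: mon_mult[OF N] mon_sub[OF N])
 also have "\<dots> = 0" using mon_zero(1)[OF N, of "Suc (n + 2)" n s] by simp
 finally show "t \<in> goodset n x y U"
  using lin_0[OF nil2D(1)[OF N]] lin_0[OF nil2D(2)[OF N]] subspace_0[OF nil2D(4)[OF N]]
  by (intro goodI[OF s(2), of 0]) auto
qed

lemma top_relation_good:
 assumes N: "nil2 n x y U" and s: "s \<in> U" "t \<in> U"
  and 0: "mon x y (n + 2) (n + 1) s + mon x y (n + 1) (n + 2) t = 0"
 shows "s \<in> goodset n x y U" "t \<in> goodset n x y U"
proof -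
 define w where "w = mon x y (n + 1) (n + 1) t + mon x y (n + 2) n s"
 have U: "w \<in> U" unfolding w_def by (intro subspace_add[OF nil2D(4)[OF N]] mon_closed[OF N] s)
 have "x w = mon x y (n + 2) (n + 1) t"
  using mon_zero(1)[OF N, of "Suc (n + 2)" n s] by (simp add: w_def lin_add[OF nil2D(1)[OF N]] mon_mult[OF N])
 moreover have "y w = 0" using 0 by (simp add: w_def lin_add[OF nil2D(2)[OF N]] mon_mult[OF N] add.commute)
 ultimately show "t \<in> goodset n x y U" using U s by (intro goodI[of _ _ w]) auto
 have "mon x y (n + 2) (n + 1) s = x (- mon x y n (n + 2) t)"
  using 0 by (simp add: mon_mult[OF N] lin_minus[OF nil2D(1)[OF N]] eq_neg_iff_add_eq_0)
 moreover have "y (- mon x y n (n + 2) t) = 0"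
  using mon_zero(2)[OF N, of "Suc (n + 2)" n t] by (simp add: mon_mult[OF N] lin_minus[OF nil2D(2)[OF N]])
 ultimately show "s \<in> goodset n x y U"
  by (intro goodI[OF s(1)]) (auto intro!: subspace_neg[OF nil2D(4)[OF N]] mon_closed[OF N s(2)])
qed

end

section \<open>Maps of top degree\<close>

context kspace begin

text \<open>
On the common kernel of \<open>\<alpha>\<close> and \<open>\<beta>\<close> the values of \<open>a\<close> and \<open>b\<close> are good, so both may be assumed to vanish there and to factor
through \<open>\<alpha>\<close> and \<open>\<beta>\<close>. The resulting form in \<open>\<alpha>\<close> and \<open>\<beta>\<close> has a symmetric part, which is the trace of monomials, and a rest \<open>\<alpha> D \<beta>\<close>. The hypothesis on relations says that
\<open>D\<close> takes good values on the vectors \<open>\<beta> t\<close> with \<open>y t\<close> in the image of \<open>x\<close>; on a complement of these vectors \<open>\<alpha> D \<beta>\<close> is the trace of a map that vanishes on the image of \<open>x\<close>.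
\<close>

lemma top_map_is_dtr:
 assumes N: "nil2 n x y U" and N': "nil2 n x' y' U'"
  and lin: "lin a" "lin b" and rng: "\<And>v. a v \<in> U'" "\<And>v. b v \<in> U'"
  and kill: "\<And>v. v \<in> U ==> mon x y (n + 2) (n + 1) v = 0 ==> mon x y (n + 1) (n + 2) v = 0 ==>
   mon x' y' (n + 2) (n + 1) (a v) + mon x' y' (n + 1) (n + 2) (b v) = 0"
  and rel: "\<And>s t. s \<in> U ==> t \<in> U ==> x s + y t = 0 ==> a t + b s \<in> goodset n x' y' U'"
 shows "\<exists>\<phi>. lin \<phi> \<and> (\<forall>v. \<phi> v \<in> U') \<and>
  (\<forall>v\<in>U. mon x' y' (n + 2) (n + 1) (a v) + mon x' y' (n + 1) (n + 2) (b v) = dtr n x' y' x y \<phi> v)"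
proof -
 define \<alpha> where "\<alpha> = mon x y (n + 2) (n + 1)"
 define \<beta> where "\<beta> = mon x y (n + 1) (n + 2)"
 define \<alpha>' where "\<alpha>' = mon x' y' (n + 2) (n + 1)"
 define \<beta>' where "\<beta>' = mon x' y' (n + 1) (n + 2)"
 note U = nil2D(4)[OF N] and U' = nil2D(4)[OF N'] and lx = nil2D(1)[OF N] and ly = nil2D(2)[OF N]
  and lx' = nil2D(1)[OF N'] and ly' = nil2D(2)[OF N'] and xU = nil2D(5)[OF N] and yU = nil2D(6)[OF N]
 note gs = good_subspace[OF N']
 have l\<alpha>: "lin \<alpha>" "lin \<beta>" "lin \<alpha>'" "lin \<beta>'"
  unfolding \<alpha>_def \<beta>_def \<alpha>'_def \<beta>'_def by (rule mon_lin[OF lx ly] mon_lin[OF lx' ly'])+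
 obtain r where r: "lin r" "range r \<subseteq> U'" "\<And>v. v \<in> U' ==> r v = v" using retraction[OF U'] by auto
 have rU: "r v \<in> U'" for v using r(2) by auto
 \<comment> \<open>make \<open>a\<close> and \<open>b\<close> vanish on the common kernel of \<open>\<alpha>\<close> and \<open>\<beta>\<close>\<close>
 define W where "W = {v \<in> U. \<alpha> v = 0 \<and> \<beta> v = 0}"
 have sW: "subspace W"
 proof -
  have "W = U \<inter> ({v. \<alpha> v = 0} \<inter> {v. \<beta> v = 0})" by (auto simp: W_def)
  then show ?thesis using subspace_inter[OF U subspace_inter[OF subspace_ker[OF l\<alpha>(1)] subspace_ker[OF l\<alpha>(2)]]] by simp
 qed
 obtain \<pi> where \<pi>: "lin \<pi>" "range \<pi> \<subseteq> W" "\<And>v. v \<in> W ==> \<pi> v = v" using retraction[OF sW] by auto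
 have \<pi>W: "\<pi> v \<in> W" for v using \<pi>(2) by auto
 define a1 where "a1 v = a v - a (\<pi> v)" for v
 define b1 where "b1 v = b v - b (\<pi> v)" for v
 have la: "lin a1" "lin b1" unfolding a1_def[abs_def] b1_def[abs_def]
  by (rule lin_sub[OF lin(1) lin_comp[OF lin(1) \<pi>(1)]], rule lin_sub[OF lin(2) lin_comp[OF lin(2) \<pi>(1)]])
 have top: "\<alpha>' (a v) + \<beta>' (b v) = 0" if "v \<in> W" for v
  using kill that by (simp add: W_def \<alpha>_def \<beta>_def \<alpha>'_def \<beta>'_def)
 have ab1: "\<alpha>' (a v) + \<beta>' (b v) = \<alpha>' (a1 v) + \<beta>' (b1 v)" for v
  using top[OF \<pi>W[of v]]
  by (simp add: a1_def b1_def lin_diff[OF l\<alpha>(3)] lin_diff[OF l\<alpha>(4)]) (simp add: add_eq_0_iff)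
 have good\<pi>: "a (\<pi> v) \<in> goodset n x' y' U'" "b (\<pi> v) \<in> goodset n x' y' U'" for v
  using top_relation_good[OF N' rng(1) rng(2) top[OF \<pi>W[of v], unfolded \<alpha>'_def \<beta>'_def]] by auto
 have rel1: "a1 t + b1 s \<in> goodset n x' y' U'" if "s \<in> U" "t \<in> U" "x s + y t = 0" for s t
 proof -
  have "a1 t + b1 s = (a t + b s) - (a (\<pi> t) + b (\<pi> s))" by (simp add: a1_def b1_def)
  then show ?thesis using subspace_diff[OF gs rel[OF that] subspace_add[OF gs good\<pi>(1)[of t] good\<pi>(2)[of s]]] by simp
 qed
 have split: "\<exists>A B. lin A \<and> lin B \<and> (\<forall>v. A v \<in> U') \<and> (\<forall>v. B v \<in> U') \<and> (\<forall>u\<in>U. f u = A (\<alpha> u) + B (\<beta> u))"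
  if f: "lin f" "\<And>v. f v \<in> U'" "\<And>v. v \<in> W ==> f v = 0" for f
 proof -
  obtain A B where AB: "lin A" "lin B" "\<And>u. u \<in> U ==> f u = A (\<alpha> u) + B (\<beta> u)"
   using factor_through_pair[OF l\<alpha>(1,2) f(1) U] f(3) by (auto simp: W_def)
  have "f u = r (A (\<alpha> u)) + r (B (\<beta> u))" if "u \<in> U" for u
   using r(3)[OF f(2)[of u]] by (simp add: AB(3)[OF that] lin_add[OF r(1)])
  then show ?thesis using lin_comp[OF r(1) AB(1)] lin_comp[OF r(1) AB(2)] rU
   by (intro exI[of _ "%v. r (A v)"] exI[of _ "%v. r (B v)"]) auto
 qed
 have a1U: "a1 v \<in> U'" "b1 v \<in> U'" for v
  unfolding a1_def b1_def using rng subspace_diff[OF U'] by auto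
 have a1W: "a1 v = 0" "b1 v = 0" if "v \<in> W" for v using \<pi>(3)[OF that] by (simp_all add: a1_def b1_def)
 obtain A B where A: "lin A" "lin B" "\<And>v. A v \<in> U'" "\<And>v. B v \<in> U'" "\<And>u. u \<in> U ==> a1 u = A (\<alpha> u) + B (\<beta> u)"
  using split[OF la(1) a1U(1) a1W(1)] by metis
 obtain B' C where B': "lin B'" "lin C" "\<And>v. B' v \<in> U'" "\<And>v. C v \<in> U'" "\<And>u. u \<in> U ==> b1 u = B' (\<alpha> u) + C (\<beta> u)"
  using split[OF la(2) a1U(2) a1W(2)] by metis
 \<comment> \<open>remove the symmetric part\<close>
 define D where "D v = B v - B' v" for v
 have lD: "lin D" unfolding D_def[abs_def] by (rule lin_sub[OF A(2) B'(1)])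
 have DU: "D v \<in> U'" for v unfolding D_def using A(4) B'(3) by (rule subspace_diff[OF U'])
 define \<phi>1 where "\<phi>1 v = mon x' y' (n + 2) n (A v) + (mon x' y' (n + 1) (n + 1) (B' v) + mon x' y' n (n + 2) (C v))" for v
 have l\<phi>1: "lin \<phi>1" unfolding \<phi>1_def[abs_def]
  by (rule lin_plus[OF lin_comp[OF mon_lin[OF lx' ly'] A(1)] lin_plus[OF lin_comp[OF mon_lin[OF lx' ly'] B'(1)] lin_comp[OF mon_lin[OF lx' ly'] B'(2)]]])
 have \<phi>1U: "\<phi>1 v \<in> U'" for v
  unfolding \<phi>1_def by (intro subspace_add[OF U'] mon_closed[OF N'] A(3) B'(3,4))
 have \<phi>1: "\<alpha>' (a v) + \<beta>' (b v) = dtr n x' y' x y \<phi>1 v + \<alpha>' (D (\<beta> v))" if v: "v \<in> U" for v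
 proof -
  have "dtr n x' y' x y \<phi>1 v = \<alpha>' (A (\<alpha> v)) + ((\<alpha>' (B' (\<beta> v)) + \<beta>' (B' (\<alpha> v))) + \<beta>' (C (\<beta> v)))"
   unfolding \<phi>1_def dtr_add[OF N'] dtr_monomials(1)[OF N N' A(1,3) v] dtr_monomials(2)[OF N N' B'(2,4) v]
    dtr_monomials(3)[OF N N' B'(1,3) v] \<alpha>_def \<beta>_def \<alpha>'_def \<beta>'_def ..
  moreover have "\<alpha>' (a v) + \<beta>' (b v) = (\<alpha>' (A (\<alpha> v)) + \<alpha>' (B (\<beta> v))) + (\<beta>' (B' (\<alpha> v)) + \<beta>' (C (\<beta> v)))"
   unfolding ab1 A(5)[OF v] B'(5)[OF v] lin_add[OF l\<alpha>(3)] lin_add[OF l\<alpha>(4)] ..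
  ultimately show ?thesis by (simp add: D_def lin_diff[OF l\<alpha>(3)])
 qed
 have D_good: "D (\<beta> t) \<in> goodset n x' y' U'" if st: "s \<in> U" "t \<in> U" "x s + y t = 0" for s t
 proof -
  have e: "x s = - y t" "y t = - x s" using st(3) by (simp_all add: eq_neg_iff_add_eq_0 add.commute)
  have "\<alpha> t = mon x y (n + 2) n (y t)" by (simp add: \<alpha>_def mon_mult[OF N])
  also have "\<dots> = - mon x y (Suc (n + 2)) n s" unfolding e(2) by (simp add: mon_mult[OF N] mon_sub[OF N])
  finally have 1: "\<alpha> t = 0" using mon_zero(1)[OF N, of "Suc (n + 2)" n s] by simp
  have "\<beta> s = mon x y n (n + 2) (x s)" by (simp add: \<beta>_def mon_mult[OF N])
  also have "\<dots> = - mon x y n (Suc (n + 2)) t" unfolding e(1) by (simp add: mon_mult[OF N] mon_sub[OF N])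
  finally have 2: "\<beta> s = 0" using mon_zero(2)[OF N, of "Suc (n + 2)" n t] by simp
  have "\<alpha> s = mon x y (n + 1) (n + 1) (x s)" by (simp add: \<alpha>_def mon_mult[OF N])
  also have "\<dots> = - \<beta> t" unfolding e(1) by (simp add: \<beta>_def mon_mult[OF N] mon_sub[OF N])
  finally have 3: "\<alpha> s = - \<beta> t" .
  have "a1 t + b1 s = B (\<beta> t) - B' (\<beta> t)"
   unfolding A(5)[OF st(2)] B'(5)[OF st(1)] 1 2 3 by (simp add: lin_0[OF A(1)] lin_0[OF B'(2)] lin_minus[OF B'(1)])
  then show ?thesis using rel1[OF st] by (simp add: D_def)
 qed
 \<comment> \<open>split \<open>D\<close> along the values of \<open>\<beta>\<close> on relations\<close>
 define Y where "Y = \<beta> ` {t \<in> U. y t \<in> x ` U}"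
 have sxU: "subspace (x ` U)" by (rule subspace_image[OF lx U])
 have Ygood: "D z \<in> goodset n x' y' U'" if z: "z \<in> Y" for z
 proof -
  obtain t s where t: "t \<in> U" "s \<in> U" "y t = x s" "z = \<beta> t" using z by (auto simp: Y_def)
  show ?thesis unfolding t(4) by (rule D_good[of "- s"]) (use t subspace_neg[OF U] in \<open>simp_all add: lin_minus[OF lx]\<close>)
 qed
 have sY: "subspace Y" unfolding Y_def
 proof (rule subspace_image[OF l\<alpha>(2)])
  show "subspace {t \<in> U. y t \<in> x ` U}"
   using subspace_0[OF U] subspace_add[OF U] subspace_scale[OF U] subspace_0[OF sxU] subspace_add[OF sxU] subspace_scale[OF sxU]
   by (intro subspaceI) (auto simp: lin_0[OF ly] lin_add[OF ly] lin_scale[OF ly])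
 qed
 obtain rh where rh: "lin rh" "range rh \<subseteq> Y" "\<And>v. v \<in> Y ==> rh v = v" using retraction[OF sY] by auto
 define D2 where "D2 v = D (rh v)" for v
 define D1 where "D1 v = D v - D2 v" for v
 have lD2: "lin D2" unfolding D2_def[abs_def] by (rule lin_comp[OF lD rh(1)])
 have lD1: "lin D1" unfolding D1_def[abs_def] by (rule lin_sub[OF lD lD2])
 have D1U: "D1 v \<in> U'" for v unfolding D1_def D2_def using DU by (intro subspace_diff[OF U']) auto
 have D1Y: "D1 v = 0" if "v \<in> Y" for v using rh(3)[OF that] by (simp add: D1_def D2_def)
 have D2g: "D2 v \<in> goodset n x' y' U'" for v unfolding D2_def using rh(2) by (intro Ygood) auto
 \<comment> \<open>the part vanishing on relations\<close>
 obtain \<tau> where \<tau>: "lin \<tau>" "\<And>v. \<tau> (\<tau> v) = \<tau> v" "\<And>v. \<tau> v = 0 \<longleftrightarrow> v \<in> x ` U"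
  using projection_along[OF sxU] by auto
 obtain L where L: "lin L" "\<And>u. u \<in> U ==> L (\<tau> (y u)) = D1 (\<beta> u)"
 proof -
  have "\<exists>L. lin L \<and> (\<forall>u\<in>U. L (\<tau> (y u)) = D1 (\<beta> u))"
  proof (rule factor_through[OF lin_comp[OF \<tau>(1) ly] lin_comp[OF lD1 l\<alpha>(2)] U])
   fix u assume "u \<in> U" "\<tau> (y u) = 0"
   then show "D1 (\<beta> u) = 0" by (intro D1Y) (simp add: Y_def \<tau>(3))
  qed
  then show ?thesis using that by blast
 qed
 define \<eta> where "\<eta> v = r (L (\<tau> v))" for v
 have l\<eta>: "lin \<eta>" unfolding \<eta>_def[abs_def] by (rule lin_comp[OF r(1) lin_comp[OF L(1) \<tau>(1)]])
 have \<eta>U: "\<eta> v \<in> U'" for v by (simp add: \<eta>_def rU)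
 have \<eta>x: "\<eta> (x v) = 0" if "v \<in> U" for v
 proof -
  have "\<tau> (x v) = 0" using that by (simp add: \<tau>(3))
  then show ?thesis by (simp add: \<eta>_def lin_0[OF L(1)] lin_0[OF r(1)])
 qed
 have \<eta>y: "\<eta> (y v) = D1 (\<beta> v)" if "v \<in> U" for v using L(2)[OF that] r(3)[OF D1U] by (simp add: \<eta>_def)
 have \<eta>: "dtr n x' y' x y \<eta> v = \<alpha>' (D1 (\<beta> v))" if v: "v \<in> U" for v
 proof -
  have "dtr n x' y' x y \<eta> v = mon x' y' (n + 2 - 0) (n + 2 - 1) (\<eta> (mon x y 0 1 v))"
   unfolding dtr_def
  proof (rule sum_point)
   fix c d assume cd: "c \<le> n + 2" "d \<le> n + 2" "(c, d) \<noteq> (0, 1)"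
   show "mon x' y' (n + 2 - c) (n + 2 - d) (\<eta> (mon x y c d v)) = 0"
   proof (cases c)
    case (Suc c')
    then have "\<eta> (mon x y c d v) = \<eta> (x (mon x y c' d v))" by (simp add: mon_mult[OF N])
    also have "\<dots> = 0" by (rule \<eta>x[OF mon_closed[OF N v]])
    finally show ?thesis by (simp add: mon_sub[OF N'])
   next
    case c0: 0
    show ?thesis
    proof (cases d)
     case 0
     then show ?thesis using mon_zero(3)[OF N' \<eta>U] c0 by simp
    next
     case (Suc d')
     then obtain d'' where d: "d = Suc (Suc d'')" using cd c0 by (cases d') auto
     have "\<eta> (mon x y c d v) = \<eta> (y (mon x y 0 (Suc d'') v))" by (simp add: mon_mult[OF N] c0 d)
     also have "\<dots> = D1 (\<beta> (mon x y 0 (Suc d'') v))" by (rule \<eta>y[OF mon_closed[OF N v]])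
     also have "\<beta> (mon x y 0 (Suc d'') v) = mon x y (n + 1) (n + 2 + Suc d'') v" by (simp add: \<beta>_def mon_mult[OF N])
     also have "\<dots> = 0" by (rule mon_zero(2)[OF N]) simp
     finally show ?thesis by (simp add: lin_0[OF lD1] mon_sub[OF N'])
    qed
   qed
  qed auto
  also have "mon x y 0 1 v = y v" by (simp add: mon_def)
  finally show ?thesis using \<eta>y[OF v] by (simp add: \<alpha>'_def)
 qed
 \<comment> \<open>the part with good values\<close>
 define Z where "Z = {z \<in> U'. y' z = 0}"
 have sZ: "subspace Z" unfolding Z_def using subspace_inter[OF U' subspace_ker[OF ly']] by (simp add: Int_def)
 have "range (%v. \<alpha>' (D2 v)) \<subseteq> x' ` Z"
  using D2g by (auto simp: goodset_def Z_def \<alpha>'_def image_iff)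
 then obtain \<chi> where \<chi>: "lin \<chi>" "range \<chi> \<subseteq> Z" "\<And>v. x' (\<chi> v) = \<alpha>' (D2 v)"
  using lift_through[OF lx' lin_comp[OF l\<alpha>(3) lD2] sZ] by auto
 have \<chi>Z: "\<chi> v \<in> U'" "y' (\<chi> v) = 0" for v using \<chi>(2) by (auto simp: Z_def)
 have \<chi>d: "dtr n x' y' x y \<chi> v = \<alpha>' (D2 (\<beta> v))" if v: "v \<in> U" for v
 proof -
  have "dtr n x' y' x y \<chi> v = mon x' y' (n + 2 - (n + 1)) (n + 2 - (n + 2)) (\<chi> (mon x y (n + 1) (n + 2) v))"
   unfolding dtr_def
  proof (rule sum_point)
   fix c d assume cd: "c \<le> n + 2" "d \<le> n + 2" "(c, d) \<noteq> (n + 1, n + 2)"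
   show "mon x' y' (n + 2 - c) (n + 2 - d) (\<chi> (mon x y c d v)) = 0"
   proof (cases "d = n + 2")
    case False
    then obtain k where "n + 2 - d = Suc k" using cd(2) by (cases "n + 2 - d") auto
    then have "mon x' y' (n + 2 - c) (n + 2 - d) (\<chi> (mon x y c d v)) =
      mon x' y' (n + 2 - c) k (y' (\<chi> (mon x y c d v)))" by (simp add: mon_mult[OF N'])
    then show ?thesis by (simp add: \<chi>Z mon_sub[OF N'])
   next
    case d: True
    show ?thesis
    proof (cases "c = n + 2")
     case True
     then show ?thesis using nil2D(9)[OF N v] d by (simp add: lin_0[OF \<chi>(1)] mon_sub[OF N'])
    next
     case False
     then obtain k where k: "n + 2 - c = Suc (Suc k)" using cd d by (cases "n + 2 - c"; cases "n + 2 - c - 1") auto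
     have "mon x' y' (n + 2 - c) (n + 2 - d) (\<chi> (mon x y c d v)) =
      mon x' y' (Suc k) (n + 2 - d) (x' (\<chi> (mon x y c d v)))" unfolding k by (simp only: mon_mult[OF N'])
     also have "\<dots> = mon x' y' (Suc k + (n + 2)) (n + 2 - d + (n + 1)) (D2 (mon x y c d v))"
      by (simp only: \<chi>(3) \<alpha>'_def mon_mult(5)[OF N'])
     also have "\<dots> = 0" by (rule mon_zero(1)[OF N']) simp
     finally show ?thesis .
    qed
   qed
  qed auto
  also have "\<dots> = x' (\<chi> (\<beta> v))" by (simp add: mon_def \<beta>_def)
  finally show ?thesis by (simp add: \<chi>(3))
 qed
 show ?thesis
 proof (intro exI[of _ "%v. \<phi>1 v + (\<eta> v + \<chi> v)"] conjI allI ballI)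
  show "lin (%v. \<phi>1 v + (\<eta> v + \<chi> v))" by (rule lin_plus[OF l\<phi>1 lin_plus[OF l\<eta> \<chi>(1)]])
  show "\<phi>1 v + (\<eta> v + \<chi> v) \<in> U'" for v by (intro subspace_add[OF U'] \<phi>1U \<eta>U \<chi>Z)
  fix v assume v: "v \<in> U"
  have "\<alpha>' (D (\<beta> v)) = \<alpha>' (D1 (\<beta> v)) + \<alpha>' (D2 (\<beta> v))" by (simp add: D1_def lin_diff[OF l\<alpha>(3)])
  then show "mon x' y' (n + 2) (n + 1) (a v) + mon x' y' (n + 1) (n + 2) (b v) = dtr n x' y' x y (%v. \<phi>1 v + (\<eta> v + \<chi> v)) v"
   using \<phi>1[OF v] by (simp add: dtr_add[OF N'] \<eta>[OF v] \<chi>d[OF v] \<alpha>'_def \<beta>'_def)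
 qed
qed

end

section \<open>Composites of ghost-like maps\<close>

context kspace begin

definition nhom :: "('v => 'v) => ('v => 'v) => 'v set => ('v => 'v) => ('v => 'v) => 'v set => ('v => 'v) => bool" where
 "nhom x y U x' y' U' F \<longleftrightarrow> lin F \<and> (\<forall>v. F (x v) = x' (F v) \<and> F (y v) = y' (F v)) \<and> (\<forall>v\<in>U. F v \<in> U')"

lemma nhomD: assumes "nhom x y U x' y' U' F"
 shows "lin F" "F (x v) = x' (F v)" "F (y v) = y' (F v)" "v \<in> U ==> F v \<in> U'" "F (mon x y c d v) = mon x' y' c d (F v)"
proof -
 show 1: "lin F" "F (x v) = x' (F v)" "F (y v) = y' (F v)" "v \<in> U ==> F v \<in> U'" for v
  using assms by (auto simp: nhom_def)
 show "F (mon x y c d v) = mon x' y' c d (F v)"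
  unfolding mon_def pow_intertwine[of F x x', OF 1(2)] pow_intertwine[of F y y', OF 1(3)] ..
qed

definition relation :: "('v => 'v) => ('v => 'v) => 'v set => 'v => 'v => bool" where
 "relation x y U s t \<longleftrightarrow> s \<in> U \<and> t \<in> U \<and> x s + y t = 0"

text \<open>
The conditions come from the Tate cohomology of \<open>k\<close> in degrees \<open>0\<close>, \<open>-1\<close> and \<open>-2\<close>, in this order, for a ghost with values in the kernel of the norm.
\<close>

definition nghost :: "nat => ('v => 'v) => ('v => 'v) => 'v set => ('v => 'v) => ('v => 'v) => 'v set => ('v => 'v) => bool" where
 "nghost n x y U x' y' U' F \<longleftrightarrow> nhom x y U x' y' U' F \<and>
  (\<forall>v\<in>U. x v = 0 --> y v = 0 --> F v = 0) \<and>
  (\<forall>v\<in>U. \<exists>s\<in>U'. \<exists>t\<in>U'. F v = x' s + y' t) \<and>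
  (\<forall>s t. relation x y U s t --> (\<exists>w\<in>U'. \<exists>m\<in>U'. \<exists>m'\<in>U'.
   F s = y' w + (x' ^^ (n + 2)) m \<and> F t = - x' w + (y' ^^ (n + 2)) m'))"

definition kills :: "nat => ('v => 'v) => ('v => 'v) => 'v set => ('v => 'v) => bool" where
 "kills j x y U C \<longleftrightarrow> (\<forall>v\<in>U. (\<forall>c d. c + d = j --> mon x y c d v = 0) --> C v = 0)"

text \<open>
The coefficients \<open>u\<close> are indexed by integers to avoid boundary cases; they vanish outside \<open>0, \<dots>, j\<close>. Applied to a relation \<open>(s, t)\<close> the combinations \<open>u c t + u (c - 1) s\<close> are,
modulo the radical, again made of components of relations.
\<close>

definition expands :: "nat => ('v => 'v) => ('v => 'v) => 'v set => ('v => 'v) => ('v => 'v) => 'v set => ('v => 'v) => bool" where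
 "expands j x y U x' y' U' C \<longleftrightarrow> (\<exists>u :: int => 'v => 'v. (\<forall>c. lin (u c)) \<and> (\<forall>c v. u c v \<in> U') \<and>
  (\<forall>c v. c < 0 \<or> int j < c --> u c v = 0) \<and>
  (\<forall>v\<in>U. C v = (\<Sum>c\<le>j. mon x' y' c (j - c) (u (int c) v))) \<and>
  (\<forall>s t. relation x y U s t --> (\<exists>\<nu> \<nu>'. \<forall>c. relation x' y' U' (\<nu> c) (\<nu>' c) \<and>
   u c t + u (c - 1) s - (\<nu>' c + \<nu> (c - 1)) \<in> jac x' y' U')))"

lemma relationD: "relation x y U s t ==> s \<in> U" "relation x y U s t ==> t \<in> U" "relation x y U s t ==> x s + y t = 0"
 by (auto simp: relation_def)

lemma relation_add: assumes "nil2 n x y U" "relation x y U s t" "relation x y U s' t'"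
 shows "relation x y U (s + s') (t + t')"
 using assms subspace_add[OF nil2D(4)[OF assms(1)]]
 by (auto simp: relation_def lin_add[OF nil2D(1)[OF assms(1)]] lin_add[OF nil2D(2)[OF assms(1)]])
  (metis add.assoc add.left_commute add.right_neutral)

lemma kills_Suc:
 assumes N: "nil2 n x y U" and C: "nhom x y U x1 y1 U1 C" "kills j x y U C" and F: "nghost n x1 y1 U1 x2 y2 U2 F"
 shows "kills (Suc j) x y U (%v. F (C v))"
 unfolding kills_def
proof (intro ballI impI)
 fix v assume v: "v \<in> U" "\<forall>c d. c + d = Suc j --> mon x y c d v = 0"
 have "C (x v) = 0" "C (y v) = 0"
  using C(2) nil2D(5,6)[OF N v(1)] v(2) by (auto simp: kills_def mon_mult[OF N])
 then show "F (C v) = 0" using F nhomD[OF C(1)] v(1) by (auto simp: nghost_def)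
qed

lemma expands_0:
 assumes N: "nil2 n x y U" and N': "nil2 n x' y' U'" and C: "nhom x y U x' y' U' C"
 shows "expands 0 x y U x' y' U' C"
proof -
 obtain \<pi> where \<pi>: "lin \<pi>" "range \<pi> \<subseteq> U" "\<And>v. v \<in> U ==> \<pi> v = v" using retraction[OF nil2D(4)[OF N]] by auto
 define u where "u c = (if c = 0 then (%v. C (\<pi> v)) else (%v. 0))" for c :: int
 have z: "0 \<in> U'" "0 \<in> jac x' y' U'" by (rule subspace_0[OF nil2D(4)[OF N']] subspace_0[OF jac_subspace[OF N']])+
 show ?thesis
  unfolding expands_def
 proof (intro exI[of _ u] conjI allI impI ballI)
  show "lin (u c)" for c unfolding u_def using lin_comp[OF nhomD(1)[OF C] \<pi>(1)] by simp
  show "u c v \<in> U'" for c v unfolding u_def using z \<pi>(2) nhomD(4)[OF C] by auto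
  show "u c v = 0" if "c < 0 \<or> int 0 < c" for c v using that by (auto simp: u_def)
  show "C v = (\<Sum>c\<le>0. mon x' y' c (0 - c) (u (int c) v))" if "v \<in> U" for v
   using \<pi>(3)[OF that] by (simp add: u_def mon_0)
  fix s t assume st: "relation x y U s t"
  have r: "relation x' y' U' (C s) (C t)"
   using st nhomD(4)[OF C] lin_add[OF nhomD(1)[OF C], of "x s" "y t"] lin_0[OF nhomD(1)[OF C]]
   by (auto simp: relation_def nhomD(2,3)[OF C])
  have r0: "relation x' y' U' 0 0" using z by (simp add: relation_def lin_0[OF nil2D(1)[OF N']] lin_0[OF nil2D(2)[OF N']])
  show "\<exists>\<nu> \<nu>'. \<forall>c. relation x' y' U' (\<nu> c) (\<nu>' c) \<and> u c t + u (c - 1) s - (\<nu>' c + \<nu> (c - 1)) \<in> jac x' y' U'"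
   using r r0 z \<pi>(3)[OF relationD(1)[OF st]] \<pi>(3)[OF relationD(2)[OF st]]
   by (intro exI[of _ "%c. if c = 0 then C s else 0"] exI[of _ "%c. if c = 0 then C t else 0"]) (auto simp: u_def)
 qed
qed

lemma relation_image:
 assumes N: "nil2 n x1 y1 U1" and N': "nil2 n x2 y2 U2" and F: "nghost n x1 y1 U1 x2 y2 U2 F"
  and XY: "\<And>v. X v \<in> U2" "\<And>v. Y v \<in> U2" "\<And>v. v \<in> U1 ==> F v = x2 (X v) + y2 (Y v)"
  and r: "relation x1 y1 U1 s t"
 shows "\<exists>a a' b b'. relation x2 y2 U2 a a' \<and> relation x2 y2 U2 b b' \<and> X s - a \<in> jac x2 y2 U2 \<and>
  Y s + X t - (a' + b) \<in> jac x2 y2 U2 \<and> Y t - b' \<in> jac x2 y2 U2"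
proof -
 note lx = nil2D(1)[OF N'] and ly = nil2D(2)[OF N'] and U = nil2D(4)[OF N']
 obtain w m m' where w: "w \<in> U2" "m \<in> U2" "m' \<in> U2" "F s = y2 w + (x2 ^^ (n + 2)) m" "F t = - x2 w + (y2 ^^ (n + 2)) m'"
  using F r unfolding nghost_def by blast
 define q where "q = (x2 ^^ Suc n) m"
 define q' where "q' = (y2 ^^ Suc n) m'"
 have q: "q \<in> U2" "q' \<in> U2" "(x2 ^^ n) m \<in> U2" "(y2 ^^ n) m' \<in> U2"
 proof -
  have "(x2 ^^ k) m \<in> U2" "(y2 ^^ k) m' \<in> U2" for k
   using pow_closed[of U2 x2 m k] pow_closed[of U2 y2 m' k] nil2D(5,6)[OF N'] w by blast+
  then show "q \<in> U2" "q' \<in> U2" "(x2 ^^ n) m \<in> U2" "(y2 ^^ n) m' \<in> U2" unfolding q_def q'_def by blast+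
 qed
 have e: "x2 (X s) + y2 (Y s) = y2 w + x2 q" "x2 (X t) + y2 (Y t) = - x2 w + y2 q'"
  using XY(3)[OF relationD(1)[OF r]] XY(3)[OF relationD(2)[OF r]] w(4,5) by (simp_all add: q_def q'_def)
 have "x2 (X s - q) + y2 (Y s - w) = 0" "x2 (X t + w) + y2 (Y t - q') = 0"
  using e by (simp_all add: lin_diff[OF lx] lin_diff[OF ly] lin_add[OF lx] algebra_simps)
 then have "relation x2 y2 U2 (X s - q) (Y s - w)" "relation x2 y2 U2 (X t + w) (Y t - q')"
  unfolding relation_def using XY(1,2) w q subspace_add[OF U] subspace_diff[OF U] by auto
 moreover have "q \<in> jac x2 y2 U2" "q' \<in> jac x2 y2 U2"
  using jac_incl(1)[OF N' q(3)] jac_incl(2)[OF N' q(4)] by (simp_all add: q_def q'_def)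
 moreover have "0 \<in> jac x2 y2 U2" by (rule subspace_0[OF jac_subspace[OF N']])
 ultimately show ?thesis
  by (intro exI[of _ "X s - q"] exI[of _ "Y s - w"] exI[of _ "X t + w"] exI[of _ "Y t - q'"]) (auto simp: algebra_simps)
qed

lemma jac_image:
 assumes N: "nil2 n x1 y1 U1" and N': "nil2 n x2 y2 U2" and F: "nghost n x1 y1 U1 x2 y2 U2 F"
  and XY: "\<And>v. X v \<in> U2" "\<And>v. Y v \<in> U2" "\<And>v. v \<in> U1 ==> F v = x2 (X v) + y2 (Y v)"
  and d: "\<delta> \<in> jac x1 y1 U1"
 shows "\<exists>a a'. relation x2 y2 U2 a a' \<and> X \<delta> - a \<in> jac x2 y2 U2 \<and> Y \<delta> - a' \<in> jac x2 y2 U2"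
proof -
 note lx = nil2D(1)[OF N'] and ly = nil2D(2)[OF N'] and U = nil2D(4)[OF N']
 have Fh: "nhom x1 y1 U1 x2 y2 U2 F" using F by (simp add: nghost_def)
 obtain s t where st: "s \<in> U1" "t \<in> U1" "\<delta> = x1 s + y1 t" using d by (auto simp: jac_def)
 have dU: "\<delta> \<in> U1" using d jac_sub[OF N] by auto
 have J: "F v \<in> jac x2 y2 U2" if "v \<in> U1" for v using F that unfolding nghost_def jac_def by blast
 have "x2 (X \<delta>) + y2 (Y \<delta>) = x2 (F s) + y2 (F t)"
  unfolding XY(3)[OF dU, symmetric] by (simp add: st(3) lin_add[OF nhomD(1)[OF Fh]] nhomD(2,3)[OF Fh])
 then have "relation x2 y2 U2 (X \<delta> - F s) (Y \<delta> - F t)"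
  unfolding relation_def using XY(1,2) nhomD(4)[OF Fh] st subspace_diff[OF U]
  by (auto simp: lin_diff[OF lx] lin_diff[OF ly] algebra_simps)
 then show ?thesis using J st by (intro exI[of _ "X \<delta> - F s"] exI[of _ "Y \<delta> - F t"]) auto
qed

text \<open>
If a ghost is written as \<open>x X + y Y\<close>, then \<open>u\<close> becomes \<open>X u (c - 1) + Y u c\<close>. The terms \<open>y w\<close> and \<open>- x w\<close> that a ghost produces from a relation cancel between
neighbouring indices; this is what makes the invariant reproduce itself.
\<close>

lemma expands_Suc:
 assumes N: "nil2 n x1 y1 U1" and N': "nil2 n x2 y2 U2" and C: "expands j x y U x1 y1 U1 C"
  and F: "nghost n x1 y1 U1 x2 y2 U2 F"
 shows "expands (Suc j) x y U x2 y2 U2 (%v. F (C v))"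
proof -
 note U1 = nil2D(4)[OF N] and U2 = nil2D(4)[OF N'] and sJ = jac_subspace[OF N']
 have Fh: "nhom x1 y1 U1 x2 y2 U2 F" using F by (simp add: nghost_def)
 obtain \<pi> where \<pi>: "lin \<pi>" "range \<pi> \<subseteq> U1" "\<And>v. v \<in> U1 ==> \<pi> v = v" using retraction[OF U1] by auto
 have "\<exists>s\<in>U2. \<exists>t\<in>U2. F (\<pi> v) = x2 s + y2 t" for v using F \<pi>(2) unfolding nghost_def by blast
 then obtain X Y where XY: "lin X" "lin Y" "range X \<subseteq> U2" "range Y \<subseteq> U2" "\<And>v. F (\<pi> v) = x2 (X v) + y2 (Y v)"
  using lift_through_sum[OF nil2D(1)[OF N'] nil2D(2)[OF N'] lin_comp[OF nhomD(1)[OF Fh] \<pi>(1)] U2] by blast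
 have X: "\<And>v. X v \<in> U2" "\<And>v. Y v \<in> U2" using XY(3,4) by auto
 have FXY: "F v = x2 (X v) + y2 (Y v)" if "v \<in> U1" for v using XY(5)[of v] \<pi>(3)[OF that] by simp
 obtain u :: "int => 'v => 'v" where u: "\<And>c. lin (u c)" "\<And>c v. u c v \<in> U1" "\<And>c v. c < 0 \<or> int j < c ==> u c v = 0"
  "\<And>v. v \<in> U ==> C v = (\<Sum>c\<le>j. mon x1 y1 c (j - c) (u (int c) v))"
  and ur: "\<And>s t. relation x y U s t ==> \<exists>\<nu> \<nu>'. \<forall>c. relation x1 y1 U1 (\<nu> c) (\<nu>' c) \<and>
   u c t + u (c - 1) s - (\<nu>' c + \<nu> (c - 1)) \<in> jac x1 y1 U1"
  using C unfolding expands_def by blast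
 define u' where "u' c v = X (u (c - 1) v) + Y (u c v)" for c v
 show ?thesis
  unfolding expands_def
 proof (intro exI[of _ u'] conjI allI impI ballI)
  show "lin (u' c)" for c unfolding u'_def[abs_def] by (rule lin_plus[OF lin_comp[OF XY(1) u(1)] lin_comp[OF XY(2) u(1)]])
  show "u' c v \<in> U2" for c v unfolding u'_def using X by (intro subspace_add[OF U2]) auto
  show "u' c v = 0" if "c < 0 \<or> int (Suc j) < c" for c v
   using that u(3)[of c v] u(3)[of "c - 1" v] by (auto simp: u'_def lin_0[OF XY(1)] lin_0[OF XY(2)])
  show "F (C v) = (\<Sum>c\<le>Suc j. mon x2 y2 c (Suc j - c) (u' (int c) v))" if v: "v \<in> U" for v
  proof -
   have "(\<Sum>c\<le>Suc j. mon x2 y2 c (Suc j - c) (u' (int c) v)) =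
     (\<Sum>c\<le>Suc j. mon x2 y2 c (Suc j - c) (X (u (int c - 1) v))) + (\<Sum>c\<le>Suc j. mon x2 y2 c (Suc j - c) (Y (u (int c) v)))"
    by (simp only: u'_def mon_sub[OF N'] sum.distrib)
   also have "(\<Sum>c\<le>Suc j. mon x2 y2 c (Suc j - c) (X (u (int c - 1) v))) = (\<Sum>c\<le>j. mon x2 y2 (Suc c) (j - c) (X (u (int c) v)))"
    by (subst sum.atMost_Suc_shift) (simp add: u(3) lin_0[OF XY(1)] mon_sub[OF N'])
   also have "(\<Sum>c\<le>Suc j. mon x2 y2 c (Suc j - c) (Y (u (int c) v))) = (\<Sum>c\<le>j. mon x2 y2 c (Suc (j - c)) (Y (u (int c) v)))"
    using u(3)[of "int (Suc j)" v] by (simp add: lin_0[OF XY(2)] mon_sub[OF N'] Suc_diff_le)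
   also have "(\<Sum>c\<le>j. mon x2 y2 (Suc c) (j - c) (X (u (int c) v))) + (\<Sum>c\<le>j. mon x2 y2 c (Suc (j - c)) (Y (u (int c) v))) =
     (\<Sum>c\<le>j. F (mon x1 y1 c (j - c) (u (int c) v)))"
    unfolding sum.distrib[symmetric]
    by (rule sum.cong[OF refl]) (simp add: nhomD(5)[OF Fh] FXY[OF u(2)] mon_sub[OF N'] mon_mult[OF N'])
   also have "\<dots> = F (C v)" by (simp add: u(4)[OF v] lin_sum[OF nhomD(1)[OF Fh]])
   finally show ?thesis ..
  qed
  fix s t assume "relation x y U s t"
  from ur[OF this] obtain \<nu> \<nu>' where \<nu>: "\<And>c. relation x1 y1 U1 (\<nu> c) (\<nu>' c)"
   "\<And>c. u c t + u (c - 1) s - (\<nu>' c + \<nu> (c - 1)) \<in> jac x1 y1 U1" by blast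
  define \<delta> where "\<delta> c = u c t + u (c - 1) s - (\<nu>' c + \<nu> (c - 1))" for c
  have "\<forall>c. \<exists>a a' b b'. relation x2 y2 U2 a a' \<and> relation x2 y2 U2 b b' \<and> X (\<nu> c) - a \<in> jac x2 y2 U2 \<and>
    Y (\<nu> c) + X (\<nu>' c) - (a' + b) \<in> jac x2 y2 U2 \<and> Y (\<nu>' c) - b' \<in> jac x2 y2 U2"
   using relation_image[OF N N' F X FXY \<nu>(1)] by blast
  then obtain a a' b b' where ab: "\<And>c. relation x2 y2 U2 (a c) (a' c)" "\<And>c. relation x2 y2 U2 (b c) (b' c)"
   "\<And>c. X (\<nu> c) - a c \<in> jac x2 y2 U2" "\<And>c. Y (\<nu> c) + X (\<nu>' c) - (a' c + b c) \<in> jac x2 y2 U2"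
   "\<And>c. Y (\<nu>' c) - b' c \<in> jac x2 y2 U2" by metis
  have "\<forall>c. \<exists>d d'. relation x2 y2 U2 d d' \<and> X (\<delta> c) - d \<in> jac x2 y2 U2 \<and> Y (\<delta> c) - d' \<in> jac x2 y2 U2"
   unfolding \<delta>_def using jac_image[OF N N' F X FXY \<nu>(2)] by blast
  then obtain d d' where d: "\<And>c. relation x2 y2 U2 (d c) (d' c)" "\<And>c. X (\<delta> c) - d c \<in> jac x2 y2 U2"
   "\<And>c. Y (\<delta> c) - d' c \<in> jac x2 y2 U2" by metis
  define \<mu> where "\<mu> c = b c + a (c - 1) + d c" for c
  define \<mu>' where "\<mu>' c = b' c + a' (c - 1) + d' c" for c
  show "\<exists>\<nu> \<nu>'. \<forall>c. relation x2 y2 U2 (\<nu> c) (\<nu>' c) \<and> u' c t + u' (c - 1) s - (\<nu>' c + \<nu> (c - 1)) \<in> jac x2 y2 U2"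
  proof (rule exI[of _ \<mu>], rule exI[of _ \<mu>'], intro allI conjI)
   fix c
   show "relation x2 y2 U2 (\<mu> c) (\<mu>' c)"
    unfolding \<mu>_def \<mu>'_def by (rule relation_add[OF N' relation_add[OF N' ab(2) ab(1)] d(1)])
   have k: "u c t + u (c - 1) s = \<nu>' c + \<nu> (c - 1) + \<delta> c" for c by (simp add: \<delta>_def)
   have "u' c t + u' (c - 1) s = Y (u c t + u (c - 1) s) + X (u (c - 1) t + u (c - 1 - 1) s)"
    by (simp add: u'_def lin_add[OF XY(1)] lin_add[OF XY(2)])
   also have "\<dots> = (Y (\<nu>' c) + Y (\<nu> (c - 1)) + Y (\<delta> c)) + (X (\<nu>' (c - 1)) + X (\<nu> (c - 1 - 1)) + X (\<delta> (c - 1)))"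
    by (simp only: k lin_add[OF XY(1)] lin_add[OF XY(2)])
   finally have "u' c t + u' (c - 1) s - (\<mu>' c + \<mu> (c - 1)) =
     ((Y (\<nu>' c) - b' c) + (Y (\<nu> (c - 1)) + X (\<nu>' (c - 1)) - (a' (c - 1) + b (c - 1))) + (Y (\<delta> c) - d' c)) +
     ((X (\<nu> (c - 1 - 1)) - a (c - 1 - 1)) + (X (\<delta> (c - 1)) - d (c - 1)))"
    by (simp add: \<mu>_def \<mu>'_def algebra_simps)
   also have "\<dots> \<in> jac x2 y2 U2" by (intro subspace_add[OF sJ] ab(3-5) d(2,3))
   finally show "u' c t + u' (c - 1) s - (\<mu>' c + \<mu> (c - 1)) \<in> jac x2 y2 U2" .
  qed
 qed
qed

lemma long_composite_is_dtr:
 assumes N: "nil2 n x y U" and N': "nil2 n x' y' U'"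
  and K: "kills (2 * n + 3) x y U C" and E: "expands (2 * n + 3) x y U x' y' U' C"
 shows "\<exists>\<phi>. lin \<phi> \<and> (\<forall>v. \<phi> v \<in> U') \<and> (\<forall>v\<in>U. C v = dtr n x' y' x y \<phi> v)"
proof -
 obtain u :: "int => 'v => 'v" where u: "\<And>c. lin (u c)" "\<And>c v. u c v \<in> U'"
  "\<And>v. v \<in> U ==> C v = (\<Sum>c\<le>2 * n + 3. mon x' y' c (2 * n + 3 - c) (u (int c) v))"
  and ur: "\<And>s t. relation x y U s t ==> \<exists>\<nu> \<nu>'. \<forall>c. relation x' y' U' (\<nu> c) (\<nu>' c) \<and>
   u c t + u (c - 1) s - (\<nu>' c + \<nu> (c - 1)) \<in> jac x' y' U'"
  using E unfolding expands_def by blast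
 define a where "a = u (int (n + 2))"
 define b where "b = u (int (n + 1))"
 have Cab: "C v = mon x' y' (n + 2) (n + 1) (a v) + mon x' y' (n + 1) (n + 2) (b v)" if v: "v \<in> U" for v
 proof -
  let ?f = "%c. mon x' y' c (2 * n + 3 - c) (u (int c) v)"
  have "C v = sum ?f {n + 1, n + 2}"
   unfolding u(3)[OF v]
  proof (rule sum.mono_neutral_right)
   show "\<forall>c\<in>{..2 * n + 3} - {n + 1, n + 2}. ?f c = 0"
   proof
    fix c assume c: "c \<in> {..2 * n + 3} - {n + 1, n + 2}"
    then consider "n + 3 \<le> c" | "n + 3 \<le> 2 * n + 3 - c" by force
    then show "?f c = 0" by cases (auto intro: mon_zero(1,2)[OF N'])
   qed
  qed auto
  also have "\<dots> = ?f (n + 1) + ?f (n + 2)" by simp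
  finally show ?thesis by (simp add: a_def b_def add.commute)
 qed
 show ?thesis
 proof -
  have "\<exists>\<phi>. lin \<phi> \<and> (\<forall>v. \<phi> v \<in> U') \<and>
   (\<forall>v\<in>U. mon x' y' (n + 2) (n + 1) (a v) + mon x' y' (n + 1) (n + 2) (b v) = dtr n x' y' x y \<phi> v)"
  proof (rule top_map_is_dtr[OF N N'])
   show "lin a" "lin b" "a v \<in> U'" "b v \<in> U'" for v unfolding a_def b_def by (rule u)+
  next
   fix v assume v: "v \<in> U" "mon x y (n + 2) (n + 1) v = 0" "mon x y (n + 1) (n + 2) v = 0"
   have "mon x y c d v = 0" if cd: "c + d = 2 * n + 3" for c d
   proof -
    have "n + 3 \<le> c \<or> n + 3 \<le> d \<or> (c = n + 2 \<and> d = n + 1) \<or> (c = n + 1 \<and> d = n + 2)" using cd by arith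
    then show ?thesis using v mon_zero(1,2)[OF N] by blast
   qed
   then have "C v = 0" using K v(1) by (simp add: kills_def)
   then show "mon x' y' (n + 2) (n + 1) (a v) + mon x' y' (n + 1) (n + 2) (b v) = 0" using Cab[OF v(1)] by simp
  next
   fix s t assume "s \<in> U" "t \<in> U" "x s + y t = 0"
   then have "relation x y U s t" by (simp add: relation_def)
   from ur[OF this] obtain \<nu> \<nu>' where \<nu>: "\<And>c. relation x' y' U' (\<nu> c) (\<nu>' c)"
    "\<And>c. u c t + u (c - 1) s - (\<nu>' c + \<nu> (c - 1)) \<in> jac x' y' U'" by blast
   note g = relation_good[OF N' relationD[OF \<nu>(1)]] and sg = good_subspace[OF N']
   let ?c = "int (n + 2)"
   have "?c - 1 = int (n + 1)" by simp
   then have "a t + b s = (\<nu>' ?c + \<nu> (?c - 1)) + (u ?c t + u (?c - 1) s - (\<nu>' ?c + \<nu> (?c - 1)))"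
    by (simp add: a_def b_def)
   also have "\<dots> \<in> goodset n x' y' U'"
    by (intro subspace_add[OF sg] g subsetD[OF jac_good[OF N'] \<nu>(2)])
   finally show "a t + b s \<in> goodset n x' y' U'" .
  qed
  then show ?thesis using Cab by auto
 qed
qed

end

section \<open>Extending ghosts over cosyzygies\<close>

context p_modules begin

lemma in_range_iff: "(\<exists>v. f v = y) \<longleftrightarrow> y \<in> range f" by auto

lemma szero_add: assumes r: "rep rh'" and "szero rh rh' F" "szero rh rh' H" shows "szero rh rh' (%v. F v + H v)"
proof -
 obtain \<phi> \<psi> where \<phi>: "lin \<phi>" "\<And>v. F v = Tr rh rh' \<phi> v" "lin \<psi>" "\<And>v. H v = Tr rh rh' \<psi> v"
  using assms by (auto simp: szero_def)
 then show ?thesis unfolding szero_def using lin_plus[OF \<phi>(1,3)]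
  by (intro exI[of _ "%v. \<phi> v + \<psi> v"]) (simp add: Tr_def lin_add[OF repD(1)[OF r]] sum.distrib)
qed

lemma szero_comp_left: assumes "szero rh rh' F" "equiv rh' rh'' H" shows "szero rh rh'' (%v. H (F v))"
proof -
 obtain \<phi> where \<phi>: "lin \<phi>" "\<And>v. F v = Tr rh rh' \<phi> v" using assms(1) by (auto simp: szero_def)
 show ?thesis unfolding szero_def \<phi>(2) Tr_comp_left[OF assms(2)]
  using lin_comp[OF equivD(1)[OF assms(2)] \<phi>(1)] by blast
qed

lemma szero_comp_right: assumes "szero rh' rh'' F" "equiv rh rh' H" shows "szero rh rh'' (%v. F (H v))"
proof -
 obtain \<phi> where \<phi>: "lin \<phi>" "\<And>v. F v = Tr rh' rh'' \<phi> v" using assms(1) by (auto simp: szero_def)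
 show ?thesis unfolding szero_def \<phi>(2) Tr_comp_right[OF assms(2)]
  using lin_comp[OF \<phi>(1) equivD(1)[OF assms(2)]] by blast
qed

lemma ghost_restricts_to_szero:
 assumes gh: "ghost KG K M N f" and M: "coord M rh ka em" and N: "coord N rh' ka' em'"
  and W: "coord W rhW kaW emW" "is_Omega_power KG n K W" and H: "equiv rhW rh H"
 shows "szero rhW rh' (%v. ka' (f (em (H v))))"
proof -
 let ?h = "%x. em (H (kaW x))"
 have "?h \<in> left_module_hom KG W M" by (rule hom_unhat(1)[OF W(1) M H])
 then have "stably_zero KG W N (f \<circ> ?h)" using gh W(2) by (auto simp: ghost_def)
 from stably_zeroD[OF W(1) N this] have "szero rhW rh' (%v. ka' (f (em (H (rhW \<one> v)))))"
  by (simp add: coordD(5)[OF W(1)])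
 then show ?thesis by (simp add: equivD(2)[OF H one_closed] coord_eps(2)[OF M])
qed

text \<open>
The image of \<open>\<Theta>\<close> is the cokernel of the embedding \<open>J\<close>, hence a desyzygy of \<open>W\<close>, and it embeds into \<open>rh1\<close>.
\<close>

lemma cosyzygy:
 assumes pr: "proj rh0" and r1: "rep rh1" and \<Theta>: "equiv rh0 rh1 \<Theta>" and W: "coord W rhW kaW emW"
  and J: "equiv rhW rh0 J" "\<forall>v. J (rhW \<one> v) = 0 --> rhW \<one> v = 0"
  and ker: "\<forall>w. \<Theta> (rh0 \<one> w) = 0 \<longleftrightarrow> (\<exists>v. J (rhW \<one> v) = rh0 \<one> w)"
 shows "\<exists>W' rh' ka' em' I. coord W' rh' ka' em' \<and> is_Omega KG W' W \<and> equiv rh' rh1 I \<and>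
  (\<forall>v. I (rh' \<one> v) = 0 --> rh' \<one> v = 0) \<and> range (%v. I (rh' \<one> v)) = range (%v. \<Theta> (rh0 \<one> v)) \<and>
  (\<forall>rhM \<Psi>. rep rhM --> equiv rh0 rhM \<Psi> --> (\<forall>v. \<Theta> (rh0 \<one> v) = 0 --> \<Psi> (rh0 \<one> v) = 0) -->
   (\<exists>H. equiv rh' rhM H \<and> (\<forall>v. \<exists>w. I w = \<Theta> (rh0 \<one> v) \<and> H w = \<Psi> (rh0 \<one> v))))"
proof -
 have r0: "rep rh0" using pr by (simp add: proj_def)
 note l\<Theta> = equivD(1)[OF \<Theta>] and l0 = repD(1)[OF r0 one_closed]
 define U where "U = range (%v. \<Theta> (rh0 \<one> v))"
 have sU: "subspace U" unfolding U_def by (rule subspace_range[OF lin_comp[OF l\<Theta> l0]])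
 have U1: "rh1 \<one> u = u" if "u \<in> U" for u
  using that equiv_one[OF r0 \<Theta>] by (auto simp: U_def)
 have Us: "U \<subseteq> range (rh1 \<one>)"
 proof
  fix u assume "u \<in> U"
  then show "u \<in> range (rh1 \<one>)" using U1[of u] by (intro range_eqI[of _ _ u]) simp
 qed
 have Ug: "rh1 k u \<in> U" if k: "k \<in> carrier G" and "u \<in> U" for k u
 proof -
  obtain v where "u = \<Theta> (rh0 \<one> v)" using \<open>u \<in> U\<close> by (auto simp: U_def)
  then have "rh1 k u = \<Theta> (rh0 \<one> (rh0 k v))" using k by (simp add: rep1[OF r0] flip: equivD(2)[OF \<Theta>])
  then show ?thesis by (auto simp: U_def)
 qed
 obtain \<pi> where \<pi>: "lin \<pi>" "range \<pi> \<subseteq> U" "\<And>v. v \<in> U ==> \<pi> v = v" and rU: "rep (%g v. rh1 g (\<pi> v))"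
  and \<pi>1: "\<And>v. rh1 \<one> (\<pi> v) = \<pi> v" and \<pi>e: "equiv (%g v. rh1 g (\<pi> v)) rh1 \<pi>"
  using sub_rep[OF r1 sU Us Ug] by auto
 have \<pi>U: "\<pi> v \<in> U" for v using \<pi>(2) by auto
 have \<pi>\<pi>: "\<pi> (\<pi> v) = \<pi> v" for v by (rule \<pi>(3)[OF \<pi>U])
 define rh' where "rh' = (%g v. rh1 g (\<pi> v))"
 note rU = rU[folded rh'_def] and \<pi>e = \<pi>e[folded rh'_def]
 have rh'1: "rh' \<one> v = \<pi> v" for v by (simp add: rh'_def \<pi>1)
 note W' = coord_realize[OF rU]
 have \<Theta>U: "\<Theta> (rh0 \<one> v) \<in> U" for v by (auto simp: U_def)
 have ex: "exact rhW rh0 rh' J (%v. \<Theta> (rh0 \<one> v))"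
  unfolding exact_def
 proof (intro conjI allI impI)
  show "equiv rhW rh0 J" by (rule J(1))
  show "equiv rh0 rh' (%v. \<Theta> (rh0 \<one> v))"
   unfolding equiv_def
  proof (intro conjI ballI allI)
   show "lin (%v. \<Theta> (rh0 \<one> v))" by (rule lin_comp[OF l\<Theta> l0])
   show "\<Theta> (rh0 \<one> (rh0 k v)) = rh' k (\<Theta> (rh0 \<one> v))" if "k \<in> carrier G" for k v
    unfolding rh'_def \<pi>(3)[OF \<Theta>U] using that by (simp add: rep1[OF r0] flip: equivD(2)[OF \<Theta>])
  qed
  show "rhW \<one> v = 0" if "J (rhW \<one> v) = 0" for v using J(2) that by blast
  show "\<exists>w. \<Theta> (rh0 \<one> (rh0 \<one> w)) = rh' \<one> v" for v
   using \<pi>U[of v] by (auto simp: rh'1 U_def rep1[OF r0] intro: sym)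
  show "(\<Theta> (rh0 \<one> (rh0 \<one> w)) = 0) = (\<exists>v. J (rhW \<one> v) = rh0 \<one> w)" for w
   using ker by (simp add: rep1[OF r0])
 qed
 show ?thesis
 proof (rule exI[of _ "realize rh'"], rule exI[of _ rh'], rule exI[of _ "inv_into UNIV \<iota>"],
   rule exI[of _ "%v. \<iota> (rh' \<one> v)"], rule exI[of _ \<pi>], intro conjI allI impI W' \<pi>e)
  show "is_Omega KG (realize rh') W" unfolding is_Omega_iff[OF W' W] using pr ex by blast
  show "rh' \<one> v = 0" if "\<pi> (rh' \<one> v) = 0" for v using that by (simp add: rh'1 \<pi>\<pi>)
  show "range (%v. \<pi> (rh' \<one> v)) = range (%v. \<Theta> (rh0 \<one> v))"
  proof -
   have "range (%v. \<pi> (rh' \<one> v)) = U" unfolding rh'1 \<pi>\<pi> using \<pi>(2,3) by (auto simp: image_iff) metis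
   then show ?thesis by (simp add: U_def)
  qed
 next
  fix rhM \<Psi> assume rM: "rep rhM" and \<Psi>: "equiv rh0 rhM \<Psi>" and kill: "\<forall>v. \<Theta> (rh0 \<one> v) = 0 --> \<Psi> (rh0 \<one> v) = 0"
  obtain L where L: "lin L" "\<And>v. L (\<Theta> (rh0 \<one> v)) = \<Psi> (rh0 \<one> v)"
   using factor_through[OF l\<Theta> equivD(1)[OF \<Psi>] subspace_range[OF l0]] kill by auto
  have "equiv rh' rhM (%v. L (\<pi> v))"
   unfolding equiv_def
  proof (intro conjI ballI allI)
   show "lin (%v. L (\<pi> v))" by (rule lin_comp[OF L(1) \<pi>(1)])
   fix k v assume k: "k \<in> carrier G"
   obtain w where w: "\<pi> v = \<Theta> (rh0 \<one> w)" using \<pi>U[of v] by (auto simp: U_def)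
   have "rh1 k (\<pi> v) = \<Theta> (rh0 \<one> (rh0 k w))" unfolding w using k by (simp add: rep1[OF r0] flip: equivD(2)[OF \<Theta>])
   then have "L (\<pi> (rh' k v)) = \<Psi> (rh0 \<one> (rh0 k w))"
    unfolding rh'_def \<pi>(3)[OF Ug[OF k \<pi>U]] by (simp only: L(2))
   also have "\<dots> = rhM k (L (\<pi> v))" unfolding w L(2) using k by (simp add: rep1[OF r0] flip: equivD(2)[OF \<Psi>])
   finally show "L (\<pi> (rh' k v)) = rhM k (L (\<pi> v))" .
  qed
  moreover have "\<pi> (\<Theta> (rh0 \<one> v)) = \<Theta> (rh0 \<one> v)" for v by (rule \<pi>(3)[OF \<Theta>U])
  ultimately show "\<exists>H. equiv rh' rhM H \<and> (\<forall>v. \<exists>w. \<pi> w = \<Theta> (rh0 \<one> v) \<and> H w = \<Psi> (rh0 \<one> v))"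
   using L(2) by (intro exI[of _ "%v. L (\<pi> v)"]) (auto intro!: exI[of _ "\<Theta> (rh0 \<one> _)"])
 qed
qed

lemma trivial_embedding:
 assumes K: "coord K rhK kaK emK" and r: "rep rh" and \<nu>: "\<nu> \<noteq> 0" "\<And>k. k \<in> carrier G ==> rh k \<nu> = \<nu>"
 shows "\<exists>J. equiv rhK rh J \<and> (\<forall>v. J (rhK \<one> v) = 0 --> rhK \<one> v = 0) \<and>
  (\<forall>w. (\<exists>v. J (rhK \<one> v) = w) \<longleftrightarrow> (\<exists>c. w = pscale c \<nu>))"
proof -
 obtain k0 where t: "triv rhK k0" using coord_trivial[OF K] by blast
 then have rK: "rep rhK" and k0: "k0 \<noteq> 0" "rhK \<one> k0 = k0" and fx: "\<And>g v. g \<in> carrier G ==> rhK g v = rhK \<one> v"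
  and rank: "\<And>v. \<exists>c. rhK \<one> v = pscale c k0" unfolding triv_def by blast+
 note lK = repD(1)[OF rK one_closed] and lr = repD(1)[OF r]
 obtain u where u: "lookup k0 u \<noteq> 0" using k0(1) by (metis poly_mapping_eqI lookup_zero)
 define L where "L v = pscale (lookup v u / lookup k0 u) \<nu>" for v
 have lL: "lin L" by (rule linI) (simp_all add: L_def lookup_add add_divide_distrib scale_left_distrib)
 have Lk: "L (pscale c k0) = pscale c \<nu>" for c using u by (simp add: L_def)
 have L\<nu>: "rh k (L v) = L v" if "k \<in> carrier G" for k v
  using \<nu>(2)[OF that] by (simp add: L_def lin_scale[OF lr[OF that]])
 have one: "rhK \<one> (rhK \<one> v) = rhK \<one> v" for v by (simp add: rep1[OF rK])
 show ?thesis
 proof (intro exI[of _ "%v. L (rhK \<one> v)"] conjI allI impI)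
  show "equiv rhK rh (%v. L (rhK \<one> v))"
   unfolding equiv_def
  proof (intro conjI ballI allI)
   show "lin (%v. L (rhK \<one> v))" by (rule lin_comp[OF lL lK])
   show "L (rhK \<one> (rhK k v)) = rh k (L (rhK \<one> v))" if k: "k \<in> carrier G" for k v
    unfolding L\<nu>[OF k] fx[OF k] one ..
  qed
  fix v
  assume 0: "L (rhK \<one> (rhK \<one> v)) = 0"
  obtain c where c: "rhK \<one> v = pscale c k0" using rank by blast
  then have "pscale c \<nu> = 0" using 0 unfolding one by (simp add: Lk)
  then show "rhK \<one> v = 0" using \<nu>(1) c by simp
 next
  fix w
  show "(\<exists>v. L (rhK \<one> (rhK \<one> v)) = w) = (\<exists>c. w = pscale c \<nu>)"
  proof
   assume "\<exists>v. L (rhK \<one> (rhK \<one> v)) = w"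
   then obtain v where v: "L (rhK \<one> v) = w" unfolding one by blast
   obtain c where c: "rhK \<one> v = pscale c k0" using rank by blast
   show "\<exists>c. w = pscale c \<nu>" using v unfolding c Lk by blast
  next
   assume "\<exists>c. w = pscale c \<nu>"
   then obtain c where c: "w = pscale c \<nu>" by blast
   have "L (rhK \<one> (pscale c k0)) = w" unfolding c lin_scale[OF lK] k0(2) Lk ..
   then show "\<exists>v. L (rhK \<one> (rhK \<one> v)) = w" unfolding one by blast
  qed
 qed
qed

lemma ghost_extends:
 assumes gh: "ghost KG K M N f" and M: "coord M rh ka em" and N: "coord N rh' ka' em'"
  and W: "coord W rhW kaW emW" "is_Omega_power KG n K W" and H: "equiv rhW rh H"
  and r: "rep rh1" and I: "equiv rhW rh1 I" "\<And>v. I (rhW \<one> v) = 0 ==> rhW \<one> v = 0"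
 shows "\<exists>F. equiv rh1 rh' F \<and> (\<forall>v. F (I v) = ka' (f (em (H v))))"
 by (rule extend_over_injection[OF coordD(2)[OF W(1)] r coordD(2)[OF N] I ghost_restricts_to_szero[OF gh M N W H]])

text \<open>
A homomorphism from \<open>\<Omega>\<^sup>-\<^sup>1 k\<close> or \<open>\<Omega>\<^sup>-\<^sup>2 k\<close> is one from a projective module that vanishes on a kernel. Followed by a ghost it is a trace, so it
extends to the next projective module.
\<close>

lemma ghost_cosyzygies:
 assumes gh: "ghost KG K M N f" and M: "coord M rh ka em" and N: "coord N rh' ka' em'"
  and P0: "proj rh0" and \<nu>: "\<nu> \<noteq> 0" "\<And>k. k \<in> carrier G ==> rh0 k \<nu> = \<nu>"
  and P1: "proj rh1" and \<Theta>1: "equiv rh0 rh1 \<Theta>1" "\<And>w. \<Theta>1 (rh0 \<one> w) = 0 \<longleftrightarrow> (\<exists>c. rh0 \<one> w = pscale c \<nu>)"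
 shows "equiv rh0 rh \<Psi> ==> (\<And>v. \<Theta>1 (rh0 \<one> v) = 0 ==> \<Psi> (rh0 \<one> v) = 0) ==>
   \<exists>F. equiv rh1 rh' F \<and> (\<forall>v. F (\<Theta>1 (rh0 \<one> v)) = ka' (f (em (\<Psi> (rh0 \<one> v)))))"
  and "rep rh2 ==> equiv rh1 rh2 \<Theta>2 ==> (\<And>w. \<Theta>2 (rh1 \<one> w) = 0 \<longleftrightarrow> (\<exists>v. \<Theta>1 (rh0 \<one> v) = rh1 \<one> w)) ==>
   equiv rh1 rh \<Psi> ==> (\<And>v. \<Theta>2 (rh1 \<one> v) = 0 ==> \<Psi> (rh1 \<one> v) = 0) ==>
   \<exists>F. equiv rh2 rh' F \<and> (\<forall>v. F (\<Theta>2 (rh1 \<one> v)) = ka' (f (em (\<Psi> (rh1 \<one> v)))))"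
proof -
 have r: "rep rh0" "rep rh1" "rep rh" using P0 P1 coordD(2)[OF M] by (simp_all add: proj_def)
 obtain rhK kaK emK where K: "coord K rhK kaK emK" using coord_exists[OF left_module_trivial] by blast
 obtain J where J: "equiv rhK rh0 J" "\<And>v. J (rhK \<one> v) = 0 ==> rhK \<one> v = 0"
  "\<And>w. (\<exists>v. J (rhK \<one> v) = w) \<longleftrightarrow> (\<exists>c. w = pscale c \<nu>)"
 proof -
  have "\<exists>J. equiv rhK rh0 J \<and> (\<forall>v. J (rhK \<one> v) = 0 --> rhK \<one> v = 0) \<and>
    (\<forall>w. (\<exists>v. J (rhK \<one> v) = w) \<longleftrightarrow> (\<exists>c. w = pscale c \<nu>))" by (rule trivial_embedding[OF K r(1) \<nu>])
  then show ?thesis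
  proof (elim exE conjE)
   fix J assume "equiv rhK rh0 J" and 2: "\<forall>v. J (rhK \<one> v) = 0 --> rhK \<one> v = 0"
    and 3: "\<forall>w. (\<exists>u. J (rhK \<one> u) = w) = (\<exists>c. w = pscale c \<nu>)"
   then show thesis by (intro that[of J]) simp_all
  qed
 qed
 have ker1: "\<forall>w. \<Theta>1 (rh0 \<one> w) = 0 \<longleftrightarrow> (\<exists>v. J (rhK \<one> v) = rh0 \<one> w)" unfolding \<Theta>1(2) J(3) by blast
 have J2: "\<forall>v. J (rhK \<one> v) = 0 --> rhK \<one> v = 0" using J(2) by blast
 obtain W1 rhW1 ka1 em1 I1 where c1: "coord W1 rhW1 ka1 em1 \<and> is_Omega KG W1 K \<and> equiv rhW1 rh1 I1 \<and>
  (\<forall>v. I1 (rhW1 \<one> v) = 0 --> rhW1 \<one> v = 0) \<and> range (%v. I1 (rhW1 \<one> v)) = range (%v. \<Theta>1 (rh0 \<one> v)) \<and>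
  (\<forall>rhM \<Psi>. rep rhM --> equiv rh0 rhM \<Psi> --> (\<forall>v. \<Theta>1 (rh0 \<one> v) = 0 --> \<Psi> (rh0 \<one> v) = 0) -->
   (\<exists>H. equiv rhW1 rhM H \<and> (\<forall>v. \<exists>w. I1 w = \<Theta>1 (rh0 \<one> v) \<and> H w = \<Psi> (rh0 \<one> v))))"
  using cosyzygy[OF P0 r(2) \<Theta>1(1) K J(1) J2 ker1] by (elim exE) (rule that)
 note W1 = c1[THEN conjunct1] c1[THEN conjunct2, THEN conjunct1] c1[THEN conjunct2, THEN conjunct2, THEN conjunct1]
  c1[THEN conjunct2, THEN conjunct2, THEN conjunct2, THEN conjunct1, rule_format]
  c1[THEN conjunct2, THEN conjunct2, THEN conjunct2, THEN conjunct2, THEN conjunct1]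
  c1[THEN conjunct2, THEN conjunct2, THEN conjunct2, THEN conjunct2, THEN conjunct2, rule_format]
 {
  assume \<Psi>: "equiv rh0 rh \<Psi>" "\<And>v. \<Theta>1 (rh0 \<one> v) = 0 ==> \<Psi> (rh0 \<one> v) = 0"
  obtain H where H: "equiv rhW1 rh H" "\<And>v. \<exists>w. I1 w = \<Theta>1 (rh0 \<one> v) \<and> H w = \<Psi> (rh0 \<one> v)"
   using W1(6)[OF r(3) \<Psi>] by blast
  have "is_Omega_power KG (- 1) K W1" using W1(2) by (simp add: is_Omega_power_def eq_OO)
  from ghost_extends[OF gh M N W1(1) this H(1) r(2) W1(3,4)]
  show "\<exists>F. equiv rh1 rh' F \<and> (\<forall>v. F (\<Theta>1 (rh0 \<one> v)) = ka' (f (em (\<Psi> (rh0 \<one> v)))))"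
   using H(2) by metis
 next
  assume \<Theta>2: "rep rh2" "equiv rh1 rh2 \<Theta>2" "\<And>w. \<Theta>2 (rh1 \<one> w) = 0 \<longleftrightarrow> (\<exists>v. \<Theta>1 (rh0 \<one> v) = rh1 \<one> w)"
   and \<Psi>: "equiv rh1 rh \<Psi>" "\<And>v. \<Theta>2 (rh1 \<one> v) = 0 ==> \<Psi> (rh1 \<one> v) = 0"
  have ker2: "\<forall>w. \<Theta>2 (rh1 \<one> w) = 0 \<longleftrightarrow> (\<exists>v. I1 (rhW1 \<one> v) = rh1 \<one> w)"
  proof
   fix w
   have "(\<exists>v. \<Theta>1 (rh0 \<one> v) = rh1 \<one> w) \<longleftrightarrow> rh1 \<one> w \<in> range (%v. \<Theta>1 (rh0 \<one> v))" by (rule in_range_iff)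
   also have "\<dots> \<longleftrightarrow> rh1 \<one> w \<in> range (%v. I1 (rhW1 \<one> v))" unfolding W1(5) ..
   also have "\<dots> \<longleftrightarrow> (\<exists>v. I1 (rhW1 \<one> v) = rh1 \<one> w)" by (rule in_range_iff[symmetric])
   finally show "\<Theta>2 (rh1 \<one> w) = 0 \<longleftrightarrow> (\<exists>v. I1 (rhW1 \<one> v) = rh1 \<one> w)" unfolding \<Theta>2(3) .
  qed
  obtain W2 rhW2 ka2 em2 I2 where c2: "coord W2 rhW2 ka2 em2 \<and> is_Omega KG W2 W1 \<and> equiv rhW2 rh2 I2 \<and>
  (\<forall>v. I2 (rhW2 \<one> v) = 0 --> rhW2 \<one> v = 0) \<and> range (%v. I2 (rhW2 \<one> v)) = range (%v. \<Theta>2 (rh1 \<one> v)) \<and>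
  (\<forall>rhM \<Psi>. rep rhM --> equiv rh1 rhM \<Psi> --> (\<forall>v. \<Theta>2 (rh1 \<one> v) = 0 --> \<Psi> (rh1 \<one> v) = 0) -->
   (\<exists>H. equiv rhW2 rhM H \<and> (\<forall>v. \<exists>w. I2 w = \<Theta>2 (rh1 \<one> v) \<and> H w = \<Psi> (rh1 \<one> v))))"
   using cosyzygy[OF P1 \<Theta>2(1,2) W1(1) W1(3) c1[THEN conjunct2, THEN conjunct2, THEN conjunct2, THEN conjunct1] ker2] by (elim exE) (rule that)
  note W2 = c2[THEN conjunct1] c2[THEN conjunct2, THEN conjunct1] c2[THEN conjunct2, THEN conjunct2, THEN conjunct1]
  c2[THEN conjunct2, THEN conjunct2, THEN conjunct2, THEN conjunct1, rule_format]
  c2[THEN conjunct2, THEN conjunct2, THEN conjunct2, THEN conjunct2, THEN conjunct1]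
  c2[THEN conjunct2, THEN conjunct2, THEN conjunct2, THEN conjunct2, THEN conjunct2, rule_format]
  obtain H where H: "equiv rhW2 rh H" "\<And>v. \<exists>w. I2 w = \<Theta>2 (rh1 \<one> v) \<and> H w = \<Psi> (rh1 \<one> v)"
   using W2(6)[OF r(3) \<Psi>] by blast
  have "is_Omega_power KG (- 2) K W2" using W1(2) W2(2) by (auto simp: is_Omega_power_def numeral_2_eq_2 eq_OO)
  from ghost_extends[OF gh M N W2(1) this H(1) \<Theta>2(1) W2(3,4)]
  show "\<exists>F. equiv rh2 rh' F \<and> (\<forall>v. F (\<Theta>2 (rh1 \<one> v)) = ka' (f (em (\<Psi> (rh1 \<one> v)))))"
   using H(2) by metis
 }
qed

lemma ghost_fixed:
 assumes gh: "ghost KG K M N f" and M: "coord M rh ka em" and N: "coord N rh' ka' em'"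
  and v: "\<And>k. k \<in> carrier G ==> rh k v = v"
 shows "\<exists>n. rh' \<one> n = n \<and> ka' (f (em v)) = (\<Sum>k\<in>carrier G. rh' k n)"
proof (cases "v = 0")
 case True
 have "f \<in> left_module_hom KG M N" using gh by (simp add: ghost_def)
 from equivD(1)[OF hom_hat(1)[OF M N this]] have "ka' (f (em v)) = 0" unfolding True by (rule lin_0)
 then show ?thesis using lin_0[OF repD(1)[OF coordD(2)[OF N]]] by (intro exI[of _ 0]) simp
next
 case False
 obtain rhK kaK emK where K: "coord K rhK kaK emK" using coord_exists[OF left_module_trivial] by blast
 note rN = coordD(2)[OF N] and rK = coordD(2)[OF K]
 obtain J where J: "equiv rhK rh J" "\<And>v. J (rhK \<one> v) = 0 ==> rhK \<one> v = 0"
   "\<And>w. (\<exists>u. J (rhK \<one> u) = w) \<longleftrightarrow> (\<exists>c. w = pscale c v)"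
 proof -
  have "\<exists>J. equiv rhK rh J \<and> (\<forall>u. J (rhK \<one> u) = 0 --> rhK \<one> u = 0) \<and>
    (\<forall>w. (\<exists>u. J (rhK \<one> u) = w) \<longleftrightarrow> (\<exists>c. w = pscale c v))" by (rule trivial_embedding[OF K coordD(2)[OF M] False v])
  then show ?thesis
  proof (elim exE conjE)
   fix J assume "equiv rhK rh J" and 2: "\<forall>v. J (rhK \<one> v) = 0 --> rhK \<one> v = 0"
    and 3: "\<forall>w. (\<exists>u. J (rhK \<one> u) = w) = (\<exists>c. w = pscale c v)"
   then show thesis by (intro that[of J]) simp_all
  qed
 qed
 have "\<exists>c. v = pscale c v" by (rule exI[of _ 1]) simp
 then obtain u where u: "J (rhK \<one> u) = v" using J(3)[of v] by blast
 have "is_Omega_power KG 0 K K" by (simp add: is_Omega_power_def)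
 from ghost_restricts_to_szero[OF gh M N K this J(1)] obtain \<phi>
  where \<phi>: "lin \<phi>" "\<And>w. ka' (f (em (J w))) = Tr rhK rh' \<phi> w" by (auto simp: szero_def)
 have fx: "rhK k u = rhK \<one> u" if "k \<in> carrier G" for k using coord_trivial[OF K] that unfolding triv_def by blast
 have "ka' (f (em v)) = Tr rhK rh' \<phi> u" using \<phi>(2)[of "rhK \<one> u"] by (simp add: u Tr_one[OF rK])
 also have "\<dots> = (\<Sum>k\<in>carrier G. rh' k (rh' \<one> (\<phi> (rhK \<one> u))))"
  unfolding Tr_def by (rule sum.cong[OF refl]) (simp only: fx[OF inv_closed] rep1(1)[OF rN])
 finally show ?thesis
  by (intro exI[of _ "rh' \<one> (\<phi> (rhK \<one> u))"] conjI) (rule rep1(1)[OF rN one_closed], assumption)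
qed

subsection \<open>Maps out of the regular representation, and direct sums\<close>

definition orb where "orb rh v = ext rh (%w. pscale (lookup w u0) v)"

lemma orb_equiv: assumes "rep rh" shows "equiv Reg rh (orb rh v)" and "g \<in> carrier G ==> orb rh v (bs g) = rh g v"
proof -
 have l: "lin (%w. pscale (lookup w u0) v)" by (rule linI) (simp_all add: lookup_add scale_left_distrib)
 have w0: "lookup w0 u0 = 1" by (simp add: w0_def)
 show "equiv Reg rh (orb rh v)" unfolding Reg_def orb_def by (rule ext_equiv[OF assms l]) (simp add: E0_def w0)
 show "g \<in> carrier G ==> orb rh v (bs g) = rh g v"
  unfolding orb_def bs_def by (simp add: ext_\<theta>[OF assms l] w0)
qed

text \<open>
Direct sums of copies of a representation, indexed by group elements because the inclusions \<open>\<theta>\<close> are; only distinctness of the indices matters.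
\<close>

definition dsum where "dsum S rh g v = (\<Sum>s\<in>S. \<theta> s (rh g (\<sigma> s v)))"

lemma \<sigma>_sum_\<theta>: assumes S: "S \<subseteq> carrier G" and s: "s \<in> S" shows "\<sigma> s (\<Sum>t\<in>S. \<theta> t (w t)) = w s"
proof -
 have "finite S" using S finite_G finite_subset by blast
 have "\<sigma> s (\<Sum>t\<in>S. \<theta> t (w t)) = (\<Sum>t\<in>S. if t = s then w s else 0)"
  unfolding lin_sum[OF lin_\<sigma>] using S s by (intro sum.cong refl) (auto simp: \<sigma>\<theta> subset_iff)
 then show ?thesis using \<open>finite S\<close> s by simp
qed

lemma \<sigma>_dsum: "S \<subseteq> carrier G ==> s \<in> S ==> \<sigma> s (dsum S rh g v) = rh g (\<sigma> s v)"
 unfolding dsum_def by (rule \<sigma>_sum_\<theta>)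

lemma rep_dsum: assumes r: "rep rh" and S: "S \<subseteq> carrier G" shows "rep (dsum S rh)"
 unfolding rep_def
proof (intro conjI ballI allI)
 fix g assume g: "g \<in> carrier G"
 have "lin (%v. \<Sum>s\<in>S. \<theta> s (rh g (\<sigma> s v)))"
  by (rule lin_summ) (rule lin_comp[OF lin_\<theta> lin_comp[OF repD(1)[OF r g] lin_\<sigma>]])
 then show "lin (dsum S rh g)" by (simp only: dsum_def[abs_def])
 show "dsum S rh (g \<otimes> h) v = dsum S rh g (dsum S rh h v)" if h: "h \<in> carrier G" for h v
  unfolding dsum_def[of S rh g] dsum_def[of S rh "g \<otimes> h"]
  by (rule sum.cong[OF refl]) (simp add: \<sigma>_dsum[OF S] repD(2)[OF r g h])
qed

lemma dsum_fixed: "S \<subseteq> carrier G ==> dsum S rh g w = w ==> s \<in> S ==> rh g (\<sigma> s w) = \<sigma> s w"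
 using \<sigma>_dsum[of S s rh g w] by simp

lemma dsum_into: assumes S: "S \<subseteq> carrier G" and f: "\<And>s. s \<in> S ==> equiv rh rh' (f s)"
 shows "equiv rh (dsum S rh') (%v. \<Sum>s\<in>S. \<theta> s (f s v))"
 unfolding equiv_def
proof (intro conjI ballI allI)
 show "lin (%v. \<Sum>s\<in>S. \<theta> s (f s v))" by (rule lin_summ) (rule lin_comp[OF lin_\<theta> equivD(1)[OF f]])
 show "(\<Sum>s\<in>S. \<theta> s (f s (rh g v))) = dsum S rh' g (\<Sum>s\<in>S. \<theta> s (f s v))" if g: "g \<in> carrier G" for g v
  unfolding dsum_def by (rule sum.cong[OF refl]) (simp add: \<sigma>_sum_\<theta>[OF S] equivD(2)[OF f g])
qed

lemma \<theta>_dsum: assumes S: "S \<subseteq> carrier G" and r: "rep rh" and s: "s \<in> S" shows "equiv rh (dsum S rh) (\<theta> s)"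
 unfolding equiv_def
proof (intro conjI ballI allI lin_\<theta>)
 fix g v assume g: "g \<in> carrier G"
 have "finite S" using S finite_G finite_subset by blast
 have "dsum S rh g (\<theta> s v) = (\<Sum>t\<in>S. if t = s then \<theta> s (rh g v) else 0)"
  unfolding dsum_def using S s
  by (intro sum.cong refl) (auto simp: \<sigma>\<theta> subset_iff lin_0[OF repD(1)[OF r g]] lin_0[OF lin_\<theta>])
 then show "\<theta> s (rh g v) = dsum S rh g (\<theta> s v)" using \<open>finite S\<close> s by simp
qed

lemma proj_dsum: assumes P: "proj rh" and S: "S \<subseteq> carrier G" shows "proj (dsum S rh)"
proof -
 have r: "rep rh" using P by (simp add: proj_def)
 obtain \<phi> where \<phi>: "lin \<phi>" "\<And>v. rh \<one> v = Tr rh rh \<phi> v" using P by (auto simp: proj_def szero_def)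
 have l: "lin (%v. \<Sum>s\<in>S. \<theta> s (\<phi> (\<sigma> s v)))"
  by (rule lin_summ) (rule lin_comp[OF lin_\<theta> lin_comp[OF \<phi>(1) lin_\<sigma>]])
 have "dsum S rh \<one> v = Tr (dsum S rh) (dsum S rh) (%v. \<Sum>s\<in>S. \<theta> s (\<phi> (\<sigma> s v))) v" for v
 proof -
  have "Tr (dsum S rh) (dsum S rh) (%v. \<Sum>s\<in>S. \<theta> s (\<phi> (\<sigma> s v))) v =
    (\<Sum>g\<in>carrier G. \<Sum>s\<in>S. \<theta> s (rh g (\<phi> (rh (inv g) (\<sigma> s v)))))"
   unfolding Tr_def
  proof (rule sum.cong[OF refl])
   fix g assume "g \<in> carrier G"
   have "\<sigma> s (\<Sum>t\<in>S. \<theta> t (\<phi> (\<sigma> t (dsum S rh (inv g) v)))) = \<phi> (rh (inv g) (\<sigma> s v))" if "s \<in> S" for s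
    unfolding \<sigma>_sum_\<theta>[OF S that] \<sigma>_dsum[OF S that] ..
   then show "dsum S rh g (\<Sum>s\<in>S. \<theta> s (\<phi> (\<sigma> s (dsum S rh (inv g) v)))) = (\<Sum>s\<in>S. \<theta> s (rh g (\<phi> (rh (inv g) (\<sigma> s v)))))"
    unfolding dsum_def[of S rh g] by (intro sum.cong[OF refl]) simp
  qed
  also have "\<dots> = (\<Sum>s\<in>S. \<theta> s (Tr rh rh \<phi> (\<sigma> s v)))"
   by (subst sum.swap) (simp add: Tr_def lin_sum[OF lin_\<theta>])
  also have "\<dots> = dsum S rh \<one> v" unfolding dsum_def by (simp add: \<phi>(2))
  finally show ?thesis ..
 qed
 then show ?thesis unfolding proj_def szero_def using rep_dsum[OF r S] l by blast
qed

end

section \<open>Abelian groups with two generators\<close>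

context kspace begin

lemma cyc_kernel: assumes "lin x" "lin x'" "lin \<phi>" "x v = 0" "0 < n"
 shows "cyc x' x n \<phi> v = (x' ^^ (n - 1)) (\<phi> v)"
proof -
 have "(x ^^ b) v = 0" if "0 < b" for b using that assms(4) by (cases b) (simp_all add: funpow_swap1 lin_0[OF lin_pow[OF assms(1)]])
 then have "cyc x' x n \<phi> v = (\<Sum>b<n. if b = 0 then (x' ^^ (n - 1)) (\<phi> v) else 0)"
  unfolding cyc_def by (intro sum.cong[OF refl]) (auto simp: lin_0[OF assms(3)] lin_0[OF lin_pow[OF assms(2)]])
 then show ?thesis using assms(5) by simp
qed

lemma cyc_top: assumes x': "lin x'" and U: "subspace U" "\<And>v. v \<in> U ==> x' v \<in> U" "\<And>v. \<phi> v \<in> U" and "0 < n"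
 shows "\<exists>w\<in>U. cyc x' x n \<phi> v = \<phi> ((x ^^ (n - 1)) v) + x' w"
proof -
 obtain m where n: "n = Suc m" using \<open>0 < n\<close> by (cases n) auto
 have "(\<Sum>b<m. (x' ^^ (m - b)) (\<phi> ((x ^^ b) v))) = x' (\<Sum>b<m. (x' ^^ (m - Suc b)) (\<phi> ((x ^^ b) v)))"
  unfolding lin_sum[OF x']
 proof (rule sum.cong[OF refl])
  fix b assume "b \<in> {..<m}"
  then have "m - b = Suc (m - Suc b)" by auto
  then show "(x' ^^ (m - b)) (\<phi> ((x ^^ b) v)) = x' ((x' ^^ (m - Suc b)) (\<phi> ((x ^^ b) v)))" by simp
 qed
 moreover have "(x' ^^ k) u \<in> U" if "u \<in> U" for k u using pow_closed[of U x' u k] U(2) that by blast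
 then have "(\<Sum>b<m. (x' ^^ (m - Suc b)) (\<phi> ((x ^^ b) v))) \<in> U" using U(3) by (intro subspace_sum[OF U(1)]) blast
 ultimately show ?thesis unfolding cyc_def n by (auto simp: add.commute)
qed

end

context p_modules begin

definition dx :: "'g => ('g => ('u \<Rightarrow>\<^sub>0 'k) => ('u \<Rightarrow>\<^sub>0 'k)) => ('u \<Rightarrow>\<^sub>0 'k) => ('u \<Rightarrow>\<^sub>0 'k)" where
 "dx k rh v = rh k v - rh \<one> v"

definition mU :: "('g => ('u \<Rightarrow>\<^sub>0 'k) => ('u \<Rightarrow>\<^sub>0 'k)) => ('u \<Rightarrow>\<^sub>0 'k) set" where
 "mU rh = {v. rh \<one> v = v}"

lemma mU_subspace: "rep rh ==> subspace (mU rh)"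
 unfolding mU_def using repD(1)[OF _ one_closed] by (intro subspaceI) (auto simp: lin_simps)

lemma mU_rep: "rep rh ==> k \<in> carrier G ==> rh k v \<in> mU rh" by (simp add: mU_def rep1)
lemma mU_D: "v \<in> mU rh ==> rh \<one> v = v" by (simp add: mU_def)
lemma mU_equiv: "equiv rh rh' F ==> v \<in> mU rh ==> F v \<in> mU rh'"
 using equivD(2)[of rh rh' F \<one> v] by (simp add: mU_def)

lemma dx_lin: assumes "rep rh" "k \<in> carrier G" shows "lin (dx k rh)"
 unfolding dx_def[abs_def] using assms by (intro lin_sub repD(1)) auto

lemma dx_one: assumes "rep rh" "k \<in> carrier G" shows "rh \<one> (dx k rh v) = dx k rh v" "dx k rh (rh \<one> v) = dx k rh v"
 using assms by (simp_all add: dx_def lin_diff[OF repD(1)] rep1)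

lemma dx_mU: assumes "rep rh" "k \<in> carrier G" shows "dx k rh v \<in> mU rh"
 using dx_one[OF assms] by (simp add: mU_def)

lemma dx_pow_mU: assumes "rep rh" "k \<in> carrier G" "v \<in> mU rh" shows "(dx k rh ^^ n) v \<in> mU rh"
 using dx_mU[OF assms(1,2)] assms(3) by (induction n) auto

lemma dx_pow: assumes "rep rh" "k \<in> carrier G" "v \<in> mU rh"
 shows "(dx k rh ^^ n) v = ((%v. rh k v - v) ^^ n) v"
proof (induction n)
 case (Suc n)
 have "(dx k rh ^^ Suc n) v = rh k ((dx k rh ^^ n) v) - (dx k rh ^^ n) v"
  using mU_D[OF dx_pow_mU[OF assms, of n]] by (simp add: dx_def)
 then show ?case by (simp add: Suc)
qed simp

lemma dx_equivariant: assumes "equiv rh rh' F" "k \<in> carrier G" shows "F (dx k rh v) = dx k rh' (F v)"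
 using assms by (simp add: dx_def lin_diff[OF equivD(1)[OF assms(1)]] equivD(2)[OF assms(1)])

lemma dx_nil: assumes r: "rep rh" and k: "k \<in> carrier G" "k [^] (p ^ c) = \<one>" shows "(dx k rh ^^ (p ^ c)) v = 0"
proof -
 obtain m where m: "p ^ c = Suc m" using prime_p prime_gt_0_nat by (metis Suc_pred' zero_less_power)
 have "(dx k rh ^^ (p ^ c)) v = (dx k rh ^^ (p ^ c)) (rh \<one> v)" unfolding m funpow_Suc_right o_apply dx_one(2)[OF r k(1)] ..
 also have "\<dots> = ((%v. rh k v - v) ^^ (p ^ c)) (rh \<one> v)" by (rule dx_pow[OF r k(1) mU_rep[OF r one_closed]])
 also have "\<dots> = 0" by (rule pow_minus_one_zero[OF repD(1)[OF r k(1)]]) (simp add: rep_pow[OF r k(1)] k(2))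
 finally show ?thesis .
qed

definition normalized where
 "normalized rh rh' \<phi> \<longleftrightarrow> lin \<phi> \<and> (\<forall>v. \<phi> (rh \<one> v) = \<phi> v) \<and> (\<forall>v. rh' \<one> (\<phi> v) = \<phi> v)"

lemma cyc_trace:
 assumes r: "rep rh" "rep rh'" and k: "k \<in> carrier G" "k [^] (p ^ c) = \<one>" and \<phi>: "normalized rh rh' \<phi>"
 shows "cyc (dx k rh') (dx k rh) (p ^ c) \<phi> v = (\<Sum>i<p ^ c. rh' (k [^] i) (\<phi> (rh (inv k \<otimes> inv (k [^] i)) v)))"
  and "normalized rh rh' (cyc (dx k rh') (dx k rh) (p ^ c) \<phi>)"
proof -
 note l = repD(1)[OF r(1)] and l' = repD(1)[OF r(2)]
 have l\<phi>: "lin \<phi>" and \<phi>1: "\<And>v. \<phi> (rh \<one> v) = \<phi> v" "\<And>v. rh' \<one> (\<phi> v) = \<phi> v" using \<phi> by (auto simp: normalized_def)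
 have step: "commutator (dx k rh') (dx k rh) \<psi> = commutator (rh' k) (rh k) \<psi> \<and> normalized rh rh' (commutator (rh' k) (rh k) \<psi>)"
  if \<psi>: "normalized rh rh' \<psi>" for \<psi>
 proof -
  have l\<psi>: "lin \<psi>" and \<psi>1: "\<And>v. \<psi> (rh \<one> v) = \<psi> v" "\<And>v. rh' \<one> (\<psi> v) = \<psi> v" using \<psi> by (auto simp: normalized_def)
  have "lin (%v. rh' k (\<psi> v) - \<psi> (rh k v))" by (rule lin_sub[OF lin_comp[OF l'[OF k(1)] l\<psi>] lin_comp[OF l\<psi> l[OF k(1)]]])
  moreover have "commutator (dx k rh') (dx k rh) \<psi> v = commutator (rh' k) (rh k) \<psi> v" for v
   by (simp add: commutator_def dx_def lin_diff[OF l\<psi>] \<psi>1)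
  ultimately show ?thesis
   unfolding normalized_def fun_eq_iff
   by (simp add: commutator_def lin_diff[OF l'[OF one_closed]] \<psi>1 rep1[OF r(1) k(1)] rep1[OF r(2) k(1)])
 qed
 have pow: "(commutator (dx k rh') (dx k rh) ^^ m) \<phi> = (commutator (rh' k) (rh k) ^^ m) \<phi> \<and>
   normalized rh rh' ((commutator (rh' k) (rh k) ^^ m) \<phi>)" for m
  by (induction m) (use \<phi> step in auto)
 have eq: "cyc (dx k rh') (dx k rh) (p ^ c) \<phi> = (commutator (rh' k) (rh k) ^^ (p ^ c - 1)) \<phi>"
  using cyc_eq_commutator_power[OF prime_p char_k dx_lin[OF r(2) k(1)] dx_lin[OF r(1) k(1)] l\<phi>] pow by (auto simp: fun_eq_iff)
 show "normalized rh rh' (cyc (dx k rh') (dx k rh) (p ^ c) \<phi>)" unfolding eq using pow by blast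
 have "cyc (dx k rh') (dx k rh) (p ^ c) \<phi> v = cyc (rh' k) (rh k) (p ^ c) \<phi> v"
  unfolding eq cyc_eq_commutator_power[OF prime_p char_k l'[OF k(1)] l[OF k(1)] l\<phi>] ..
 also have "\<dots> = (\<Sum>b<p ^ c. rh' (k [^] (p ^ c - Suc b)) (\<phi> (rh (k [^] b) v)))"
  unfolding cyc_def
 proof (rule sum.cong[OF refl])
  fix b
  have "\<phi> ((rh k ^^ b) v) = \<phi> (rh \<one> ((rh k ^^ b) v))" by (simp only: \<phi>1)
  also have "rh \<one> ((rh k ^^ b) v) = (rh k ^^ b) (rh \<one> v)"
   by (induction b) (simp_all add: rep1[OF r(1) k(1)], metis rep1[OF r(1) k(1)])
  also have "\<dots> = rh (k [^] b) v" by (rule rep_pow[OF r(1) k(1)])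
  finally have 1: "\<phi> ((rh k ^^ b) v) = \<phi> (rh (k [^] b) v)" .
  have "(rh' k ^^ m) (\<phi> w) = rh' (k [^] m) (\<phi> w)" for m w
   using rep_pow[OF r(2) k(1), of m "\<phi> w"] by (simp add: \<phi>1)
  then show "(rh' k ^^ (p ^ c - 1 - b)) (\<phi> ((rh k ^^ b) v)) = rh' (k [^] (p ^ c - Suc b)) (\<phi> (rh (k [^] b) v))"
   by (simp add: 1)
 qed
 also have "\<dots> = (\<Sum>b<p ^ c. rh' (k [^] (p ^ c - Suc b)) (\<phi> (rh (inv k \<otimes> inv (k [^] (p ^ c - Suc b))) v)))"
 proof (rule sum.cong[OF refl])
  fix b assume b: "b \<in> {..<p ^ c}"
  let ?m = "p ^ c - Suc b"
  have "k [^] b \<otimes> (k [^] ?m \<otimes> k) = k [^] (b + Suc ?m)" using k(1) by (simp add: nat_pow_mult m_assoc[symmetric])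
  also have "b + Suc ?m = p ^ c" using b by auto
  finally have "inv (k [^] ?m \<otimes> k) = k [^] b" using k by (intro inv_equality) auto
  then have "inv k \<otimes> inv (k [^] ?m) = k [^] b" using k(1) by (simp add: inv_mult_group)
  then show "rh' (k [^] ?m) (\<phi> (rh (k [^] b) v)) = rh' (k [^] ?m) (\<phi> (rh (inv k \<otimes> inv (k [^] ?m)) v))" by simp
 qed
 also have "\<dots> = (\<Sum>i<p ^ c. rh' (k [^] i) (\<phi> (rh (inv k \<otimes> inv (k [^] i)) v)))"
  by (rule sum.nat_diff_reindex[of "%i. rh' (k [^] i) (\<phi> (rh (inv k \<otimes> inv (k [^] i)) v))"])
 finally show "cyc (dx k rh') (dx k rh) (p ^ c) \<phi> v = (\<Sum>i<p ^ c. rh' (k [^] i) (\<phi> (rh (inv k \<otimes> inv (k [^] i)) v)))" .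
qed

lemma Reg_lin_eq_0: assumes "lin L" "\<And>k. k \<in> carrier G ==> L (bs k) = 0" shows "L (Reg \<one> u) = 0"
proof -
 have "span (bs ` carrier G) \<subseteq> {v. L v = 0}" using assms(2) by (intro span_minimal subspace_ker[OF assms(1)]) auto
 then show ?thesis using Reg_one_span by blast
qed

lemma ghost_number_le:
 assumes "\<And>M N f. ghost_composite KG K n M N f ==> stably_zero KG M N f"
 shows "ghost_number e G \<le> enat n"
 unfolding ghost_number_def ghost_length_def
 by (rule SUP_least, rule Inf_lower) (use assms in blast)

end

text \<open>
Cyclic groups are included, with \<open>h\<close> trivial and \<open>b = 0\<close>.
\<close>

locale two_gens = p_modules +
 fixes g h and a b :: nat
 assumes gh: "g \<in> carrier G" "h \<in> carrier G" and comm: "k \<in> carrier G ==> l \<in> carrier G ==> k \<otimes> l = l \<otimes> k"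
  and gpow: "g [^] (p ^ a) = \<one>" and hpow: "h [^] (p ^ b) = \<one>" and a0: "a \<noteq> 0"
  and bij: "bij_betw (%(i, j). g [^] (i::nat) \<otimes> h [^] (j::nat)) ({..<p ^ a} \<times> {..<p ^ b}) (carrier G)"
begin

abbreviation "X \<equiv> dx g"
abbreviation "Y \<equiv> dx h"
definition nm where "nm rh v = (X rh ^^ (p ^ a - 1)) ((Y rh ^^ (p ^ b - 1)) v)"
definition T2 where "T2 rh rh' \<phi> = cyc (X rh') (X rh) (p ^ a) (cyc (Y rh') (Y rh) (p ^ b) \<phi>)"

lemma p0: "0 < p ^ c" using prime_p prime_gt_0_nat by simp

lemma dx_equiv: assumes "rep rh" "k \<in> carrier G" shows "equiv rh rh (dx k rh)"
 unfolding equiv_def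
 using dx_lin[OF assms] assms comm by (simp add: dx_def lin_diff[OF repD(1)[OF assms(1)]] repD(2)[OF assms(1)])

lemma XY: assumes "rep rh" shows "X rh (Y rh v) = Y rh (X rh v)"
 using dx_equivariant[OF dx_equiv[OF assms gh(1)] gh(2)] .

lemma equiv_pow: assumes "equiv rh rh F" shows "equiv rh rh (F ^^ n)"
 unfolding equiv_def
proof (intro conjI ballI allI)
 show "lin (F ^^ n)" by (rule lin_pow[OF equivD(1)[OF assms]])
 show "(F ^^ n) (rh k v) = rh k ((F ^^ n) v)" if "k \<in> carrier G" for k v
  by (induction n) (simp_all add: equivD(2)[OF assms that])
qed

lemma nm_equiv: assumes "rep rh" shows "equiv rh rh (nm rh)"
 unfolding nm_def[abs_def] by (rule equiv_comp[OF equiv_pow equiv_pow]) (rule dx_equiv[OF assms gh(2)], rule dx_equiv[OF assms gh(1)])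

lemma nm_equivariant: assumes "equiv rh rh' F" shows "F (nm rh v) = nm rh' (F v)"
 unfolding nm_def pow_intertwine[of F "X rh" "X rh'", OF dx_equivariant[OF assms gh(1)]]
  pow_intertwine[of F "Y rh" "Y rh'", OF dx_equivariant[OF assms gh(2)]] ..

lemma nm_mU: assumes "rep rh" "v \<in> mU rh" shows "nm rh v \<in> mU rh"
 unfolding nm_def by (intro dx_pow_mU assms gh)

lemma norm_sum: assumes r: "rep rh" and v: "v \<in> mU rh" shows "(\<Sum>k\<in>carrier G. rh k v) = nm rh v"
proof -
 have cs: "(dx k rh ^^ (p ^ c - 1)) w = (\<Sum>l<p ^ c. rh (k [^] l) w)" if k: "k \<in> carrier G" and w: "w \<in> mU rh" for k w c
  unfolding dx_pow[OF r k w] pow_minus_one[OF repD(1)[OF r k]]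
  by (rule sum.cong[OF refl]) (use rep_pow[OF r k, of _ w] mU_D[OF w] in simp)
 have "nm rh v = (\<Sum>i<p ^ a. rh (g [^] i) (\<Sum>j<p ^ b. rh (h [^] j) v))"
  unfolding nm_def cs[OF gh(1) dx_pow_mU[OF r gh(2) v]] unfolding cs[OF gh(2) v] ..
 also have "\<dots> = (\<Sum>i<p ^ a. \<Sum>j<p ^ b. rh (g [^] i \<otimes> h [^] j) v)"
  using gh by (simp add: lin_sum[OF repD(1)[OF r]] repD(2)[OF r])
 also have "\<dots> = (\<Sum>y\<in>{..<p ^ a} \<times> {..<p ^ b}. rh ((%(i, j). g [^] i \<otimes> h [^] j) y) v)"
  by (simp add: sum.cartesian_product case_prod_unfold)
 also have "\<dots> = (\<Sum>k\<in>carrier G. rh k v)" by (rule sum.reindex_bij_betw[OF bij])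
 finally show ?thesis ..
qed

lemma nm_fixed: assumes r: "rep rh" and v: "v \<in> mU rh" and k: "k \<in> carrier G"
 shows "rh k (nm rh v) = nm rh v" "nm rh (rh k v) = nm rh v"
proof -
 show 1: "rh k (nm rh v) = nm rh v"
  unfolding norm_sum[OF r v, symmetric] lin_sum[OF repD(1)[OF r k]] using k
  by (simp add: repD(2)[OF r]) (rule sum_group_left[OF k])
 show "nm rh (rh k v) = nm rh v" using equivD(2)[OF nm_equiv[OF r] k] 1 by simp
qed

lemma T2_trace:
 assumes r: "rep rh" "rep rh'" and \<phi>: "normalized rh rh' \<phi>"
 shows "T2 rh rh' \<phi> v = Tr rh rh' (%v. \<phi> (rh (inv h \<otimes> inv g) v)) v"
proof -
 note c1 = cyc_trace[OF r gh(2) hpow \<phi>]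
 have "T2 rh rh' \<phi> v = (\<Sum>i<p ^ a. rh' (g [^] i) (\<Sum>j<p ^ b. rh' (h [^] j) (\<phi> (rh (inv h \<otimes> inv (h [^] j)) (rh (inv g \<otimes> inv (g [^] i)) v)))))"
  unfolding T2_def cyc_trace(1)[OF r gh(1) gpow c1(2)] c1(1) ..
 also have "\<dots> = (\<Sum>i<p ^ a. \<Sum>j<p ^ b. rh' (g [^] i \<otimes> h [^] j) (\<phi> (rh (inv h \<otimes> inv g) (rh (inv (g [^] i \<otimes> h [^] j)) v))))"
 proof (intro sum.cong[OF refl])
  fix i :: nat
  have "rh' (h [^] j) (\<phi> (rh (inv h \<otimes> inv (h [^] j)) (rh (inv g \<otimes> inv (g [^] i)) v))) =
    rh' (h [^] j) (\<phi> (rh (inv h \<otimes> inv g) (rh (inv (g [^] i \<otimes> h [^] j)) v)))" for j :: nat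
  proof -
   have "(inv h \<otimes> inv (h [^] j)) \<otimes> (inv g \<otimes> inv (g [^] i)) = inv h \<otimes> ((inv (h [^] j) \<otimes> inv g) \<otimes> inv (g [^] i))"
    using gh by (simp add: m_assoc)
   also have "inv (h [^] j) \<otimes> inv g = inv g \<otimes> inv (h [^] j)" by (rule comm) (use gh in auto)
   also have "inv h \<otimes> (inv g \<otimes> inv (h [^] j) \<otimes> inv (g [^] i)) = (inv h \<otimes> inv g) \<otimes> inv (g [^] i \<otimes> h [^] j)"
    using gh by (simp add: m_assoc inv_mult_group)
   finally show ?thesis using gh by (simp add: repD(2)[OF r(1)])
  qed
  then show "rh' (g [^] i) (\<Sum>j<p ^ b. rh' (h [^] j) (\<phi> (rh (inv h \<otimes> inv (h [^] j)) (rh (inv g \<otimes> inv (g [^] i)) v)))) =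
    (\<Sum>j<p ^ b. rh' (g [^] i \<otimes> h [^] j) (\<phi> (rh (inv h \<otimes> inv g) (rh (inv (g [^] i \<otimes> h [^] j)) v))))"
   using gh by (simp add: lin_sum[OF repD(1)[OF r(2)]] repD(2)[OF r(2)])
 qed
 also have "\<dots> = (\<Sum>y\<in>{..<p ^ a} \<times> {..<p ^ b}. (%k. rh' k (\<phi> (rh (inv h \<otimes> inv g) (rh (inv k) v)))) ((%(i, j). g [^] i \<otimes> h [^] j) y))"
  by (simp add: sum.cartesian_product case_prod_unfold)
 also have "\<dots> = (\<Sum>k\<in>carrier G. rh' k (\<phi> (rh (inv h \<otimes> inv g) (rh (inv k) v))))" by (rule sum.reindex_bij_betw[OF bij])
 finally show ?thesis by (simp add: Tr_def)
qed

lemma T2_cong: assumes r: "rep rh" and v: "v \<in> mU rh" shows "T2 rh rh' (%v. \<phi> (rh \<one> v)) v = T2 rh rh' \<phi> v"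
proof -
 have "rh \<one> ((Y rh ^^ j) ((X rh ^^ i) v)) = (Y rh ^^ j) ((X rh ^^ i) v)" for i j
  by (rule mU_D[OF dx_pow_mU[OF r gh(2) dx_pow_mU[OF r gh(1) v]]])
 then show ?thesis by (simp add: T2_def cyc_def)
qed

lemma T2_szero:
 assumes r: "rep rh" "rep rh'" and \<phi>: "lin \<phi>" "\<And>v. \<phi> v \<in> mU rh'" and H: "equiv rh0 rh H" "\<And>v. H v \<in> mU rh"
  and F: "\<And>v. F v = T2 rh rh' \<phi> (H v)"
 shows "szero rh0 rh' F"
proof -
 have n: "normalized rh rh' (%v. \<phi> (rh \<one> v))"
  unfolding normalized_def using lin_comp[OF \<phi>(1) repD(1)[OF r(1) one_closed]] mU_D[OF \<phi>(2)] by (simp add: rep1[OF r(1)])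
 have "lin (%v. \<phi> (rh \<one> (rh (inv h \<otimes> inv g) v)))"
  by (rule lin_comp[OF lin_comp[OF \<phi>(1) repD(1)[OF r(1) one_closed]] repD(1)[OF r(1)]]) (use gh in simp)
 then have "szero rh rh' (T2 rh rh' (%v. \<phi> (rh \<one> v)))" unfolding szero_def using T2_trace[OF r n] by blast
 from szero_comp_right[OF this H(1)] show ?thesis by (simp add: T2_cong[OF r(1) H(2)] F[abs_def])
qed

lemma proj_T2:
 assumes P: "proj rh"
 obtains \<phi> where "lin \<phi>" "\<And>v. \<phi> v \<in> mU rh" "\<And>v. v \<in> mU rh ==> v = T2 rh rh \<phi> v"
proof -
 have r: "rep rh" using P by (simp add: proj_def)
 obtain \<psi> where \<psi>: "lin \<psi>" "\<And>v. rh \<one> v = Tr rh rh \<psi> v" using P by (auto simp: proj_def szero_def)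
 define \<phi> where "\<phi> v = rh \<one> (\<psi> (rh (g \<otimes> h) v))" for v
 have l: "lin \<phi>" unfolding \<phi>_def[abs_def]
  by (rule lin_comp[OF repD(1)[OF r one_closed] lin_comp[OF \<psi>(1) repD(1)[OF r]]]) (use gh in simp)
 have n: "normalized rh rh \<phi>" unfolding normalized_def using l gh by (simp add: \<phi>_def rep1[OF r])
 have "T2 rh rh \<phi> v = rh \<one> v" for v
 proof -
  have "(g \<otimes> h) \<otimes> (inv h \<otimes> inv g) = \<one>" using gh by (simp add: m_assoc) (simp add: m_assoc[symmetric])
  then have e: "\<phi> (rh (inv h \<otimes> inv g) w) = rh \<one> (\<psi> (rh \<one> w))" for w
   using gh by (simp add: \<phi>_def repD(2)[OF r])
  have "T2 rh rh \<phi> v = Tr rh rh (%w. rh \<one> (\<psi> (rh \<one> w))) v" unfolding T2_trace[OF r r n] e ..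
  also have "\<dots> = Tr rh rh \<psi> v" unfolding Tr_def by (rule sum.cong[OF refl]) (simp add: rep1[OF r])
  finally show ?thesis using \<psi>(2) by simp
 qed
 note T = this
 show thesis
 proof (rule that[OF l])
  show "\<phi> v \<in> mU rh" for v unfolding \<phi>_def by (rule mU_rep[OF r one_closed])
  show "v = T2 rh rh \<phi> v" if "v \<in> mU rh" for v unfolding T using mU_D[OF that] by simp
 qed
qed

text \<open>
In \<open>v = \<Sum>c d. x\<^sup>q\<^sup>-\<^sup>1\<^sup>-\<^sup>c y\<^sup>r\<^sup>-\<^sup>1\<^sup>-\<^sup>d \<phi> (x\<^sup>c y\<^sup>d v)\<close> only those terms are left whose argument does not vanish.
\<close>

lemma proj_facts:
 assumes P: "proj rh" and v: "v \<in> mU rh"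
 shows "X rh v = 0 ==> Y rh v = 0 ==> \<exists>u\<in>mU rh. v = nm rh u"
  and "nm rh v = 0 ==> \<exists>s\<in>mU rh. \<exists>t\<in>mU rh. v = X rh s + Y rh t"
  and "(X rh ^^ (p ^ a - 1)) v = 0 ==> \<exists>s\<in>mU rh. v = X rh s"
  and "X rh v = 0 ==> \<exists>s\<in>mU rh. v = (X rh ^^ (p ^ a - 1)) s"
proof -
 have r: "rep rh" using P by (simp add: proj_def)
 obtain \<phi> where \<phi>: "lin \<phi>" "\<And>v. \<phi> v \<in> mU rh" "\<And>v. v \<in> mU rh ==> v = T2 rh rh \<phi> v" by (rule proj_T2[OF P]) blast
 note U = mU_subspace[OF r] and lX = dx_lin[OF r gh(1)] and lY = dx_lin[OF r gh(2)] and mX = dx_mU[OF r gh(1)] and mY = dx_mU[OF r gh(2)]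
 define \<psi> where "\<psi> = cyc (Y rh) (Y rh) (p ^ b) \<phi>"
 have l\<psi>: "lin \<psi>" unfolding \<psi>_def by (rule cyc_lin[OF lY lY \<phi>(1)])
 have \<psi>U: "\<psi> w \<in> mU rh" for w
  unfolding \<psi>_def cyc_def by (intro subspace_sum[OF U] dx_pow_mU[OF r gh(2)] \<phi>(2))
 have v\<psi>: "v = cyc (X rh) (X rh) (p ^ a) \<psi> v" using \<phi>(3)[OF v] by (simp add: T2_def \<psi>_def)
 have k: "X rh v = 0 ==> v = (X rh ^^ (p ^ a - 1)) (\<psi> v)" using v\<psi> cyc_kernel[OF lX lX l\<psi> _ p0[of a], of v] by simp
 obtain w where w: "w \<in> mU rh" "v = \<psi> ((X rh ^^ (p ^ a - 1)) v) + X rh w"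
  using v\<psi> cyc_top[where \<phi> = \<psi> and x = "X rh" and v = v, OF lX U mX \<psi>U p0[of a]] by auto
 show "\<exists>s\<in>mU rh. v = (X rh ^^ (p ^ a - 1)) s" if "X rh v = 0" using k[OF that] \<psi>U by blast
 show "\<exists>s\<in>mU rh. v = X rh s" if "(X rh ^^ (p ^ a - 1)) v = 0" using w unfolding that lin_0[OF l\<psi>] by auto
 show "\<exists>u\<in>mU rh. v = nm rh u" if "X rh v = 0" "Y rh v = 0"
  using k[OF that(1)] \<phi>(2)[of v] unfolding \<psi>_def cyc_kernel[where x = "Y rh" and v = v, OF lY lY \<phi>(1) that(2) p0] nm_def[symmetric] by blast
 show "\<exists>s\<in>mU rh. \<exists>t\<in>mU rh. v = X rh s + Y rh t" if 0: "nm rh v = 0"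
 proof -
  let ?z = "(X rh ^^ (p ^ a - 1)) v"
  have XYp: "(Y rh ^^ j) ((X rh ^^ i) v) = (X rh ^^ i) ((Y rh ^^ j) v)" for i j
  proof -
   have "equiv rh rh (X rh ^^ i)" by (rule equiv_pow[OF dx_equiv[OF r gh(1)]])
   from pow_intertwine[of "X rh ^^ i" "Y rh" "Y rh", OF dx_equivariant[OF this gh(2)]] show ?thesis by simp
  qed
  have "(Y rh ^^ (p ^ b - 1)) ?z = 0" using 0 by (simp only: XYp nm_def)
  moreover obtain t where "t \<in> mU rh" "\<psi> ?z = \<phi> ((Y rh ^^ (p ^ b - 1)) ?z) + Y rh t"
   using cyc_top[where \<phi> = \<phi> and x = "Y rh" and v = ?z, OF lY U mY \<phi>(2) p0[of b]] unfolding \<psi>_def by blast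
  ultimately show ?thesis using w by (intro bexI[of _ w] bexI[of _ t]) (auto simp: lin_0[OF \<phi>(1)] add.commute)
 qed
qed

end

section \<open>Ghosts in degrees 0, -1 and -2\<close>

context p_modules begin

lemma equiv_plus: assumes r: "rep rh'" and F: "equiv rh rh' F" "equiv rh rh' H"
 shows "equiv rh rh' (%v. F v + H v)" "equiv rh rh' (%v. F v - H v)"
 unfolding equiv_def using lin_plus[OF equivD(1)[OF F(1)] equivD(1)[OF F(2)]] lin_sub[OF equivD(1)[OF F(1)] equivD(1)[OF F(2)]]
 by (simp_all add: equivD(2)[OF F(1)] equivD(2)[OF F(2)] lin_add[OF repD(1)[OF r]] lin_diff[OF repD(1)[OF r]])

lemma \<sigma>_equiv: "S \<subseteq> carrier G ==> s \<in> S ==> equiv (dsum S rh) rh (\<sigma> s)"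
 unfolding equiv_def by (intro conjI ballI allI lin_\<sigma>) (rule \<sigma>_dsum)

lemma pow_last: "0 < n ==> (F ^^ (n - 1)) (F v) = (F ^^ n) v"
 by (cases n) (simp_all add: funpow_swap1)

end

context two_gens begin

definition \<nu>0 where "\<nu>0 = (\<Sum>k\<in>carrier G. bs k)"

lemma \<nu>0: "\<nu>0 \<noteq> 0" "k \<in> carrier G ==> Reg k \<nu>0 = \<nu>0"
proof -
 show "\<nu>0 \<noteq> 0" using norm_bs_nonzero by (simp add: \<nu>0_def)
 assume k: "k \<in> carrier G"
 have "Reg k \<nu>0 = (\<Sum>l\<in>carrier G. bs (k \<otimes> l))"
  unfolding \<nu>0_def lin_sum[OF repD(1)[OF rep_Reg k]] using k by (intro sum.cong[OF refl]) (simp add: Reg_bs)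
 then show "Reg k \<nu>0 = \<nu>0" unfolding \<nu>0_def sum_group_left[OF k] .
qed

lemma bs_mU: "k \<in> carrier G ==> bs k \<in> mU Reg" by (simp add: mU_def Reg_bs)

lemma nm_bs: assumes k: "k \<in> carrier G" shows "nm Reg (bs k) = \<nu>0"
proof -
 have "nm Reg (bs k) = (\<Sum>l\<in>carrier G. Reg l (bs k))" by (rule norm_sum[OF rep_Reg bs_mU[OF k], symmetric])
 also have "\<dots> = (\<Sum>l\<in>carrier G. bs (l \<otimes> k))" by (rule sum.cong[OF refl]) (simp add: Reg_bs k)
 finally show ?thesis unfolding sum_group_right[OF k] \<nu>0_def .
qed

lemma Reg_socle: assumes w: "w \<in> mU Reg"
 shows "X Reg w = 0 \<and> Y Reg w = 0 \<longleftrightarrow> (\<exists>c. w = pscale c \<nu>0)"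
proof
 assume "X Reg w = 0 \<and> Y Reg w = 0"
 then obtain u where u: "u \<in> mU Reg" "w = nm Reg u" using proj_facts(1)[OF proj_Reg w] by blast
 note l = equivD(1)[OF nm_equiv[OF rep_Reg]]
 have "subspace {u. \<exists>c. nm Reg u = pscale c \<nu>0}"
 proof (rule subspaceI, goal_cases)
  case 1 show ?case using lin_0[OF l] by (auto intro!: exI[of _ 0])
 next
  case (2 u v)
  then obtain c d where "nm Reg u = pscale c \<nu>0" "nm Reg v = pscale d \<nu>0" by blast
  then have "nm Reg (u + v) = pscale (c + d) \<nu>0" by (simp add: lin_add[OF l] scale_left_distrib)
  then show ?case by blast
 next
  case (3 d u)
  then obtain c where "nm Reg u = pscale c \<nu>0" by blast
  then have "nm Reg (pscale d u) = pscale (d * c) \<nu>0" by (simp add: lin_scale[OF l])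
  then show ?case by blast
 qed
 moreover have "bs ` carrier G \<subseteq> {u. \<exists>c. nm Reg u = pscale c \<nu>0}"
 proof clarify
  fix k assume "k \<in> carrier G"
  then have "nm Reg (bs k) = pscale 1 \<nu>0" by (simp add: nm_bs)
  then show "\<exists>c. nm Reg (bs k) = pscale c \<nu>0" by blast
 qed
 ultimately have "span (bs ` carrier G) \<subseteq> {u. \<exists>c. nm Reg u = pscale c \<nu>0}" by (intro span_minimal)
 then have "Reg \<one> u \<in> {u. \<exists>c. nm Reg u = pscale c \<nu>0}" using Reg_one_span by blast
 then show "\<exists>c. w = pscale c \<nu>0" using u by (simp add: mU_D)
next
 assume "\<exists>c. w = pscale c \<nu>0"
 then obtain c where w: "w = pscale c \<nu>0" by blast
 have "dx k Reg w = 0" if "k \<in> carrier G" for k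
  unfolding w lin_scale[OF dx_lin[OF rep_Reg that]] by (simp add: dx_def \<nu>0 that)
 then show "X Reg w = 0 \<and> Y Reg w = 0" using gh by blast
qed

lemma orb_socle: assumes r: "rep rh" and v: "v \<in> mU rh" "nm rh v = 0" and w: "w \<in> mU Reg" "X Reg w = 0" "Y Reg w = 0"
 shows "orb rh v w = 0"
proof -
 note l = equivD(1)[OF orb_equiv(1)[OF r]]
 obtain c where c: "w = pscale c \<nu>0" using Reg_socle[OF w(1)] w by blast
 have "orb rh v \<nu>0 = (\<Sum>k\<in>carrier G. rh k v)"
  unfolding \<nu>0_def lin_sum[OF l] by (rule sum.cong[OF refl]) (rule orb_equiv(2)[OF r])
 then show ?thesis using v by (simp add: c lin_scale[OF l] norm_sum[OF r])
qed

lemma fixed_all: assumes r: "rep rh" and v: "v \<in> mU rh" "X rh v = 0" "Y rh v = 0" and k: "k \<in> carrier G"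
 shows "rh k v = v"
proof -
 have fx: "rh (l [^] (i :: nat)) v = v" if l: "l \<in> carrier G" "dx l rh v = 0" for l i
 proof -
  have "rh l v = v" using l(2) mU_D[OF v(1)] by (simp add: dx_def)
  then have "(rh l ^^ i) v = v" by (induction i) auto
  then show ?thesis using rep_pow[OF r l(1), of i v] mU_D[OF v(1)] by simp
 qed
 obtain i j :: nat where "k = g [^] i \<otimes> h [^] j"
  using bij k unfolding bij_betw_def by (metis (no_types, lifting) case_prod_conv imageE surj_pair)
 then have "rh k v = rh (g [^] i) (rh (h [^] j) v)" using gh by (simp add: repD(2)[OF r])
 then show ?thesis using fx gh v by simp
qed

lemma gens_distinct: shows "g \<noteq> \<one>" and "b \<noteq> 0 ==> h \<noteq> \<one>" and "b \<noteq> 0 ==> h \<noteq> g"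
proof -
 have big: "1 < p ^ c" if "c \<noteq> 0" for c using that one_less_power[OF prime_gt_1_nat[OF prime_p], of c] by simp
 note inj = inj_onD[OF bij_betw_imp_inj_on[OF bij]]
 show "g \<noteq> \<one>" using inj[of "(1, 0)" "(0, 0)"] big[OF a0] prime_gt_0_nat[OF prime_p] gh by auto
 assume b: "b \<noteq> 0"
 show "h \<noteq> \<one>" using inj[of "(0, 1)" "(0, 0)"] big[OF b] prime_gt_0_nat[OF prime_p] gh by auto
 show "h \<noteq> g" using inj[of "(0, 1)" "(1, 0)"] big[OF b] big[OF a0] prime_gt_0_nat[OF prime_p] gh by auto
qed

definition \<Theta>1 where "\<Theta>1 w = (\<Sum>s\<in>{\<one>, g}. \<theta> s (if s = \<one> then X Reg w else Y Reg w))"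

lemma \<Theta>1: "equiv Reg (dsum {\<one>, g} Reg) \<Theta>1" "\<sigma> \<one> (\<Theta>1 w) = X Reg w" "\<sigma> g (\<Theta>1 w) = Y Reg w"
 "\<Theta>1 w = \<theta> \<one> (X Reg w) + \<theta> g (Y Reg w)" "\<Theta>1 (Reg \<one> w) = 0 \<longleftrightarrow> (\<exists>c. Reg \<one> w = pscale c \<nu>0)"
proof -
 have S: "{\<one>, g} \<subseteq> carrier G" using gh by simp
 have "equiv Reg Reg (%w. if s = \<one> then X Reg w else Y Reg w)" if "s \<in> {\<one>, g}" for s
  using dx_equiv[OF rep_Reg] gh by (cases "s = \<one>") simp_all
 then show "equiv Reg (dsum {\<one>, g} Reg) \<Theta>1" unfolding \<Theta>1_def[abs_def] by (intro dsum_into[OF S])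
 have s: "\<sigma> s (\<Theta>1 w) = (if s = \<one> then X Reg w else Y Reg w)" if "s \<in> {\<one>, g}" for s w
  unfolding \<Theta>1_def by (rule \<sigma>_sum_\<theta>[OF S that])
 show 1: "\<sigma> \<one> (\<Theta>1 w) = X Reg w" "\<sigma> g (\<Theta>1 w) = Y Reg w" for w
  using s[of \<one> w] s[of g w] gens_distinct(1) by auto
 show 2: "\<Theta>1 w = \<theta> \<one> (X Reg w) + \<theta> g (Y Reg w)" for w
  using gens_distinct(1) by (auto simp: \<Theta>1_def)
 have "\<Theta>1 (Reg \<one> w) = 0 \<longleftrightarrow> X Reg (Reg \<one> w) = 0 \<and> Y Reg (Reg \<one> w) = 0"
  using 1[of "Reg \<one> w"] 2[of "Reg \<one> w"] by (auto simp: lin_0[OF lin_\<sigma>] lin_0[OF lin_\<theta>])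
 then show "\<Theta>1 (Reg \<one> w) = 0 \<longleftrightarrow> (\<exists>c. Reg \<one> w = pscale c \<nu>0)"
  using Reg_socle[OF mU_rep[OF rep_Reg one_closed]] by blast
qed

lemma ghost_on_socle:
 assumes gh': "ghost KG K M N f" and M: "coord M rh ka em" and N: "coord N rh' ka' em'"
  and v: "v \<in> mU rh" "X rh v = 0" "Y rh v = 0"
 shows "\<exists>n\<in>mU rh'. ka' (f (em v)) = nm rh' n"
 using ghost_fixed[OF gh' M N fixed_all[OF coordD(2)[OF M] v]] norm_sum[OF coordD(2)[OF N]] by (auto simp: mU_def)

lemma ghost_on_norm_kernel:
 assumes gh': "ghost KG K M N f" and M: "coord M rh ka em" and N: "coord N rh' ka' em'"
  and v: "v \<in> mU rh" "nm rh v = 0"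
 shows "\<exists>s\<in>mU rh'. \<exists>t\<in>mU rh'. ka' (f (em v)) = X rh' s + Y rh' t"
proof -
 note r = coordD(2)[OF M] and r' = coordD(2)[OF N]
 have S: "{\<one>, g} \<subseteq> carrier G" using gh by simp
 have "\<exists>F. equiv (dsum {\<one>, g} Reg) rh' F \<and> (\<forall>w. F (\<Theta>1 (Reg \<one> w)) = ka' (f (em (orb rh v (Reg \<one> w)))))"
 proof (rule ghost_cosyzygies(1)[OF gh' M N proj_Reg \<nu>0 proj_dsum[OF proj_Reg S] \<Theta>1(1,5) orb_equiv(1)[OF r]])
  fix w assume "\<Theta>1 (Reg \<one> w) = 0"
  then have "X Reg (Reg \<one> w) = 0 \<and> Y Reg (Reg \<one> w) = 0"
   using \<Theta>1(2,3)[of "Reg \<one> w"] by (simp add: lin_0[OF lin_\<sigma>])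
  then show "orb rh v (Reg \<one> w) = 0" using orb_socle[OF r v mU_rep[OF rep_Reg one_closed]] by blast
 qed
 then obtain F where F: "equiv (dsum {\<one>, g} Reg) rh' F" "\<And>w. F (\<Theta>1 (Reg \<one> w)) = ka' (f (em (orb rh v (Reg \<one> w))))" by blast
 have e: "equiv Reg rh' (%w. F (\<theta> s w))" if "s \<in> {\<one>, g}" for s
  by (rule equiv_comp[OF \<theta>_dsum[OF S rep_Reg that] F(1)])
 have "orb rh v (bs \<one>) = v" using orb_equiv(2)[OF r one_closed] mU_D[OF v(1)] by simp
 then have "ka' (f (em v)) = F (\<Theta>1 (bs \<one>))" using F(2)[of "bs \<one>"] by (simp add: Reg_bs)
 also have "\<dots> = X rh' (F (\<theta> \<one> (bs \<one>))) + Y rh' (F (\<theta> g (bs \<one>)))"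
  unfolding \<Theta>1(4) lin_add[OF equivD(1)[OF F(1)]]
  using dx_equivariant[OF e gh(1), of \<one> "bs \<one>"] dx_equivariant[OF e gh(2), of g "bs \<one>"] by simp
 finally have F': "ka' (f (em v)) = X rh' (F (\<theta> \<one> (bs \<one>))) + Y rh' (F (\<theta> g (bs \<one>)))" .
 have "F (\<theta> k (bs \<one>)) \<in> mU rh'" if "k \<in> {\<one>, g}" for k by (rule mU_equiv[OF e[OF that] bs_mU[OF one_closed]])
 then show ?thesis using F' by blast
qed

definition \<Theta>2 where "\<Theta>2 w = (\<Sum>s\<in>{\<one>, g, h}. \<theta> s (if s = \<one> then Y Reg (\<sigma> \<one> w) - X Reg (\<sigma> g w)
 else if s = g then (X Reg ^^ (p ^ a - 1)) (\<sigma> \<one> w) else (Y Reg ^^ (p ^ b - 1)) (\<sigma> g w)))"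

lemma \<Theta>2:
 assumes b: "b \<noteq> 0"
 shows "equiv (dsum {\<one>, g} Reg) (dsum {\<one>, g, h} Reg) \<Theta>2"
  "\<Theta>2 w = \<theta> \<one> (Y Reg (\<sigma> \<one> w) - X Reg (\<sigma> g w)) + (\<theta> g ((X Reg ^^ (p ^ a - 1)) (\<sigma> \<one> w)) + \<theta> h ((Y Reg ^^ (p ^ b - 1)) (\<sigma> g w)))"
  "\<Theta>2 (dsum {\<one>, g} Reg \<one> w) = 0 \<longleftrightarrow> (\<exists>v. \<Theta>1 (Reg \<one> v) = dsum {\<one>, g} Reg \<one> w)"
proof -
 have S1: "{\<one>, g} \<subseteq> carrier G" and S2: "{\<one>, g, h} \<subseteq> carrier G" using gh by auto
 note d = gens_distinct(1) gens_distinct(2,3)[OF b]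
 note eX = dx_equiv[OF rep_Reg gh(1)] and eY = dx_equiv[OF rep_Reg gh(2)]
 note e1 = \<sigma>_equiv[OF S1 insertI1, of Reg] and eg = \<sigma>_equiv[OF S1 insertI2[OF singletonI], of Reg]
 have "equiv (dsum {\<one>, g} Reg) Reg (%w. if s = \<one> then Y Reg (\<sigma> \<one> w) - X Reg (\<sigma> g w)
   else if s = g then (X Reg ^^ (p ^ a - 1)) (\<sigma> \<one> w) else (Y Reg ^^ (p ^ b - 1)) (\<sigma> g w))" for s
  using equiv_plus(2)[OF rep_Reg equiv_comp[OF e1 eY] equiv_comp[OF eg eX]] equiv_comp[OF e1 equiv_pow[OF eX]] equiv_comp[OF eg equiv_pow[OF eY]]
  by (cases "s = \<one>"; cases "s = g") simp_all
 then show "equiv (dsum {\<one>, g} Reg) (dsum {\<one>, g, h} Reg) \<Theta>2" unfolding \<Theta>2_def[abs_def] by (intro dsum_into[OF S2])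
 show sum: "\<Theta>2 w = \<theta> \<one> (Y Reg (\<sigma> \<one> w) - X Reg (\<sigma> g w)) + (\<theta> g ((X Reg ^^ (p ^ a - 1)) (\<sigma> \<one> w)) + \<theta> h ((Y Reg ^^ (p ^ b - 1)) (\<sigma> g w)))" for w
  using d by (auto simp: \<Theta>2_def)
 have s: "\<sigma> s (\<Theta>2 w) = (if s = \<one> then Y Reg (\<sigma> \<one> w) - X Reg (\<sigma> g w)
   else if s = g then (X Reg ^^ (p ^ a - 1)) (\<sigma> \<one> w) else (Y Reg ^^ (p ^ b - 1)) (\<sigma> g w))" if "s \<in> {\<one>, g, h}" for s w
  unfolding \<Theta>2_def by (rule \<sigma>_sum_\<theta>[OF S2 that])
 have z: "\<Theta>2 w = 0 \<longleftrightarrow> Y Reg (\<sigma> \<one> w) = X Reg (\<sigma> g w) \<and> (X Reg ^^ (p ^ a - 1)) (\<sigma> \<one> w) = 0 \<and> (Y Reg ^^ (p ^ b - 1)) (\<sigma> g w) = 0" for w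
  using s[of \<one> w] s[of g w] s[of h w] sum[of w] d by (auto simp: lin_0[OF lin_\<sigma>] lin_0[OF lin_\<theta>])
 note lX = dx_lin[OF rep_Reg gh(1)] and lY = dx_lin[OF rep_Reg gh(2)]
 define y where "y = dsum {\<one>, g} Reg \<one> w"
 have y1: "dsum {\<one>, g} Reg \<one> y = y" unfolding y_def by (rule rep1(1)[OF rep_dsum[OF rep_Reg S1] one_closed])
 have yU: "\<sigma> \<one> y \<in> mU Reg" "\<sigma> g y \<in> mU Reg" using dsum_fixed[OF S1 y1] by (auto simp: mU_def)
 have ysum: "y = \<theta> \<one> (\<sigma> \<one> y) + \<theta> g (\<sigma> g y)"
 proof -
  have "y = (\<Sum>s\<in>{\<one>, g}. \<theta> s (Reg \<one> (\<sigma> s y)))" using y1 by (simp only: dsum_def)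
  then show ?thesis using d(1) mU_D[OF yU(1)] mU_D[OF yU(2)] by auto
 qed
 have "\<Theta>2 y = 0 \<longleftrightarrow> (\<exists>v. \<Theta>1 (Reg \<one> v) = y)"
 proof
  assume "\<Theta>2 y = 0"
  then have 0: "Y Reg (\<sigma> \<one> y) = X Reg (\<sigma> g y)" "(X Reg ^^ (p ^ a - 1)) (\<sigma> \<one> y) = 0" "(Y Reg ^^ (p ^ b - 1)) (\<sigma> g y) = 0"
   unfolding z by blast+
  obtain s where s: "s \<in> mU Reg" "\<sigma> \<one> y = X Reg s" using proj_facts(3)[OF proj_Reg yU(1) 0(2)] by blast
  define q where "q = Y Reg s - \<sigma> g y"
  have qU: "q \<in> mU Reg" unfolding q_def by (rule subspace_diff[OF mU_subspace[OF rep_Reg] dx_mU[OF rep_Reg gh(2)] yU(2)])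
  have "X Reg q = 0" using 0(1) unfolding q_def lin_diff[OF lX] s(2) XY[OF rep_Reg] by simp
  then obtain t where t: "t \<in> mU Reg" "q = (X Reg ^^ (p ^ a - 1)) t" using proj_facts(4)[OF proj_Reg qU] by blast
  have XYp: "(Y Reg ^^ j) ((X Reg ^^ i) v) = (X Reg ^^ i) ((Y Reg ^^ j) v)" for i j v
   using pow_intertwine[of "X Reg ^^ i" "Y Reg" "Y Reg", OF dx_equivariant[OF equiv_pow[OF eX] gh(2)]] by simp
  have "nm Reg t = (Y Reg ^^ (p ^ b - 1)) q" by (simp only: t(2) XYp nm_def)
  also have "\<dots> = (Y Reg ^^ (p ^ b)) s"
   unfolding q_def lin_diff[OF lin_pow[OF lY]] 0(3) pow_last[OF p0] by simp
  also have "\<dots> = 0" by (rule dx_nil[OF rep_Reg gh(2) hpow])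
  finally obtain t1 t2 where t12: "t1 \<in> mU Reg" "t2 \<in> mU Reg" "t = X Reg t1 + Y Reg t2"
   using proj_facts(2)[OF proj_Reg t(1)] by blast
  have "q = (X Reg ^^ (p ^ a)) t1 + (X Reg ^^ (p ^ a - 1)) (Y Reg t2)"
   by (simp only: t(2) t12(3) lin_add[OF lin_pow[OF lX]] pow_last[OF p0])
  then have q: "q = Y Reg ((X Reg ^^ (p ^ a - 1)) t2)"
   using XYp[of 1 "p ^ a - 1" t2] by (simp add: dx_nil[OF rep_Reg gh(1) gpow])
  define u where "u = s - (X Reg ^^ (p ^ a - 1)) t2"
  have uU: "u \<in> mU Reg" unfolding u_def
   by (rule subspace_diff[OF mU_subspace[OF rep_Reg] s(1) dx_pow_mU[OF rep_Reg gh(1) t12(2)]])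
  have Suc: "Suc (p ^ a - 1) = p ^ a" using p0[of a] by simp
  have "X Reg ((X Reg ^^ (p ^ a - 1)) t2) = (X Reg ^^ Suc (p ^ a - 1)) t2" by simp
  also have "\<dots> = 0" unfolding Suc by (rule dx_nil[OF rep_Reg gh(1) gpow])
  finally have "X Reg u = \<sigma> \<one> y" by (simp add: u_def lin_diff[OF lX] s(2))
  moreover have "Y Reg u = \<sigma> g y"
  proof -
   have "\<sigma> g y = Y Reg s - q" by (simp add: q_def)
   then show ?thesis by (simp only: u_def lin_diff[OF lY] q[symmetric])
  qed
  ultimately have "\<Theta>1 (Reg \<one> u) = y" unfolding mU_D[OF uU] \<Theta>1(4) using ysum by simp
  then show "\<exists>v. \<Theta>1 (Reg \<one> v) = y" by blast
 next
  assume "\<exists>v. \<Theta>1 (Reg \<one> v) = y"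
  then obtain v where "y = \<Theta>1 (Reg \<one> v)" by blast
  then have "\<sigma> \<one> y = X Reg (Reg \<one> v)" "\<sigma> g y = Y Reg (Reg \<one> v)" using \<Theta>1(2,3) by simp_all
  then show "\<Theta>2 y = 0"
   unfolding z by (simp only: pow_last[OF p0] dx_nil[OF rep_Reg gh(1) gpow] dx_nil[OF rep_Reg gh(2) hpow] XY[OF rep_Reg] simp_thms)
 qed
 then show "\<Theta>2 (dsum {\<one>, g} Reg \<one> w) = 0 \<longleftrightarrow> (\<exists>v. \<Theta>1 (Reg \<one> v) = dsum {\<one>, g} Reg \<one> w)"
  unfolding y_def .
qed

lemma ghost_on_relation:
 assumes gh': "ghost KG K M N f" and M: "coord M rh ka em" and N: "coord N rh' ka' em'"
  and b: "b \<noteq> 0" and s: "s \<in> mU rh" "t \<in> mU rh" "X rh s + Y rh t = 0"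
 shows "\<exists>w\<in>mU rh'. \<exists>m\<in>mU rh'. \<exists>m'\<in>mU rh'. ka' (f (em s)) = Y rh' w + (X rh' ^^ (p ^ a - 1)) m \<and>
  ka' (f (em t)) = - X rh' w + (Y rh' ^^ (p ^ b - 1)) m'"
proof -
 note r = coordD(2)[OF M] and r' = coordD(2)[OF N]
 have S1: "{\<one>, g} \<subseteq> carrier G" and S2: "{\<one>, g, h} \<subseteq> carrier G" using gh by auto
 have in1: "\<one> \<in> {\<one>, g}" "g \<in> {\<one>, g}" by auto
 note d = gens_distinct(1) gens_distinct(2,3)[OF b]
 note e1 = \<sigma>_equiv[OF S1 in1(1), of Reg] and eg = \<sigma>_equiv[OF S1 in1(2), of Reg]
 define \<Psi> where "\<Psi> w = orb rh s (\<sigma> \<one> w) + orb rh t (\<sigma> g w)" for w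
 have e\<Psi>: "equiv (dsum {\<one>, g} Reg) rh \<Psi>" unfolding \<Psi>_def[abs_def]
  by (rule equiv_plus(1)[OF r equiv_comp[OF e1 orb_equiv(1)[OF r]] equiv_comp[OF eg orb_equiv(1)[OF r]]])
 have "\<exists>F. equiv (dsum {\<one>, g, h} Reg) rh' F \<and> (\<forall>w. F (\<Theta>2 (dsum {\<one>, g} Reg \<one> w)) = ka' (f (em (\<Psi> (dsum {\<one>, g} Reg \<one> w)))))"
 proof (rule ghost_cosyzygies(2)[OF gh' M N proj_Reg \<nu>0 proj_dsum[OF proj_Reg S1] \<Theta>1(1,5) rep_dsum[OF rep_Reg S2] \<Theta>2(1,3)[OF b] e\<Psi>])
  fix w assume "\<Theta>2 (dsum {\<one>, g} Reg \<one> w) = 0"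
  then obtain v where v: "\<Theta>1 (Reg \<one> v) = dsum {\<one>, g} Reg \<one> w" unfolding \<Theta>2(3)[OF b] by blast
  have "\<Psi> (\<Theta>1 (Reg \<one> v)) = 0"
  proof (rule Reg_lin_eq_0)
   show "lin (%v. \<Psi> (\<Theta>1 v))" by (rule lin_comp[OF equivD(1)[OF e\<Psi>] equivD(1)[OF \<Theta>1(1)]])
   fix k assume k: "k \<in> carrier G"
   have "\<Psi> (\<Theta>1 (bs k)) = X rh (rh k s) + Y rh (rh k t)"
    unfolding \<Psi>_def \<Theta>1(2,3) dx_equivariant[OF orb_equiv(1)[OF r] gh(1)] dx_equivariant[OF orb_equiv(1)[OF r] gh(2)] orb_equiv(2)[OF r k] ..
   also have "\<dots> = rh k (X rh s + Y rh t)"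
    by (simp add: equivD(2)[OF dx_equiv[OF r gh(1)] k] equivD(2)[OF dx_equiv[OF r gh(2)] k] lin_add[OF repD(1)[OF r k]])
   finally show "\<Psi> (\<Theta>1 (bs k)) = 0" unfolding s(3) lin_0[OF repD(1)[OF r k]] .
  qed
  then show "\<Psi> (dsum {\<one>, g} Reg \<one> w) = 0" unfolding v .
 qed
 then obtain F where F: "equiv (dsum {\<one>, g, h} Reg) rh' F"
  "\<And>w. F (\<Theta>2 (dsum {\<one>, g} Reg \<one> w)) = ka' (f (em (\<Psi> (dsum {\<one>, g} Reg \<one> w))))" by blast
 have e: "equiv Reg rh' (%w. F (\<theta> k w))" if "k \<in> {\<one>, g, h}" for k
  by (rule equiv_comp[OF \<theta>_dsum[OF S2 rep_Reg that] F(1)])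
 note lF = equivD(1)[OF F(1)]
 have fx: "dsum {\<one>, g} Reg \<one> (\<theta> k (bs \<one>)) = \<theta> k (bs \<one>)" if "k \<in> {\<one>, g}" for k
  using equivD(2)[OF \<theta>_dsum[OF S1 rep_Reg that] one_closed, of "bs \<one>"] by (simp add: Reg_bs)
 have \<sigma>1: "\<sigma> \<one> (\<theta> \<one> v) = v" "\<sigma> g (\<theta> g v) = v" "\<sigma> g (\<theta> \<one> v) = 0" "\<sigma> \<one> (\<theta> g v) = 0" for v
  using gh d(1) by (simp_all add: \<sigma>\<theta>)
 have orb0: "orb rh v 0 = 0" for v by (rule lin_0[OF equivD(1)[OF orb_equiv(1)[OF r]]])
 have orb1: "orb rh v (bs \<one>) = v" if "v \<in> mU rh" for v using orb_equiv(2)[OF r one_closed] mU_D[OF that] by simp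
 note zX = lin_0[OF dx_lin[OF rep_Reg gh(1)]] lin_0[OF dx_lin[OF rep_Reg gh(2)]] lin_0[OF lin_pow[OF dx_lin[OF rep_Reg gh(1)]]]
  lin_0[OF lin_pow[OF dx_lin[OF rep_Reg gh(2)]]] lin_0[OF lin_\<theta>]
 let ?w = "F (\<theta> \<one> (bs \<one>))" and ?m = "F (\<theta> g (bs \<one>))" and ?m' = "F (\<theta> h (bs \<one>))"
 have dF: "F (\<theta> k (dx l Reg v)) = dx l rh' (F (\<theta> k v))" if "k \<in> {\<one>, g, h}" "l \<in> carrier G" for k l v
  by (rule dx_equivariant[OF e[OF that(1)] that(2)])
 have dFp: "F (\<theta> k ((dx l Reg ^^ i) v)) = (dx l rh' ^^ i) (F (\<theta> k v))" if "k \<in> {\<one>, g, h}" "l \<in> carrier G" for k l v i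
  by (rule pow_intertwine[of "%v. F (\<theta> k v)"]) (rule dF[OF that])
 have "ka' (f (em s)) = F (\<Theta>2 (\<theta> \<one> (bs \<one>)))"
  using F(2)[of "\<theta> \<one> (bs \<one>)"] by (simp add: fx \<Psi>_def \<sigma>1 orb0 orb1[OF s(1)])
 also have "\<dots> = F (\<theta> \<one> (Y Reg (bs \<one>))) + F (\<theta> g ((X Reg ^^ (p ^ a - 1)) (bs \<one>)))"
  unfolding \<Theta>2(2)[OF b] \<sigma>1 zX by (simp add: lin_add[OF lF])
 also have "\<dots> = Y rh' ?w + (X rh' ^^ (p ^ a - 1)) ?m" using gh by (simp add: dF dFp)
 finally have 1: "ka' (f (em s)) = Y rh' ?w + (X rh' ^^ (p ^ a - 1)) ?m" .
 have "ka' (f (em t)) = F (\<Theta>2 (\<theta> g (bs \<one>)))"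
  using F(2)[of "\<theta> g (bs \<one>)"] by (simp add: fx \<Psi>_def \<sigma>1 orb0 orb1[OF s(2)])
 also have "\<dots> = - F (\<theta> \<one> (X Reg (bs \<one>))) + F (\<theta> h ((Y Reg ^^ (p ^ b - 1)) (bs \<one>)))"
  unfolding \<Theta>2(2)[OF b] \<sigma>1 zX by (simp add: lin_add[OF lF] lin_minus[OF lF] lin_minus[OF lin_\<theta>] lin_diff[OF lF])
 also have "\<dots> = - X rh' ?w + (Y rh' ^^ (p ^ b - 1)) ?m'" using gh by (simp add: dF dFp)
 finally have 2: "ka' (f (em t)) = - X rh' ?w + (Y rh' ^^ (p ^ b - 1)) ?m'" .
 have "F (\<theta> k (bs \<one>)) \<in> mU rh'" if "k \<in> {\<one>, g, h}" for k by (rule mU_equiv[OF e[OF that] bs_mU[OF one_closed]])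
 then show ?thesis using 1 2 by blast
qed

end

section \<open>The upper bounds\<close>

context group_modules begin

lemma thick_left_modules: "thick_subcategory KG {M :: ('g => 'k, 'u) module. left_module KG M}"
 unfolding thick_subcategory_def triangulated_subcategory_def
 using left_module_trivial
 by (auto simp: stably_isomorphic_def stable_retract_def is_Omega_def short_exact_def exact_triangle_def)

lemma thick_left_module: "M \<in> Thick KG K ==> left_module KG M"
 unfolding Thick_def using thick_left_modules left_module_trivial by blast

end

context two_gens begin

text \<open>
On the image of the norm choose a linear section \<open>s\<close>; then \<open>1\<close> minus the trace of \<open>s\<close> annihilates the norm from both sides.
\<close>

lemma norm_killer:
 assumes r: "rep rh"
 obtains d where "equiv rh rh d" "\<And>v. d v \<in> mU rh" "\<And>v. v \<in> mU rh ==> nm rh (d v) = 0" "\<And>v. v \<in> mU rh ==> d (nm rh v) = 0"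
  "szero rh rh (%v. rh \<one> v - d v)"
proof -
 note U = mU_subspace[OF r] and ln = equivD(1)[OF nm_equiv[OF r]]
 obtain s where s: "lin s" "range s \<subseteq> mU rh" "\<And>v. v \<in> nm rh ` mU rh ==> nm rh (s v) = v"
  using section_on[OF ln U] by auto
 have sU: "s v \<in> mU rh" for v using s(2) by auto
 note eT = Tr_equiv[OF r r s(1)]
 define d where "d v = rh \<one> v - Tr rh rh s v" for v
 have ed: "equiv rh rh d" unfolding d_def[abs_def] by (rule equiv_plus(2)[OF r equiv_rep1[OF r] eT])
 have TU: "Tr rh rh s v \<in> mU rh" for v
  using equivD(2)[OF eT one_closed, of v] by (simp add: mU_def Tr_one[OF r])
 show thesis
 proof (rule that[OF ed])
  show "d v \<in> mU rh" for v unfolding d_def by (rule subspace_diff[OF U mU_rep[OF r one_closed] TU])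
  have "Tr rh rh s v = rh \<one> v - d v" for v by (simp add: d_def)
  then show "szero rh rh (%v. rh \<one> v - d v)" unfolding szero_def using s(1) by (intro exI[of _ s]) simp
  fix v assume v: "v \<in> mU rh"
  have snm: "nm rh (s (nm rh v)) = nm rh v" using s(3) v by blast
  have "nm rh (Tr rh rh s v) = (\<Sum>k\<in>carrier G. nm rh (s (rh (inv k) v)))"
   unfolding Tr_def lin_sum[OF ln] by (rule sum.cong[OF refl]) (rule nm_fixed(2)[OF r sU])
  also have "\<dots> = nm rh (s (\<Sum>k\<in>carrier G. rh (inv k) v))" by (simp add: lin_sum[OF s(1)] lin_sum[OF ln])
  also have "(\<Sum>k\<in>carrier G. rh (inv k) v) = (\<Sum>k\<in>carrier G. rh k v)"
   by (rule sum.reindex_bij_witness[where i = "%k. inv k" and j = "%k. inv k"]) auto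
  finally have "nm rh (Tr rh rh s v) = nm rh v" using norm_sum[OF r v] snm by simp
  then show "nm rh (d v) = 0" using mU_D[OF v] by (simp add: d_def lin_diff[OF ln])
  have "Tr rh rh s (nm rh v) = (\<Sum>k\<in>carrier G. rh k (s (nm rh v)))"
   unfolding Tr_def by (rule sum.cong[OF refl]) (simp add: nm_fixed(1)[OF r v])
  also have "\<dots> = nm rh v" unfolding norm_sum[OF r sU] snm ..
  finally show "d (nm rh v) = 0" using mU_D[OF nm_mU[OF r v]] by (simp add: d_def)
 qed
qed

lemma ghost_composite_Thick: "ghost_composite R T j M N f ==> M \<in> Thick R T \<and> N \<in> Thick R T"
 by (induction rule: ghost_composite.induct) auto

lemma coord_composite:
 assumes gc: "ghost_composite KG K j M L f" and M: "coord M rh ka em" and L: "coord L rhL kaL emL"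
 shows "ka' ((u \<circ> f) (em v)) = ka' (u (emL (kaL (f (em v)))))"
 using coordD(4)[OF L homD(1)[OF ghost_composite_hom[OF gc] coordD(3)[OF M]]] by simp

lemma cyclic_upper_bound:
 assumes b: "b = 0" and h: "h = \<one>" and m: "p ^ a = 2 * m + 1"
 shows "ghost_number e G \<le> enat m"
proof (rule ghost_number_le)
 have Y0: "Y rh v = 0" for rh v by (simp add: dx_def h)
 have nmX: "nm rh v = (X rh ^^ (p ^ a - 1)) v" for rh v unfolding nm_def by (simp add: b)
 have inv: "ghost_composite KG K j M N f ==> \<forall>rh ka em rh' ka' em'. coord M rh ka em --> coord N rh' ka' em' -->
   cyc_inv (p ^ a) j (X rh) (mU rh) (X rh') (mU rh') (%v. ka' (f (em v)))" for j M N f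
 proof (induction rule: ghost_composite.induct)
  case (zero M N f)
  show ?case
  proof (intro allI impI)
   fix rh ka em rh' ka' em' assume M: "coord M rh ka em" and N: "coord N rh' ka' em'"
   note F = hom_hat(1)[OF M N zero(3)]
   show "cyc_inv (p ^ a) 0 (X rh) (mU rh) (X rh') (mU rh') (%v. ka' (f (em v)))"
    by (rule cyc_inv_0[OF mU_subspace[OF coordD(2)[OF N]] mU_equiv[OF F] dx_equivariant[OF F gh(1)]
       dx_lin[OF coordD(2)[OF N] gh(1)] equivD(1)[OF F]])
  qed
 next
  case (Suc j M L f N u)
  show ?case
  proof (intro allI impI)
   fix rh ka em rh' ka' em' assume M: "coord M rh ka em" and N: "coord N rh' ka' em'"
   have "left_module KG L" "u \<in> left_module_hom KG L N" using Suc.hyps(4) by (simp_all add: ghost_def)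
   then obtain rhL kaL emL where L: "coord L rhL kaL emL" using coord_exists by blast
   note F = hom_hat(1)[OF L N \<open>u \<in> left_module_hom KG L N\<close>]
   note rL = coordD(2)[OF L] and rN = coordD(2)[OF N]
   have "cyc_inv (p ^ a) j (X rh) (mU rh) (X rhL) (mU rhL) (%v. kaL (f (em v)))" using Suc.IH M L by blast
   then have "cyc_inv (p ^ a) (Suc j) (X rh) (mU rh) (X rh') (mU rh') (%v. ka' (u (emL (kaL (f (em v))))))"
   proof (rule cyc_inv_Suc[where F = "%w. ka' (u (emL w))", OF _ dx_lin[OF rL gh(1)] dx_lin[OF rN gh(1)] equivD(1)[OF F] mU_equiv[OF F]
      dx_equivariant[OF F gh(1)] dx_mU[OF rL gh(1)] mU_subspace[OF rN] dx_mU[OF rN gh(1)]])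
    fix v assume v: "v \<in> mU rhL"
    show "\<exists>w\<in>mU rh'. ka' (u (emL v)) = (X rh' ^^ (p ^ a - 1)) w" if "X rhL v = 0"
     using ghost_on_socle[OF Suc.hyps(4) L N v that Y0] by (simp add: nmX)
    show "\<exists>w\<in>mU rh'. ka' (u (emL v)) = X rh' w" if "(X rhL ^^ (p ^ a - 1)) v = 0"
     using ghost_on_norm_kernel[OF Suc.hyps(4) L N v] that by (auto simp: nmX Y0)
   qed
   then show "cyc_inv (p ^ a) (Suc j) (X rh) (mU rh) (X rh') (mU rh') (%v. ka' ((u \<circ> f) (em v)))"
    unfolding coord_composite[OF Suc.hyps(1) M L] .
  qed
 qed
 fix M N f assume gc: "ghost_composite KG K m M N f"
 have hom: "f \<in> left_module_hom KG M N" by (rule ghost_composite_hom[OF gc])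
 have "left_module KG M \<and> left_module KG N" using ghost_composite_Thick[OF gc] thick_left_module by blast
 then obtain rh ka em rh' ka' em' where M: "coord M rh ka em" and N: "coord N rh' ka' em'" using coord_exists by meson
 note r = coordD(2)[OF M] and r' = coordD(2)[OF N] and F = hom_hat(1)[OF M N hom]
 have I: "cyc_inv (p ^ a) m (X rh) (mU rh) (X rh') (mU rh') (%v. ka' (f (em v)))" using inv[OF gc] M N by blast
 have "\<exists>\<phi>. lin \<phi> \<and> range \<phi> \<subseteq> mU rh' \<and> (\<forall>v\<in>mU rh. ka' (f (em v)) = cyc (X rh') (X rh) (p ^ a) \<phi> v)"
  by (rule cyc_layers[OF dx_lin[OF r gh(1)] dx_lin[OF r' gh(1)] equivD(1)[OF F] mU_subspace[OF r] dx_mU[OF r gh(1)]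
     mU_subspace[OF r'] dx_mU[OF r' gh(1)] dx_nil[OF r gh(1) gpow] dx_nil[OF r' gh(1) gpow] dx_equivariant[OF F gh(1)]])
   (rule cyc_inv_final[OF I m _ _ _ dx_mU[OF r' gh(1)]])
 then obtain \<phi> where \<phi>: "lin \<phi>" "range \<phi> \<subseteq> mU rh'" "\<And>v. v \<in> mU rh ==> ka' (f (em v)) = cyc (X rh') (X rh) (p ^ a) \<phi> v" by blast
 have \<phi>U: "\<phi> v \<in> mU rh'" for v using \<phi>(2) by auto
 have one: "cyc (Y rh') (Y rh) (p ^ b) \<phi> = \<phi>" by (simp add: fun_eq_iff cyc_def b)
 have "szero rh rh' (%v. ka' (f (em v)))"
 proof (rule T2_szero[OF r r' \<phi>(1) \<phi>U equiv_rep1[OF r] mU_rep[OF r one_closed]])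
  fix v
  show "ka' (f (em v)) = T2 rh rh' \<phi> (rh \<one> v)"
   unfolding T2_def one using \<phi>(3)[OF mU_rep[OF r one_closed], of v] by (simp add: coord_eps(2)[OF M])
 qed
 then show "stably_zero KG M N f" using stably_zero_iff[OF M N hom] by simp
qed

definition M0 where "M0 rh = {v \<in> mU rh. nm rh v = 0}"

lemma M0_equiv: assumes "equiv rh rh' F" "v \<in> M0 rh" shows "F v \<in> M0 rh'"
 using assms(2) mU_equiv[OF assms(1)] nm_equivariant[OF assms(1), of v] lin_0[OF equivD(1)[OF assms(1)]]
 by (auto simp: M0_def)

lemma M0_nil2:
 assumes "a = 1" "b = 1" "p = n + 3" and r: "rep rh"
 shows "nil2 n (X rh) (Y rh) (M0 rh)"
 unfolding nil2_def
proof (intro conjI allI ballI)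
 show "lin (X rh)" "lin (Y rh)" by (rule dx_lin[OF r gh(1)], rule dx_lin[OF r gh(2)])
 show "X rh (Y rh v) = Y rh (X rh v)" for v by (rule XY[OF r])
 show "subspace (M0 rh)"
  unfolding M0_def using subspace_inter[OF mU_subspace[OF r] subspace_ker[OF equivD(1)[OF nm_equiv[OF r]]]] by (simp add: Int_def)
 show "X rh v \<in> M0 rh" "Y rh v \<in> M0 rh" if "v \<in> M0 rh" for v
  using M0_equiv[OF dx_equiv[OF r gh(1)] that] M0_equiv[OF dx_equiv[OF r gh(2)] that] .
 show "(X rh ^^ (n + 3)) v = 0" "(Y rh ^^ (n + 3)) v = 0" for v
  using dx_nil[OF r gh(1) gpow, of v] dx_nil[OF r gh(2) hpow, of v] assms(1-3) by simp_all
 show "mon (X rh) (Y rh) (n + 2) (n + 2) v = 0" if "v \<in> M0 rh" for v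
 proof -
  have e: "p ^ a - 1 = n + 2" "p ^ b - 1 = n + 2" using assms(1-3) by simp_all
  have "nm rh v = 0" using that by (simp add: M0_def)
  then show ?thesis unfolding mon_def nm_def e .
 qed
qed

lemma M0_nhom: assumes "equiv rh rh' F" shows "nhom (X rh) (Y rh) (M0 rh) (X rh') (Y rh') (M0 rh') F"
 unfolding nhom_def using equivD(1)[OF assms] dx_equivariant[OF assms gh(1)] dx_equivariant[OF assms gh(2)] M0_equiv[OF assms] by blast

lemma killed_ghost:
 assumes ab: "a = 1" "b = 1" "p = n + 3"
  and gh': "ghost KG K M N u" and M: "coord M rh ka em" and N: "coord N rh' ka' em'"
  and d: "equiv rh' rh' d" "\<And>v. d v \<in> mU rh'" "\<And>v. v \<in> mU rh' ==> nm rh' (d v) = 0" "\<And>v. v \<in> mU rh' ==> d (nm rh' v) = 0"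
 shows "nghost n (X rh) (Y rh) (M0 rh) (X rh') (Y rh') (M0 rh') (%v. d (ka' (u (em v))))"
 unfolding nghost_def
proof (intro conjI ballI allI impI)
 note r' = coordD(2)[OF N] and ld = equivD(1)[OF d(1)]
 have hom: "u \<in> left_module_hom KG M N" using gh' by (simp add: ghost_def)
 have dM: "d v \<in> M0 rh'" if "v \<in> mU rh'" for v using d(2,3) that by (simp add: M0_def)
 note dX = dx_equivariant[OF d(1) gh(1)] and dY = dx_equivariant[OF d(1) gh(2)]
 show "nhom (X rh) (Y rh) (M0 rh) (X rh') (Y rh') (M0 rh') (%v. d (ka' (u (em v))))"
  by (rule M0_nhom[OF equiv_comp[OF hom_hat(1)[OF M N hom] d(1)]])
 show "d (ka' (u (em v))) = 0" if v: "v \<in> M0 rh" "X rh v = 0" "Y rh v = 0" for v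
  using ghost_on_socle[OF gh' M N _ v(2,3)] v(1) d(4) by (auto simp: M0_def)
 show "\<exists>s\<in>M0 rh'. \<exists>t\<in>M0 rh'. d (ka' (u (em v))) = X rh' s + Y rh' t" if "v \<in> M0 rh" for v
 proof -
  have v: "v \<in> mU rh" "nm rh v = 0" using that by (auto simp: M0_def)
  obtain s t where "s \<in> mU rh'" "t \<in> mU rh'" "ka' (u (em v)) = X rh' s + Y rh' t"
   using ghost_on_norm_kernel[OF gh' M N v] by blast
  then show ?thesis using dM by (intro bexI[of _ "d s"] bexI[of _ "d t"]) (simp_all add: lin_add[OF ld] dX dY)
 qed
 fix s t assume "relation (X rh) (Y rh) (M0 rh) s t"
 then have st: "s \<in> mU rh" "t \<in> mU rh" "X rh s + Y rh t = 0" by (auto simp: relation_def M0_def)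
 have b0: "b \<noteq> 0" using ab by simp
 obtain w m m' where w: "w \<in> mU rh'" "m \<in> mU rh'" "m' \<in> mU rh'" "ka' (u (em s)) = Y rh' w + (X rh' ^^ (p ^ a - 1)) m"
  "ka' (u (em t)) = - X rh' w + (Y rh' ^^ (p ^ b - 1)) m'"
  using ghost_on_relation[OF gh' M N b0 st] by blast
 have n: "p ^ a - 1 = n + 2" "p ^ b - 1 = n + 2" using ab by simp_all
 have "d (ka' (u (em s))) = Y rh' (d w) + (X rh' ^^ (n + 2)) (d m)"
  unfolding w(4) n lin_add[OF ld] dY pow_intertwine[of d "X rh'" "X rh'", OF dX] ..
 moreover have "d (ka' (u (em t))) = - X rh' (d w) + (Y rh' ^^ (n + 2)) (d m')"
  unfolding w(5) n lin_add[OF ld] lin_minus[OF ld] dX pow_intertwine[of d "Y rh'" "Y rh'", OF dY] ..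
 ultimately show "\<exists>w\<in>M0 rh'. \<exists>m\<in>M0 rh'. \<exists>m'\<in>M0 rh'. d (ka' (u (em s))) = Y rh' w + (X rh' ^^ (n + 2)) m \<and>
   d (ka' (u (em t))) = - X rh' w + (Y rh' ^^ (n + 2)) m'"
  using dM w(1-3) by blast
qed

lemma szero_zero: assumes "rep rh'" shows "szero rh rh' (%v. 0)"
 unfolding szero_def Tr_def by (rule exI[of _ "%v. 0"]) (simp add: lin_0[OF repD(1)[OF assms]])

lemma elementary_upper_bound:
 assumes ab: "a = 1" "b = 1" "p = n + 3"
 shows "ghost_number e G \<le> enat (2 * n + 3)"
proof (rule ghost_number_le)
 note nil = M0_nil2[OF ab]
 have inv: "ghost_composite KG K j M N f ==> \<forall>rh ka em rh' ka' em'. coord M rh ka em --> coord N rh' ka' em' -->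
   (\<exists>F. equiv rh rh' F \<and> (\<forall>v. F (rh \<one> v) = F v) \<and> szero rh rh' (%v. ka' (f (em v)) - F v) \<and>
    kills j (X rh) (Y rh) (M0 rh) F \<and> expands j (X rh) (Y rh) (M0 rh) (X rh') (Y rh') (M0 rh') F)" for j M N f
 proof (induction rule: ghost_composite.induct)
  case (zero M N f)
  show ?case
  proof (intro allI impI)
   fix rh ka em rh' ka' em' assume M: "coord M rh ka em" and N: "coord N rh' ka' em'"
   note F = hom_hat(1)[OF M N zero(3)] and r = coordD(2)[OF M] and r' = coordD(2)[OF N]
   show "\<exists>F. equiv rh rh' F \<and> (\<forall>v. F (rh \<one> v) = F v) \<and> szero rh rh' (%v. ka' (f (em v)) - F v) \<and>
    kills 0 (X rh) (Y rh) (M0 rh) F \<and> expands 0 (X rh) (Y rh) (M0 rh) (X rh') (Y rh') (M0 rh') F"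
   proof (intro exI[of _ "%v. ka' (f (em v))"] conjI allI F)
    show "ka' (f (em (rh \<one> v))) = ka' (f (em v))" for v by (simp add: coord_eps(2)[OF M])
    show "szero rh rh' (%v. ka' (f (em v)) - ka' (f (em v)))" using szero_zero[OF r'] by simp
    show "kills 0 (X rh) (Y rh) (M0 rh) (%v. ka' (f (em v)))" using lin_0[OF equivD(1)[OF F]] by (simp add: kills_def mon_def)
    show "expands 0 (X rh) (Y rh) (M0 rh) (X rh') (Y rh') (M0 rh') (%v. ka' (f (em v)))"
     by (rule expands_0[OF nil[OF r] nil[OF r'] M0_nhom[OF F]])
   qed
  qed
 next
  case (Suc j M L f N u)
  show ?case
  proof (intro allI impI)
   fix rh ka em rh' ka' em' assume M: "coord M rh ka em" and N: "coord N rh' ka' em'"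
   have "left_module KG L" and hu: "u \<in> left_module_hom KG L N" using Suc.hyps(4) by (simp_all add: ghost_def)
   then obtain rhL kaL emL where L: "coord L rhL kaL emL" using coord_exists by blast
   note H = hom_hat(1)[OF L N hu]
   note r = coordD(2)[OF M] and rL = coordD(2)[OF L] and rN = coordD(2)[OF N]
   obtain F where F: "equiv rh rhL F" "\<And>v. F (rh \<one> v) = F v" "szero rh rhL (%v. kaL (f (em v)) - F v)"
    "kills j (X rh) (Y rh) (M0 rh) F" "expands j (X rh) (Y rh) (M0 rh) (X rhL) (Y rhL) (M0 rhL) F"
    using Suc.IH M L by blast
   obtain d where d: "equiv rh' rh' d" "\<And>v. d v \<in> mU rh'" "\<And>v. v \<in> mU rh' ==> nm rh' (d v) = 0"
     "\<And>v. v \<in> mU rh' ==> d (nm rh' v) = 0" "szero rh' rh' (%v. rh' \<one> v - d v)"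
    by (rule norm_killer[OF rN]) blast
   note ng = killed_ghost[OF ab Suc.hyps(4) L N d(1-4)]
   define F' where "F' v = d (ka' (u (emL (F v))))" for v
   have "szero rh rh' (%v. ka' ((u \<circ> f) (em v)) - F' v)"
   proof -
    have 1: "szero rh rh' (%v. ka' (u (emL (kaL (f (em v)) - F v))))" by (rule szero_comp_left[OF F(3) H])
    have 2: "szero rh rh' (%v. rh' \<one> (ka' (u (emL (F v)))) - d (ka' (u (emL (F v)))))"
     by (rule szero_comp_right[OF d(5) equiv_comp[OF F(1) H]])
    have "ka' (u (emL (kaL (f (em v)) - F v))) + (rh' \<one> (ka' (u (emL (F v)))) - d (ka' (u (emL (F v))))) =
      ka' ((u \<circ> f) (em v)) - F' v" for v
     unfolding coord_composite[OF Suc.hyps(1) M L] lin_diff[OF equivD(1)[OF H]] hom_hat(2)[OF L N hu] F'_def by simp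
    then show ?thesis using szero_add[OF rN 1 2] by simp
   qed
   moreover have "equiv rh rh' F'" unfolding F'_def[abs_def] by (rule equiv_comp[OF equiv_comp[OF F(1) H] d(1)])
   moreover have "F' (rh \<one> v) = F' v" for v by (simp add: F'_def F(2))
   moreover have "kills (Suc j) (X rh) (Y rh) (M0 rh) F'"
    unfolding F'_def[abs_def] by (rule kills_Suc[OF nil[OF r] M0_nhom[OF F(1)] F(4) ng])
   moreover have "expands (Suc j) (X rh) (Y rh) (M0 rh) (X rh') (Y rh') (M0 rh') F'"
    unfolding F'_def[abs_def] by (rule expands_Suc[OF nil[OF rL] nil[OF rN] F(5) ng])
   ultimately show "\<exists>F. equiv rh rh' F \<and> (\<forall>v. F (rh \<one> v) = F v) \<and> szero rh rh' (%v. ka' ((u \<circ> f) (em v)) - F v) \<and>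
    kills (Suc j) (X rh) (Y rh) (M0 rh) F \<and> expands (Suc j) (X rh) (Y rh) (M0 rh) (X rh') (Y rh') (M0 rh') F" by blast
  qed
 qed
 fix M N f assume gc: "ghost_composite KG K (2 * n + 3) M N f"
 have hom: "f \<in> left_module_hom KG M N" by (rule ghost_composite_hom[OF gc])
 have "left_module KG M \<and> left_module KG N" using ghost_composite_Thick[OF gc] thick_left_module by blast
 then obtain rh ka em rh' ka' em' where M: "coord M rh ka em" and N: "coord N rh' ka' em'" using coord_exists by meson
 note r = coordD(2)[OF M] and r' = coordD(2)[OF N]
 obtain F where F: "equiv rh rh' F" "\<And>v. F (rh \<one> v) = F v" "szero rh rh' (%v. ka' (f (em v)) - F v)"
  "kills (2 * n + 3) (X rh) (Y rh) (M0 rh) F" "expands (2 * n + 3) (X rh) (Y rh) (M0 rh) (X rh') (Y rh') (M0 rh') F"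
  using inv[OF gc] M N by blast
 obtain \<phi> where \<phi>: "lin \<phi>" "\<And>v. \<phi> v \<in> M0 rh'" "\<And>v. v \<in> M0 rh ==> F v = dtr n (X rh') (Y rh') (X rh) (Y rh) \<phi> v"
  using long_composite_is_dtr[OF nil[OF r] nil[OF r'] F(4,5)] by blast
 obtain d where d: "equiv rh rh d" "\<And>v. d v \<in> mU rh" "\<And>v. v \<in> mU rh ==> nm rh (d v) = 0"
   "\<And>v. v \<in> mU rh ==> d (nm rh v) = 0" "szero rh rh (%v. rh \<one> v - d v)"
  by (rule norm_killer[OF r]) blast
 have d1: "d (rh \<one> v) = d v" for v using equivD(2)[OF d(1) one_closed, of v] mU_D[OF d(2)] by simp
 have dM0: "d v \<in> M0 rh" for v using d(3)[OF mU_rep[OF r one_closed], of v] d(2) by (simp add: M0_def d1)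
 have \<phi>U: "\<phi> v \<in> mU rh'" for v using \<phi>(2) by (simp add: M0_def)
 have 1: "szero rh rh' (%v. F (d v))"
 proof (rule T2_szero[OF r r' \<phi>(1) \<phi>U d(1,2)])
  fix v show "F (d v) = T2 rh rh' \<phi> (d v)"
   unfolding \<phi>(3)[OF dM0] dtr_eq_cyc[OF nil[OF r] nil[OF r']] T2_def using ab by simp
 qed
 have 2: "szero rh rh' (%v. F (rh \<one> v - d v))" by (rule szero_comp_left[OF d(5) F(1)])
 have "ka' (f (em v)) - F v + (F (d v) + F (rh \<one> v - d v)) = ka' (f (em v))" for v
  by (simp add: lin_diff[OF equivD(1)[OF F(1)]] F(2))
 then have "szero rh rh' (%v. ka' (f (em v)))" using szero_add[OF r' F(3) szero_add[OF r' 1 2]] by simp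
 then show "stably_zero KG M N f" using stably_zero_iff[OF M N hom] by simp
qed

end

section \<open>The smallest ghost numbers\<close>

context p_group begin

lemma prime_order_powers_inj:
 assumes z: "z \<in> carrier G" "z \<noteq> \<one>" "z [^] p = \<one>"
 shows "inj_on (%l. z [^] (l :: nat)) {..<p}"
proof (rule inj_onI)
 have t: "subgroup {\<one>} G" by (rule triv_subgroup)
 have zZ: "z \<notin> {\<one>}" "z [^] p \<in> {\<one>}" "\<And>k. k \<in> {\<one>} ==> z \<otimes> k \<otimes> inv z \<in> {\<one>}" using z by auto
 have inj: "inj_on (%(k, l). k \<otimes> z [^] l) ({\<one>} \<times> {..<p})" by (rule extend_subgroup(2)[OF t z(1) zZ])
 fix i j assume "i \<in> {..<p}" "j \<in> {..<p}" "z [^] i = z [^] j"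
 then have "(\<one>, i) = (\<one>, j)" using z(1) by (intro inj_onD[OF inj]) auto
 then show "i = j" by simp
qed

lemma powers_commute:
 assumes g: "g \<in> carrier G" and gen: "carrier G = (%i. g [^] (i :: nat)) ` A" and k: "k \<in> carrier G" "l \<in> carrier G"
 shows "k \<otimes> l = l \<otimes> k"
proof -
 obtain i j :: nat where "k = g [^] i" "l = g [^] j" using k gen by auto
 then show ?thesis using g by (simp add: nat_pow_mult add.commute)
qed

end

context p_modules begin

lemma ghost_number_ge:
 assumes "odd p" "r \<noteq> 0"
 shows "enat ((p - 1) div 2 + (r - 1) * (p - 1)) \<le> ghost_number e G"
proof -
 obtain z where z: "z \<in> carrier G" "z \<noteq> \<one>" "z [^] p = \<one>" "\<And>g. g \<in> carrier G ==> g \<otimes> z = z \<otimes> g"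
  using central_element[OF assms(2)] by blast
 have "order G = p * p ^ (r - 1)" using order_G assms(2) by (cases r) simp_all
 then show ?thesis
  using ghost_number_lower_bound[OF z(1,4,3) prime_order_powers_inj[OF z(1-3)], of 1 "r - 1"] assms(1) prime_gt_1_nat[OF prime_p]
  by simp
qed

lemma cyclic_ghost_number:
 assumes "odd p" "a \<noteq> 0" and g: "g \<in> carrier G" "g [^] (p ^ a) = \<one>"
  and bij: "bij_betw (%i. g [^] (i :: nat)) {..<p ^ a} (carrier G)"
 shows "ghost_number e G = enat ((p ^ a - 1) div 2)"
proof (rule antisym)
 have gen: "carrier G = (%i. g [^] (i :: nat)) ` {..<p ^ a}" and inj: "inj_on (%i. g [^] (i :: nat)) {..<p ^ a}"
  using bij by (auto simp: bij_betw_def)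
 note comm = powers_commute[OF g(1) gen]
 have ord: "order G = p ^ a * p ^ 0" using bij_betw_same_card[OF bij] by (simp add: order_def)
 have q: "odd (p ^ a)" "1 < p ^ a" using assms(1,2) one_less_power[OF prime_gt_1_nat[OF prime_p], of a] by simp_all
 show "enat ((p ^ a - 1) div 2) \<le> ghost_number e G"
  using ghost_number_lower_bound[OF g(1) comm[OF _ g(1)] g(2) inj refl ord q] by simp
 have "bij_betw (%(i, j). g [^] (i :: nat) \<otimes> \<one> [^] (j :: nat)) ({..<p ^ a} \<times> {..<p ^ 0}) (carrier G)"
  unfolding bij_betw_def
 proof
  show "inj_on (%(i, j). g [^] (i :: nat) \<otimes> \<one> [^] (j :: nat)) ({..<p ^ a} \<times> {..<p ^ 0})"
   using inj g(1) by (auto simp: inj_on_def)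
  have eq: "g [^] i \<otimes> \<one> [^] j = g [^] i" for i j :: nat using g(1) by simp
  have "(%(i, j). g [^] (i :: nat) \<otimes> \<one> [^] (j :: nat)) ` ({..<p ^ a} \<times> {..<p ^ 0}) = (%y. g [^] fst y) ` ({..<p ^ a} \<times> {..<p ^ 0})"
   by (rule image_cong[OF refl]) (simp only: case_prod_unfold eq)
  also have "\<dots> = (%i. g [^] i) ` (fst ` ({..<p ^ a} \<times> {..<p ^ 0}))" by (simp only: image_image)
  also have "fst ` ({..<p ^ a} \<times> {..<p ^ 0 :: nat}) = {..<p ^ a}" by force
  finally show "(%(i, j). g [^] (i :: nat) \<otimes> \<one> [^] (j :: nat)) ` ({..<p ^ a} \<times> {..<p ^ 0}) = carrier G"
   unfolding gen .
 qed
 then interpret two_gens G e p r g \<one> a 0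
  using g assms(2) comm by unfold_locales auto
 have "p ^ a = 2 * ((p ^ a - 1) div 2) + 1" using q(1) by (elim oddE) simp
 then show "ghost_number e G \<le> enat ((p ^ a - 1) div 2)" by (intro cyclic_upper_bound) auto
qed

lemma elementary_ghost_number_le:
 assumes "odd p" and g: "g \<in> carrier G" "g [^] p = \<one>" and h: "h \<in> carrier G" "h [^] p = \<one>"
  and bij: "bij_betw (%(i, j). g [^] (i :: nat) \<otimes> h [^] (j :: nat)) ({..<p} \<times> {..<p}) (carrier G)"
  and comm: "\<And>k l. k \<in> carrier G ==> l \<in> carrier G ==> k \<otimes> l = l \<otimes> k"
 shows "ghost_number e G \<le> enat (2 * p - 3)"
proof -
 interpret two_gens G e p r g h 1 1 using g h bij comm by unfold_locales auto
 have "3 \<le> p" using assms(1) prime_gt_1_nat[OF prime_p] by (cases "p = 2") auto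
 then have "p = (p - 3) + 3" by simp
 from elementary_upper_bound[OF refl refl this] show ?thesis using \<open>3 \<le> p\<close> by (simp add: diff_mult_distrib2)
qed

end

lemma nat_copy:
 assumes "group H" "finite (carrier H)"
 obtains G :: "nat monoid" where "group G" "finite (carrier G)" "H \<cong> G" "order G = order H"
proof -
 obtain f :: "'a => nat" where f: "inj_on f (carrier H)" using finite_imp_inj_to_nat_seg[OF assms(2)] by blast
 interpret group H by (rule assms(1))
 show thesis
 proof (rule that[of "image_group f H"])
  show "group (image_group f H)" by (rule inj_imp_image_group_is_group[OF f])
  show "finite (carrier (image_group f H))" using assms(2) by (simp add: image_group_carrier)
  show "H \<cong> image_group f H" using inj_imp_image_group_iso[OF f] by (auto simp: is_iso_def)
  show "order (image_group f H) = order H" by (simp add: order_def image_group_carrier card_image[OF f])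
 qed
qed

lemma integer_mod_cyclic:
 assumes "1 < n"
 shows "group (integer_mod_group n)" "finite (carrier (integer_mod_group n))" "order (integer_mod_group n) = n"
  "1 \<in> carrier (integer_mod_group n)" "1 [^]\<^bsub>integer_mod_group n\<^esub> n = \<one>\<^bsub>integer_mod_group n\<^esub>"
  "bij_betw (%i. 1 [^]\<^bsub>integer_mod_group n\<^esub> (i :: nat)) {..<n} (carrier (integer_mod_group n))"
proof -
 show "group (integer_mod_group n)" "finite (carrier (integer_mod_group n))" "order (integer_mod_group n) = n"
  "1 \<in> carrier (integer_mod_group n)" "1 [^]\<^bsub>integer_mod_group n\<^esub> n = \<one>\<^bsub>integer_mod_group n\<^esub>"
  using assms by (simp_all add: carrier_integer_mod_group order_def)
 show "bij_betw (%i. 1 [^]\<^bsub>integer_mod_group n\<^esub> (i :: nat)) {..<n} (carrier (integer_mod_group n))"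
 proof (rule bij_betw_byWitness[where f' = nat])
  show "\<forall>i\<in>{..<n}. nat (1 [^]\<^bsub>integer_mod_group n\<^esub> i) = i" by simp
  show "\<forall>y\<in>carrier (integer_mod_group n). 1 [^]\<^bsub>integer_mod_group n\<^esub> nat y = y" using assms by (auto simp: carrier_integer_mod_group)
  show "(%i. 1 [^]\<^bsub>integer_mod_group n\<^esub> (i :: nat)) ` {..<n} \<subseteq> carrier (integer_mod_group n)" using assms by (auto simp: carrier_integer_mod_group)
  show "nat ` carrier (integer_mod_group n) \<subseteq> {..<n}" using assms by (auto simp: carrier_integer_mod_group)
 qed
qed

lemma elementary_iso:
 assumes "group G" and p: "1 < p" and g: "g \<in> carrier G" "g [^]\<^bsub>G\<^esub> p = \<one>\<^bsub>G\<^esub>" and h: "h \<in> carrier G" "h [^]\<^bsub>G\<^esub> p = \<one>\<^bsub>G\<^esub>"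
  and bij: "bij_betw (%(i, j). g [^]\<^bsub>G\<^esub> (i :: nat) \<otimes>\<^bsub>G\<^esub> h [^]\<^bsub>G\<^esub> (j :: nat)) ({..<p} \<times> {..<p}) (carrier G)"
  and comm: "\<And>k l. k \<in> carrier G ==> l \<in> carrier G ==> k \<otimes>\<^bsub>G\<^esub> l = l \<otimes>\<^bsub>G\<^esub> k"
 shows "integer_mod_group p \<times>\<times> integer_mod_group p \<cong> G"
proof -
 interpret group G by (rule assms(1))
 let ?Z = "integer_mod_group p"
 define \<phi> where "\<phi> = (%(i, j). g [^]\<^bsub>G\<^esub> nat i \<otimes>\<^bsub>G\<^esub> h [^]\<^bsub>G\<^esub> nat j)"
 have car: "carrier (?Z \<times>\<times> ?Z) = {0..<int p} \<times> {0..<int p}" using p by (simp add: DirProd_def carrier_integer_mod_group)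
 have pm: "k [^]\<^bsub>G\<^esub> nat ((i + i') mod int p) = k [^]\<^bsub>G\<^esub> nat i \<otimes>\<^bsub>G\<^esub> k [^]\<^bsub>G\<^esub> nat i'"
  if k: "k \<in> carrier G" "k [^]\<^bsub>G\<^esub> p = \<one>\<^bsub>G\<^esub>" and i: "0 \<le> i" "0 \<le> i'" for k and i i' :: int
 proof -
  have "nat ((i + i') mod int p) = (nat i + nat i') mod p" using i by (simp add: nat_mod_distrib nat_add_distrib)
  moreover have "k [^]\<^bsub>G\<^esub> (n :: nat) = k [^]\<^bsub>G\<^esub> (n mod p)" for n
  proof -
   have "k [^]\<^bsub>G\<^esub> n = (k [^]\<^bsub>G\<^esub> p) [^]\<^bsub>G\<^esub> (n div p) \<otimes>\<^bsub>G\<^esub> k [^]\<^bsub>G\<^esub> (n mod p)" using k(1) by (simp add: nat_pow_pow nat_pow_mult)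
   then show ?thesis using k by simp
  qed
  ultimately show ?thesis using k(1) by (simp add: nat_pow_mult)
 qed
 have "\<phi> \<in> hom (?Z \<times>\<times> ?Z) G"
 proof (rule homI)
  show "\<phi> x \<in> carrier G" if "x \<in> carrier (?Z \<times>\<times> ?Z)" for x using g h by (auto simp: \<phi>_def split: prod.split)
  fix x y assume xy: "x \<in> carrier (?Z \<times>\<times> ?Z)" "y \<in> carrier (?Z \<times>\<times> ?Z)"
  obtain i j i' j' where x: "x = (i, j)" "y = (i', j')" by (cases x, cases y)
  have nn: "0 \<le> i" "0 \<le> j" "0 \<le> i'" "0 \<le> j'" using xy x unfolding car by auto
  let ?a = "g [^]\<^bsub>G\<^esub> nat i" and ?b = "g [^]\<^bsub>G\<^esub> nat i'" and ?c = "h [^]\<^bsub>G\<^esub> nat j" and ?d = "h [^]\<^bsub>G\<^esub> nat j'"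
  have cl: "?a \<in> carrier G" "?b \<in> carrier G" "?c \<in> carrier G" "?d \<in> carrier G" using g h by auto
  have "\<phi> (x \<otimes>\<^bsub>?Z \<times>\<times> ?Z\<^esub> y) = (?a \<otimes>\<^bsub>G\<^esub> ?b) \<otimes>\<^bsub>G\<^esub> (?c \<otimes>\<^bsub>G\<^esub> ?d)"
   unfolding x by (simp add: DirProd_def \<phi>_def pm[OF g nn(1,3)] pm[OF h nn(2,4)])
  also have "\<dots> = ?a \<otimes>\<^bsub>G\<^esub> (?b \<otimes>\<^bsub>G\<^esub> ?c) \<otimes>\<^bsub>G\<^esub> ?d" using cl by (simp add: m_assoc)
  also have "\<dots> = ?a \<otimes>\<^bsub>G\<^esub> (?c \<otimes>\<^bsub>G\<^esub> ?b) \<otimes>\<^bsub>G\<^esub> ?d" using comm[OF cl(2,3)] by simp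
  also have "\<dots> = \<phi> x \<otimes>\<^bsub>G\<^esub> \<phi> y" using cl by (simp add: x \<phi>_def m_assoc)
  finally show "\<phi> (x \<otimes>\<^bsub>?Z \<times>\<times> ?Z\<^esub> y) = \<phi> x \<otimes>\<^bsub>G\<^esub> \<phi> y" .
 qed
 moreover have "bij_betw \<phi> (carrier (?Z \<times>\<times> ?Z)) (carrier G)"
 proof -
  have "bij_betw (map_prod nat nat) ({0..<int p} \<times> {0..<int p}) ({..<p} \<times> {..<p})"
   by (rule bij_betw_byWitness[where f' = "map_prod int int"]) auto
  from bij_betw_trans[OF this bij] show ?thesis unfolding car by (simp add: \<phi>_def comp_def map_prod_def case_prod_unfold)
 qed
 ultimately show ?thesis by (auto simp: is_iso_def iso_def)
qed

theorem theorem4p35: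
  fixes p :: nat and e :: "'k::field \<Rightarrow> 'u"
  assumes "prime p" and "odd p" and "CHAR('k) = p"
    and "infinite (UNIV :: 'u set)" and "inj e"
  shows "\<exists>l :: nat \<Rightarrow> nat.
    strict_mono_on {1..} l \<and> l ` {1..} = ghost_numbers_of_p_groups p e \<and>
    real (l 1) = (real p - 1) / 2 \<and>
    3 * (real p - 1) / 2 \<le> real (l 2) \<and>
    enat (l 2) = ghost_number e (integer_mod_group p \<times>\<times> integer_mod_group p) \<and>
    real (l 2) \<le> 2 * real p - 3 \<and>
    min (((real p)\<^sup>2 - 1) / 2) (2 * real p - 1) \<le> real (l 3)"
proof -
 define S where "S = ghost_numbers_of_p_groups p e"
 define c where "c = (p - 1) div 2"
 have p3: "3 \<le> p" using assms(1,2) prime_gt_1_nat[OF assms(1)] by (cases "p = 2") auto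
 have pc: "p = 2 * c + 1" using assms(2) p3 by (auto simp: c_def elim!: oddE)
 have c1: "1 \<le> c" using pc p3 by simp
 have pm: "p_modules G e p r" if "group G" "finite (carrier G)" "order G = p ^ r" for G :: "('g, 'm) monoid_scheme" and r
  using that assms by (intro p_modules.intro group_modules.intro p_group.intro group_modules_axioms.intro p_group_axioms.intro p_modules_axioms.intro)
 let ?E = "integer_mod_group p \<times>\<times> integer_mod_group p"
 let ?Z = "integer_mod_group p"
 have Z: "group ?Z" "finite (carrier ?Z)" "order ?Z = p" using integer_mod_cyclic[of p] p3 by auto
 have E: "group ?E" "finite (carrier ?E)" "order ?E = p ^ 2"
  using DirProd_group[OF Z(1) Z(1)] Z(2,3) by (simp_all add: order_def DirProd_def card_cartesian_product power2_eq_square)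
 have E2: "2 * c + c \<le> 4 * c - 1" using c1 by simp
 \<comment> \<open>the possible values\<close>
 have order_p: "ghost_number e G = enat c" if G: "group G" "finite (carrier G)" "order G = p ^ 1" for G :: "nat monoid"
 proof -
  interpret p_modules G e p 1 by (rule pm[OF G])
  obtain z where z: "z \<in> carrier G" "z \<noteq> \<one>\<^bsub>G\<^esub>" "z [^]\<^bsub>G\<^esub> p = \<one>\<^bsub>G\<^esub>" using central_element by auto
  have inj: "inj_on (%l. z [^]\<^bsub>G\<^esub> (l :: nat)) {..<p}" by (rule prime_order_powers_inj[OF z])
  have "(%l. z [^]\<^bsub>G\<^esub> (l :: nat)) ` {..<p} = carrier G"
   using z(1) G(3) by (intro card_subset_eq[OF G(2)]) (auto simp: card_image[OF inj] order_def)
  then have "bij_betw (%l. z [^]\<^bsub>G\<^esub> (l :: nat)) {..<p ^ 1} (carrier G)" using inj by (simp add: bij_betw_def)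
  then show ?thesis using cyclic_ghost_number[OF assms(2), of 1 z] z by (simp add: c_def)
 qed
 have order_p2: "ghost_number e G = ghost_number e ?E \<and> ghost_number e G \<le> enat (2 * p - 3) \<or> enat ((p ^ 2 - 1) div 2) \<le> ghost_number e G"
  if G: "group G" "finite (carrier G)" "order G = p ^ 2" for G :: "nat monoid"
 proof -
  interpret p_modules G e p 2 by (rule pm[OF G])
  from cyclic_or_elementary[OF G(3)] show ?thesis
  proof (elim disjE bexE conjE)
   fix g assume "g \<in> carrier G" "bij_betw (%i. g [^]\<^bsub>G\<^esub> i) {..<p ^ 2} (carrier G)" "g [^]\<^bsub>G\<^esub> (p ^ 2) = \<one>\<^bsub>G\<^esub>"
   then show ?thesis using cyclic_ghost_number[OF assms(2), of 2 g] by simp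
  next
   fix g h assume gh: "g \<in> carrier G" "h \<in> carrier G" "g [^]\<^bsub>G\<^esub> p = \<one>\<^bsub>G\<^esub>" "h [^]\<^bsub>G\<^esub> p = \<one>\<^bsub>G\<^esub>"
    "bij_betw (%(i, j). g [^]\<^bsub>G\<^esub> i \<otimes>\<^bsub>G\<^esub> h [^]\<^bsub>G\<^esub> j) ({..<p} \<times> {..<p}) (carrier G)"
    and comm: "\<forall>k\<in>carrier G. \<forall>l\<in>carrier G. k \<otimes>\<^bsub>G\<^esub> l = l \<otimes>\<^bsub>G\<^esub> k"
   have p1: "1 < p" using p3 by simp
   have cm: "k \<otimes>\<^bsub>G\<^esub> l = l \<otimes>\<^bsub>G\<^esub> k" if "k \<in> carrier G" "l \<in> carrier G" for k l using comm that by blast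
   have "?E \<cong> G" by (rule elementary_iso[OF G(1) p1 gh(1,3,2,4,5) cm])
   from ghost_number_iso[OF E(1,2) G(1,2) this, of e] have "ghost_number e G = ghost_number e ?E" ..
   moreover have "ghost_number e G \<le> enat (2 * p - 3)" by (rule elementary_ghost_number_le[OF assms(2) gh(1,3,2,4,5) cm])
   ultimately show ?thesis by simp
  qed
 qed
 have large: "enat (2 * p - 1) \<le> ghost_number e G" if G: "group G" "finite (carrier G)" "order G = p ^ r" and r: "3 \<le> r" for G :: "nat monoid" and r
 proof -
  interpret p_modules G e p r by (rule pm[OF G])
  have "2 * (p - 1) \<le> (r - 1) * (p - 1)" using r by (intro mult_right_mono) auto
  then have "2 * p - 1 \<le> (p - 1) div 2 + (r - 1) * (p - 1)" using c1 p3 unfolding c_def by linarith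
  moreover have "enat ((p - 1) div 2 + (r - 1) * (p - 1)) \<le> ghost_number e G" using ghost_number_ge[OF assms(2)] r by simp
  ultimately show ?thesis by (meson enat_ord_simps(1) order_trans)
 qed
 \<comment> \<open>the elementary group\<close>
 have nontriv: "carrier G \<noteq> {\<one>\<^bsub>G\<^esub>}" if "order G = p ^ r" "r \<noteq> 0" for G :: "nat monoid" and r
 proof
  assume "carrier G = {\<one>\<^bsub>G\<^esub>}"
  then have "p ^ r = 1" using that by (simp add: order_def)
  then show False using that p3 by simp
 qed
 obtain Ec :: "nat monoid" where Ec: "group Ec" "finite (carrier Ec)" "?E \<cong> Ec" "order Ec = order ?E" by (rule nat_copy[OF E(1,2)])
 have Ege: "enat (3 * c) \<le> ghost_number e ?E"
 proof -
  interpret p_modules ?E e p 2 by (rule pm[OF E])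
  show ?thesis using ghost_number_ge[OF assms(2)] pc by simp
 qed
 have Ele: "ghost_number e ?E \<le> enat (2 * p - 3)"
 proof -
  interpret Z: group ?Z by (rule Z(1))
  interpret p_modules ?E e p 2 by (rule pm[OF E])
  let ?g = "(1, 0) :: int \<times> int" and ?h = "(0, 1) :: int \<times> int"
  have pw: "?g [^]\<^bsub>?E\<^esub> (i :: nat) = (int i mod int p, 0)" "?h [^]\<^bsub>?E\<^esub> (i :: nat) = (0, int i mod int p)" for i
   by (induction i) (simp_all add: DirProd_def mod_simps add.commute)
  have m: "x \<otimes>\<^bsub>?E\<^esub> y = ((fst x + fst y) mod int p, (snd x + snd y) mod int p)" for x y by (simp add: DirProd_def case_prod_unfold)
  have one: "\<one>\<^bsub>?E\<^esub> = (0, 0)" by (simp add: DirProd_def)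
  have car: "carrier ?E = {0..<int p} \<times> {0..<int p}" using p3 by (simp add: DirProd_def carrier_integer_mod_group)
  show ?thesis
  proof (rule elementary_ghost_number_le[OF assms(2)])
   show "?g \<in> carrier ?E" "?h \<in> carrier ?E" using p3 by (auto simp: car)
   show "?g [^]\<^bsub>?E\<^esub> p = \<one>\<^bsub>?E\<^esub>" "?h [^]\<^bsub>?E\<^esub> p = \<one>\<^bsub>?E\<^esub>" by (simp_all add: pw one)
   show "k \<otimes>\<^bsub>?E\<^esub> l = l \<otimes>\<^bsub>?E\<^esub> k" for k l by (simp add: m add.commute)
   show "bij_betw (%(i, j). ?g [^]\<^bsub>?E\<^esub> i \<otimes>\<^bsub>?E\<^esub> ?h [^]\<^bsub>?E\<^esub> j) ({..<p} \<times> {..<p}) (carrier ?E)"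
    unfolding car by (rule bij_betw_byWitness[where f' = "map_prod nat nat"]) (auto simp: pw m)
  qed
 qed
 obtain L where L: "ghost_number e ?E = enat L" using Ele by (cases "ghost_number e ?E") auto
 have L1: "3 * c \<le> L" "L \<le> 2 * p - 3" using Ege Ele by (simp_all add: L)
 have LS: "L \<in> S"
  using Ec E(3) L nontriv[of Ec 2] ghost_number_iso[OF E(1,2) Ec(1,2,3), of e]
  unfolding S_def ghost_numbers_of_p_groups_def by (auto intro!: exI[of _ Ec] exI[of _ 2])
 \<comment> \<open>the cyclic groups\<close>
 have cyc: "(p ^ a - 1) div 2 \<in> S" if a: "a \<noteq> 0" for a
 proof -
  have pa: "1 < p ^ a" using one_less_power[OF prime_gt_1_nat[OF assms(1)]] a by simp
  note C = integer_mod_cyclic[OF pa]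
  interpret p_modules "integer_mod_group (p ^ a)" e p a by (rule pm[OF C(1-3)])
  have gn: "ghost_number e (integer_mod_group (p ^ a)) = enat ((p ^ a - 1) div 2)"
   by (rule cyclic_ghost_number[OF assms(2) a C(4,5,6)])
  obtain Cc :: "nat monoid" where Cc: "group Cc" "finite (carrier Cc)" "integer_mod_group (p ^ a) \<cong> Cc" "order Cc = order (integer_mod_group (p ^ a))"
   by (rule nat_copy[OF C(1,2)])
  show ?thesis
   using Cc C(3) gn nontriv[of Cc a] a ghost_number_iso[OF C(1,2) Cc(1,2,3), of e]
   unfolding S_def ghost_numbers_of_p_groups_def by (auto intro!: exI[of _ Cc] exI[of _ a])
 qed
 have cS: "c \<in> S" using cyc[of 1] by (simp add: c_def)
 have inf: "infinite S"
 proof -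
  have "a \<le> (p ^ Suc a - 1) div 2" for a
  proof (induction a)
   case (Suc a)
   have "3 * p ^ Suc a \<le> p ^ Suc (Suc a)" using p3 by simp
   moreover have "1 \<le> p ^ Suc a" using p3 by simp
   ultimately have "(p ^ Suc a - 1) div 2 + 1 \<le> (p ^ Suc (Suc a) - 1) div 2" by linarith
   then show ?case using Suc by linarith
  qed simp
  then show ?thesis unfolding infinite_nat_iff_unbounded_le using cyc by blast
 qed
 define M where "M = min ((p ^ 2 - 1) div 2) (2 * p - 1)"
 have p2: "(p ^ 2 - 1) div 2 = 2 * c * c + 2 * c" unfolding pc by (simp add: power2_eq_square algebra_simps)
 have LM: "L < M"
 proof -
  have "2 * p - 3 < (p ^ 2 - 1) div 2" unfolding p2 using mult_le_mono2[OF c1, of "2 * c"] c1 pc by linarith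
  then show ?thesis using L1(2) p3 by (simp add: M_def)
 qed
 have possible: "s = c \<or> s = L \<or> M \<le> s" if sS: "s \<in> S" for s
 proof -
  obtain G :: "nat monoid" and r where G: "group G" "finite (carrier G)" "carrier G \<noteq> {\<one>\<^bsub>G\<^esub>}" "order G = p ^ r" "ghost_number e G = enat s"
   using sS unfolding S_def ghost_numbers_of_p_groups_def by blast
  have "r \<noteq> 0"
  proof
   assume "r = 0"
   then have "card (carrier G) = 1" using G(4) by (simp add: order_def)
   moreover have "\<one>\<^bsub>G\<^esub> \<in> carrier G" using G(1) by (simp add: group.is_monoid monoid.one_closed)
   ultimately show False using G(3) by (auto simp: card_1_singleton_iff)
  qed
  then consider "r = 1" | "r = 2" | "3 \<le> r" by linarith
  then show ?thesis
  proof cases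
   case 1
   then show ?thesis using order_p[OF G(1,2)] G(4,5) by simp
  next
   case 2
   then show ?thesis using order_p2[OF G(1,2)] G(4,5) L by (auto simp: M_def)
  next
   case 3
   then show ?thesis using large[OF G(1,2,4)] G(5) by (auto simp: M_def)
  qed
 qed
 define l where "l i = enumerate S (i - 1)" for i
 have mono: "strict_mono_on {1..} l"
  by (rule strict_mono_onI) (simp add: l_def enumerate_mono[OF _ inf])
 have lS: "l i \<in> S" for i unfolding l_def by (rule enumerate_in_set[OF inf])
 have range: "l ` {1..} = S"
 proof (intro equalityI subsetI)
  fix s assume "s \<in> S"
  then have "s \<in> range (enumerate S)" unfolding range_enumerate[OF inf] .
  then obtain k where "s = enumerate S k" by (rule rangeE)
  then have "s = l (Suc k)" by (simp add: l_def)
  then show "s \<in> l ` {1..}" by auto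
 qed (use lS in auto)
 have less: "l i < l j" if "1 \<le> i" "i < j" for i j using strict_mono_onD[OF mono] that by simp
 have cL: "c < L" using L1(1) c1 by simp
 have l1: "l 1 = c"
 proof -
  obtain i where i: "1 \<le> i" "c = l i" using cS range by auto
  then have "l 1 \<le> c" using less[of 1 i] by (cases "i = 1") auto
  then show ?thesis using possible[OF lS, of 1] cL LM by auto
 qed
 have l2: "l 2 = L"
 proof -
  obtain i where i: "1 \<le> i" "L = l i" using LS range by auto
  then have "i \<noteq> 1" using l1 cL by auto
  then have "l 2 \<le> L" using i less[of 2 i] by (cases "i = 2") auto
  moreover have "c < l 2" using less[of 1 2] l1 by simp
  ultimately show ?thesis using possible[OF lS, of 2] LM by auto
 qed
 have l3: "M \<le> l 3" using possible[OF lS, of 3] less[of 2 3] l2 cL by auto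
 have rp: "real p = 2 * real c + 1" using pc by simp
 have "real M = min (((real p)\<^sup>2 - 1) / 2) (2 * real p - 1)"
 proof -
  have 1: "real (2 * c * c + 2 * c) = ((real p)\<^sup>2 - 1) / 2" unfolding rp by (simp add: power2_eq_square algebra_simps)
  have "real (2 * p - 1) = 2 * real p - 1" using p3 by linarith
  then show ?thesis unfolding M_def p2 of_nat_min 1 by simp
 qed
 then have "min (((real p)\<^sup>2 - 1) / 2) (2 * real p - 1) \<le> real (l 3)" using l3 by simp
 moreover have "real (l 1) = (real p - 1) / 2" using l1 rp by simp
 moreover have "3 * (real p - 1) / 2 \<le> real (l 2)" using L1(1) l2 rp by simp
 moreover have "real (l 2) \<le> 2 * real p - 3"
 proof -
  have "L + 3 \<le> 2 * p" using L1(2) p3 by simp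
  then have "real L + 3 \<le> 2 * real p" by linarith
  then show ?thesis using l2 by simp
 qed
 moreover have "enat (l 2) = ghost_number e ?E" using l2 L by simp
 moreover note mono range[unfolded S_def]
 ultimately show ?thesis by (intro exI[of _ l] conjI)
qed

end
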